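(* Let $(K,\mathrm{Ad},\mathfrak{n}^+)$ be a regular prehomogeneous vector space of commutative parabolic type, let $(K,\mathrm{Ad},\mathfrak{n}^-)$ be its contragredient (also a regular prehomogeneous vector space of commutative parabolic type), and let $\overline{f}\in\mathbb{C}[\mathfrak{n}^-]$ be the basic relative invariant of $(K,\mathrm{Ad},\mathfrak{n}^-)$. Set $R=\mathbb{C}[\mathfrak{n}^+]$, acting on $\mathbb{C}[\mathfrak{n}^-]$ by constant-coefficient differential operators, and $F=\overline{f}^{\,s}$ for a positive integer $s$. Then the Artinian Gorenstein algebra $R/\mathrm{Ann}_R(F)$ has the strong Lefschetz property. Moreover, $L\in R_1\simeq\mathfrak{n}^-$ is a Lefschetz element of $R/\mathrm{Ann}_R(F)$ if and only if $L$ lies in the open $K$-orbit of the prehomogeneous vector space $(K,\mathrm{Ad},\mathfrak{n}^-)$; in particular this condition is independent of $s$.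
   Context: **Prehomogeneous vector spaces.** A representation $(G,\pi,V)$ of a complex Lie group $G$ on a finite-dimensional $\mathbb{C}$-vector space $V$ is a prehomogeneous vector space if $V$ has a Zariski open $G$-orbit. A polynomial function $F$ on $V$ is a relative invariant if there is a group character $\chi:G\to\mathbb{C}^\times$ with $F(gv)=\chi(g)F(v)$ for all $g\in G$, $v\in V$. **Commutative parabolic type.** Let $\mathfrak{g}$ be a complex simple Lie algebra, $\mathfrak{p}$ a maximal parabolic subalgebra whose nilpotent radical $\mathfrak{n}^+$ is commutative, $\mathfrak{k}$ a Levi subalgebra of $\mathfrak{p}$ (so $\mathfrak{p}=\mathfrak{k}\oplus\mathfrak{n}^+$), and $\mathfrak{n}^-$ the opposite of $\mathfrak{n}^+$, so $\mathfrak{g}=\mathfrak{n}^-\oplus\mathfrak{k}\oplus\mathfrak{n}^+$. Let $K$ be the (connected) complex Lie subgroup with Lie algebra $\mathfrak{k}$ of a connected complex Lie group with Lie algebra $\mathfrak{g}$; it acts on $\mathfrak{n}^\pm$ by the adjoint action $\mathrm{Ad}$. Then $(K,\mathrm{Ad},\mathfrak{n}^+)$ is a prehomogeneous vector space, called of commutative parabolic type. It is called regular if it has a nonconstant relative invariant. Writing the type as the pair (type of $\mathfrak{g}$, index of the simple root defining $\mathfrak{p}$), the regular ones are those of types $(\mathrm{A}_{2n-1},n)$, $(\mathrm{B}_m,1)$, $(\mathrm{C}_n,n)$, $(\mathrm{D}_m,1)$, $(\mathrm{D}_{2m},2m)$, $(\mathrm{E}_7,7)$. In the regular case there is an irreducible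 relative invariant, unique up to nonzero scalar, called the basic relative invariant; every other relative invariant is, up to scalar, a power of it. If $(K,\mathrm{Ad},\mathfrak{n}^+)$ is regular, then so is its contragredient with respect to the Killing form, $(K,\mathrm{Ad},\mathfrak{n}^-)$, which therefore has a basic relative invariant in $\mathbb{C}[\mathfrak{n}^-]$. **Differential operators.** Let $(x,y)$ denote the Killing form of $\mathfrak{g}$. Each $f\in\mathbb{C}[\mathfrak{n}^+]$ defines a constant-coefficient differential operator $f(\partial)$ on $\mathfrak{n}^-$ (in the variable $y$) by $f(\partial)\exp(x,y)=f(x)\exp(x,y)$ for $x\in\mathfrak{n}^+$, $y\in\mathfrak{n}^-$. This identifies $R=\mathbb{C}[\mathfrak{n}^+]$ with the ring of constant-coefficient partial differential operators on $\mathfrak{n}^-$. The degree-one component $R_1=(\mathfrak{n}^+)^*$ is identified with $\mathfrak{n}^-$ via the Killing form. For $F\in\mathbb{C}[\mathfrak{n}^-]$, $\mathrm{Ann}_R(F)=\{P\in R\mid P(\partial)F=0\}$; for homogeneous $F\neq 0$ the quotient $R/\mathrm{Ann}_R(F)$ is a graded Artinian Gorenstein algebra. **Strong Lefschetz property.** A graded Artinian algebra $A=\bigoplus_{i=0}^{c}A_i$ over a field $k$ (with $A_0\simeq k$, $A_c\neq0$) has the strong Lefschetz property if there is $L\in A_1$ such that the multiplication map $\times L^{c-2i}:A_i\to A_{c-i}$ is bijective for every $i=0,1,\ldots,\lfloor c/2\rfloor$; such an $L$ is called a Lefschetz element. An element $L\in R_1$ is called a Lefschetz element of $R/\mathrm{Ann}_R(F)$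 if its class is one. *)

theory Defs
  imports
    "HOL-Analysis.Analysis"
    "HOL-Algebra.QuotRing"
    "HOL-Algebra.Ring_Divisibility"
    "HOL-Algebra.Embedded_Algebras"
begin

text \<open>
  A finite-dimensional complex Lie algebra is given by a bracket \<open>br\<close> on the vector space
  \<open>complex ^ 'n\<close> (scalar multiplication \<open>*s\<close>); subalgebras, ideals and subspaces are sets.
\<close>

section \<open>Complex Lie algebras\<close>

definition lie_algebra :: "(complex ^ 'n \<Rightarrow> complex ^ 'n \<Rightarrow> complex ^ 'n) \<Rightarrow> bool" where
  "lie_algebra br \<longleftrightarrow>
     (\<forall>x. Vector_Spaces.linear (*s) (*s) (\<lambda>y. br x y)) \<and>
     (\<forall>y. Vector_Spaces.linear (*s) (*s) (\<lambda>x. br x y)) \<and>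
     (\<forall>x. br x x = 0) \<and>
     (\<forall>x y z. br x (br y z) + br y (br z x) + br z (br x y) = 0)"

definition lie_subalgebra ::
  "(complex ^ 'n \<Rightarrow> complex ^ 'n \<Rightarrow> complex ^ 'n) \<Rightarrow> (complex ^ 'n) set \<Rightarrow> bool" where
  "lie_subalgebra br h \<longleftrightarrow> vec.subspace h \<and> (\<forall>x\<in>h. \<forall>y\<in>h. br x y \<in> h)"

definition lie_ideal ::
  "(complex ^ 'n \<Rightarrow> complex ^ 'n \<Rightarrow> complex ^ 'n) \<Rightarrow> (complex ^ 'n) set \<Rightarrow> (complex ^ 'n) set \<Rightarrow> bool" where
  "lie_ideal br h I \<longleftrightarrow> vec.subspace I \<and> I \<subseteq> h \<and> (\<forall>x\<in>h. \<forall>y\<in>I. br x y \<in> I)"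

definition simple_lie_algebra :: "(complex ^ 'n \<Rightarrow> complex ^ 'n \<Rightarrow> complex ^ 'n) \<Rightarrow> bool" where
  "simple_lie_algebra br \<longleftrightarrow>
     lie_algebra br \<and> (\<exists>x y. br x y \<noteq> 0) \<and> (\<forall>I. lie_ideal br UNIV I \<longrightarrow> I = {0} \<or> I = UNIV)"

definition lie_prod ::
  "(complex ^ 'n \<Rightarrow> complex ^ 'n \<Rightarrow> complex ^ 'n) \<Rightarrow> (complex ^ 'n) set \<Rightarrow> (complex ^ 'n) set \<Rightarrow> (complex ^ 'n) set" where
  "lie_prod br A B = vec.span {br a b | a b. a \<in> A \<and> b \<in> B}"

definition solvable_lie ::
  "(complex ^ 'n \<Rightarrow> complex ^ 'n \<Rightarrow> complex ^ 'n) \<Rightarrow> (complex ^ 'n) set \<Rightarrow> bool" where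
  "solvable_lie br h \<longleftrightarrow> (\<exists>m. ((\<lambda>A. lie_prod br A A) ^^ m) h = {0})"

definition nilpotent_lie ::
  "(complex ^ 'n \<Rightarrow> complex ^ 'n \<Rightarrow> complex ^ 'n) \<Rightarrow> (complex ^ 'n) set \<Rightarrow> bool" where
  "nilpotent_lie br h \<longleftrightarrow> (\<exists>m. ((\<lambda>A. lie_prod br h A) ^^ m) h = {0})"

definition commutative_lie ::
  "(complex ^ 'n \<Rightarrow> complex ^ 'n \<Rightarrow> complex ^ 'n) \<Rightarrow> (complex ^ 'n) set \<Rightarrow> bool" where
  "commutative_lie br h \<longleftrightarrow> (\<forall>x\<in>h. \<forall>y\<in>h. br x y = 0)"

text \<open>Reductive: the radical is the centre.\<close>

definition reductive_lie ::
  "(complex ^ 'n \<Rightarrow> complex ^ 'n \<Rightarrow> complex ^ 'n) \<Rightarrow> (complex ^ 'n) set \<Rightarrow> bool" where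
  "reductive_lie br h \<longleftrightarrow>
     (\<forall>I. lie_ideal br h I \<and> solvable_lie br I \<longrightarrow> (\<forall>x\<in>h. \<forall>y\<in>I. br x y = 0))"

definition killing_form ::
  "(complex ^ 'n \<Rightarrow> complex ^ 'n \<Rightarrow> complex ^ 'n) \<Rightarrow> complex ^ 'n \<Rightarrow> complex ^ 'n \<Rightarrow> complex" where
  "killing_form br x y = trace (matrix (\<lambda>z. br x (br y z)))"


section \<open>Parabolic subalgebras\<close>

definition borel_subalgebra ::
  "(complex ^ 'n \<Rightarrow> complex ^ 'n \<Rightarrow> complex ^ 'n) \<Rightarrow> (complex ^ 'n) set \<Rightarrow> bool" where
  "borel_subalgebra br b \<longleftrightarrow>
     lie_subalgebra br b \<and> solvable_lie br b \<and>
     (\<forall>b'. lie_subalgebra br b' \<and> solvable_lie br b' \<and> b \<subseteq> b' \<longrightarrow> b' = b)"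

definition parabolic_subalgebra ::
  "(complex ^ 'n \<Rightarrow> complex ^ 'n \<Rightarrow> complex ^ 'n) \<Rightarrow> (complex ^ 'n) set \<Rightarrow> bool" where
  "parabolic_subalgebra br p \<longleftrightarrow> lie_subalgebra br p \<and> (\<exists>b. borel_subalgebra br b \<and> b \<subseteq> p)"

definition maximal_parabolic ::
  "(complex ^ 'n \<Rightarrow> complex ^ 'n \<Rightarrow> complex ^ 'n) \<Rightarrow> (complex ^ 'n) set \<Rightarrow> bool" where
  "maximal_parabolic br p \<longleftrightarrow>
     parabolic_subalgebra br p \<and> p \<noteq> UNIV \<and>
     (\<forall>q. parabolic_subalgebra br q \<and> p \<subseteq> q \<and> q \<noteq> UNIV \<longrightarrow> q = p)"

text \<open>
  The largest nilpotent ideal. For a parabolic subalgebra of a semisimple Lie algebra this is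
  the usual nilpotent radical, since the centre of a Levi subalgebra acts semisimply and
  faithfully.
\<close>

definition nilpotent_radical ::
  "(complex ^ 'n \<Rightarrow> complex ^ 'n \<Rightarrow> complex ^ 'n) \<Rightarrow> (complex ^ 'n) set \<Rightarrow> (complex ^ 'n) set \<Rightarrow> bool" where
  "nilpotent_radical br p n \<longleftrightarrow>
     lie_ideal br p n \<and> nilpotent_lie br n \<and>
     (\<forall>I. lie_ideal br p I \<and> nilpotent_lie br I \<longrightarrow> I \<subseteq> n)"

definition levi_subalgebra ::
  "(complex ^ 'n \<Rightarrow> complex ^ 'n \<Rightarrow> complex ^ 'n) \<Rightarrow> (complex ^ 'n) set \<Rightarrow> (complex ^ 'n) set \<Rightarrow> bool" where
  "levi_subalgebra br p k \<longleftrightarrow>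
     lie_subalgebra br k \<and> reductive_lie br k \<and>
     (\<exists>n. nilpotent_radical br p n \<and> k \<inter> n = {0} \<and> p = {x + y | x y. x \<in> k \<and> y \<in> n})"

text \<open>
  \<open>nm\<close> is the nilpotent radical of the parabolic opposite to \<open>p\<close> with respect to the Levi
  subalgebra \<open>k\<close>, two parabolics being opposite when they meet in a common Levi subalgebra.
\<close>

definition opposite_radical ::
  "(complex ^ 'n \<Rightarrow> complex ^ 'n \<Rightarrow> complex ^ 'n) \<Rightarrow>
   (complex ^ 'n) set \<Rightarrow> (complex ^ 'n) set \<Rightarrow> (complex ^ 'n) set \<Rightarrow> bool" where
  "opposite_radical br p k nm \<longleftrightarrow>
     (\<exists>q. parabolic_subalgebra br q \<and> p \<inter> q = k \<and> levi_subalgebra br p k \<and>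
          levi_subalgebra br q k \<and> nilpotent_radical br q nm)"

definition commutative_parabolic_type ::
  "(complex ^ 'n \<Rightarrow> complex ^ 'n \<Rightarrow> complex ^ 'n) \<Rightarrow> (complex ^ 'n) set \<Rightarrow>
   (complex ^ 'n) set \<Rightarrow> (complex ^ 'n) set \<Rightarrow> (complex ^ 'n) set \<Rightarrow> bool" where
  "commutative_parabolic_type br p k np nm \<longleftrightarrow>
     simple_lie_algebra br \<and> maximal_parabolic br p \<and>
     nilpotent_radical br p np \<and> commutative_lie br np \<and>
     levi_subalgebra br p k \<and> opposite_radical br p k nm"


section \<open>The adjoint action of the connected group with Lie algebra \<open>k\<close>\<close>

text \<open>\<open>exp_ad br x = exp (ad x) = Ad (exp x)\<close>.\<close>

definition exp_ad ::
  "(complex ^ 'n \<Rightarrow> complex ^ 'n \<Rightarrow> complex ^ 'n) \<Rightarrow> complex ^ 'n \<Rightarrow> complex ^ 'n \<Rightarrow> complex ^ 'n" where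
  "exp_ad br x y = suminf (\<lambda>m. (1 / fact m) *s ((br x ^^ m) y))"

text \<open>
  The image \<open>Ad(K)\<close> of the connected Lie group \<open>K\<close> with Lie algebra \<open>k\<close>. A connected Lie group
  is generated by the exponentials of its Lie algebra, so \<open>Ad(K)\<close> consists of the finite
  products of the \<open>exp (ad x)\<close> with \<open>x \<in> k\<close>; inverses are \<open>exp (ad (-x))\<close>. It
  does not depend on the choice of the ambient connected Lie group.
\<close>

inductive_set Ad_group ::
  "(complex ^ 'n \<Rightarrow> complex ^ 'n \<Rightarrow> complex ^ 'n) \<Rightarrow> (complex ^ 'n) set \<Rightarrow>
   (complex ^ 'n \<Rightarrow> complex ^ 'n) set"
  for br k where
  Ad_id: "id \<in> Ad_group br k"
| Ad_exp: "x \<in> k \<Longrightarrow> h \<in> Ad_group br k \<Longrightarrow> exp_ad br x \<circ> h \<in> Ad_group br k"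


section \<open>Polynomial functions on a subspace\<close>

inductive_set poly_functions :: "(complex ^ 'n \<Rightarrow> complex) set" where
  poly_const: "(\<lambda>_. c) \<in> poly_functions"
| poly_linear: "Vector_Spaces.linear (*s) (*) l \<Longrightarrow> l \<in> poly_functions"
| poly_add: "p \<in> poly_functions \<Longrightarrow> q \<in> poly_functions \<Longrightarrow> (\<lambda>x. p x + q x) \<in> poly_functions"
| poly_mult: "p \<in> poly_functions \<Longrightarrow> q \<in> poly_functions \<Longrightarrow> (\<lambda>x. p x * q x) \<in> poly_functions"

text \<open>
  The ring \<open>\<complex>[V]\<close> for a linear subspace \<open>V\<close>. Its elements are extensional
  functions (\<open>undefined\<close> off \<open>V\<close>), so that equality is equality on \<open>V\<close>; every linear form on
  \<open>V\<close> extends to the whole space, so restricting ambient polynomials loses nothing.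
\<close>

definition coord_ring :: "(complex ^ 'n) set \<Rightarrow> (complex ^ 'n \<Rightarrow> complex) ring" where
  "coord_ring V =
     \<lparr>carrier = (\<lambda>p. restrict p V) ` poly_functions,
      mult = (\<lambda>p q. \<lambda>x\<in>V. p x * q x), one = (\<lambda>x\<in>V. 1),
      zero = (\<lambda>x\<in>V. 0), add = (\<lambda>p q. \<lambda>x\<in>V. p x + q x)\<rparr>"

definition homogeneous_part :: "(complex ^ 'n) set \<Rightarrow> nat \<Rightarrow> (complex ^ 'n \<Rightarrow> complex) set" where
  "homogeneous_part V i =
     {p \<in> carrier (coord_ring V). \<forall>c. \<forall>x\<in>V. p (c *s x) = c ^ i * p x}"

definition zariski_open :: "(complex ^ 'n) set \<Rightarrow> (complex ^ 'n) set \<Rightarrow> bool" where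
  "zariski_open V U \<longleftrightarrow>
     (\<exists>S\<subseteq>carrier (coord_ring V). U = V - {v \<in> V. \<forall>p\<in>S. p v = 0})"


section \<open>Prehomogeneous vector spaces\<close>

text \<open>Below \<open>G\<close> is a group of linear maps, under composition, acting on the subspace \<open>V\<close>.\<close>

definition group_orbit :: "(complex ^ 'n \<Rightarrow> complex ^ 'n) set \<Rightarrow> complex ^ 'n \<Rightarrow> (complex ^ 'n) set" where
  "group_orbit G v = (\<lambda>g. g v) ` G"

definition prehomogeneous :: "(complex ^ 'n \<Rightarrow> complex ^ 'n) set \<Rightarrow> (complex ^ 'n) set \<Rightarrow> bool" where
  "prehomogeneous G V \<longleftrightarrow> (\<exists>v\<in>V. zariski_open V (group_orbit G v))"

text \<open>
  The points whose orbit is Zariski open. Nonempty Zariski open subsets of \<open>V\<close> meet, so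
  this is the unique open orbit if there is one, and empty otherwise.
\<close>

definition open_orbit :: "(complex ^ 'n \<Rightarrow> complex ^ 'n) set \<Rightarrow> (complex ^ 'n) set \<Rightarrow> (complex ^ 'n) set" where
  "open_orbit G V = {v \<in> V. zariski_open V (group_orbit G v)}"

definition group_character ::
  "(complex ^ 'n \<Rightarrow> complex ^ 'n) set \<Rightarrow> ((complex ^ 'n \<Rightarrow> complex ^ 'n) \<Rightarrow> complex) \<Rightarrow> bool" where
  "group_character G ch \<longleftrightarrow>
     (\<forall>g\<in>G. ch g \<noteq> 0) \<and> (\<forall>g\<in>G. \<forall>h\<in>G. ch (g \<circ> h) = ch g * ch h)"

definition relative_invariant ::
  "(complex ^ 'n \<Rightarrow> complex ^ 'n) set \<Rightarrow> (complex ^ 'n) set \<Rightarrow> (complex ^ 'n \<Rightarrow> complex) \<Rightarrow> bool" where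
  "relative_invariant G V F \<longleftrightarrow>
     F \<in> carrier (coord_ring V) \<and>
     (\<exists>ch. group_character G ch \<and> (\<forall>g\<in>G. \<forall>v\<in>V. F (g v) = ch g * F v))"

definition regular_prehomogeneous ::
  "(complex ^ 'n \<Rightarrow> complex ^ 'n) set \<Rightarrow> (complex ^ 'n) set \<Rightarrow> bool" where
  "regular_prehomogeneous G V \<longleftrightarrow>
     prehomogeneous G V \<and>
     (\<exists>F. relative_invariant G V F \<and> \<not> (\<exists>c. \<forall>v\<in>V. F v = c))"

definition basic_relative_invariant ::
  "(complex ^ 'n \<Rightarrow> complex ^ 'n) set \<Rightarrow> (complex ^ 'n) set \<Rightarrow> (complex ^ 'n \<Rightarrow> complex) \<Rightarrow> bool" where
  "basic_relative_invariant G V f \<longleftrightarrow>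
     relative_invariant G V f \<and> ring_irreducible\<^bsub>coord_ring V\<^esub> f"


section \<open>Constant-coefficient differential operators\<close>

definition directional_deriv ::
  "complex ^ 'n \<Rightarrow> (complex ^ 'n \<Rightarrow> complex) \<Rightarrow> complex ^ 'n \<Rightarrow> complex" where
  "directional_deriv u g y = deriv (\<lambda>t. g (y + t *s u)) 0"

text \<open>
  The operators generated by the derivatives in the directions of \<open>V\<close>. At points of \<open>V\<close> they
  only see the restriction to \<open>V\<close> of the function they are applied to. They are meant to be
  applied to functions that are holomorphic on \<open>V\<close>; on other functions \<^const>\<open>deriv\<close> may
  return arbitrary values.
\<close>

inductive_set cc_diff_ops ::
  "(complex ^ 'n) set \<Rightarrow> ((complex ^ 'n \<Rightarrow> complex) \<Rightarrow> (complex ^ 'n \<Rightarrow> complex)) set"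
  for V where
  op_id: "(\<lambda>g. g) \<in> cc_diff_ops V"
| op_deriv: "u \<in> V \<Longrightarrow> D \<in> cc_diff_ops V \<Longrightarrow> (\<lambda>g. directional_deriv u (D g)) \<in> cc_diff_ops V"
| op_scale: "D \<in> cc_diff_ops V \<Longrightarrow> (\<lambda>g y. c * D g y) \<in> cc_diff_ops V"
| op_add: "D \<in> cc_diff_ops V \<Longrightarrow> E \<in> cc_diff_ops V \<Longrightarrow> (\<lambda>g y. D g y + E g y) \<in> cc_diff_ops V"

text \<open>
  The operator \<open>P(\<partial>)\<close> on \<open>nm\<close> attached to \<open>P \<in> \<complex>[np]\<close>. The exponential
  functions determine the action on holomorphic functions on \<open>nm\<close>, in particular on
  polynomials, but not on arbitrary functions; hence \<open>SOME\<close> and not \<open>THE\<close>.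
\<close>

definition diff_op ::
  "(complex ^ 'n \<Rightarrow> complex ^ 'n \<Rightarrow> complex ^ 'n) \<Rightarrow> (complex ^ 'n) set \<Rightarrow> (complex ^ 'n) set \<Rightarrow>
   (complex ^ 'n \<Rightarrow> complex) \<Rightarrow> (complex ^ 'n \<Rightarrow> complex) \<Rightarrow> (complex ^ 'n \<Rightarrow> complex)" where
  "diff_op br np nm P =
     (SOME D. D \<in> cc_diff_ops nm \<and>
        (\<forall>x\<in>np. \<forall>y\<in>nm. D (\<lambda>z. exp (killing_form br x z)) y = P x * exp (killing_form br x y)))"

definition annihilator ::
  "(complex ^ 'n \<Rightarrow> complex ^ 'n \<Rightarrow> complex ^ 'n) \<Rightarrow> (complex ^ 'n) set \<Rightarrow> (complex ^ 'n) set \<Rightarrow>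
   (complex ^ 'n \<Rightarrow> complex) \<Rightarrow> (complex ^ 'n \<Rightarrow> complex) set" where
  "annihilator br np nm F =
     {P \<in> carrier (coord_ring np). \<forall>y\<in>nm. diff_op br np nm P F y = 0}"


section \<open>Graded Artinian algebras and the strong Lefschetz property\<close>

definition artinian_ring :: "('a, 'b) ring_scheme \<Rightarrow> bool" where
  "artinian_ring A \<longleftrightarrow>
     cring A \<and>
     (\<forall>I :: nat \<Rightarrow> 'a set. (\<forall>m. ideal (I m) A \<and> I (Suc m) \<subseteq> I m) \<longrightarrow> (\<exists>N. \<forall>m\<ge>N. I m = I N))"

text \<open>
  The ground field is embedded as a subfield \<open>k\<close> of \<open>A\<close> (as in \<^theory>\<open>HOL-Algebra.Embedded_Algebras\<close>),
  and \<open>A\<^sub>0 \<simeq> k\<close> becomes \<open>gr 0 = k\<close>; \<open>c\<close> is the top degree. The components are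
  \<open>k\<close>-subspaces because they are closed under multiplication by \<open>gr 0\<close>.
\<close>

definition graded_artinian_algebra ::
  "'a set \<Rightarrow> ('a, 'b) ring_scheme \<Rightarrow> (nat \<Rightarrow> 'a set) \<Rightarrow> nat \<Rightarrow> bool" where
  "graded_artinian_algebra k A gr c \<longleftrightarrow>
     artinian_ring A \<and> subfield k A \<and> gr 0 = k \<and>
     (\<forall>i. additive_subgroup (gr i) A) \<and>
     (\<forall>i j. \<forall>a\<in>gr i. \<forall>b\<in>gr j. a \<otimes>\<^bsub>A\<^esub> b \<in> gr (i + j)) \<and>
     (\<forall>a\<in>carrier A. \<exists>!f. f \<in> PiE {..c} gr \<and> a = (\<Oplus>\<^bsub>A\<^esub>i\<in>{..c}. f i)) \<and>
     gr c \<noteq> {\<zero>\<^bsub>A\<^esub>} \<and> (\<forall>i>c. gr i = {\<zero>\<^bsub>A\<^esub>})"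

definition socle :: "('a, 'b) ring_scheme \<Rightarrow> (nat \<Rightarrow> 'a set) \<Rightarrow> 'a set" where
  "socle A gr = {a \<in> carrier A. \<forall>i\<ge>1. \<forall>x\<in>gr i. a \<otimes>\<^bsub>A\<^esub> x = \<zero>\<^bsub>A\<^esub>}"

definition graded_artinian_gorenstein ::
  "'a set \<Rightarrow> ('a, 'b) ring_scheme \<Rightarrow> (nat \<Rightarrow> 'a set) \<Rightarrow> bool" where
  "graded_artinian_gorenstein k A gr \<longleftrightarrow>
     (\<exists>c. graded_artinian_algebra k A gr c) \<and> ring.dimension A 1 k (socle A gr)"

definition lefschetz_element ::
  "'a set \<Rightarrow> ('a, 'b) ring_scheme \<Rightarrow> (nat \<Rightarrow> 'a set) \<Rightarrow> 'a \<Rightarrow> bool" where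
  "lefschetz_element k A gr l \<longleftrightarrow>
     l \<in> gr 1 \<and>
     (\<exists>c. graded_artinian_algebra k A gr c \<and>
          (\<forall>i\<le>c div 2. bij_betw (\<lambda>a. l [^]\<^bsub>A\<^esub> (c - 2 * i) \<otimes>\<^bsub>A\<^esub> a) (gr i) (gr (c - i))))"

definition strong_lefschetz :: "'a set \<Rightarrow> ('a, 'b) ring_scheme \<Rightarrow> (nat \<Rightarrow> 'a set) \<Rightarrow> bool" where
  "strong_lefschetz k A gr \<longleftrightarrow> (\<exists>l. lefschetz_element k A gr l)"


section \<open>The algebra \<open>R / Ann F\<close>\<close>

definition gor_class ::
  "(complex ^ 'n \<Rightarrow> complex ^ 'n \<Rightarrow> complex ^ 'n) \<Rightarrow> (complex ^ 'n) set \<Rightarrow> (complex ^ 'n) set \<Rightarrow>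
   (complex ^ 'n \<Rightarrow> complex) \<Rightarrow> (complex ^ 'n \<Rightarrow> complex) \<Rightarrow> (complex ^ 'n \<Rightarrow> complex) set" where
  "gor_class br np nm F P = annihilator br np nm F +>\<^bsub>coord_ring np\<^esub> P"

definition gor_algebra ::
  "(complex ^ 'n \<Rightarrow> complex ^ 'n \<Rightarrow> complex ^ 'n) \<Rightarrow> (complex ^ 'n) set \<Rightarrow> (complex ^ 'n) set \<Rightarrow>
   (complex ^ 'n \<Rightarrow> complex) \<Rightarrow> (complex ^ 'n \<Rightarrow> complex) set ring" where
  "gor_algebra br np nm F = coord_ring np Quot annihilator br np nm F"

definition gor_grading ::
  "(complex ^ 'n \<Rightarrow> complex ^ 'n \<Rightarrow> complex ^ 'n) \<Rightarrow> (complex ^ 'n) set \<Rightarrow> (complex ^ 'n) set \<Rightarrow>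
   (complex ^ 'n \<Rightarrow> complex) \<Rightarrow> nat \<Rightarrow> (complex ^ 'n \<Rightarrow> complex) set set" where
  "gor_grading br np nm F i = gor_class br np nm F ` homogeneous_part np i"

definition gor_field ::
  "(complex ^ 'n \<Rightarrow> complex ^ 'n \<Rightarrow> complex ^ 'n) \<Rightarrow> (complex ^ 'n) set \<Rightarrow> (complex ^ 'n) set \<Rightarrow>
   (complex ^ 'n \<Rightarrow> complex) \<Rightarrow> (complex ^ 'n \<Rightarrow> complex) set set" where
  "gor_field br np nm F = range (\<lambda>c. gor_class br np nm F (\<lambda>x\<in>np. c))"

text \<open>The identification of \<open>nm\<close> with the degree-one part of \<open>\<complex>[np]\<close>.\<close>

definition killing_linear_form ::
  "(complex ^ 'n \<Rightarrow> complex ^ 'n \<Rightarrow> complex ^ 'n) \<Rightarrow> (complex ^ 'n) set \<Rightarrow>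
   complex ^ 'n \<Rightarrow> complex ^ 'n \<Rightarrow> complex" where
  "killing_linear_form br np L = (\<lambda>x\<in>np. killing_form br x L)"

end

theory Submission
  imports Defs "HOL-Computational_Algebra.Fundamental_Theorem_Algebra" "HOL-Library.Function_Algebras"
begin

text \<open>
  The theorem rests on finding a copy of \<open>sl(2)\<close> attached to every \<open>L\<close> with \<open>f L \<noteq> 0\<close>.

  The hypotheses speak of parabolic subalgebras and nilpotent radicals. From them one recovers an
  element \<open>H\<close> of \<open>k\<close> whose adjoint action has eigenvalues \<open>1\<close>, \<open>0\<close>, \<open>-1\<close> on \<open>np\<close>, \<open>k\<close>, \<open>nm\<close>, and which
  spans the centre of \<open>k\<close> (\<open>commutative_parabolic_short_grading\<close>). The tool is the Killing form: by
  Lie's theorem and Cartan's criterion a Borel subalgebra contains its orthogonal space, therefore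
  the nilpotent radical of a parabolic subalgebra \<open>p\<close> is the orthogonal space of \<open>p\<close>
  (\<open>nilpotent_radical_eq_perp\<close>), and simplicity together with the fact that all derivations are
  inner does the rest.

  Let \<open>f\<close> be a relative invariant of degree \<open>r\<close> on \<open>nm\<close>. The elements of \<open>k\<close> act on it through a
  linear form that kills \<open>[k, k]\<close>, and so through \<open>z \<mapsto> a (H, z)\<close> for a nonzero constant \<open>a\<close>
  (\<open>character\<close>). If \<open>f L \<noteq> 0\<close>, the logarithmic derivative of \<open>f\<close> at \<open>L\<close> is represented by an element
  \<open>x\<close> of \<open>np\<close>, and the formula for the character says exactly that \<open>[x, L] = - a H\<close>
  (\<open>lowering_partner\<close>): up to scaling, \<open>L\<close>, \<open>H\<close>, \<open>x\<close> form an \<open>sl(2)\<close>-triple.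

  This triple acts on polynomials on \<open>nm\<close>: \<open>L\<close> by the derivative \<open>\<partial>\<^sub>L\<close>, \<open>H\<close> by the degree, and \<open>x\<close> by the
  first-order operator \<open>rho m x\<close>, the derivative along the quadratic vector field
  \<open>[[x, y], y] / 2\<close> plus \<open>m (x, y)\<close>. Since \<open>[x, y]\<close> lies in \<open>k\<close>, the derivative of \<open>F = f ^ s\<close> along that
  field is again given by the character, and for \<open>m = - s a / 2\<close> the operator kills \<open>F\<close> (\<open>rho_F\<close>).
  Commuting \<open>rho m x\<close> past a derivative produces only an operator from \<open>k\<close> and a scalar, so the
  space of all constant-coefficient derivatives of \<open>F\<close> is stable under the triple (\<open>rho_stable\<close>). It is
  finite-dimensional and graded by the degrees \<open>0, \<dots>, N\<close> with \<open>N = r s\<close>, and the weight of the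
  degree-\<open>d\<close> part is \<open>N - 2 d\<close>. The representation theory of \<open>sl(2)\<close> then makes \<open>\<partial>\<^sub>L\<^bsup>N-2i\<^esup>\<close> a
  bijection from degree \<open>N - i\<close> to degree \<open>i\<close> (\<open>lefschetz_for_derivatives\<close>). The map
  \<open>P \<mapsto> P(\<partial>) F\<close> identifies the degree-\<open>i\<close> part of \<open>R / Ann F\<close> with the degree-\<open>(N - i)\<close> part of that space
  and multiplication by \<open>L\<close> with \<open>\<partial>\<^sub>L\<close>, which proves that \<open>L\<close> is a Lefschetz element.

  Conversely, if \<open>L\<close> is a Lefschetz element, then \<open>\<partial>\<^sub>L\<^bsup>N\<^esup> F \<noteq> 0\<close>. This derivative is constant, and
  Euler's identity shows that it is \<open>N! F(L)\<close>; hence \<open>f L \<noteq> 0\<close> (\<open>nonvanishing_if_lefschetz\<close>).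

  It remains to identify \<open>f L \<noteq> 0\<close> with membership in the open orbit. The triple also shows that
  \<open>z \<mapsto> [z, L]\<close> maps \<open>k\<close> onto \<open>nm\<close>, so orbits in the set \<open>f \<noteq> 0\<close> are open in the usual topology; as a
  complex line minus finitely many points is connected, that set is a single orbit
  (\<open>orbit_eq_nonvanishing\<close>). A Zariski open orbit meets it because the product of two nonzero
  polynomials is nonzero.
\<close>

section \<open>Linear algebra over the complex numbers\<close>

abbreviation lin :: "(complex ^ 'n \<Rightarrow> complex ^ 'n) \<Rightarrow> bool" where
  "lin T \<equiv> Vector_Spaces.linear (*s) (*s) T"

lemma linI:
  fixes T :: "complex ^ 'n \<Rightarrow> complex ^ 'n"
  assumes "\<And>x y. T (x + y) = T x + T y" "\<And>c x. T (c *s x) = c *s T x"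
  shows "lin T"
  using assms by unfold_locales auto

lemma lin_rules:
  fixes T :: "complex ^ 'n \<Rightarrow> complex ^ 'n"
  assumes "lin T"
  shows "T (x + y) = T x + T y" "T (c *s x) = c *s T x" "T 0 = 0" "T (x - y) = T x - T y" "T (- x) = - T x"
    "T (sum g A) = (\<Sum>a\<in>A. T (g a))"
  using assms vec.linear_add vec.linear_scale vec.linear_0 vec.linear_diff vec.linear_neg vec.linear_sum by blast+

lemma lin_funpow: "lin T \<Longrightarrow> lin (T ^^ m)"
  by (induction m) (auto intro!: linI simp: lin_rules)

lemma lin_shift: "lin T \<Longrightarrow> lin (\<lambda>u. T u - a *s u)"
  by (rule linI) (auto simp: lin_rules vec.scale_right_diff_distrib vec.scale_right_distrib mult.commute)

definition poly_op :: "(complex ^ 'n \<Rightarrow> complex ^ 'n) \<Rightarrow> complex poly \<Rightarrow> complex ^ 'n \<Rightarrow> complex ^ 'n" where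
  "poly_op T q v = (\<Sum>i\<le>degree q. Polynomial.coeff q i *s (T ^^ i) v)"

lemma poly_op_bound:
  assumes "degree q \<le> m"
  shows "poly_op T q v = (\<Sum>i\<le>m. Polynomial.coeff q i *s (T ^^ i) v)"
  unfolding poly_op_def
  by (rule sum.mono_neutral_left) (use assms in \<open>auto simp: coeff_eq_0\<close>)

lemma poly_op_linear_factor:
  assumes "lin T"
  shows "poly_op T ([:-a, 1:] * q) v = T (poly_op T q v) - a *s poly_op T q v"
proof -
  let ?m = "Suc (degree q)"
  have d: "degree ([:-a, 1:] * q) \<le> ?m"
    using degree_mult_le[of "[:-a,1:]" q] by simp
  have e: "[:-a, 1:] * q = pCons 0 q - Polynomial.smult a q" by simp
  have "poly_op T ([:-a, 1:] * q) v = (\<Sum>i\<le>?m. (Polynomial.coeff (pCons 0 q) i - a * Polynomial.coeff q i) *s (T ^^ i) v)"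
    unfolding poly_op_bound[OF d] unfolding e coeff_diff coeff_smult ..
  also have "\<dots> = (\<Sum>i\<le>?m. Polynomial.coeff (pCons 0 q) i *s (T ^^ i) v) - (\<Sum>i\<le>?m. (a * Polynomial.coeff q i) *s (T ^^ i) v)"
    by (simp only: vec.scale_left_diff_distrib sum_subtractf)
  also have "(\<Sum>i\<le>?m. Polynomial.coeff (pCons 0 q) i *s (T ^^ i) v) = T (poly_op T q v)"
    unfolding poly_op_def sum.atMost_Suc_shift by (simp add: lin_rules[OF assms])
  also have "(\<Sum>i\<le>?m. (a * Polynomial.coeff q i) *s (T ^^ i) v) = a *s poly_op T q v"
    unfolding poly_op_bound[of q ?m, OF le_SucI[OF order_refl]] vec.scale_sum_right by simp
  finally show ?thesis .
qed

lemma exists_annihilating_poly: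
  fixes v :: "complex ^ 'n"
  assumes "lin T"
  shows "\<exists>q. q \<noteq> 0 \<and> poly_op T q v = 0"
proof (cases "inj_on (\<lambda>i. (T ^^ i) v) {..CARD('n)}")
  case False
  then obtain i j where ij: "i \<noteq> j" "(T ^^ i) v = (T ^^ j) v" unfolding inj_on_def by blast
  let ?q = "Polynomial.monom 1 i - Polynomial.monom 1 j :: complex poly"
  have "?q \<noteq> 0" using ij(1) by (auto simp: monom_eq_iff')
  moreover have "poly_op T ?q v = 0"
  proof -
    have d: "degree ?q \<le> max i j" by (metis degree_diff_le_max degree_monom_eq zero_neq_one)
    have "poly_op T ?q v = (\<Sum>l\<le>max i j. (if l = i then (T ^^ l) v else 0) - (if l = j then (T ^^ l) v else 0))"
      unfolding poly_op_bound[OF d] by (rule sum.cong) auto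
    also have "\<dots> = 0" using ij by (simp add: sum_subtractf)
    finally show ?thesis .
  qed
  ultimately show ?thesis by blast
next
  case True
  let ?S = "(\<lambda>i. (T ^^ i) v) ` {..CARD('n)}"
  have "card ?S = Suc CARD('n)" using True by (simp add: card_image)
  moreover have "vec.dim ?S \<le> CARD('n)" using vec.dim_subset_UNIV[of ?S] by (simp add: vec.dimension_def card_cart_basis)
  ultimately have "vec.dependent ?S" using vec.dim_eq_card_independent[of ?S] by auto
  then obtain u x where u: "(\<Sum>x\<in>?S. u x *s x) = 0" "x \<in> ?S" "u x \<noteq> 0"
    using vec.dependent_finite[of ?S] by auto
  then obtain j where j: "j \<le> CARD('n)" "u ((T ^^ j) v) \<noteq> 0" by auto
  let ?q = "\<Sum>i\<le>CARD('n). Polynomial.monom (u ((T ^^ i) v)) i"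
  have c: "Polynomial.coeff ?q l = (if l \<le> CARD('n) then u ((T ^^ l) v) else 0)" for l
    by (simp add: coeff_sum)
  have "?q \<noteq> 0" using j c[of j] by (metis coeff_0)
  moreover have "degree ?q \<le> CARD('n)" by (rule degree_le) (use c in auto)
  then have "poly_op T ?q v = (\<Sum>i\<le>CARD('n). u ((T ^^ i) v) *s (T ^^ i) v)"
    by (subst poly_op_bound) (auto simp: c intro!: sum.cong)
  then have "poly_op T ?q v = 0" using u(1) by (subst (asm) sum.reindex[OF True]) (simp add: o_def)
  ultimately show ?thesis by blast
qed

lemma poly_op_in_subspace:
  assumes "vec.subspace W" "T ` W \<subseteq> W" "v \<in> W"
  shows "poly_op T q v \<in> W"
proof -
  have "(T ^^ i) v \<in> W" for i using assms by (induction i) auto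
  then show ?thesis unfolding poly_op_def
    by (intro vec.subspace_sum[OF assms(1)] vec.subspace_scale[OF assms(1)])
qed

text \<open>An eigenvector in \<open>W / W0\<close>, for a subspace \<open>W0\<close> that need not be \<open>T\<close>-invariant: take a polynomial \<open>q\<close> of
least degree that sends some \<open>w\<close> outside \<open>W0\<close> into \<open>W0\<close>, and split off a root of \<open>q\<close>. Working modulo a
subspace avoids quotient spaces throughout; flags are built by repeating such a step.\<close>
lemma eigenvector_mod:
  fixes T :: "complex ^ 'n \<Rightarrow> complex ^ 'n"
  assumes T: "lin T" and W: "vec.subspace W" "T ` W \<subseteq> W" and W0: "vec.subspace W0"
    and w: "w \<in> W" "w \<notin> W0"
  shows "\<exists>v a. v \<in> W \<and> v \<notin> W0 \<and> T v - a *s v \<in> W0"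
proof -
  define P where "P n \<longleftrightarrow> (\<exists>q w. degree q = n \<and> q \<noteq> 0 \<and> w \<in> W \<and> w \<notin> W0 \<and> poly_op T q w \<in> W0)" for n
  have "\<exists>n. P n" using exists_annihilating_poly[OF T, of w] w vec.subspace_0[OF W0] unfolding P_def by metis
  then obtain n where n: "P n" "\<And>m. m < n \<Longrightarrow> \<not> P m" using LeastI_ex[of P] not_less_Least[of _ P] by metis
  then obtain q w where q: "degree q = n" "q \<noteq> 0" "w \<in> W" "w \<notin> W0" "poly_op T q w \<in> W0"
    unfolding P_def by auto
  have "n \<noteq> 0"
  proof
    assume "n = 0"
    then have "Polynomial.coeff q 0 *s w \<in> W0" "Polynomial.coeff q 0 \<noteq> 0" using q leading_coeff_0_iff[of q] by (auto simp: poly_op_def)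
    then have "inverse (Polynomial.coeff q 0) *s (Polynomial.coeff q 0 *s w) \<in> W0" using vec.subspace_scale[OF W0] by blast
    then show False using q \<open>Polynomial.coeff q 0 \<noteq> 0\<close> by simp
  qed
  then obtain a where "poly q a = 0" using q fundamental_theorem_of_algebra_alt[of q]
    by (metis degree_pCons_0 degree_0)
  then obtain q' where q': "q = [:-a, 1:] * q'" using poly_eq_0_iff_dvd by blast
  have nz: "q' \<noteq> 0" using q' q by auto
  have dg: "degree q' < n" using q(1) nz unfolding q' by (subst (asm) degree_mult_eq) auto
  let ?v = "poly_op T q' w"
  have "?v \<in> W" using poly_op_in_subspace[OF W] q by auto
  moreover have "?v \<notin> W0" using n(2)[OF dg] nz q unfolding P_def by blast
  moreover have "T ?v - a *s ?v \<in> W0" using q(5) poly_op_linear_factor[OF T] unfolding q' by simp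
  ultimately show ?thesis by blast
qed

subsection \<open>Flags and traces\<close>

text \<open>The one induction behind all triangular bases below. The property \<open>Q\<close> of a new basis vector relates
it to the span of its predecessors, and only has to be realised one step at a time.\<close>
lemma flag_exists:
  fixes W :: "(complex ^ 'n) set"
  assumes W: "vec.subspace W"
    and step: "\<And>w j. j < vec.dim W \<Longrightarrow> w ` {..<j} \<subseteq> W \<Longrightarrow>
        (\<forall>i<j. Q (vec.span (w ` {..<i})) (w i)) \<Longrightarrow> vec.span (w ` {..<j}) \<noteq> W \<Longrightarrow>
        \<exists>v\<in>W. v \<notin> vec.span (w ` {..<j}) \<and> Q (vec.span (w ` {..<j})) v"
  shows "\<exists>w. inj_on w {..<vec.dim W} \<and> vec.independent (w ` {..<vec.dim W}) \<and>
     vec.span (w ` {..<vec.dim W}) = W \<and> (\<forall>i<vec.dim W. Q (vec.span (w ` {..<i})) (w i))"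
proof -
  have "\<exists>w. (\<forall>i<j. Q (vec.span (w ` {..<i})) (w i)) \<and> w ` {..<j} \<subseteq> W \<and> inj_on w {..<j} \<and> vec.independent (w ` {..<j})"
    if "j \<le> vec.dim W" for j
    using that
  proof (induction j)
    case 0
    then show ?case by (auto simp: vec.independent_empty)
  next
    case (Suc j)
    then obtain w where w: "\<forall>i<j. Q (vec.span (w ` {..<i})) (w i)" "w ` {..<j} \<subseteq> W" "inj_on w {..<j}" "vec.independent (w ` {..<j})"
      by auto
    have "vec.dim (vec.span (w ` {..<j})) = j" using w by (simp add: vec.dim_eq_card_independent card_image)
    then have "vec.span (w ` {..<j}) \<noteq> W" using Suc.prems by auto
    then obtain v where v: "v \<in> W" "v \<notin> vec.span (w ` {..<j})" "Q (vec.span (w ` {..<j})) v"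
      using step[of j w] Suc.prems w by auto
    let ?w = "w(j := v)"
    have im: "?w ` {..<i} = w ` {..<i}" if "i \<le> j" for i using that by auto
    have im2: "?w ` {..<Suc j} = insert v (w ` {..<j})" by (auto simp: lessThan_Suc)
    have "\<forall>i<Suc j. Q (vec.span (?w ` {..<i})) (?w i)"
    proof (intro allI impI)
      fix i assume "i < Suc j"
      then show "Q (vec.span (?w ` {..<i})) (?w i)" using im[of i] w(1) v(3) by (cases "i = j") auto
    qed
    moreover have "inj_on ?w {..<Suc j}"
    proof -
      have "v \<notin> w ` {..<j}" using v(2) vec.span_base[of v "w ` {..<j}"] by metis
      then show ?thesis using w(3) by (simp add: lessThan_Suc inj_on_insert inj_on_fun_updI)
    qed
    moreover have "?w ` {..<Suc j} \<subseteq> W" unfolding im2 using v(1) w(2) by blast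
    moreover have "vec.independent (?w ` {..<Suc j})" unfolding im2 using vec.independent_insertI[OF v(2) w(4)] .
    ultimately show ?case by blast
  qed
  from this[OF order_refl] obtain w where w: "\<forall>i<vec.dim W. Q (vec.span (w ` {..<i})) (w i)" "w ` {..<vec.dim W} \<subseteq> W"
    "inj_on w {..<vec.dim W}" "vec.independent (w ` {..<vec.dim W})" by auto
  moreover have "vec.span (w ` {..<vec.dim W}) = W"
  proof -
    have "card (w ` {..<vec.dim W}) = vec.dim W" using w(3) by (simp add: card_image)
    then have "W \<subseteq> vec.span (w ` {..<vec.dim W})" using vec.card_ge_dim_independent[OF w(2,4)] by simp
    then show ?thesis using vec.span_minimal[OF w(2) W] by blast
  qed
  ultimately show ?thesis by blast
qed

definition tr :: "(complex ^ 'n \<Rightarrow> complex ^ 'n) \<Rightarrow> complex" where "tr T = trace (matrix T)"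

lemma tr_add: "tr (\<lambda>x. S x + T x) = tr S + tr T"
  by (simp add: tr_def trace_def matrix_def sum.distrib)

lemma tr_diff: "tr (\<lambda>x. S x - T x) = tr S - tr T"
  by (simp add: tr_def trace_def matrix_def sum_subtractf)

lemma tr_scale: "tr (\<lambda>x. c *s T x) = c * tr T"
  by (simp add: tr_def trace_def matrix_def sum_distrib_left)

lemma tr_commute:
  assumes "lin S" "lin T"
  shows "tr (\<lambda>x. S (T x)) = tr (\<lambda>x. T (S x))"
proof -
  have "matrix (\<lambda>x. S (T x)) = matrix S ** matrix T" "matrix (\<lambda>x. T (S x)) = matrix T ** matrix S"
    using matrix_compose_gen[OF assms(1,2)] matrix_compose_gen[OF assms(2,1)]
      matrix_compose_gen[OF assms(2,1)] by (simp_all add: o_def)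
  then show ?thesis unfolding tr_def using trace_mul_sym by metis
qed

text \<open>The diagonal entries are read off with the coordinate functionals \<open>r\<close> of the flag basis.\<close>
lemma tr_triangular:
  fixes M :: "complex ^ 'n \<Rightarrow> complex ^ 'n" and N :: nat
  assumes M: "lin M" and inj: "inj_on w {..<N}" and ind: "vec.independent (w ` {..<N})"
    and sp: "vec.span (w ` {..<N}) = UNIV"
    and tri: "\<And>i. i < N \<Longrightarrow> M (w i) - d i *s w i \<in> vec.span (w ` {..<i})"
  shows "tr M = (\<Sum>i<N. d i)"
proof -
  let ?B = "w ` {..<N}"
  define r where "r v i = vec.representation ?B v (w i)" for v i
  have rep: "(\<Sum>i<N. r v i *s w i) = v" for v
    unfolding r_def
    using vec.sum_representation_eq[OF ind, of v ?B, OF _ _ order_refl] sp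
    by (simp add: sum.reindex[OF inj, unfolded o_def])
  have radd: "r (u + v) i = r u i + r v i" for u v i
    unfolding r_def using vec.representation_add[OF ind] sp by simp
  have rscale: "r (c *s v) i = c * r v i" for c v i
    unfolding r_def using vec.representation_scale[OF ind] sp by simp
  have r0: "r 0 i = 0" for i unfolding r_def by (simp add: vec.representation_zero)
  have rsum: "r (\<Sum>a\<in>A. g a) i = (\<Sum>a\<in>A. r (g a) i)" for g :: "'n \<Rightarrow> complex ^ 'n" and A i
    by (induction A rule: infinite_finite_induct) (auto simp: radd r0)
  have rlow: "r v i = 0" if "v \<in> vec.span (w ` {..<i})" "i < N" for v i
  proof -
    have sub: "w ` {..<i} \<subseteq> ?B" using that by auto
    have "vec.representation ?B v = vec.representation (w ` {..<i}) v"
      using vec.representation_extend[OF ind that(1) sub] .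
    moreover have "w i \<notin> w ` {..<i}" using inj_onD[OF inj, of i] that(2) by fastforce
    ultimately show ?thesis unfolding r_def using vec.representation_ne_zero by metis
  qed
  have rw: "r (w i) i = 1" if "i < N" for i
    unfolding r_def using vec.representation_basis[OF ind, of "w i"] that by auto
  have diag: "r (M (w i)) i = d i" if "i < N" for i
  proof -
    have "M (w i) = d i *s w i + (M (w i) - d i *s w i)" by simp
    then have "r (M (w i)) i = r (d i *s w i) i + r (M (w i) - d i *s w i) i" by (metis radd)
    then show ?thesis using rlow[OF tri[OF that] that] rw[OF that] by (simp add: rscale)
  qed
  have comp: "M (axis j 1) $ j = (\<Sum>i<N. r (axis j 1) i * M (w i) $ j)" for j
  proof -
    have "M (axis j 1) = M (\<Sum>i<N. r (axis j 1) i *s w i)" by (simp add: rep)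
    also have "\<dots> = (\<Sum>i<N. r (axis j 1) i *s M (w i))" by (simp add: lin_rules[OF M])
    finally show ?thesis by simp
  qed
  have "tr M = (\<Sum>j\<in>UNIV. M (axis j 1) $ j)" by (simp add: tr_def trace_def matrix_def)
  also have "\<dots> = (\<Sum>i<N. \<Sum>j\<in>UNIV. M (w i) $ j * r (axis j 1) i)"
    unfolding comp by (subst sum.swap) (simp add: mult.commute)
  also have "\<dots> = (\<Sum>i<N. r (\<Sum>j\<in>UNIV. M (w i) $ j *s axis j 1) i)" by (simp add: rsum rscale)
  also have "\<dots> = (\<Sum>i<N. r (M (w i)) i)"
    by (simp only: basis_expansion)
  also have "\<dots> = (\<Sum>i<N. d i)" using diag by simp
  finally show ?thesis .
qed

lemma triangular_funpow:
  assumes T: "lin T" and S: "vec.subspace S" "T ` S \<subseteq> S" and "T v - a *s v \<in> S"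
  shows "(T ^^ m) v - a ^ m *s v \<in> S"
proof (induction m)
  case (Suc m)
  have "T ((T ^^ m) v - a ^ m *s v) + a ^ m *s (T v - a *s v) \<in> S"
    using Suc S assms(4) vec.subspace_add[OF S(1)] vec.subspace_scale[OF S(1)] by blast
  then show ?case by (simp add: lin_rules[OF T] vec.scale_right_diff_distrib mult.commute)
qed (simp add: vec.subspace_0[OF S(1)])

lemma flag_mono: "i \<le> j \<Longrightarrow> vec.span (w ` {..<i}) \<subseteq> vec.span (w ` {..<j})" for i j :: nat
  by (intro vec.span_mono) auto

lemma flag_invariant:
  fixes j :: nat
  assumes T: "lin T" and tri: "\<And>i. i < j \<Longrightarrow> T (w i) - a i *s w i \<in> vec.span (w ` {..<i})"
  shows "T ` vec.span (w ` {..<j}) \<subseteq> vec.span (w ` {..<j})"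
proof -
  have "T (w i) \<in> vec.span (w ` {..<j})" if "i < j" for i
  proof -
    have "T (w i) - a i *s w i \<in> vec.span (w ` {..<j})" using tri[OF that] flag_mono[of i j w] that by auto
    moreover have "a i *s w i \<in> vec.span (w ` {..<j})" using that by (intro vec.span_scale vec.span_base) auto
    ultimately show ?thesis using vec.span_add[of "T (w i) - a i *s w i" _ "a i *s w i"] by simp
  qed
  then have "w ` {..<j} \<subseteq> {v. T v \<in> vec.span (w ` {..<j})}" by auto
  moreover have "vec.subspace {v. T v \<in> vec.span (w ` {..<j})}"
    by (rule vec.subspaceI) (auto simp: lin_rules[OF T] vec.span_zero vec.span_add vec.span_scale)
  ultimately have "vec.span (w ` {..<j}) \<subseteq> {v. T v \<in> vec.span (w ` {..<j})}" by (rule vec.span_minimal)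
  then show ?thesis by auto
qed

text \<open>A nilpotent operator has only the eigenvalue \<open>0\<close> on each step of an invariant flag.\<close>
lemma tr_nilpotent:
  fixes T :: "complex ^ 'n \<Rightarrow> complex ^ 'n"
  assumes T: "lin T" and nil: "\<And>v. \<exists>m. (T ^^ m) v = 0"
  shows "tr T = 0"
proof -
  let ?Q = "\<lambda>S v. T v \<in> S"
  have "\<exists>w. inj_on w {..<vec.dim (UNIV :: (complex^'n) set)} \<and> vec.independent (w ` {..<vec.dim (UNIV :: (complex^'n) set)}) \<and>
     vec.span (w ` {..<vec.dim (UNIV :: (complex^'n) set)}) = UNIV \<and> (\<forall>i<vec.dim (UNIV :: (complex^'n) set). ?Q (vec.span (w ` {..<i})) (w i))"
  proof (rule flag_exists, simp)
    fix w :: "nat \<Rightarrow> complex ^ 'n" and j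
    let ?S = "vec.span (w ` {..<j})"
    assume tri: "\<forall>i<j. ?Q (vec.span (w ` {..<i})) (w i)" and ne: "?S \<noteq> UNIV"
    have inv: "T ` ?S \<subseteq> ?S" using flag_invariant[OF T, of j w "\<lambda>_. 0"] tri by simp
    obtain u where "u \<notin> ?S" using ne by blast
    then obtain v a where v: "v \<notin> ?S" "T v - a *s v \<in> ?S"
      using eigenvector_mod[OF T, of UNIV ?S u] by auto
    obtain m where m: "(T ^^ m) v = 0" using nil by blast
    have "- (a ^ m *s v) \<in> ?S" using triangular_funpow[OF T _ inv v(2), of m] m by simp
    then have "a ^ m *s v \<in> ?S" using vec.span_neg[of "- (a ^ m *s v)"] by simp
    then have "inverse (a ^ m) *s (a ^ m *s v) \<in> ?S" by (rule vec.span_scale)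
    then have "a = 0" using v(1) by (cases "a = 0") auto
    then show "\<exists>v\<in>UNIV. v \<notin> ?S \<and> ?Q ?S v" using v by auto
  qed
  then show ?thesis
    using tr_triangular[OF T, of _ _ "\<lambda>_. 0"] by auto
qed

subsection \<open>Generalised eigenspaces\<close>

definition geig :: "(complex ^ 'n \<Rightarrow> complex ^ 'n) \<Rightarrow> complex \<Rightarrow> (complex ^ 'n) set" where
  "geig T a = {v. \<exists>m. ((\<lambda>u. T u - a *s u) ^^ m) v = 0}"

lemma funpow_zero_mono:
  assumes "lin N" "(N ^^ m) v = 0" "m \<le> l"
  shows "(N ^^ l) v = 0"
  using assms(2,3) lin_rules(3)[OF lin_funpow[OF assms(1)]]
  by (metis funpow_add comp_apply le_add_diff_inverse2)

lemma geig_subspace: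
  assumes T: "lin T"
  shows "vec.subspace (geig T a)"
proof -
  let ?N = "\<lambda>u. T u - a *s u"
  have N: "lin ?N" using lin_shift[OF T] .
  show ?thesis
  proof (rule vec.subspaceI)
    show "0 \<in> geig T a" by (auto simp: geig_def intro!: exI[of _ 0])
  next
    fix x y assume "x \<in> geig T a" "y \<in> geig T a"
    then obtain l m where "(?N ^^ l) x = 0" "(?N ^^ m) y = 0" by (auto simp: geig_def)
    then have "(?N ^^ (max l m)) x = 0" "(?N ^^ (max l m)) y = 0"
      by (auto intro: funpow_zero_mono[OF N])
    then have "(?N ^^ (max l m)) (x + y) = 0"
      unfolding lin_rules(1)[OF lin_funpow[OF N]] by simp
    then show "x + y \<in> geig T a" by (auto simp: geig_def)
  next
    fix c x assume "x \<in> geig T a"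
    then obtain l where "(?N ^^ l) x = 0" by (auto simp: geig_def)
    then have "(?N ^^ l) (c *s x) = 0" using lin_rules(2)[OF lin_funpow[OF N]] by simp
    then show "c *s x \<in> geig T a" by (auto simp: geig_def)
  qed
qed

lemma geig_shift_iff:
  assumes T: "lin T"
  shows "T v - a *s v \<in> geig T a \<longleftrightarrow> v \<in> geig T a"
proof -
  let ?N = "\<lambda>u. T u - a *s u"
  have e: "(?N ^^ m) (T v - a *s v) = (?N ^^ Suc m) v" for m by (simp only: funpow_Suc_right o_apply)
  show ?thesis
  proof
    assume "T v - a *s v \<in> geig T a"
    then obtain m where "(?N ^^ m) (T v - a *s v) = 0" unfolding geig_def mem_Collect_eq by (rule exE)
    then show "v \<in> geig T a" unfolding e geig_def mem_Collect_eq by (rule exI)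
  next
    assume "v \<in> geig T a"
    then obtain m where "(?N ^^ m) v = 0" unfolding geig_def mem_Collect_eq by (rule exE)
    then have "(?N ^^ Suc m) v = 0" using funpow_zero_mono[OF lin_shift[OF T] _ le_SucI[OF order_refl]] by blast
    then show "T v - a *s v \<in> geig T a" unfolding e[symmetric] geig_def mem_Collect_eq by (rule exI)
  qed
qed

lemma geig_invariant:
  assumes T: "lin T" and v: "v \<in> geig T a"
  shows "T v \<in> geig T a"
proof -
  have "(T v - a *s v) + a *s v \<in> geig T a"
    using geig_shift_iff[OF T] v vec.subspace_add[OF geig_subspace[OF T]] vec.subspace_scale[OF geig_subspace[OF T]] by blast
  then show ?thesis by simp
qed

text \<open>\<open>T - a\<close> is invertible on the generalised eigenspace of any other eigenvalue \<open>b\<close>; the solution is found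
by descending along the powers of the nilpotent operator \<open>T - b\<close>.\<close>
lemma geig_shift_solve:
  assumes T: "lin T" and ne: "b \<noteq> a" and W: "vec.subspace W" "T ` W \<subseteq> W" and u: "u \<in> W" "u \<in> geig T b"
  shows "\<exists>u'\<in>W. T u' - a *s u' = u"
proof -
  let ?N = "\<lambda>u. T u - b *s u"
  obtain m where "(?N ^^ m) u = 0" using u unfolding geig_def by auto
  then show ?thesis using u(1)
  proof (induction m arbitrary: u)
    case 0
    then show ?case using vec.subspace_0[OF W(1)] by (intro bexI[of _ 0]) (auto simp: lin_rules[OF T])
  next
    case (Suc m)
    have "?N u \<in> W" using W Suc.prems vec.subspace_diff[OF W(1)] vec.subspace_scale[OF W(1)] by blast
    moreover have "(?N ^^ m) (?N u) = 0" using Suc.prems(1) by (simp only: funpow_Suc_right o_apply)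
    ultimately obtain x where x: "x \<in> W" "T x - a *s x = ?N u" using Suc.IH by blast
    let ?u = "inverse (b - a) *s (u - x)"
    have "T ?u - a *s ?u = inverse (b - a) *s ((T u - a *s u) - (T x - a *s x))"
      by (simp add: lin_rules[OF T] vec.scale_right_diff_distrib mult.commute)
    also have "\<dots> = inverse (b - a) *s ((b - a) *s u)" unfolding x(2) by (simp add: vec.scale_left_diff_distrib)
    also have "\<dots> = u" using ne by (simp only: vec.scale_scale) simp
    finally have "T ?u - a *s ?u = u" .
    moreover have "?u \<in> W" using x Suc.prems vec.subspace_diff[OF W(1)] vec.subspace_scale[OF W(1)] by blast
    ultimately show ?case by blast
  qed
qed

lemma geig_eigenvector_unique:
  assumes T: "lin T" and v: "v \<in> geig T b" "T v = a *s v" and "a \<noteq> b"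
  shows "v = 0"
proof -
  let ?N = "\<lambda>u. T u - b *s u"
  obtain m where m: "(?N ^^ m) v = 0" using v unfolding geig_def by auto
  have "(?N ^^ m) v = (a - b) ^ m *s v"
  proof (induction m)
    case (Suc m)
    then show ?case using v(2) by (simp add: lin_rules[OF T] vec.scale_left_diff_distrib algebra_simps)
  qed simp
  then show ?thesis using m assms(4) by simp
qed

lemma geig_disjoint:
  assumes T: "lin T" and v: "v \<in> geig T a" "v \<in> geig T b" and "a \<noteq> b"
  shows "v = 0"
proof -
  let ?N = "\<lambda>u. T u - a *s u"
  obtain m where "(?N ^^ m) v = 0" using v unfolding geig_def by auto
  then show ?thesis using v(2)
  proof (induction m)
    case (Suc m)
    have "(?N ^^ i) v \<in> geig T b" for i
    proof (induction i)
      case (Suc i)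
      then show ?case using geig_invariant[OF T] vec.subspace_diff[OF geig_subspace[OF T]] vec.subspace_scale[OF geig_subspace[OF T]] by auto
    qed (use Suc in simp)
    moreover have "T ((?N ^^ m) v) = a *s (?N ^^ m) v" using Suc.prems(1) by simp
    ultimately have "(?N ^^ m) v = 0" using geig_eigenvector_unique[OF T _ _ assms(4)] by blast
    then show ?case using Suc by blast
  qed simp
qed

lemma geig_independent:
  assumes T: "lin T" and "finite A" "\<And>a. a \<in> A \<Longrightarrow> v a \<in> geig T a" "(\<Sum>a\<in>A. v a) = 0" "a \<in> A"
  shows "v a = 0"
  using assms(2-5)
proof (induction A arbitrary: v a rule: finite_induct)
  case (insert b A)
  let ?N = "\<lambda>u. T u - b *s u"
  have N: "lin ?N" using lin_shift[OF T] .
  obtain m where m: "(?N ^^ m) (v b) = 0" using insert.prems(1)[of b] unfolding geig_def by auto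
  have mem: "(?N ^^ i) (v a) \<in> geig T a" if "a \<in> A" for a i
  proof (induction i)
    case (Suc i)
    then show ?case using geig_invariant[OF T] vec.subspace_diff[OF geig_subspace[OF T]] vec.subspace_scale[OF geig_subspace[OF T]] by auto
  qed (use insert.prems that in simp)
  have "(?N ^^ m) (\<Sum>a\<in>insert b A. v a) = 0" using insert.prems by (simp only: lin_rules(3)[OF lin_funpow[OF N]])
  then have "(\<Sum>a\<in>A. (?N ^^ m) (v a)) = 0"
    using insert.hyps m by (simp add: lin_rules(1,6)[OF lin_funpow[OF N]])
  then have z: "(?N ^^ m) (v a) = 0" if "a \<in> A" for a using insert.IH[of "\<lambda>a. (?N ^^ m) (v a)"] mem that by blast
  have za: "v a = 0" if "a \<in> A" for a
  proof (rule geig_disjoint[OF T])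
    show "v a \<in> geig T a" using insert.prems that by simp
    show "v a \<in> geig T b" using z[OF that] unfolding geig_def by blast
    show "a \<noteq> b" using that insert.hyps by auto
  qed
  then have "v b = 0" using insert.prems(2) insert.hyps by simp
  then show ?case using za insert.prems by blast
qed simp

text \<open>A Jordan-type basis of an invariant subspace: it triangularises \<open>T\<close> and consists of generalised
eigenvectors. An eigenvector \<open>v\<close> modulo the span \<open>S\<close> of its predecessors is only a generalised
eigenvector up to an element of \<open>S\<close>, and subtracting a suitable \<open>s\<close> in \<open>S\<close> repairs this.\<close>
lemma geig_flag:
  fixes T :: "complex ^ 'n \<Rightarrow> complex ^ 'n"
  assumes T: "lin T" and W: "vec.subspace W" "T ` W \<subseteq> W"
  shows "\<exists>w a. inj_on w {..<vec.dim W} \<and> vec.independent (w ` {..<vec.dim W}) \<and>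
     vec.span (w ` {..<vec.dim W}) = W \<and>
     (\<forall>i<vec.dim W. w i \<in> geig T (a i) \<and> T (w i) - a i *s w i \<in> vec.span (w ` {..<i}))"
proof -
  let ?Q = "\<lambda>S v. \<exists>a. v \<in> geig T a \<and> T v - a *s v \<in> S"
  have "\<exists>w. inj_on w {..<vec.dim W} \<and> vec.independent (w ` {..<vec.dim W}) \<and>
     vec.span (w ` {..<vec.dim W}) = W \<and> (\<forall>i<vec.dim W. ?Q (vec.span (w ` {..<i})) (w i))"
  proof (rule flag_exists[OF W(1)])
    fix w :: "nat \<Rightarrow> complex ^ 'n" and j
    let ?S = "vec.span (w ` {..<j})"
    assume wW: "w ` {..<j} \<subseteq> W" and tri: "\<forall>i<j. ?Q (vec.span (w ` {..<i})) (w i)" and ne: "?S \<noteq> W"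
    obtain a where a: "\<And>i. i < j \<Longrightarrow> w i \<in> geig T (a i) \<and> T (w i) - a i *s w i \<in> vec.span (w ` {..<i})"
      using choice[of "\<lambda>i a. i < j \<longrightarrow> w i \<in> geig T a \<and> T (w i) - a *s w i \<in> vec.span (w ` {..<i})"] tri by blast
    have inv: "T ` ?S \<subseteq> ?S" using flag_invariant[OF T, of j w a] a by simp
    have sub: "?S \<subseteq> W" using wW W by (simp add: vec.span_minimal)
    then obtain u where "u \<in> W" "u \<notin> ?S" using ne by blast
    then obtain v b where v: "v \<in> W" "v \<notin> ?S" "T v - b *s v \<in> ?S"
      using eigenvector_mod[OF T W, of ?S u] by auto
    \<comment> \<open>The parts of \<open>z\<close> belonging to eigenvalues other than \<open>b\<close> lie in the image of \<open>T - b\<close>.\<close>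
    have key: "\<exists>s\<in>?S. z - (T s - b *s s) \<in> geig T b" if "z \<in> ?S" for z
      using that
    proof (induction z rule: vec.span_induct_alt)
      case base
      show ?case using vec.span_zero vec.subspace_0[OF geig_subspace[OF T]] by (intro bexI[of _ 0]) (auto simp: lin_rules[OF T])
    next
      case (step c x y)
      then obtain s where s: "s \<in> ?S" "y - (T s - b *s s) \<in> geig T b" by blast
      obtain i where i: "i < j" "x = w i" using step by auto
      show ?case
      proof (cases "a i = b")
        case True
        then have "c *s x + (y - (T s - b *s s)) \<in> geig T b"
          using a[OF i(1)] i(2) s(2) vec.subspace_add[OF geig_subspace[OF T]] vec.subspace_scale[OF geig_subspace[OF T]] by blast
        then show ?thesis using s(1) by (intro bexI[of _ s]) (simp_all add: add_diff_eq)
      next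
        case False
        have "x \<in> ?S" using i by (auto intro: vec.span_base)
        then obtain x' where x': "x' \<in> ?S" "T x' - b *s x' = x"
          using geig_shift_solve[OF T False _ inv] a[OF i(1)] i(2) by auto
        have "T (c *s x' + s) - b *s (c *s x' + s) = c *s (T x' - b *s x') + (T s - b *s s)"
          by (simp add: lin_rules[OF T] vec.scale_right_diff_distrib vec.scale_right_distrib mult.commute)
        then have "T (c *s x' + s) - b *s (c *s x' + s) = c *s x + (T s - b *s s)" unfolding x'(2) .
        then have "c *s x + y - (T (c *s x' + s) - b *s (c *s x' + s)) \<in> geig T b" using s(2) by (simp add: algebra_simps)
        moreover have "c *s x' + s \<in> ?S" using x'(1) s(1) by (intro vec.span_add vec.span_scale)
        ultimately show ?thesis by blast
      qed
    qed
    obtain s where s: "s \<in> ?S" "T v - b *s v - (T s - b *s s) \<in> geig T b" using key[OF v(3)] by blast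
    have e: "T (v - s) - b *s (v - s) = T v - b *s v - (T s - b *s s)"
      by (simp add: lin_rules[OF T] vec.scale_right_diff_distrib)
    have "T s - b *s s \<in> ?S" using s(1) inv by (intro vec.span_diff vec.span_scale) auto
    then have 2: "T v - b *s v - (T s - b *s s) \<in> ?S" using vec.span_diff[OF v(3)] by blast
    have "v - s \<in> geig T b" using s(2) geig_shift_iff[OF T, of "v - s" b] unfolding e by blast
    moreover have "T (v - s) - b *s (v - s) \<in> ?S" unfolding e by (rule 2)
    moreover have "v - s \<notin> ?S" using v(2) s(1) vec.span_add[of "v - s" _ s] by auto
    moreover have "v - s \<in> W" using v(1) s(1) sub vec.subspace_diff[OF W(1)] by blast
    ultimately show "\<exists>v\<in>W. v \<notin> ?S \<and> ?Q ?S v" by blast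
  qed
  then obtain w where w: "inj_on w {..<vec.dim W}" "vec.independent (w ` {..<vec.dim W})"
     "vec.span (w ` {..<vec.dim W}) = W" "\<forall>i<vec.dim W. ?Q (vec.span (w ` {..<i})) (w i)" by blast
  then obtain a where "\<forall>i<vec.dim W. w i \<in> geig T (a i) \<and> T (w i) - a i *s w i \<in> vec.span (w ` {..<i})"
    using choice[of "\<lambda>i a. i < vec.dim W \<longrightarrow> w i \<in> geig T a \<and> T (w i) - a *s w i \<in> vec.span (w ` {..<i})"] by blast
  then show ?thesis using w by blast
qed

lemma invariant_spanned_by_geig:
  fixes T :: "complex ^ 'n \<Rightarrow> complex ^ 'n"
  assumes T: "lin T" and W: "vec.subspace W" "T ` W \<subseteq> W"
  shows "W \<subseteq> vec.span (W \<inter> (\<Union>a. geig T a))"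
proof -
  obtain w a where w: "vec.span (w ` {..<vec.dim W}) = W"
     "\<forall>i<vec.dim W. w i \<in> geig T (a i)"
    using geig_flag[OF T W] by blast
  have "w ` {..<vec.dim W} \<subseteq> W \<inter> (\<Union>a. geig T a)" using w(2) vec.span_superset[of "w ` {..<vec.dim W}"] unfolding w(1) by blast
  then show ?thesis using vec.span_mono[of "w ` {..<vec.dim W}" "W \<inter> (\<Union>a. geig T a)"] unfolding w(1) by blast
qed

text \<open>The operator \<open>D\<close> acting as \<open>cnj a\<close> on the generalised eigenspace of \<open>a\<close> is the test element of Cartan's
criterion. The trace of \<open>D T\<close> is the sum of the \<open>cnj a * a\<close>, so its vanishing forces all
eigenvalues of \<open>T\<close> to be \<open>0\<close>. Complex conjugation takes the place of the rational linear forms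
on eigenvalues of the usual proof.\<close>
lemma conj_operator:
  fixes T :: "complex ^ 'n \<Rightarrow> complex ^ 'n"
  assumes T: "lin T"
  obtains D where "lin D" "\<And>a v. v \<in> geig T a \<Longrightarrow> D v = cnj a *s v"
    "tr (\<lambda>v. D (T v)) = 0 \<Longrightarrow> UNIV = geig T 0"
proof -
  obtain n :: nat and w a where w: "inj_on w {..<n}" "vec.independent (w ` {..<n})" "vec.span (w ` {..<n}) = UNIV"
     and wa: "\<And>i. i < n \<Longrightarrow> w i \<in> geig T (a i)" "\<And>i. i < n \<Longrightarrow> T (w i) - a i *s w i \<in> vec.span (w ` {..<i})"
    using geig_flag[OF T vec.subspace_UNIV] by blast
  obtain D where D: "lin D" "\<And>x. x \<in> w ` {..<n} \<Longrightarrow> D x = cnj (a (the_inv_into {..<n} w x)) *s x"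
    using vec.linear_independent_extend[OF w(2), of "\<lambda>x. cnj (a (the_inv_into {..<n} w x)) *s x"] by blast
  have Dw: "D (w i) = cnj (a i) *s w i" if "i < n" for i
    using D(2)[of "w i"] that the_inv_into_f_f[OF w(1), of i] by simp
  have Dv: "D v = cnj b *s v" if v: "v \<in> geig T b" for v b
  proof -
    obtain c where c: "v = (\<Sum>x\<in>w ` {..<n}. c x *s x)"
    proof -
      have "v \<in> range (\<lambda>c. \<Sum>x\<in>w ` {..<n}. c x *s x)"
        using vec.span_finite[of "w ` {..<n}"] w(3) by simp
      then show thesis using that by blast
    qed
    let ?A = "insert b (a ` {..<n})"
    define u where "u l = (\<Sum>i | i < n \<and> a i = l. c (w i) *s w i)" for l
    have vs: "v = (\<Sum>i<n. c (w i) *s w i)" unfolding c by (rule sum.reindex[OF w(1), unfolded o_def])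
    have us: "(\<Sum>l\<in>?A. u l) = v" unfolding vs u_def
      by (rule sum.group[of "{..<n}" ?A a "\<lambda>i. c (w i) *s w i", unfolded lessThan_iff]) auto
    have um: "u l \<in> geig T l" for l unfolding u_def
      using wa(1) by (intro vec.subspace_sum[OF geig_subspace[OF T]] vec.subspace_scale[OF geig_subspace[OF T]]) auto
    have "(\<Sum>l\<in>?A. u l - (if l = b then v else 0)) = 0"
      unfolding sum_subtractf us by simp
    then have "u l - (if l = b then v else 0) = 0" if "l \<in> ?A" for l
      using geig_independent[OF T, of ?A "\<lambda>l. u l - (if l = b then v else 0)" l] that um v
        vec.subspace_diff[OF geig_subspace[OF T]] by auto
    then have ul: "u l = (if l = b then v else 0)" if "l \<in> ?A" for l using that by simp
    have "D v = (\<Sum>l\<in>?A. D (u l))" using us lin_rules(6)[OF D(1), of u ?A] by simp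
    also have "\<dots> = (\<Sum>l\<in>?A. cnj l *s u l)"
    proof (rule sum.cong)
      fix l
      show "D (u l) = cnj l *s u l" unfolding u_def lin_rules(6)[OF D(1)] vec.scale_sum_right
        by (rule sum.cong) (auto simp: lin_rules(2)[OF D(1)] Dw mult.commute)
    qed simp
    also have "\<dots> = (\<Sum>l\<in>?A. if l = b then cnj b *s v else 0)" by (rule sum.cong) (auto simp: ul)
    finally show ?thesis by simp
  qed
  have Dinv: "D ` vec.span (w ` {..<j}) \<subseteq> vec.span (w ` {..<j})" if "j \<le> n" for j
    using flag_invariant[OF D(1), of j w "\<lambda>i. cnj (a i)"] Dw that by (simp add: vec.span_zero)
  have DT: "lin (\<lambda>v. D (T v))" by (rule linI) (simp_all add: lin_rules[OF T] lin_rules[OF D(1)])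
  have tr: "tr (\<lambda>v. D (T v)) = (\<Sum>i<n. cnj (a i) * a i)"
  proof (rule tr_triangular[OF DT w])
    fix i assume i: "i < n"
    have "D (T (w i)) - (cnj (a i) * a i) *s w i = D (T (w i) - a i *s w i)"
      by (simp add: lin_rules[OF D(1)] Dw[OF i] mult.commute)
    then show "D (T (w i)) - (cnj (a i) * a i) *s w i \<in> vec.span (w ` {..<i})"
      using Dinv[of i] wa(2)[OF i] i by auto
  qed
  have "UNIV = geig T 0" if "tr (\<lambda>v. D (T v)) = 0"
  proof -
    have "(\<Sum>i<n. cnj (a i) * a i) = of_real (\<Sum>i<n. (cmod (a i))\<^sup>2)"
      by (simp add: complex_norm_square mult.commute del: of_real_power)
    then have "complex_of_real (\<Sum>i<n. (cmod (a i))\<^sup>2) = 0" using that tr by simp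
    then have "(\<Sum>i<n. (cmod (a i))\<^sup>2) = 0" unfolding of_real_eq_0_iff .
    then have "a i = 0" if "i < n" for i using that by (simp add: sum_nonneg_eq_0_iff)
    then have "w ` {..<n} \<subseteq> geig T 0" using wa(1) by fastforce
    then show ?thesis using vec.span_minimal[OF _ geig_subspace[OF T]] w(3) by blast
  qed
  then show thesis using that D(1) Dv by blast
qed

section \<open>Solvable subalgebras and the Killing form\<close>

lemma dim_le_card: "vec.dim S \<le> CARD('n)" for S :: "(complex ^ 'n) set"
  using vec.dim_subset_UNIV[of S] by (simp add: vec.dimension_def card_cart_basis)

locale complex_lie_algebra =
  fixes br :: "complex ^ 'n \<Rightarrow> complex ^ 'n \<Rightarrow> complex ^ 'n"
  assumes lie: "lie_algebra br"
begin

abbreviation kf :: "complex ^ 'n \<Rightarrow> complex ^ 'n \<Rightarrow> complex" where "kf \<equiv> killing_form br"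

lemma br_lin: "lin (br x)" "lin (\<lambda>x. br x y)"
  using lie unfolding lie_algebra_def by auto

lemmas br_simps = lin_rules[OF br_lin(1)] lin_rules[OF br_lin(2)]

lemma br_self [simp]: "br x x = 0"
  using lie unfolding lie_algebra_def by auto

lemma br_anti: "br x y = - br y x"
proof -
  have "0 = br (x + y) (x + y)" by simp
  also have "\<dots> = (br x x + br y x) + (br x y + br y y)" by (simp only: br_simps)
  finally have "br x y + br y x = 0" by (simp add: add.commute)
  then show ?thesis by (simp add: eq_neg_iff_add_eq_0)
qed

lemma jacobi: "br x (br y z) = br (br x y) z + br y (br x z)"
proof -
  have "br x (br y z) + br y (br z x) + br z (br x y) = 0"
    using lie unfolding lie_algebra_def by auto
  moreover have "br y (br z x) = - br y (br x z)" by (subst br_anti[of z x]) (simp add: br_simps)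
  moreover have "br z (br x y) = - br (br x y) z" by (rule br_anti)
  ultimately show ?thesis by (simp add: algebra_simps)
qed

lemma br_mem_commute: "vec.subspace S \<Longrightarrow> br x y \<in> S \<Longrightarrow> br y x \<in> S"
  using br_anti[of y x] vec.subspace_neg by auto

lemma kf_tr: "kf x y = tr (\<lambda>z. br x (br y z))"
  by (simp add: killing_form_def tr_def)

lemma kf_sym: "kf x y = kf y x"
  unfolding kf_tr by (rule tr_commute[OF br_lin(1) br_lin(1)])

lemma kf_lin1: "kf (x + y) z = kf x z + kf y z" "kf (c *s x) z = c * kf x z"
  unfolding kf_tr by (simp_all add: br_simps tr_add tr_scale)

lemma kf_lin: "kf (x + y) z = kf x z + kf y z" "kf (c *s x) z = c * kf x z"
  "kf z (x + y) = kf z x + kf z y" "kf z (c *s x) = c * kf z x"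
  "kf 0 z = 0" "kf z 0 = 0" "kf (- x) z = - kf x z" "kf z (- x) = - kf z x"
  "kf (x - y) z = kf x z - kf y z" "kf z (x - y) = kf z x - kf z y"
proof -
  show a: "kf (x + y) z = kf x z + kf y z" "kf (c *s x) z = c * kf x z" for x y z c by (rule kf_lin1)+
  show b: "kf z (x + y) = kf z x + kf z y" "kf z (c *s x) = c * kf z x" for x y z c
    using a kf_sym by metis+
  show "kf 0 z = 0" "kf z 0 = 0" using a(2)[of 0 0 z] b(2)[of z 0 0] by simp_all
  show n: "kf (- x) z = - kf x z" "kf z (- x) = - kf z x" for x z
    using a(2)[of "-1" x z] b(2)[of z "-1" x] by simp_all
  show "kf (x - y) z = kf x z - kf y z" "kf z (x - y) = kf z x - kf z y"
    using a(1)[of x "- y" z] b(1)[of z x "- y"] n by simp_all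
qed

lemma kf_linear: "Vector_Spaces.linear (*s) (*) (\<lambda>z. kf z y)" "Vector_Spaces.linear (*s) (*) (kf x)"
  by (unfold_locales; simp add: kf_lin algebra_simps)+

lemma lin_comp: "lin S \<Longrightarrow> lin T \<Longrightarrow> lin (\<lambda>x. S (T x))" for S T :: "complex ^ 'n \<Rightarrow> complex ^ 'n"
  by (rule linI) (simp_all add: lin_rules)

lemma kf_invariant: "kf (br x y) z = kf x (br y z)"
proof -
  have "kf (br x y) z = tr (\<lambda>u. br x (br y (br z u)) - br y (br x (br z u)))"
    unfolding kf_tr by (rule arg_cong[of _ _ tr]) (auto simp: jacobi[of x y] fun_eq_iff)
  also have "\<dots> = tr (\<lambda>u. br x (br y (br z u))) - tr (\<lambda>u. br y (br x (br z u)))" by (rule tr_diff)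
  also have "tr (\<lambda>u. br y (br x (br z u))) = tr (\<lambda>u. br x (br z (br y u)))"
    by (rule tr_commute[OF br_lin(1) lin_comp[OF br_lin(1) br_lin(1)]])
  also have "tr (\<lambda>u. br x (br y (br z u))) - \<dots> = tr (\<lambda>u. br x (br y (br z u)) - br x (br z (br y u)))"
    by (rule tr_diff[symmetric])
  also have "\<dots> = kf x (br y z)"
    unfolding kf_tr by (rule arg_cong[of _ _ tr]) (auto simp: jacobi[of y z] br_simps fun_eq_iff)
  finally show ?thesis .
qed

abbreviation derived :: "(complex ^ 'n) set \<Rightarrow> (complex ^ 'n) set" where "derived A \<equiv> lie_prod br A A"

lemma lie_prod_mono: "A \<subseteq> A' \<Longrightarrow> B \<subseteq> B' \<Longrightarrow> lie_prod br A B \<subseteq> lie_prod br A' B'"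
  unfolding lie_prod_def by (intro vec.span_mono) blast

lemma lie_prod_subspace: "vec.subspace (lie_prod br A B)"
  unfolding lie_prod_def by simp

lemma lie_prod_mem: "a \<in> A \<Longrightarrow> b \<in> B \<Longrightarrow> br a b \<in> lie_prod br A B"
  unfolding lie_prod_def by (rule vec.span_base) blast

lemma lie_prod_least:
  assumes "vec.subspace S" "\<And>a b. a \<in> A \<Longrightarrow> b \<in> B \<Longrightarrow> br a b \<in> S"
  shows "lie_prod br A B \<subseteq> S"
  unfolding lie_prod_def by (rule vec.span_minimal) (use assms in auto)

lemma derived_funpow_mono: "A \<subseteq> B \<Longrightarrow> (derived ^^ m) A \<subseteq> (derived ^^ m) B"
proof (induction m)
  case (Suc m)
  then show ?case using lie_prod_mono[OF Suc.IH[OF Suc.prems] Suc.IH[OF Suc.prems]] by simp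
qed simp

lemma solvable_if_derived_subset:
  assumes "solvable_lie br b" "(derived ^^ j) c \<subseteq> b" "vec.subspace c"
  shows "solvable_lie br c"
proof -
  obtain m where "(derived ^^ m) b = {0}" using assms(1) unfolding solvable_lie_def by (rule exE)
  then have "(derived ^^ (m + j)) c \<subseteq> {0}" using derived_funpow_mono[OF assms(2), of m] by (simp add: funpow_add)
  moreover have "vec.subspace ((derived ^^ i) c)" for i
    by (induction i) (simp_all add: assms lie_prod_subspace)
  then have "0 \<in> (derived ^^ (m + j)) c" by (rule vec.subspace_0)
  ultimately show ?thesis unfolding solvable_lie_def by blast
qed

lemma solvable_derived_proper:
  assumes "solvable_lie br b" "b \<noteq> {0}"
  shows "derived b \<noteq> b"
proof
  assume e: "derived b = b"
  have "(derived ^^ m) b = b" for m by (induction m) (simp_all add: e)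
  then show False using assms unfolding solvable_lie_def by auto
qed

subsection \<open>Lie's theorem\<close>

text \<open>The invariance lemma in the proof of Lie's theorem, modulo \<open>W0\<close>: the joint eigenvalue \<open>l\<close> vanishes
on brackets with \<open>z\<close>. On the chain \<open>v, [z, v], [z, [z, v]], \<dots>\<close> the element \<open>[x, z]\<close> acts
triangularly with the constant diagonal entry \<open>l [x, z]\<close>, and its trace is that of a commutator. The
proof avoids the trace of a quotient and compares the coefficient of the last independent vector.\<close>
lemma lie_invariance:
  assumes a: "\<And>x. x \<in> A \<Longrightarrow> br x z \<in> A" and W0: "vec.subspace W0" "\<And>x w. x \<in> A \<Longrightarrow> w \<in> W0 \<Longrightarrow> br x w \<in> W0"
    "\<And>w. w \<in> W0 \<Longrightarrow> br z w \<in> W0"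
    and v: "v \<notin> W0" and l: "\<And>x. x \<in> A \<Longrightarrow> br x v - l x *s v \<in> W0" and x: "x \<in> A"
  shows "l (br x z) = 0"
proof -
  define vv where "vv i = (br z ^^ i) v" for i
  define U where "U i = vec.span (W0 \<union> vv ` {..<i})" for i
  have Us: "vec.subspace (U i)" for i by (simp add: U_def)
  have U0: "U 0 = W0" using W0(1) by (simp add: U_def vec.span_eq_iff)
  have UW: "W0 \<subseteq> U i" for i unfolding U_def by (meson le_supE vec.span_superset)
  have Um: "U i \<subseteq> U j" if "i \<le> j" for i j unfolding U_def using that by (intro vec.span_mono) auto
  have vU: "vv i \<in> U j" if "i < j" for i j unfolding U_def using that by (intro vec.span_base) auto
  have UI: "U i \<subseteq> S" if "vec.subspace S" "W0 \<subseteq> S" "\<And>j. j < i \<Longrightarrow> vv j \<in> S" for i S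
    unfolding U_def by (rule vec.span_minimal) (use that in auto)
  have zU: "br z u \<in> U (Suc i)" if "u \<in> U i" for u i
  proof -
    have "U i \<subseteq> {u. br z u \<in> U (Suc i)}"
    proof (rule UI)
      show "vec.subspace {u. br z u \<in> U (Suc i)}"
        by (rule vec.subspaceI) (auto simp: br_simps intro: vec.subspace_0[OF Us] vec.subspace_add[OF Us] vec.subspace_scale[OF Us])
      show "W0 \<subseteq> {u. br z u \<in> U (Suc i)}" using W0(3) UW by blast
      show "vv j \<in> {u. br z u \<in> U (Suc i)}" if "j < i" for j using vU[of "Suc j" "Suc i"] that by (simp add: vv_def)
    qed
    then show ?thesis using that by blast
  qed
  \<comment> \<open>The entry next to the diagonal: moving \<open>x\<close> past each of the \<open>Suc i\<close> factors \<open>z\<close>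
    contributes \<open>l [x, z]\<close> once.\<close>
  have step: "br x (vv (Suc i)) - l x *s vv (Suc i) - (of_nat (Suc i) * l (br x z)) *s vv i \<in> U i" if "x \<in> A" for x i
    using that
  proof (induction i arbitrary: x)
    case 0
    have "br z (br x v - l x *s v) + (br (br x z) v - l (br x z) *s v) \<in> W0"
      using 0 W0 l a vec.subspace_add[OF W0(1)] by blast
    then show ?case unfolding U0 by (simp add: vv_def jacobi[of x z] br_simps algebra_simps)
  next
    case (Suc i)
    let ?r = "br x (vv (Suc i)) - l x *s vv (Suc i) - (of_nat (Suc i) * l (br x z)) *s vv i"
    let ?r' = "br (br x z) (vv (Suc i)) - l (br x z) *s vv (Suc i)"
    have "br z ?r \<in> U (Suc i)" using zU Suc by blast
    moreover have "?r' \<in> U (Suc i)"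
    proof -
      let ?t = "(of_nat (Suc i) * l (br (br x z) z)) *s vv i"
      have "?r' - ?t \<in> U (Suc i)" using Suc.IH[OF a[OF Suc.prems]] Um[of i "Suc i"] by auto
      moreover have "?t \<in> U (Suc i)" using vU[of i "Suc i"] by (intro vec.subspace_scale[OF Us]) auto
      ultimately have "?r' - ?t + ?t \<in> U (Suc i)" by (rule vec.subspace_add[OF Us])
      then show ?thesis by simp
    qed
    ultimately have "br z ?r + ?r' \<in> U (Suc i)" by (rule vec.subspace_add[OF Us])
    moreover have "br z ?r + ?r' = br x (vv (Suc (Suc i))) - l x *s vv (Suc (Suc i)) - (of_nat (Suc (Suc i)) * l (br x z)) *s vv (Suc i)"
    proof -
      have e: "vv (Suc j) = br z (vv j)" for j by (simp add: vv_def)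
      show ?thesis unfolding e[of "Suc i"] jacobi[of x z "vv (Suc i)"]
        by (simp add: br_simps e[symmetric] vec_eq_iff algebra_simps)
    qed
    ultimately show ?case by simp
  qed
  have "\<exists>m. vv m \<in> U m"
  proof (rule ccontr)
    assume n: "\<nexists>m. vv m \<in> U m"
    have "i \<le> vec.dim (U i)" for i
    proof (induction i)
      case (Suc i)
      have "U (Suc i) = vec.span (insert (vv i) (W0 \<union> vv ` {..<i}))" unfolding U_def by (simp add: lessThan_Suc)
      then have "vec.dim (U (Suc i)) = Suc (vec.dim (U i))"
        using n vec.dim_insert[of "vv i" "W0 \<union> vv ` {..<i}"] unfolding U_def by simp
      then show ?case using Suc by simp
    qed simp
    then have "Suc CARD('n) \<le> vec.dim (U (Suc CARD('n)))" .
    then show False using vec.dim_subset_UNIV[of "U (Suc CARD('n))"] by (simp add: vec.dimension_def card_cart_basis)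
  qed
  \<comment> \<open>\<open>m\<close> is the length of the chain modulo \<open>W0\<close>.\<close>
  then obtain m where m: "vv m \<in> U m" "\<And>k. k < m \<Longrightarrow> vv k \<notin> U k"
    using LeastI_ex[of "\<lambda>m. vv m \<in> U m"] not_less_Least[of _ "\<lambda>m. vv m \<in> U m"] by blast
  have "m \<noteq> 0" using m(1) v U0 by (cases m) (auto simp: vv_def)
  then obtain k where k: "m = Suc k" by (cases m) auto
  have low: "U (Suc k) \<subseteq> {u. br x u - l x *s u \<in> U k}"
  proof (rule UI)
    show "vec.subspace {u. br x u - l x *s u \<in> U k}"
    proof (rule vec.subspaceI)
      fix c u assume "u \<in> {u. br x u - l x *s u \<in> U k}"
      then have "c *s (br x u - l x *s u) \<in> U k" using vec.subspace_scale[OF Us] by blast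
      then show "c *s u \<in> {u. br x u - l x *s u \<in> U k}" by (simp add: br_simps vec.scale_right_diff_distrib mult.commute)
    next
      fix u w assume "u \<in> {u. br x u - l x *s u \<in> U k}" "w \<in> {u. br x u - l x *s u \<in> U k}"
      then have "(br x u - l x *s u) + (br x w - l x *s w) \<in> U k" using vec.subspace_add[OF Us] by blast
      then show "u + w \<in> {u. br x u - l x *s u \<in> U k}" by (simp add: br_simps vec.scale_right_distrib algebra_simps)
    qed (simp add: br_simps vec.subspace_0[OF Us])
    show "W0 \<subseteq> {u. br x u - l x *s u \<in> U k}"
    proof
      fix u assume "u \<in> W0"
      then have "br x u - l x *s u \<in> W0"
        by (intro vec.subspace_diff[OF W0(1)] vec.subspace_scale[OF W0(1)] W0(2)[OF x])
      then show "u \<in> {u. br x u - l x *s u \<in> U k}" using UW[of k] by auto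
    qed
    fix j assume "j < Suc k"
    show "vv j \<in> {u. br x u - l x *s u \<in> U k}"
    proof (cases j)
      case 0
      then show ?thesis using l[OF x] UW[of k] by (auto simp: vv_def)
    next
      case (Suc i)
      let ?t = "(of_nat (Suc i) * l (br x z)) *s vv i"
      have "br x (vv j) - l x *s vv j - ?t \<in> U k" using step[OF x, of i] Um[of i k] Suc \<open>j < Suc k\<close> by auto
      moreover have "?t \<in> U k" using vU[of i k] Suc \<open>j < Suc k\<close> by (intro vec.subspace_scale[OF Us]) auto
      ultimately have "br x (vv j) - l x *s vv j - ?t + ?t \<in> U k" by (rule vec.subspace_add[OF Us])
      then show ?thesis by simp
    qed
  qed
  let ?d = "br x (vv (Suc k)) - l x *s vv (Suc k)" and ?t = "(of_nat (Suc k) * l (br x z)) *s vv k"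
  have "?d \<in> U k" using low m(1) unfolding k by blast
  then have "?d - (?d - ?t) \<in> U k" using step[OF x, of k] vec.subspace_diff[OF Us] by blast
  then have t: "?t \<in> U k" by simp
  show ?thesis
  proof (rule ccontr)
    assume nz: "l (br x z) \<noteq> 0"
    let ?c = "of_nat (Suc k) * l (br x z)"
    have c: "?c \<noteq> 0" using nz by (simp del: of_nat_Suc)
    have "inverse ?c *s ?t \<in> U k" using vec.subspace_scale[OF Us t] .
    then have "vv k \<in> U k" by (simp only: vec.scale_scale left_inverse[OF c] vec.scale_one)
    then show False using m(2) k by simp
  qed
qed

lemma span_insert_decomp:
  assumes "vec.subspace b" "u \<in> vec.span (insert v b)"
  obtains z c where "z \<in> b" "u = z + c *s v"
proof -
  obtain k where "u - k *s v \<in> vec.span b" using assms(2) unfolding vec.span_insert by blast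
  then have "u - k *s v \<in> b" using assms(1) by (metis vec.span_eq_iff)
  then show thesis using that[of "u - k *s v" k] by simp
qed

text \<open>Lie's theorem for the adjoint action of a solvable subalgebra on a subquotient \<open>W / W0\<close>. A
maximal proper subspace \<open>a\<close> between the derived algebra and \<open>b\<close> is an ideal of codimension one; by
\<open>lie_invariance\<close> its joint eigenspace is stable under the remaining direction \<open>z\<close>.\<close>
lemma lie_eigenvector:
  assumes b: "lie_subalgebra br b" "solvable_lie br b"
    and W: "vec.subspace W" "\<And>x w. x \<in> b \<Longrightarrow> w \<in> W \<Longrightarrow> br x w \<in> W"
    and W0: "vec.subspace W0" "\<And>x w. x \<in> b \<Longrightarrow> w \<in> W0 \<Longrightarrow> br x w \<in> W0"
    and w: "w \<in> W" "w \<notin> W0"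
  shows "\<exists>v\<in>W. v \<notin> W0 \<and> (\<forall>x\<in>b. \<exists>a. br x v - a *s v \<in> W0)"
  using b W(2) W0(2)
proof (induction "vec.dim b" arbitrary: b rule: less_induct)
  case (less b)
  have bs: "vec.subspace b" and bc: "\<And>x y. x \<in> b \<Longrightarrow> y \<in> b \<Longrightarrow> br x y \<in> b"
    using less.prems(1) unfolding lie_subalgebra_def by auto
  show ?case
  proof (cases "b = {0}")
    case True
    then show ?thesis using w vec.subspace_0[OF W0(1)] by (intro bexI[of _ w]) (auto simp: br_simps intro: exI[of _ 0])
  next
    case False
    have db: "derived b \<subseteq> b" "derived b \<noteq> b"
      using lie_prod_least[OF bs] bc solvable_derived_proper[OF less.prems(2) False] by auto
    define P where "P a \<longleftrightarrow> vec.subspace a \<and> derived b \<subseteq> a \<and> a \<subseteq> b \<and> a \<noteq> b" for a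
    have "P (derived b)" using db lie_prod_subspace by (simp add: P_def)
    moreover have "\<forall>a. P a \<longrightarrow> vec.dim a \<le> CARD('n)" using dim_le_card by blast
    ultimately have "\<exists>a. P a \<and> (\<forall>a'. P a' \<longrightarrow> vec.dim a' \<le> vec.dim a)" by (intro ex_has_greatest_nat[of P "derived b" vec.dim "Suc CARD('n)"]) (auto simp: less_Suc_eq_le)
    then obtain a where a: "P a" "\<And>a'. P a' \<Longrightarrow> vec.dim a' \<le> vec.dim a" by blast
    then have as: "vec.subspace a" "derived b \<subseteq> a" "a \<subseteq> b" "a \<noteq> b" by (auto simp: P_def)
    then obtain z where z: "z \<in> b" "z \<notin> a" by blast
    have "vec.dim (vec.span (insert z a)) = Suc (vec.dim a)"
      using vec.dim_insert[of z a] z as(1) by (metis vec.dim_span vec.span_eq_iff Suc_eq_plus1)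
    then have "\<not> P (vec.span (insert z a))" using a(2) by fastforce
    moreover have "vec.span (insert z a) \<subseteq> b" using z as bs by (intro vec.span_minimal) auto
    moreover have "derived b \<subseteq> vec.span (insert z a)" using as(2) vec.span_superset[of "insert z a"] by blast
    ultimately have bspan: "vec.span (insert z a) = b" unfolding P_def by auto
    have bdec: "\<exists>k. y - k *s z \<in> a" if "y \<in> b" for y
    proof -
      have "y \<in> vec.span (insert z a)" using that bspan by simp
      then obtain u c where "u \<in> a" "y = u + c *s z" by (rule span_insert_decomp[OF as(1)])
      then show ?thesis by (intro exI[of _ c]) simp
    qed
    have "a \<subset> b" using as by blast
    then have dima: "vec.dim a < vec.dim b" using as(1) bs by (metis vec.dim_psubset vec.span_eq_iff)
    have ac: "br x y \<in> a" if "x \<in> b" "y \<in> b" for x y using lie_prod_mem[OF that] as by blast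
    have asub: "lie_subalgebra br a" using as ac unfolding lie_subalgebra_def by blast
    have asol: "solvable_lie br a" using solvable_if_derived_subset[OF less.prems(2), of 0 a] as by simp
    obtain v where v: "v \<in> W" "v \<notin> W0" "\<forall>x\<in>a. \<exists>c. br x v - c *s v \<in> W0"
      using less.hyps[OF dima asub asol] less.prems as by blast
    then obtain l where l: "\<And>x. x \<in> a \<Longrightarrow> br x v - l x *s v \<in> W0" using bchoice[OF v(3)] by blast
    have l0: "l (br x z) = 0" if "x \<in> a" for x
    proof (rule lie_invariance[of a z W0 v])
      show "br x z \<in> a" if "x \<in> a" for x using ac that z as by blast
    qed (use W0 l v z less.prems that as in auto)
    let ?W = "{w \<in> W. \<forall>x\<in>a. br x w - l x *s w \<in> W0}"
    have Ws: "vec.subspace ?W"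
    proof (rule vec.subspaceI)
      fix c u assume u: "u \<in> ?W"
      then have "c *s (br x u - l x *s u) \<in> W0" if "x \<in> a" for x using vec.subspace_scale[OF W0(1)] that by blast
      then show "c *s u \<in> ?W" using u vec.subspace_scale[OF W(1)] by (simp add: br_simps vec.scale_right_diff_distrib mult.commute)
    next
      fix u w assume u: "u \<in> ?W" "w \<in> ?W"
      then have "(br x u - l x *s u) + (br x w - l x *s w) \<in> W0" if "x \<in> a" for x using vec.subspace_add[OF W0(1)] that by blast
      then show "u + w \<in> ?W" using u vec.subspace_add[OF W(1)] by (simp add: br_simps vec.scale_right_distrib algebra_simps)
    qed (simp add: br_simps vec.subspace_0[OF W0(1)] vec.subspace_0[OF W(1)])
    have zW: "br z ` ?W \<subseteq> ?W"
    proof safe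
      fix u assume u: "u \<in> W" "\<forall>x\<in>a. br x u - l x *s u \<in> W0"
      show "br z u \<in> W" using u z less.prems by blast
      fix x assume x: "x \<in> a"
      have "br (br x z) u - l (br x z) *s u \<in> W0" using u ac x z as by blast
      then have "br (br x z) u \<in> W0" using l0[OF x] by simp
      moreover have "br z (br x u - l x *s u) \<in> W0" using u x z less.prems by blast
      ultimately have "br z (br x u - l x *s u) + br (br x z) u \<in> W0" using vec.subspace_add[OF W0(1)] by blast
      then show "br x (br z u) - l x *s br z u \<in> W0" by (simp add: jacobi[of x z] br_simps algebra_simps)
    qed
    have "v \<in> ?W" using v l by blast
    then obtain v' c where v': "v' \<in> ?W" "v' \<notin> W0" "br z v' - c *s v' \<in> W0"
      using eigenvector_mod[OF br_lin(1) Ws zW W0(1)] v by blast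
    have "\<exists>a. br y v' - a *s v' \<in> W0" if y: "y \<in> b" for y
    proof -
      obtain k where k: "y - k *s z \<in> a" using bdec[OF y] by blast
      have "br (y - k *s z) v' - l (y - k *s z) *s v' \<in> W0" using v'(1) k by blast
      moreover have "k *s (br z v' - c *s v') \<in> W0" using v'(3) vec.subspace_scale[OF W0(1)] by blast
      ultimately have "(br (y - k *s z) v' - l (y - k *s z) *s v') + k *s (br z v' - c *s v') \<in> W0"
        by (rule vec.subspace_add[OF W0(1)])
      then have "br y v' - (l (y - k *s z) + k * c) *s v' \<in> W0"
        by (simp add: br_simps vec.scale_left_distrib vec.scale_right_diff_distrib algebra_simps)
      then show ?thesis by blast
    qed
    then show ?thesis using v' by blast
  qed
qed

lemma nilpotent_eigenvalue_mod:
  assumes nil: "UNIV = geig (br x) 0" and W0: "vec.subspace W0" "\<And>w. w \<in> W0 \<Longrightarrow> br x w \<in> W0"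
    and v: "v \<notin> W0" "br x v - a *s v \<in> W0"
  shows "br x v \<in> W0"
proof -
  obtain m where m: "((\<lambda>u. br x u - 0 *s u) ^^ m) v = 0" using nil unfolding geig_def by blast
  have "(br x ^^ m) v - a ^ m *s v \<in> W0"
    by (rule triangular_funpow[OF br_lin(1) W0(1) _ v(2)]) (use W0(2) in blast)
  then have "- (a ^ m *s v) \<in> W0" using m by simp
  then have "a ^ m *s v \<in> W0" using vec.subspace_neg[OF W0(1), of "- (a ^ m *s v)"] by simp
  then have "inverse (a ^ m) *s (a ^ m *s v) \<in> W0" by (rule vec.subspace_scale[OF W0(1)])
  then have "a = 0" using v(1) by (cases "a = 0") auto
  then show ?thesis using v(2) by simp
qed

text \<open>Built with \<open>lie_eigenvector\<close>, where \<open>W0\<close> is the span of the vectors already chosen.\<close>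
lemma lie_flag:
  assumes b: "lie_subalgebra br b" "solvable_lie br b"
  obtains N :: nat and w a where "inj_on w {..<N}" "vec.independent (w ` {..<N})" "vec.span (w ` {..<N}) = UNIV"
    "\<And>i x. i < N \<Longrightarrow> x \<in> b \<Longrightarrow> br x (w i) - a x i *s w i \<in> vec.span (w ` {..<i})"
    "\<And>j x u. j \<le> N \<Longrightarrow> x \<in> b \<Longrightarrow> u \<in> vec.span (w ` {..<j}) \<Longrightarrow> br x u \<in> vec.span (w ` {..<j})"
    "\<And>i. i < N \<Longrightarrow> w i \<notin> vec.span (w ` {..<i})"
proof -
  let ?Q = "\<lambda>S v. v \<notin> S \<and> (\<forall>x\<in>b. \<exists>a. br x v - a *s v \<in> S)"
  let ?n = "vec.dim (UNIV :: (complex^'n) set)"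
  have inv: "br x u \<in> vec.span (w ` {..<j})"
    if tri: "\<forall>i<j. ?Q (vec.span (w ` {..<i})) (w i)" and x: "x \<in> b" and u: "u \<in> vec.span (w ` {..<j})" for w and j :: nat and x u
  proof -
    have "\<forall>i<j. \<exists>a. br x (w i) - a *s w i \<in> vec.span (w ` {..<i})" using tri x by blast
    then obtain a where "\<And>i. i < j \<Longrightarrow> br x (w i) - a i *s w i \<in> vec.span (w ` {..<i})"
      using choice[of "\<lambda>i a. i < j \<longrightarrow> br x (w i) - a *s w i \<in> vec.span (w ` {..<i})"] by blast
    then show ?thesis using flag_invariant[OF br_lin(1), of j x w a] u by blast
  qed
  have "\<exists>w. inj_on w {..<?n} \<and> vec.independent (w ` {..<?n}) \<and>
     vec.span (w ` {..<?n}) = UNIV \<and> (\<forall>i<?n. ?Q (vec.span (w ` {..<i})) (w i))"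
  proof (rule flag_exists[OF vec.subspace_UNIV])
    fix w :: "nat \<Rightarrow> complex ^ 'n" and j
    let ?S = "vec.span (w ` {..<j})"
    assume tri: "\<forall>i<j. ?Q (vec.span (w ` {..<i})) (w i)" and ne: "?S \<noteq> UNIV"
    obtain u where "u \<notin> ?S" using ne by blast
    then show "\<exists>v\<in>UNIV. v \<notin> ?S \<and> ?Q ?S v"
      using lie_eigenvector[OF b vec.subspace_UNIV, of ?S u] inv[OF tri] by (auto simp: vec.subspace_span)
  qed
  then obtain n :: nat and w where w: "inj_on w {..<n}" "vec.independent (w ` {..<n})" "vec.span (w ` {..<n}) = UNIV"
    "\<forall>i<n. ?Q (vec.span (w ` {..<i})) (w i)" by blast
  have "\<forall>p. \<exists>c. fst p \<in> b \<and> snd p < n \<longrightarrow> br (fst p) (w (snd p)) - c *s w (snd p) \<in> vec.span (w ` {..<snd p})"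
    using w(4) by blast
  then obtain f where f: "\<And>p. fst p \<in> b \<and> snd p < n \<Longrightarrow> br (fst p) (w (snd p)) - f p *s w (snd p) \<in> vec.span (w ` {..<snd p})"
    using choice[of "\<lambda>p c. fst p \<in> b \<and> snd p < n \<longrightarrow> br (fst p) (w (snd p)) - c *s w (snd p) \<in> vec.span (w ` {..<snd p})"] by blast
  show thesis
  proof (rule that[OF w(1-3), of "\<lambda>x i. f (x, i)"])
    fix i x assume "i < n" "x \<in> b"
    then show "br x (w i) - f (x, i) *s w i \<in> vec.span (w ` {..<i})" using f[of "(x, i)"] by simp
  next
    fix j x u assume "j \<le> n" "x \<in> b" "u \<in> vec.span (w ` {..<j})"
    then show "br x u \<in> vec.span (w ` {..<j})" using inv[of j w x u] w(4) by auto
  next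
    fix i assume "i < n" then show "w i \<notin> vec.span (w ` {..<i})" using w(4) by blast
  qed
qed

text \<open>In a basis adapted to \<open>b\<close>, brackets of elements of \<open>b\<close> are strictly triangular.\<close>
lemma killing_solvable:
  assumes b: "lie_subalgebra br b" "solvable_lie br b" and x: "x \<in> b" "y \<in> b" "z \<in> b"
  shows "kf x (br y z) = 0"
proof -
  obtain N :: nat and w a where w: "inj_on w {..<N}" "vec.independent (w ` {..<N})" "vec.span (w ` {..<N}) = UNIV"
    and tri: "\<And>i x. i < N \<Longrightarrow> x \<in> b \<Longrightarrow> br x (w i) - a x i *s w i \<in> vec.span (w ` {..<i})"
    and inv: "\<And>j x u. j \<le> N \<Longrightarrow> x \<in> b \<Longrightarrow> u \<in> vec.span (w ` {..<j}) \<Longrightarrow> br x u \<in> vec.span (w ` {..<j})"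
    using lie_flag[OF b] by metis
  have "tr (\<lambda>u. br x (br (br y z) u)) = (\<Sum>i<N. 0)"
  proof (rule tr_triangular[OF _ w])
    show "lin (\<lambda>u. br x (br (br y z) u))" by (rule lin_comp[OF br_lin(1) br_lin(1)])
    fix i assume i: "i < N"
    let ?S = "vec.span (w ` {..<i})"
    have y: "br y (w i) - a y i *s w i \<in> ?S" and z: "br z (w i) - a z i *s w i \<in> ?S" using tri i x by auto
    have invi: "br x u \<in> ?S" "br y u \<in> ?S" "br z u \<in> ?S" if "u \<in> ?S" for u
      using inv[of i] i x that by auto
    have "br y (br z (w i) - a z i *s w i) + a z i *s (br y (w i) - a y i *s w i)
        - (br z (br y (w i) - a y i *s w i) + a y i *s (br z (w i) - a z i *s w i)) \<in> ?S"
      by (intro vec.span_diff vec.span_add vec.span_scale invi y z)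
    also have "br y (br z (w i) - a z i *s w i) + a z i *s (br y (w i) - a y i *s w i)
        - (br z (br y (w i) - a y i *s w i) + a y i *s (br z (w i) - a z i *s w i)) = br (br y z) (w i)"
      using jacobi[of y z "w i"] by (simp add: br_simps mult.commute)
    finally show "br x (br (br y z) (w i)) - 0 *s w i \<in> ?S" using invi by simp
  qed
  then show ?thesis unfolding kf_tr by simp
qed

subsection \<open>Cartan's criterion\<close>

text \<open>The Leibniz rule makes the generalised eigenspaces of a derivation a grading.\<close>
lemma geig_br:
  assumes T: "lin T" and der: "\<And>u v. T (br u v) = br (T u) v + br u (T v)"
    and "u \<in> geig T a" "v \<in> geig T c"
  shows "br u v \<in> geig T (a + c)"
proof -
  obtain l m where "((\<lambda>u. T u - a *s u) ^^ l) u = 0" "((\<lambda>u. T u - c *s u) ^^ m) v = 0"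
    using assms(3,4) unfolding geig_def by blast
  then show ?thesis
  proof (induction "l + m" arbitrary: l m u v)
    case 0
    then show ?case using vec.subspace_0[OF geig_subspace[OF T]] by (simp add: br_simps)
  next
    case (Suc k)
    show ?case
    proof (cases "l = 0 \<or> m = 0")
      case True
      then have "u = 0 \<or> v = 0" using Suc by auto
      then show ?thesis using vec.subspace_0[OF geig_subspace[OF T]] by (auto simp: br_simps)
    next
      case False
      then obtain l' m' where lm: "l = Suc l'" "m = Suc m'" by (metis not0_implies_Suc)
      have "br (T u - a *s u) v \<in> geig T (a + c)"
        using Suc.hyps(1)[of l' m "T u - a *s u" v] Suc.hyps(2) Suc.prems unfolding lm(1)
        by (simp only: funpow_Suc_right o_apply add_Suc add_Suc_right nat.inject simp_thms)
      moreover have "br u (T v - c *s v) \<in> geig T (a + c)"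
        using Suc.hyps(1)[of l m' u "T v - c *s v"] Suc.hyps(2) Suc.prems unfolding lm(2)
        by (simp only: funpow_Suc_right o_apply add_Suc add_Suc_right nat.inject simp_thms)
      ultimately have "br (T u - a *s u) v + br u (T v - c *s v) \<in> geig T (a + c)"
        by (rule vec.subspace_add[OF geig_subspace[OF T]])
      also have "br (T u - a *s u) v + br u (T v - c *s v) = T (br u v) - (a + c) *s br u v"
        by (simp add: der br_simps vec_eq_iff algebra_simps)
      finally show ?thesis using geig_shift_iff[OF T] by blast
    qed
  qed
qed

text \<open>Since \<open>geig_br\<close> adds eigenvalues, any operator acting by an additive function of the eigenvalue is a
derivation; complex conjugation is additive.\<close>
lemma conj_derivation:
  assumes T: "lin T" and der: "\<And>u v. T (br u v) = br (T u) v + br u (T v)"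
    and D: "lin D" "\<And>a v. v \<in> geig T a \<Longrightarrow> D v = cnj a *s v"
  shows "D (br u v) = br (D u) v + br u (D v)"
proof -
  have sp: "UNIV = vec.span (\<Union>a. geig T a)" using invariant_spanned_by_geig[OF T vec.subspace_UNIV] by auto
  have base: "D (br u v) = br (D u) v + br u (D v)" if "u \<in> geig T a" "v \<in> geig T c" for u v a c
    using D(2)[OF geig_br[OF T der that]] D(2)[OF that(1)] D(2)[OF that(2)]
    by (simp add: br_simps vec.scale_left_distrib)
  have s1: "vec.subspace {u. D (br u v) = br (D u) v + br u (D v)}" for v
    by (rule vec.subspaceI) (auto simp: br_simps lin_rules[OF D(1)] vec.scale_right_distrib algebra_simps)
  have s2: "vec.subspace {v. D (br u v) = br (D u) v + br u (D v)}" for u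
    by (rule vec.subspaceI) (auto simp: br_simps lin_rules[OF D(1)] vec.scale_right_distrib algebra_simps)
  have 1: "D (br u v) = br (D u) v + br u (D v)" if "v \<in> geig T c" for u v c
    using vec.span_minimal[OF _ s1[of v], of "\<Union>a. geig T a"] sp base that by blast
  show ?thesis using vec.span_minimal[OF _ s2[of u], of "\<Union>a. geig T a"] sp 1 by blast
qed

text \<open>Cartan's criterion. For \<open>x\<close> in \<open>[a, a]\<close> the trace of \<open>D \<circ> ad x\<close>, with \<open>D\<close> from \<open>conj_operator\<close>, is a sum of values
\<open>kf (D y) z\<close> for \<open>y\<close> and \<open>z\<close> in \<open>a\<close>. They vanish because \<open>D\<close> maps \<open>a\<close> into \<open>[a, a]\<close>: on the generalised
eigenspaces of \<open>ad x\<close> for nonzero eigenvalues \<open>ad x\<close> is invertible, and on the remaining one \<open>D\<close> is \<open>0\<close>.\<close>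
lemma cartan_nilpotent:
  assumes a: "vec.subspace a" "\<And>x y. x \<in> a \<Longrightarrow> y \<in> a \<Longrightarrow> br x y \<in> a"
    and kf: "\<And>x y z. x \<in> a \<Longrightarrow> y \<in> a \<Longrightarrow> z \<in> a \<Longrightarrow> kf (br x y) z = 0"
    and x: "x \<in> derived a"
  shows "UNIV = geig (br x) 0"
proof -
  obtain D where D: "lin D" "\<And>a v. v \<in> geig (br x) a \<Longrightarrow> D v = cnj a *s v"
    "tr (\<lambda>v. D (br x v)) = 0 \<Longrightarrow> UNIV = geig (br x) 0" using conj_operator[OF br_lin(1)] by blast
  have der: "D (br u v) = br (D u) v + br u (D v)" for u v
    using conj_derivation[OF br_lin(1) jacobi D(1,2)] .
  have xa: "x \<in> a" using x lie_prod_least[OF a(1)] a(2) by blast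
  have inv: "br x ` a \<subseteq> a" using xa a by blast
  have Dy: "D y \<in> derived a" if "y \<in> a" for y
  proof -
    have "a \<inter> (\<Union>c. geig (br x) c) \<subseteq> {y. D y \<in> derived a}"
    proof safe
      fix y c assume y: "y \<in> a" "y \<in> geig (br x) c"
      show "D y \<in> derived a"
      proof (cases "c = 0")
        case True
        then show ?thesis using D(2)[OF y(2)] vec.subspace_0[OF lie_prod_subspace] by simp
      next
        case False
        then obtain u where u: "u \<in> a" "br x u - 0 *s u = y" using geig_shift_solve[OF br_lin(1) False a(1) inv y] by blast
        then have "y \<in> derived a" using lie_prod_mem[OF xa u(1)] by simp
        then show ?thesis using D(2)[OF y(2)] vec.subspace_scale[OF lie_prod_subspace] by simp
      qed
    qed
    moreover have "vec.subspace {y. D y \<in> derived a}"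
      by (rule vec.subspaceI) (auto simp: lin_rules[OF D(1)] intro: vec.subspace_0[OF lie_prod_subspace]
          vec.subspace_add[OF lie_prod_subspace] vec.subspace_scale[OF lie_prod_subspace])
    ultimately show ?thesis using vec.span_minimal invariant_spanned_by_geig[OF br_lin(1) a(1) inv] that by blast
  qed
  have kz: "kf u z = 0" if "u \<in> derived a" "z \<in> a" for u z
  proof -
    have "vec.subspace {u. kf u z = 0}" by (rule vec.subspaceI) (auto simp: kf_lin)
    then have "derived a \<subseteq> {u. kf u z = 0}" by (rule lie_prod_least) (use kf that in blast)
    then show ?thesis using that by blast
  qed
  have "derived a \<subseteq> {u. tr (\<lambda>v. D (br u v)) = 0}"
  proof (rule lie_prod_least)
    show "vec.subspace {u. tr (\<lambda>v. D (br u v)) = 0}"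
    proof (rule vec.subspaceI)
      show "0 \<in> {u. tr (\<lambda>v. D (br u v)) = 0}" using tr_scale[of 0 "\<lambda>v. v"] by (simp add: br_simps lin_rules[OF D(1)])
    qed (simp_all add: br_simps lin_rules[OF D(1)] tr_add tr_scale)
    fix y z assume yz: "y \<in> a" "z \<in> a"
    have "tr (\<lambda>v. D (br (br y z) v)) = tr (\<lambda>v. D (br y (br z v)) - D (br z (br y v)))"
      by (rule arg_cong[of _ _ tr]) (auto simp: jacobi[of y z] lin_rules[OF D(1)])
    also have "\<dots> = tr (\<lambda>v. D (br y (br z v))) - tr (\<lambda>v. D (br z (br y v)))" by (rule tr_diff)
    also have "tr (\<lambda>v. D (br z (br y v))) = tr (\<lambda>v. br y (D (br z v)))"
      using tr_commute[OF lin_comp[OF D(1) br_lin(1)[of z]] br_lin(1)[of y]] .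
    also have "tr (\<lambda>v. D (br y (br z v))) - tr (\<lambda>v. br y (D (br z v))) = tr (\<lambda>v. D (br y (br z v)) - br y (D (br z v)))"
      by (rule tr_diff[symmetric])
    also have "\<dots> = kf (D y) z" unfolding kf_tr by (rule arg_cong[of _ _ tr]) (auto simp: der)
    also have "\<dots> = 0" using kz[OF Dy[OF yz(1)] yz(2)] .
    finally show "br y z \<in> {u. tr (\<lambda>v. D (br u v)) = 0}" by simp
  qed
  then show ?thesis using D(3) x by blast
qed

subsection \<open>Borel subalgebras\<close>

text \<open>A vector normalising \<open>b\<close> could be added to \<open>b\<close> without losing solvability, against maximality.\<close>
lemma borel_no_extension:
  assumes b: "borel_subalgebra br b" and v: "v \<notin> b" "\<And>z. z \<in> b \<Longrightarrow> br z v \<in> b"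
  shows False
proof -
  let ?b = "vec.span (insert v b)"
  have bs: "vec.subspace b" "\<And>x y. x \<in> b \<Longrightarrow> y \<in> b \<Longrightarrow> br x y \<in> b" "solvable_lie br b"
    and mx: "\<And>b'. lie_subalgebra br b' \<Longrightarrow> solvable_lie br b' \<Longrightarrow> b \<subseteq> b' \<Longrightarrow> b' = b"
    using b unfolding borel_subalgebra_def lie_subalgebra_def by auto
  have br: "br x y \<in> b" if xy: "x \<in> ?b" "y \<in> ?b" for x y
  proof -
    obtain z c where e1: "z \<in> b" "x = z + c *s v" by (rule span_insert_decomp[OF bs(1) xy(1)])
    obtain z' c' where e2: "z' \<in> b" "y = z' + c' *s v" by (rule span_insert_decomp[OF bs(1) xy(2)])
    note e = e1 e2
    have h: "br z z' \<in> b" "br z v \<in> b" "br v z' \<in> b"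
      by (fact bs(2)[OF e(1,3)] v(2)[OF e(1)] br_mem_commute[OF bs(1) v(2)[OF e(3)]])+
    have "br z z' + c' *s br z v + c *s br v z' \<in> b"
      by (intro vec.subspace_add[OF bs(1)] vec.subspace_scale[OF bs(1)] h)
    then show ?thesis unfolding e by (simp add: br_simps algebra_simps)
  qed
  have sub: "b \<subseteq> ?b" "v \<in> ?b" using vec.span_superset[of "insert v b"] by blast+
  have "lie_subalgebra br ?b" unfolding lie_subalgebra_def using br sub by auto
  moreover have "derived ?b \<subseteq> b" by (rule lie_prod_least[OF bs(1)]) (rule br)
  then have "solvable_lie br ?b" using solvable_if_derived_subset[OF bs(3), of 1 ?b] by auto
  ultimately have "?b = b" using mx sub by blast
  then show False using sub(2) v(1) by simp
qed

definition perp :: "(complex ^ 'n) set \<Rightarrow> (complex ^ 'n) set" where "perp S = {x. \<forall>y\<in>S. kf x y = 0}"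

lemma perp_subspace: "vec.subspace (perp S)"
  unfolding perp_def by (rule vec.subspaceI) (auto simp: kf_lin)

lemma perp_anti: "S \<subseteq> T \<Longrightarrow> perp T \<subseteq> perp S" unfolding perp_def by auto

lemma perp_invariant:
  assumes "\<And>y. y \<in> S \<Longrightarrow> br x y \<in> S" "u \<in> perp S"
  shows "br x u \<in> perp S"
  unfolding perp_def
proof safe
  fix y assume "y \<in> S"
  have "kf (br x u) y = - kf (br u x) y" by (subst br_anti) (simp add: kf_lin)
  also have "\<dots> = - kf u (br x y)" by (simp add: kf_invariant)
  also have "\<dots> = 0" using assms \<open>y \<in> S\<close> unfolding perp_def by simp
  finally show "kf (br x u) y = 0" .
qed

text \<open>If the orthogonal space of \<open>b\<close> were not contained in \<open>b\<close>, Lie's theorem would give in it an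
eigenvector \<open>v\<close> of \<open>b\<close> modulo \<open>b\<close>. Then \<open>b + span v\<close> is a subalgebra orthogonal to its own
brackets, so its derived algebra acts nilpotently by Cartan's criterion. Hence \<open>b + span v\<close> is
solvable, against the maximality of \<open>b\<close>.\<close>
lemma borel_perp_subset:
  assumes b: "borel_subalgebra br b"
  shows "perp b \<subseteq> b"
proof (rule ccontr)
  assume "\<not> perp b \<subseteq> b"
  then obtain w where w: "w \<in> perp b" "w \<notin> perp b \<inter> b" by blast
  have bs: "lie_subalgebra br b" "vec.subspace b" "\<And>x y. x \<in> b \<Longrightarrow> y \<in> b \<Longrightarrow> br x y \<in> b" "solvable_lie br b"
    and mx: "\<And>b'. lie_subalgebra br b' \<Longrightarrow> solvable_lie br b' \<Longrightarrow> b \<subseteq> b' \<Longrightarrow> b' = b"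
    using b unfolding borel_subalgebra_def lie_subalgebra_def by auto
  have pinv: "br x u \<in> perp b" if "x \<in> b" "u \<in> perp b" for x u
    using perp_invariant[of b x u] bs that by blast
  obtain v where v: "v \<in> perp b" "v \<notin> perp b \<inter> b" "\<And>x. x \<in> b \<Longrightarrow> \<exists>a. br x v - a *s v \<in> perp b \<inter> b"
    using lie_eigenvector[OF bs(1,4) perp_subspace[of b] _ _ _ w] pinv bs
      vec.subspace_inter[OF perp_subspace bs(2)] by (metis IntD1 IntD2 IntI)
  then have vb: "v \<notin> b" by blast
  \<comment> \<open>Some element of \<open>b\<close> must act on \<open>v\<close> with a nonzero eigenvalue \<open>a0\<close>.\<close>
  obtain z0 a0 where z0: "z0 \<in> b" "br z0 v - a0 *s v \<in> b" "br z0 v \<notin> b"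
    using borel_no_extension[OF b vb] v(3) by blast
  have a0: "a0 \<noteq> 0" using z0 by auto
  let ?b = "vec.span (insert v b)"
  have b': "vec.subspace ?b" and sub: "b \<subseteq> ?b" "v \<in> ?b" using vec.span_superset[of "insert v b"] by auto
  have bv: "br z v \<in> ?b" if "z \<in> b" for z
  proof -
    obtain a where a: "br z v - a *s v \<in> b" using v(3)[OF \<open>z \<in> b\<close>] by blast
    have "br z v - a *s v + a *s v \<in> ?b" using a sub by (intro vec.span_add vec.span_scale) auto
    then show ?thesis by simp
  qed
  have br: "br x y \<in> ?b" if xy: "x \<in> ?b" "y \<in> ?b" for x y
  proof -
    obtain z c where e1: "z \<in> b" "x = z + c *s v" by (rule span_insert_decomp[OF bs(2) xy(1)])
    obtain z' c' where e2: "z' \<in> b" "y = z' + c' *s v" by (rule span_insert_decomp[OF bs(2) xy(2)])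
    note e = e1 e2
    have h: "br z z' \<in> ?b" "br z v \<in> ?b" "br v z' \<in> ?b"
      by (fact subsetD[OF sub(1) bs(3)[OF e(1,3)]] bv[OF e(1)] br_mem_commute[OF b' bv[OF e(3)]])+
    have "br z z' + c' *s br z v + c *s br v z' \<in> ?b"
      by (intro vec.span_add vec.span_scale h)
    then show ?thesis unfolding e by (simp add: br_simps algebra_simps)
  qed
  have kfb: "kf (br x y) z = 0" if xy: "x \<in> ?b" "y \<in> ?b" "z \<in> ?b" for x y z
  proof -
    obtain x1 c1 where e1: "x1 \<in> b" "x = x1 + c1 *s v" by (rule span_insert_decomp[OF bs(2) xy(1)])
    obtain x2 c2 where e2: "x2 \<in> b" "y = x2 + c2 *s v" by (rule span_insert_decomp[OF bs(2) xy(2)])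
    obtain x3 c3 where e3: "x3 \<in> b" "z = x3 + c3 *s v" by (rule span_insert_decomp[OF bs(2) xy(3)])
    note e = e1 e2 e3
    have 1: "kf (br x1 x2) x3 = 0" using killing_solvable[OF bs(1,4)] e kf_sym by metis
    have 2: "kf (br x1 x2) v = 0" using v(1) bs(3)[OF e(1,3)] kf_sym unfolding perp_def by auto
    have 3: "kf (br u v) u' = 0" if "u \<in> b" "u' \<in> b" for u u' using pinv[OF that(1) v(1)] that unfolding perp_def by auto
    have 4: "kf (br u v) v = 0" for u by (simp add: kf_invariant kf_lin)
    have 5: "kf (br v u) t = - kf (br u v) t" for u t by (subst br_anti) (simp add: kf_lin)
    show ?thesis unfolding e using 1 2 3 4 5 e by (simp add: br_simps kf_lin)
  qed
  have nil: "UNIV = geig (br x) 0" if "x \<in> derived ?b" for x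
    using cartan_nilpotent[OF b' br kfb that] .
  have zv: "br z v \<in> b" if "z \<in> b" "z \<in> derived ?b" for z
  proof -
    obtain a where "br z v - a *s v \<in> b" using v(3)[OF \<open>z \<in> b\<close>] by blast
    then show ?thesis using nilpotent_eigenvalue_mod[OF nil[OF that(2)] bs(2) _ vb] bs(3) that by blast
  qed
  let ?v = "br z0 v"
  have v1: "?v \<in> derived ?b" using lie_prod_mem z0(1) sub by blast
  have zv1: "br z ?v \<in> b" if "z \<in> b" "z \<in> derived ?b" for z
  proof -
    have "br z (br z0 v - a0 *s v) + a0 *s br z v \<in> b"
      by (rule vec.subspace_add[OF bs(2) bs(3)[OF that(1) z0(2)] vec.subspace_scale[OF bs(2) zv[OF that]]])
    then show ?thesis by (simp add: br_simps)
  qed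
  \<comment> \<open>The bracket \<open>[z0, v]\<close> spans the derived algebra of \<open>b + span v\<close> modulo its intersection with \<open>b\<close>.\<close>
  have dec: "\<exists>z c. z \<in> b \<and> z \<in> derived ?b \<and> u = z + c *s ?v" if "u \<in> derived ?b" for u
  proof -
    have "u \<in> ?b" using that lie_prod_least[OF b' br] by blast
    then obtain z c where zc: "z \<in> b" "u = z + c *s v" by (rule span_insert_decomp[OF bs(2)])
    let ?z = "z - (c / a0) *s (?v - a0 *s v)"
    have e: "u = ?z + (c / a0) *s ?v" using a0 zc by (simp add: vec_eq_iff algebra_simps)
    have "?z \<in> b" by (rule vec.subspace_diff[OF bs(2) zc(1) vec.subspace_scale[OF bs(2) z0(2)]])
    moreover have "u - (c / a0) *s ?v \<in> derived ?b"
      by (rule vec.subspace_diff[OF lie_prod_subspace that vec.subspace_scale[OF lie_prod_subspace v1]])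
    then have "?z \<in> derived ?b" using e by (metis add_diff_cancel_right')
    ultimately show ?thesis using e by blast
  qed
  have "derived (derived ?b) \<subseteq> b"
  proof (rule lie_prod_least[OF bs(2)])
    fix x y assume "x \<in> derived ?b" "y \<in> derived ?b"
    then obtain z c z' c' where e: "z \<in> b" "z \<in> derived ?b" "x = z + c *s ?v" "z' \<in> b" "z' \<in> derived ?b" "y = z' + c' *s ?v"
      using dec by metis
    have h: "br z z' \<in> b" "br z ?v \<in> b" "br ?v z' \<in> b"
      by (fact bs(3)[OF e(1,4)] zv1[OF e(1,2)] br_mem_commute[OF bs(2) zv1[OF e(4,5)]])+
    have "br z z' + c' *s br z ?v + c *s br ?v z' \<in> b"
      by (intro vec.subspace_add[OF bs(2)] vec.subspace_scale[OF bs(2)] h)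
    then show "br x y \<in> b" unfolding e by (simp add: br_simps algebra_simps)
  qed
  then have "solvable_lie br ?b" using solvable_if_derived_subset[OF bs(4), of 2 ?b] b' by (simp add: numeral_2_eq_2)
  moreover have "lie_subalgebra br ?b" unfolding lie_subalgebra_def using b' br by auto
  ultimately have "?b = b" using mx sub by blast
  then show False using sub(2) vb by simp
qed

text \<open>The radical of the Killing form is an ideal. If it were the whole simple algebra, all adjoint
operators would be nilpotent by Cartan's criterion, and \<open>lie_eigenvector\<close> would produce a vector
outside \<open>b\<close> that normalises \<open>b\<close>.\<close>
lemma kf_nondegenerate:
  assumes s: "simple_lie_algebra br" and b: "borel_subalgebra br b" "b \<noteq> UNIV" and x: "\<And>y. kf x y = 0"
  shows "x = 0"
proof (rule ccontr)
  assume "x \<noteq> 0"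
  let ?r = "{x. \<forall>y. kf x y = 0}"
  have id: "I = {0} \<or> I = UNIV" if "lie_ideal br UNIV I" for I using s that unfolding simple_lie_algebra_def by blast
  have "vec.subspace ?r" by (rule vec.subspaceI) (auto simp: kf_lin)
  moreover have "kf (br u v) y = 0" if "v \<in> ?r" for u v y
  proof -
    have "kf (br u v) y = - kf (br v u) y" by (subst br_anti) (simp add: kf_lin)
    then show ?thesis using that by (simp add: kf_invariant)
  qed
  ultimately have "lie_ideal br UNIV ?r" unfolding lie_ideal_def by blast
  then have "?r = UNIV" using id x \<open>x \<noteq> 0\<close> by blast
  then have kf0: "kf u v = 0" for u v by blast
  have "lie_ideal br UNIV (derived UNIV)"
    unfolding lie_ideal_def by (auto intro: lie_prod_subspace lie_prod_mem)
  moreover obtain u v where "br u v \<noteq> 0" using s unfolding simple_lie_algebra_def by blast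
  then have "derived UNIV \<noteq> {0}" using lie_prod_mem[of u UNIV v UNIV] by auto
  ultimately have dU: "derived UNIV = UNIV" using id by blast
  have nil: "UNIV = geig (br x) 0" for x
    using cartan_nilpotent[of UNIV x] kf0 dU by auto
  have bs: "lie_subalgebra br b" "vec.subspace b" "\<And>x y. x \<in> b \<Longrightarrow> y \<in> b \<Longrightarrow> br x y \<in> b" "solvable_lie br b"
    using b unfolding borel_subalgebra_def lie_subalgebra_def by auto
  obtain w where "w \<notin> b" using b(2) by blast
  then obtain v where v: "v \<notin> b" "\<And>x. x \<in> b \<Longrightarrow> \<exists>a. br x v - a *s v \<in> b"
    using lie_eigenvector[OF bs(1,4) vec.subspace_UNIV _ bs(2), of w] bs(3) by blast
  have "br z v \<in> b" if "z \<in> b" for z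
    using v nilpotent_eigenvalue_mod[OF nil bs(2) _ v(1), of z] bs(3) that by blast
  then show False using borel_no_extension[OF b(1) v(1)] by blast
qed

end

subsection \<open>The nilpotent radical of a parabolic subalgebra\<close>

context complex_lie_algebra begin

lemma kf_represent:
  assumes nd: "\<And>x. (\<And>y. kf x y = 0) \<Longrightarrow> x = 0" and l: "\<And>x y. l (x + y) = l x + l y" "\<And>c x. l (c *s x) = c * l x"
  shows "\<exists>h. \<forall>z. kf h z = l z"
proof -
  let ?\<phi> = "\<lambda>h. (\<chi> i. kf h (axis i 1)) :: complex ^ 'n"
  have lin: "lin ?\<phi>" by (rule linI) (simp_all add: kf_lin vec_eq_iff)
  have ex: "l' z = (\<Sum>i\<in>UNIV. z $ i * l' (axis i 1))"
    if "\<And>x y. l' (x + y) = l' x + l' y" "\<And>c x. l' (c *s x) = c * l' x" for l' :: "complex ^ 'n \<Rightarrow> complex" and z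
  proof -
    have z0: "l' 0 = 0" using that(2)[of 0 0] by simp
    have "l' (\<Sum>i\<in>A. z $ i *s axis i 1) = (\<Sum>i\<in>A. z $ i * l' (axis i 1))" for A
      by (induction A rule: infinite_finite_induct) (simp_all add: that z0)
    from this[of UNIV] show ?thesis by (simp add: basis_expansion)
  qed
  have "inj ?\<phi>"
  proof (rule injI)
    fix x y assume "?\<phi> x = ?\<phi> y"
    then have e: "kf x (axis i 1) = kf y (axis i 1)" for i by (simp add: vec_eq_iff)
    have "kf (x - y) z = 0" for z
      using ex[of "kf (x - y)" z] by (simp add: kf_lin e)
    then have "x - y = 0" by (rule nd)
    then show "x = y" by simp
  qed
  then have "surj ?\<phi>" using vec.linear_inj_imp_surj[OF lin] by blast
  then obtain h where h: "(\<chi> i. l (axis i 1)) = ?\<phi> h" by (meson surjD)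
  have "kf h (axis i 1) = l (axis i 1)" for i using h by (simp add: vec_eq_iff)
  then have "kf h z = l z" for z using ex[of "kf h" z] ex[of l z] l by (simp add: kf_lin)
  then show ?thesis by blast
qed

text \<open>Choose \<open>h\<close> so that \<open>D\<close> and \<open>ad h\<close> have the same trace form against all \<open>ad z\<close>; then the derivation
\<open>E = D - ad h\<close> has trace zero against the adjoint representation, which makes every \<open>E x\<close>
orthogonal to everything.\<close>
lemma derivation_inner:
  assumes nd: "\<And>x. (\<And>y. kf x y = 0) \<Longrightarrow> x = 0"
    and D: "lin D" "\<And>u v. D (br u v) = br (D u) v + br u (D v)"
  shows "\<exists>h. \<forall>v. D v = br h v"
proof -
  obtain h where h: "\<And>z. kf h z = tr (\<lambda>v. D (br z v))"
    using kf_represent[OF nd, of "\<lambda>z. tr (\<lambda>v. D (br z v))"] by (auto simp: br_simps lin_rules[OF D(1)] tr_add tr_scale)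
  define E where "E v = D v - br h v" for v
  have E: "lin E" unfolding E_def by (rule linI) (simp_all add: br_simps lin_rules[OF D(1)] vec.scale_right_diff_distrib)
  have derE: "E (br u v) = br (E u) v + br u (E v)" for u v
    unfolding E_def D(2) jacobi[of h u v] by (simp add: br_simps)
  have trE: "tr (\<lambda>v. E (br z v)) = 0" for z
  proof -
    have "tr (\<lambda>v. E (br z v)) = tr (\<lambda>v. D (br z v)) - tr (\<lambda>v. br h (br z v))" unfolding E_def by (rule tr_diff)
    then show ?thesis using h[of z] by (simp add: kf_tr)
  qed
  have "kf (E x) y = 0" for x y
  proof -
    have "kf (E x) y = tr (\<lambda>v. E (br x (br y v)) - br x (E (br y v)))"
      unfolding kf_tr by (rule arg_cong[of _ _ tr]) (auto simp: derE)
    also have "\<dots> = tr (\<lambda>v. E (br x (br y v))) - tr (\<lambda>v. br x (E (br y v)))" by (rule tr_diff)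
    also have "tr (\<lambda>v. br x (E (br y v))) = tr (\<lambda>v. E (br y (br x v)))"
      by (rule tr_commute[OF br_lin(1) lin_comp[OF E br_lin(1)]])
    also have "tr (\<lambda>v. E (br x (br y v))) - \<dots> = tr (\<lambda>v. E (br x (br y v)) - E (br y (br x v)))" by (rule tr_diff[symmetric])
    also have "\<dots> = tr (\<lambda>v. E (br (br x y) v))"
      by (rule arg_cong[of _ _ tr]) (auto simp: jacobi[of x y] lin_rules[OF E])
    also have "\<dots> = 0" by (rule trE)
    finally show ?thesis .
  qed
  then have "E x = 0" for x using nd by blast
  then show ?thesis unfolding E_def by auto
qed

lemma separating_functional:
  fixes v :: "complex ^ 'n"
  assumes S: "vec.subspace S" and v: "v \<notin> S"
  obtains l :: "complex ^ 'n \<Rightarrow> complex" where "\<And>x y. l (x + y) = l x + l y" "\<And>c x. l (c *s x) = c * l x"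
    "\<And>x. x \<in> S \<Longrightarrow> l x = 0" "l v \<noteq> 0"
proof -
  obtain B where B: "B \<subseteq> S" "vec.independent B" "S \<subseteq> vec.span B" by (rule vec.basis_exists[of S], rule that)
  have "v \<notin> vec.span B" using v vec.span_minimal[OF B(1) S] by blast
  then have ind: "vec.independent (insert v B)" using vec.independent_insertI B(2) by blast
  obtain i :: 'n where True by blast
  obtain T where T: "lin T" "\<And>x. x \<in> insert v B \<Longrightarrow> T x = (if x = v then axis i 1 else 0)"
    using vec.linear_independent_extend[OF ind, of "\<lambda>x. if x = v then axis i 1 else 0"] by blast
  have "B \<subseteq> {x. T x = 0}" using T(2) v B(1) by auto
  moreover have "vec.subspace {x. T x = 0}" by (rule vec.subspaceI) (auto simp: lin_rules[OF T(1)])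
  ultimately have "T x = 0" if "x \<in> S" for x using vec.span_minimal B(3) that by blast
  then show thesis using T(2)[of v] by (intro that[of "\<lambda>x. T x $ i"]) (auto simp: lin_rules[OF T(1)])
qed

lemma perp_perp:
  assumes nd: "\<And>x. (\<And>y. kf x y = 0) \<Longrightarrow> x = 0" and S: "vec.subspace S"
  shows "perp (perp S) = S"
proof
  show "S \<subseteq> perp (perp S)" unfolding perp_def using kf_sym by auto
  show "perp (perp S) \<subseteq> S"
  proof (rule subsetI, rule ccontr)
    fix v assume v: "v \<in> perp (perp S)" "v \<notin> S"
    obtain l :: "complex ^ 'n \<Rightarrow> complex" where l: "\<And>x y. l (x + y) = l x + l y" "\<And>c x. l (c *s x) = c * l x"
      "\<And>x. x \<in> S \<Longrightarrow> l x = 0" "l v \<noteq> 0" using separating_functional[OF S v(2)] by metis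
    obtain h where h: "\<And>z. kf h z = l z" using kf_represent[OF nd l(1,2)] by blast
    have "h \<in> perp S" unfolding perp_def using h l(3) by simp
    then have "kf v h = 0" using v unfolding perp_def by blast
    then show False using h[of v] l(4) kf_sym by metis
  qed
qed

lemma parabolic_perp_subset:
  assumes "parabolic_subalgebra br p"
  shows "perp p \<subseteq> p"
proof -
  obtain b where b: "borel_subalgebra br b" "b \<subseteq> p" using assms unfolding parabolic_subalgebra_def by blast
  show ?thesis using borel_perp_subset[OF b(1)] perp_anti[OF b(2)] b(2) by blast
qed

text \<open>Every \<open>x\<close> orthogonal to \<open>p\<close> is nilpotent: the test derivation \<open>D\<close> of \<open>conj_operator\<close> is inner, say
\<open>D = ad h\<close>, and it preserves a Borel subalgebra \<open>b\<close> of \<open>p\<close>. Hence \<open>h\<close> normalises \<open>b\<close> and lies in it, and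
the trace of \<open>D \<circ> ad x\<close> is \<open>kf h x = 0\<close>. A flag for \<open>b\<close> then turns elementwise nilpotency into
nilpotency of the Lie algebra.\<close>
lemma parabolic_perp_nilpotent:
  assumes nd: "\<And>x. (\<And>y. kf x y = 0) \<Longrightarrow> x = 0" and p: "parabolic_subalgebra br p"
  shows "nilpotent_lie br (perp p)"
proof -
  obtain b where b: "borel_subalgebra br b" "b \<subseteq> p" using p unfolding parabolic_subalgebra_def by blast
  have bs: "lie_subalgebra br b" "vec.subspace b" "\<And>x y. x \<in> b \<Longrightarrow> y \<in> b \<Longrightarrow> br x y \<in> b" "solvable_lie br b"
    using b unfolding borel_subalgebra_def lie_subalgebra_def by auto
  have pb: "perp p \<subseteq> b" using borel_perp_subset[OF b(1)] perp_anti[OF b(2)] by blast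
  have nil: "UNIV = geig (br x) 0" if x: "x \<in> perp p" for x
  proof -
    obtain D where D: "lin D" "\<And>a v. v \<in> geig (br x) a \<Longrightarrow> D v = cnj a *s v"
      "tr (\<lambda>v. D (br x v)) = 0 \<Longrightarrow> UNIV = geig (br x) 0" using conj_operator[OF br_lin(1)] by blast
    have der: "D (br u v) = br (D u) v + br u (D v)" for u v
      using conj_derivation[OF br_lin(1) jacobi D(1,2)] .
    obtain h where h: "\<And>v. D v = br h v" using derivation_inner[OF nd D(1) der] by blast
    have xb: "x \<in> b" using x pb by blast
    have inv: "br x ` b \<subseteq> b" using xb bs(3) by blast
    have "b \<inter> (\<Union>c. geig (br x) c) \<subseteq> {y. D y \<in> b}"
      using D(2) vec.subspace_scale[OF bs(2)] by auto
    moreover have "vec.subspace {y. D y \<in> b}"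
      by (rule vec.subspaceI) (auto simp: lin_rules[OF D(1)] intro: vec.subspace_0[OF bs(2)]
          vec.subspace_add[OF bs(2)] vec.subspace_scale[OF bs(2)])
    ultimately have "b \<subseteq> {y. D y \<in> b}"
      using vec.span_minimal invariant_spanned_by_geig[OF br_lin(1) bs(2) inv] by blast
    then have "br z h \<in> b" if "z \<in> b" for z using br_mem_commute[OF bs(2), of h z] h that by auto
    then have "h \<in> b" using borel_no_extension[OF b(1)] by blast
    then have "kf x h = 0" using x b(2) unfolding perp_def by blast
    then have "tr (\<lambda>v. D (br x v)) = 0" unfolding h using kf_sym[of x h] by (simp add: kf_tr)
    then show ?thesis by (rule D(3))
  qed
  obtain N :: nat and w a where w: "inj_on w {..<N}" "vec.independent (w ` {..<N})" "vec.span (w ` {..<N}) = UNIV"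
    and tri: "\<And>i x. i < N \<Longrightarrow> x \<in> b \<Longrightarrow> br x (w i) - a x i *s w i \<in> vec.span (w ` {..<i})"
    and inv: "\<And>j x u. j \<le> N \<Longrightarrow> x \<in> b \<Longrightarrow> u \<in> vec.span (w ` {..<j}) \<Longrightarrow> br x u \<in> vec.span (w ` {..<j})"
    and ni: "\<And>i. i < N \<Longrightarrow> w i \<notin> vec.span (w ` {..<i})"
    using lie_flag[OF bs(1,4)] by (metis (no_types, lifting))
  have low: "br x (w i) \<in> vec.span (w ` {..<i})" if "i < N" "x \<in> perp p" for i x
  proof (rule nilpotent_eigenvalue_mod[OF nil[OF that(2)] vec.subspace_span _ ni[OF that(1)]])
    show "br x (w i) - a x i *s w i \<in> vec.span (w ` {..<i})" using tri that pb by blast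
    show "br x u \<in> vec.span (w ` {..<i})" if "u \<in> vec.span (w ` {..<i})" for u
      using inv[of i x u] that \<open>i < N\<close> \<open>x \<in> perp p\<close> pb by auto
  qed
  have low': "br x u \<in> vec.span (w ` {..<j})" if "j < N" "x \<in> perp p" "u \<in> vec.span (w ` {..<Suc j})" for j x u
  proof -
    have "w ` {..<Suc j} \<subseteq> {u. br x u \<in> vec.span (w ` {..<j})}"
    proof safe
      fix i assume "i < Suc j"
      then show "br x (w i) \<in> vec.span (w ` {..<j})" using low[of i x] that flag_mono[of i j w] by auto
    qed
    moreover have "vec.subspace {u. br x u \<in> vec.span (w ` {..<j})}"
      by (rule vec.subspaceI) (auto simp: br_simps vec.span_zero vec.span_add vec.span_scale)
    ultimately show ?thesis using vec.span_minimal that by blast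
  qed
  have it: "((\<lambda>A. lie_prod br (perp p) A) ^^ j) (perp p) \<subseteq> vec.span (w ` {..<N - j})" if "j \<le> N" for j
    using that
  proof (induction j)
    case 0
    then show ?case using w(3) by simp
  next
    case (Suc j)
    have "lie_prod br (perp p) (((\<lambda>A. lie_prod br (perp p) A) ^^ j) (perp p)) \<subseteq> vec.span (w ` {..<N - Suc j})"
    proof (rule lie_prod_least[OF vec.subspace_span])
      fix x u assume "x \<in> perp p" "u \<in> ((\<lambda>A. lie_prod br (perp p) A) ^^ j) (perp p)"
      then show "br x u \<in> vec.span (w ` {..<N - Suc j})"
        using low'[of "N - Suc j" x u] Suc by (auto simp: Suc_diff_Suc)
    qed
    then show ?case by simp
  qed
  have sub: "vec.subspace (((\<lambda>A. lie_prod br (perp p) A) ^^ j) (perp p))" for j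
    by (induction j) (simp_all add: perp_subspace lie_prod_subspace)
  have "((\<lambda>A. lie_prod br (perp p) A) ^^ N) (perp p) = {0}"
    using it[of N] vec.subspace_0[OF sub[of N]] by auto
  then show ?thesis unfolding nilpotent_lie_def by blast
qed

text \<open>For \<open>x\<close> in \<open>n\<close> and \<open>z\<close> in \<open>p\<close> the operator \<open>ad x \<circ> ad z\<close> moves \<open>p\<close> down the lower central series of \<open>n\<close>. Its
adjoint \<open>ad z \<circ> ad x\<close> for the Killing form does the same, and kills the orthogonal space of \<open>p\<close>
after finitely many steps; thus some power maps everything into \<open>p\<close>, and the
operator is nilpotent on the whole algebra.\<close>
lemma nilpotent_ideal_subset_perp:
  assumes nd: "\<And>x. (\<And>y. kf x y = 0) \<Longrightarrow> x = 0" and p: "lie_subalgebra br p" "perp p \<subseteq> p"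
    and n: "lie_ideal br p n" "nilpotent_lie br n"
  shows "n \<subseteq> perp p"
proof -
  have ps: "vec.subspace p" "\<And>x y. x \<in> p \<Longrightarrow> y \<in> p \<Longrightarrow> br x y \<in> p" using p unfolding lie_subalgebra_def by auto
  have ns: "vec.subspace n" "n \<subseteq> p" "\<And>x y. x \<in> p \<Longrightarrow> y \<in> n \<Longrightarrow> br x y \<in> n" using n unfolding lie_ideal_def by auto
  define L where "L i = ((\<lambda>A. lie_prod br n A) ^^ i) n" for i
  have L0: "L 0 = n" and LS: "L (Suc i) = lie_prod br n (L i)" for i by (simp_all add: L_def)
  obtain m where m: "L m = {0}" using n(2) unfolding nilpotent_lie_def L_def by (rule exE)
  have Lid: "br z u \<in> L i" if "z \<in> p" "u \<in> L i" for z u i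
    using that(2)
  proof (induction i arbitrary: u)
    case 0
    then show ?case using ns that unfolding L0 by blast
  next
    case (Suc i)
    have "vec.subspace {u. br z u \<in> L (Suc i)}" unfolding LS
      by (rule vec.subspaceI) (auto simp: br_simps intro: vec.subspace_0[OF lie_prod_subspace] vec.subspace_add[OF lie_prod_subspace] vec.subspace_scale[OF lie_prod_subspace])
    moreover have "br z (br x u) \<in> L (Suc i)" if "x \<in> n" "u \<in> L i" for x u
      unfolding jacobi[of z x u] LS
      using ns \<open>z \<in> p\<close> that Suc.IH by (intro vec.subspace_add[OF lie_prod_subspace] lie_prod_mem) auto
    ultimately have "L (Suc i) \<subseteq> {u. br z u \<in> L (Suc i)}" by (subst (1) LS) (rule lie_prod_least, auto)
    then show ?case using Suc.prems by blast
  qed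
  show ?thesis
  proof (rule subsetI, unfold perp_def, intro CollectI ballI)
    fix x z assume x: "x \<in> n" and z: "z \<in> p"
    let ?M = "\<lambda>u. br x (br z u)" and ?M' = "\<lambda>u. br z (br x u)"
    have xL: "br x u \<in> L 0" if "u \<in> p" for u using ns x that br_mem_commute[OF ns(1)] unfolding L0 by blast
    have M: "(?M ^^ Suc i) u \<in> L i" if "u \<in> p" for i u
    proof (induction i)
      case 0
      show ?case using xL ps z that by simp
    next
      case (Suc i)
      then show ?case using lie_prod_mem[OF x Lid[OF z]] by (simp add: LS)
    qed
    have M': "(?M' ^^ Suc i) u \<in> L i" if "u \<in> p" for i u
    proof (induction i)
      case 0
      show ?case using Lid[OF z] xL that by simp
    next
      case (Suc i)
      then show ?case using Lid[OF z, of _ "Suc i"] lie_prod_mem[OF x] by (simp add: LS)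
    qed
    have adj: "kf ((?M ^^ j) u) c = kf u ((?M' ^^ j) c)" for j u c
    proof (induction j arbitrary: u c)
      case (Suc j)
      have e: "kf (?M t) c = kf t (?M' c)" for t c
      proof -
        have "kf (br x (br z t)) c = - kf (br (br z t) x) c" by (subst br_anti) (simp add: kf_lin)
        also have "\<dots> = - kf (br z t) (br x c)" by (simp add: kf_invariant)
        also have "\<dots> = kf (br t z) (br x c)" by (subst br_anti) (simp add: kf_lin)
        finally show ?thesis by (simp add: kf_invariant)
      qed
      have "(?M' ^^ Suc j) c = (?M' ^^ j) (?M' c)" by (simp only: funpow_Suc_right o_apply)
      then show ?case using e[of "(?M ^^ j) u" c] Suc[of u "?M' c"] by simp
    qed simp
    have nil: "\<exists>m. (?M ^^ m) u = 0" for u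
    proof -
      have "(?M ^^ Suc m) u \<in> perp (perp p)"
        unfolding perp_def[of "perp p"]
      proof (intro CollectI ballI)
        fix c assume "c \<in> perp p"
        then have "(?M' ^^ Suc m) c = 0" using M'[of c m] p(2) m by blast
        then show "kf ((?M ^^ Suc m) u) c = 0" unfolding adj by (simp add: kf_lin)
      qed
      then have "(?M ^^ Suc m) u \<in> p" using perp_perp[OF nd ps(1)] by blast
      then have "(?M ^^ Suc m) ((?M ^^ Suc m) u) = 0" using M[of _ m] m by blast
      then have "(?M ^^ (Suc m + Suc m)) u = 0" unfolding funpow_add by simp
      then show ?thesis by blast
    qed
    show "kf x z = 0" unfolding kf_tr by (rule tr_nilpotent[OF lin_comp[OF br_lin(1) br_lin(1)] nil])
  qed
qed

lemma nilpotent_radical_eq_perp: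
  assumes nd: "\<And>x. (\<And>y. kf x y = 0) \<Longrightarrow> x = 0" and p: "parabolic_subalgebra br p" and n: "nilpotent_radical br p n"
  shows "n = perp p"
proof
  have sub: "lie_subalgebra br p" using p unfolding parabolic_subalgebra_def by blast
  show "n \<subseteq> perp p"
    using nilpotent_ideal_subset_perp[OF nd sub parabolic_perp_subset[OF p]] n unfolding nilpotent_radical_def by blast
  have "lie_ideal br p (perp p)"
    using perp_subspace parabolic_perp_subset[OF p] perp_invariant[of p] sub unfolding lie_ideal_def lie_subalgebra_def by blast
  then show "perp p \<subseteq> n" using parabolic_perp_nilpotent[OF nd p] n unfolding nilpotent_radical_def by blast
qed

section \<open>The short grading defined by a commutative parabolic\<close>

text \<open>Irreducibility of \<open>np\<close> as a \<open>k\<close>-module. The subspace \<open>I\<close> generated by \<open>U\<close> under \<open>nm\<close> is an ideal, hence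
everything; but it is contained in \<open>nm + k + U\<close>. The condition \<open>[U, nm] \<subseteq> k\<close> and the weak form
of the bracket of \<open>np\<close> with \<open>nm\<close> allow the lemma to be applied before \<open>nm\<close> is known to be commutative.\<close>
lemma k_submodule_eq:
  assumes ideal: "\<And>I. lie_ideal br UNIV I \<Longrightarrow> I = {0} \<or> I = UNIV"
    and sub: "vec.subspace np" "vec.subspace k" "vec.subspace nm"
    and kk: "\<And>x y. x \<in> k \<Longrightarrow> y \<in> k \<Longrightarrow> br x y \<in> k" and knm: "\<And>x y. x \<in> k \<Longrightarrow> y \<in> nm \<Longrightarrow> br x y \<in> nm"
    and nmnm: "\<And>x y. x \<in> nm \<Longrightarrow> y \<in> nm \<Longrightarrow> br x y \<in> nm"
    and npnp: "\<And>x y. x \<in> np \<Longrightarrow> y \<in> np \<Longrightarrow> br x y = 0"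
    and npnm: "\<And>x y. x \<in> np \<Longrightarrow> y \<in> nm \<Longrightarrow> \<exists>a\<in>k. \<exists>b\<in>np. br x y = a + b"
    and dec: "\<And>z. \<exists>a\<in>nm. \<exists>b\<in>k. \<exists>c\<in>np. z = a + b + c"
    and dir: "\<And>a b c. a \<in> nm \<Longrightarrow> b \<in> k \<Longrightarrow> c \<in> np \<Longrightarrow> a + b + c = 0 \<Longrightarrow> c = 0"
    and U: "vec.subspace U" "U \<subseteq> np" "U \<noteq> {0}" "\<And>z u. z \<in> k \<Longrightarrow> u \<in> U \<Longrightarrow> br z u \<in> U"
      "\<And>u y. u \<in> U \<Longrightarrow> y \<in> nm \<Longrightarrow> br u y \<in> k"
  shows "U = np"
proof -
  define F where "F = {S. vec.subspace S \<and> U \<subseteq> S \<and> (\<forall>y\<in>nm. \<forall>u\<in>S. br y u \<in> S)}"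
  define I where "I = \<Inter>F"
  have Is: "vec.subspace I" unfolding I_def by (rule vec.subspace_Inter) (auto simp: F_def)
  have UI: "U \<subseteq> I" unfolding I_def F_def by blast
  have nmI: "br y u \<in> I" if "y \<in> nm" "u \<in> I" for y u using that unfolding I_def F_def by blast
  have least: "I \<subseteq> S" if "vec.subspace S" "U \<subseteq> S" "\<And>y u. y \<in> nm \<Longrightarrow> u \<in> S \<Longrightarrow> br y u \<in> S" for S
    using that unfolding I_def F_def by blast
  have kI: "br z u \<in> I" if z: "z \<in> k" and u: "u \<in> I" for z u
  proof -
    have "I \<subseteq> {u \<in> I. \<forall>z\<in>k. br z u \<in> I}"
    proof (rule least)
      show "vec.subspace {u \<in> I. \<forall>z\<in>k. br z u \<in> I}"
        by (rule vec.subspaceI) (auto simp: br_simps intro: vec.subspace_0[OF Is] vec.subspace_add[OF Is] vec.subspace_scale[OF Is])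
      show "U \<subseteq> {u \<in> I. \<forall>z\<in>k. br z u \<in> I}" using UI U(4) by blast
      fix y u assume y: "y \<in> nm" and u: "u \<in> {u \<in> I. \<forall>z\<in>k. br z u \<in> I}"
      have "br z (br y u) \<in> I" if "z \<in> k" for z unfolding jacobi[of z y u]
        using nmI[OF knm[OF that y], of u] nmI[OF y, of "br z u"] u that by (intro vec.subspace_add[OF Is]) auto
      then show "br y u \<in> {u \<in> I. \<forall>z\<in>k. br z u \<in> I}" using nmI[OF y] u by blast
    qed
    then show ?thesis using that by blast
  qed
  have npI: "br x u \<in> I" if x: "x \<in> np" and u: "u \<in> I" for x u
  proof -
    have "I \<subseteq> {u \<in> I. \<forall>x\<in>np. br x u \<in> I}"
    proof (rule least)
      show "vec.subspace {u \<in> I. \<forall>x\<in>np. br x u \<in> I}"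
        by (rule vec.subspaceI) (auto simp: br_simps intro: vec.subspace_0[OF Is] vec.subspace_add[OF Is] vec.subspace_scale[OF Is])
      show "U \<subseteq> {u \<in> I. \<forall>x\<in>np. br x u \<in> I}"
      proof
        fix u assume "u \<in> U"
        then show "u \<in> {u \<in> I. \<forall>x\<in>np. br x u \<in> I}" using UI U(2) npnp[of _ u] vec.subspace_0[OF Is] by auto
      qed
      fix y u assume y: "y \<in> nm" and u: "u \<in> {u \<in> I. \<forall>x\<in>np. br x u \<in> I}"
      have "br x (br y u) \<in> I" if x: "x \<in> np" for x
      proof -
        obtain a b where ab: "a \<in> k" "b \<in> np" "br x y = a + b" using npnm[OF x y] by blast
        have "br a u + br b u \<in> I" using kI[OF ab(1)] ab(2) u by (intro vec.subspace_add[OF Is]) auto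
        moreover have "br y (br x u) \<in> I" using nmI[OF y] u x by blast
        ultimately have "br a u + br b u + br y (br x u) \<in> I" by (rule vec.subspace_add[OF Is])
        then show ?thesis unfolding jacobi[of x y u] ab(3) by (simp add: br_simps)
      qed
      then show "br y u \<in> {u \<in> I. \<forall>x\<in>np. br x u \<in> I}" using nmI[OF y] u by blast
    qed
    then show ?thesis using that by blast
  qed
  have "lie_ideal br UNIV I"
    unfolding lie_ideal_def
  proof (intro conjI ballI)
    fix z u assume u: "u \<in> I"
    obtain a b c where z: "a \<in> nm" "b \<in> k" "c \<in> np" "z = a + b + c" using dec[of z] by blast
    have "br a u + br b u + br c u \<in> I" using nmI[OF z(1) u] kI[OF z(2) u] npI[OF z(3) u]
      by (intro vec.subspace_add[OF Is])
    then show "br z u \<in> I" unfolding z(4) by (simp add: br_simps)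
  qed (use Is in auto)
  moreover have "I \<noteq> {0}" using UI U(3) vec.subspace_0[OF U(1)] by blast
  ultimately have IU: "I = UNIV" using ideal by blast
  let ?T = "{a + b + c |a b c. a \<in> nm \<and> b \<in> k \<and> c \<in> U}"
  have "I \<subseteq> ?T"
  proof (rule least)
    have e: "?T = {x + c |x c. x \<in> {a + b |a b. a \<in> nm \<and> b \<in> k} \<and> c \<in> U}" by blast
    show "vec.subspace ?T" unfolding e by (intro vec.subspace_sums sub U(1))
    show "U \<subseteq> ?T"
    proof
      fix u assume "u \<in> U"
      then have "u = 0 + 0 + u \<and> 0 \<in> nm \<and> 0 \<in> k \<and> u \<in> U" using sub vec.subspace_0 by auto
      then show "u \<in> ?T" by blast
    qed
    fix y u assume y: "y \<in> nm" and "u \<in> ?T"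
    then obtain a b c where u: "u = a + b + c" "a \<in> nm" "b \<in> k" "c \<in> U" by blast
    have "br y u = (br y a + br y b) + br y c + 0" unfolding u(1) by (simp add: br_simps)
    moreover have "br y a + br y b \<in> nm"
      by (rule vec.subspace_add[OF sub(3) nmnm[OF y u(2)] br_mem_commute[OF sub(3) knm[OF u(3) y]]])
    moreover have "br y c \<in> k" by (rule br_mem_commute[OF sub(2) U(5)[OF u(4) y]])
    moreover have "0 \<in> U" by (rule vec.subspace_0[OF U(1)])
    ultimately show "br y u \<in> ?T" by blast
  qed
  have "np \<subseteq> U"
  proof
    fix x assume x: "x \<in> np"
    then obtain a b c where u: "x = a + b + c" "a \<in> nm" "b \<in> k" "c \<in> U" using \<open>I \<subseteq> ?T\<close> IU by blast
    have "a + b + (c - x) = 0" using u(1) by simp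
    moreover have "c - x \<in> np" using u(4) U(2) x vec.subspace_diff[OF sub(1)] by blast
    ultimately have "c - x = 0" using dir u by blast
    then show "x \<in> U" using u(4) by simp
  qed
  then show ?thesis using U(2) by blast
qed

end

text \<open>All that the later arguments use of a commutative parabolic subalgebra: \<open>ad H\<close> is the degree operator of
a grading with only three degrees.\<close>
locale short_grading = complex_lie_algebra br for br :: "complex ^ 'n \<Rightarrow> complex ^ 'n \<Rightarrow> complex ^ 'n" +
  fixes np k nm :: "(complex ^ 'n) set" and H :: "complex ^ 'n"
  assumes sub: "vec.subspace np" "vec.subspace k" "vec.subspace nm"
    and dec: "\<And>z. \<exists>a\<in>nm. \<exists>b\<in>k. \<exists>c\<in>np. z = a + b + c"
    and kk: "\<And>x y. x \<in> k \<Longrightarrow> y \<in> k \<Longrightarrow> br x y \<in> k"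
    and knp: "\<And>x y. x \<in> k \<Longrightarrow> y \<in> np \<Longrightarrow> br x y \<in> np"
    and knm: "\<And>x y. x \<in> k \<Longrightarrow> y \<in> nm \<Longrightarrow> br x y \<in> nm"
    and npnm: "\<And>x y. x \<in> np \<Longrightarrow> y \<in> nm \<Longrightarrow> br x y \<in> k"
    and npnp: "\<And>x y. x \<in> np \<Longrightarrow> y \<in> np \<Longrightarrow> br x y = 0"
    and nmnm: "\<And>x y. x \<in> nm \<Longrightarrow> y \<in> nm \<Longrightarrow> br x y = 0"
    and Hk: "H \<in> k" and Hnp: "\<And>x. x \<in> np \<Longrightarrow> br H x = x" and Hnm: "\<And>y. y \<in> nm \<Longrightarrow> br H y = - y"
    and Hkz: "\<And>z. z \<in> k \<Longrightarrow> br H z = 0"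
    and nd: "\<And>x. (\<And>y. kf x y = 0) \<Longrightarrow> x = 0"
    and centre: "\<And>w. w \<in> k \<Longrightarrow> (\<And>z. z \<in> k \<Longrightarrow> br w z = 0) \<Longrightarrow> \<exists>a. w = a *s H"

text \<open>Opposite parabolic subalgebras \<open>p\<close> and \<open>q\<close> satisfy \<open>p + q = UNIV\<close>, because an element orthogonal to
both lies in \<open>np \<inter> nm \<subseteq> k \<inter> np = 0\<close>. This gives the decomposition into three parts. The map with
eigenvalues \<open>1\<close>, \<open>0\<close>, \<open>-1\<close> on them is a derivation as soon as \<open>nm\<close> is commutative, and hence of the form \<open>ad H\<close>. An
element of the centre of \<open>k\<close> acts on the irreducible module \<open>np\<close> by a scalar, by duality on
\<open>nm\<close> by its negative, and is therefore a multiple of \<open>H\<close>.\<close>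
lemma (in complex_lie_algebra) commutative_parabolic_short_grading:
  assumes cp: "commutative_parabolic_type br p k np nm"
  shows "\<exists>H. short_grading br np k nm H"
proof -
  have simple: "simple_lie_algebra br" and pp: "parabolic_subalgebra br p" and pne: "p \<noteq> UNIV"
    and np: "nilpotent_radical br p np" and comm: "\<And>x y. x \<in> np \<Longrightarrow> y \<in> np \<Longrightarrow> br x y = 0"
    and levi: "levi_subalgebra br p k" and opp: "opposite_radical br p k nm"
    using cp unfolding commutative_parabolic_type_def maximal_parabolic_def commutative_lie_def by auto
  have ideal: "I = {0} \<or> I = UNIV" if "lie_ideal br UNIV I" for I
    using simple that unfolding simple_lie_algebra_def by blast
  obtain b where b: "borel_subalgebra br b" "b \<subseteq> p" using pp unfolding parabolic_subalgebra_def by blast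
  have nd: "x = 0" if "\<And>y. kf x y = 0" for x
    by (rule kf_nondegenerate[OF simple b(1) _ that]) (use b(2) pne in blast)
  obtain q where q: "parabolic_subalgebra br q" "p \<inter> q = k" "levi_subalgebra br q k" "nilpotent_radical br q nm"
    using opp unfolding opposite_radical_def by blast
  have npp: "np = perp p" by (rule nilpotent_radical_eq_perp[OF nd pp np])
  have nmq: "nm = perp q" by (rule nilpotent_radical_eq_perp[OF nd q(1) q(4)])
  obtain n1 where n1: "nilpotent_radical br p n1" "k \<inter> n1 = {0}" "p = {x + y |x y. x \<in> k \<and> y \<in> n1}"
    using levi unfolding levi_subalgebra_def by blast
  obtain n2 where n2: "nilpotent_radical br q n2" "k \<inter> n2 = {0}" "q = {x + y |x y. x \<in> k \<and> y \<in> n2}"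
    using q(3) unfolding levi_subalgebra_def by blast
  have "n1 = np" using nilpotent_radical_eq_perp[OF nd pp n1(1)] npp by simp
  then have p: "p = {x + y |x y. x \<in> k \<and> y \<in> np}" "k \<inter> np = {0}" using n1 by auto
  have "n2 = nm" using nilpotent_radical_eq_perp[OF nd q(1) n2(1)] nmq by simp
  then have q': "q = {x + y |x y. x \<in> k \<and> y \<in> nm}" "k \<inter> nm = {0}" using n2 by auto
  have psub: "vec.subspace p" and qsub: "vec.subspace q"
    using pp q(1) unfolding parabolic_subalgebra_def lie_subalgebra_def by auto
  have sub: "vec.subspace np" "vec.subspace k" "vec.subspace nm"
    using levi perp_subspace unfolding npp nmq levi_subalgebra_def lie_subalgebra_def by auto
  have kk: "br x y \<in> k" if "x \<in> k" "y \<in> k" for x y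
    using levi that unfolding levi_subalgebra_def lie_subalgebra_def by blast
  have npsub: "np \<subseteq> p" "nm \<subseteq> q" "k \<subseteq> p" "k \<subseteq> q"
    using np q unfolding nilpotent_radical_def lie_ideal_def by auto
  have knp: "br x y \<in> np" if "x \<in> k" "y \<in> np" for x y
    using np npsub that unfolding nilpotent_radical_def lie_ideal_def by blast
  have knm: "br x y \<in> nm" if "x \<in> k" "y \<in> nm" for x y
    using q(4) npsub that unfolding nilpotent_radical_def lie_ideal_def by blast
  have nmid: "\<And>x y. x \<in> q \<Longrightarrow> y \<in> nm \<Longrightarrow> br x y \<in> nm"
    using conjunct1[OF q(4)[unfolded nilpotent_radical_def]] unfolding lie_ideal_def by blast
  have nmnm: "br x y \<in> nm" if "x \<in> nm" "y \<in> nm" for x y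
    by (rule nmid[OF subsetD[OF npsub(2) that(1)] that(2)])
  have perpnp: "perp np = p" unfolding npp by (rule perp_perp[OF nd psub])
  have perpnm: "perp nm = q" unfolding nmq by (rule perp_perp[OF nd qsub])
  have dec: "\<exists>a\<in>nm. \<exists>b\<in>k. \<exists>c\<in>np. z = a + b + c" for z
  proof -
    let ?S = "{x + y |x y. x \<in> p \<and> y \<in> q}"
    have S: "vec.subspace ?S" by (rule vec.subspace_sums[OF psub qsub])
    have "p \<subseteq> ?S"
    proof
      fix x assume "x \<in> p"
      then have "x = x + 0 \<and> x \<in> p \<and> 0 \<in> q" using vec.subspace_0[OF qsub] by simp
      then show "x \<in> ?S" by blast
    qed
    moreover have "q \<subseteq> ?S"
    proof
      fix x assume "x \<in> q"
      then have "x = 0 + x \<and> 0 \<in> p \<and> x \<in> q" using vec.subspace_0[OF psub] by simp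
      then show "x \<in> ?S" by blast
    qed
    ultimately have "perp ?S \<subseteq> np \<inter> nm" using perp_anti[of p ?S] perp_anti[of q ?S] unfolding npp nmq by blast
    also have "\<dots> \<subseteq> {0}" using npsub q(2) p(2) by blast
    finally have "perp ?S \<subseteq> {0}" .
    then have "perp (perp ?S) = UNIV" unfolding perp_def[of "perp ?S"] using kf_lin(6) by blast
    then have "z \<in> ?S" using perp_perp[OF nd S] by blast
    then obtain x y where xy: "x \<in> p" "y \<in> q" "z = x + y" by blast
    obtain k1 m1 where 1: "k1 \<in> k" "m1 \<in> np" "x = k1 + m1" using xy(1) p(1) by blast
    obtain k2 m2 where 2: "k2 \<in> k" "m2 \<in> nm" "y = k2 + m2" using xy(2) q'(1) by blast
    have "z = m2 + (k1 + k2) + m1" using xy 1 2 by simp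
    moreover have "k1 + k2 \<in> k" using 1 2 vec.subspace_add[OF sub(2)] by blast
    ultimately show ?thesis using 1 2 by blast
  qed
  have dir: "c = 0 \<and> b = 0 \<and> a = 0" if "a \<in> nm" "b \<in> k" "c \<in> np" "a + b + c = 0" for a b c
  proof -
    have "b + a \<in> q" using that q'(1) by blast
    then have "- (b + a) \<in> q" by (rule vec.subspace_neg[OF qsub])
    moreover have "- (b + a) = c" using that(4) by (metis add.commute eq_neg_iff_add_eq_0)
    ultimately have "c \<in> q" by simp
    then have "c \<in> k \<inter> np" using that(3) npsub q(2) by blast
    then have c: "c = 0" using p(2) by blast
    then have "a = - b" using that(4) by (simp add: eq_neg_iff_add_eq_0)
    then have "a \<in> k \<inter> nm" using that vec.subspace_neg[OF sub(2)] by auto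
    then have "a = 0" using q'(2) by blast
    then show ?thesis using c that(4) by simp
  qed
  have inp: "br x y \<in> p" if "x \<in> np" "y \<in> nm" for x y
  proof -
    have "kf (br x y) u = 0" if "u \<in> np" for u
    proof -
      have "kf (br x y) u = - kf (br y x) u" by (subst br_anti) (simp add: kf_lin)
      then show ?thesis using comm[OF \<open>x \<in> np\<close> that] by (simp add: kf_invariant kf_lin)
    qed
    then have "br x y \<in> perp np" unfolding perp_def by blast
    then show ?thesis unfolding perpnp .
  qed
  have npnm0: "\<exists>a\<in>k. \<exists>b\<in>np. br x y = a + b" if "x \<in> np" "y \<in> nm" for x y
    using inp[OF that] p(1) by blast
  have inq: "br x y \<in> k" if "x \<in> np" "y \<in> nm" "\<And>y'. y' \<in> nm \<Longrightarrow> kf x (br y y') = 0" for x y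
  proof -
    have "br x y \<in> perp nm" unfolding perp_def using that(3) by (simp add: kf_invariant)
    then show ?thesis using inp[OF that(1,2)] q(2) perpnm by blast
  qed
  note irr = k_submodule_eq[OF ideal sub kk knm nmnm comm npnm0 dec conjunct1[OF dir]]
  let ?n2 = "lie_prod br nm nm"
  have n2nm: "?n2 \<subseteq> nm" by (rule lie_prod_least[OF sub(3) nmnm])
  \<comment> \<open>Commutativity of \<open>nm\<close>: the part of \<open>np\<close> orthogonal to \<open>[nm, nm]\<close> is a nonzero submodule because
    \<open>nm\<close> is nilpotent, so it is all of \<open>np\<close>, and \<open>[nm, nm]\<close> is orthogonal to everything.\<close>
  have nm0: "br x y = 0" if xy: "x \<in> nm" "y \<in> nm" for x y
  proof (rule ccontr)
    assume nz: "br x y \<noteq> 0"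
    have ne: "?n2 \<noteq> nm"
    proof
      assume e: "?n2 = nm"
      have "((\<lambda>A. lie_prod br nm A) ^^ m) nm = nm" for m by (induction m) (simp_all add: e)
      moreover have "nilpotent_lie br nm" using q(4) unfolding nilpotent_radical_def by blast
      ultimately have "nm = {0}" unfolding nilpotent_lie_def by metis
      then show False using nmnm[OF xy] nz by blast
    qed
    then obtain v where v: "v \<in> nm" "v \<notin> ?n2" using n2nm by blast
    let ?U = "np \<inter> perp ?n2"
    have "v \<notin> perp (perp ?n2)" using perp_perp[OF nd lie_prod_subspace] v(2) by blast
    then obtain h where h: "h \<in> perp ?n2" "kf v h \<noteq> 0" unfolding perp_def[of "perp ?n2"] by blast
    obtain a b c where abc: "a \<in> nm" "b \<in> k" "c \<in> np" "h = a + b + c" using dec[of h] by blast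
    have q0: "kf u w = 0" if "u \<in> q" "w \<in> nm" for u w using that nmq kf_sym unfolding perp_def by auto
    have hc: "kf h w = kf c w" if "w \<in> nm" for w using q0[OF subsetD[OF npsub(2) abc(1)] that] q0[OF subsetD[OF npsub(4) abc(2)] that] unfolding abc(4) by (simp add: kf_lin)
    have "kf c w = 0" if "w \<in> ?n2" for w
      using h(1) hc[OF subsetD[OF n2nm that]] that unfolding perp_def by simp
    then have "c \<in> ?U" using abc(3) unfolding perp_def by blast
    moreover have "c \<noteq> 0"
    proof
      assume "c = 0"
      then have "kf h v = 0" using hc[OF v(1)] by (simp only: kf_lin)
      then show False using h(2) kf_sym[of v h] by simp
    qed
    ultimately have U0: "?U \<noteq> {0}" by blast
    have "?U = np"
    proof (rule irr)
      show "vec.subspace ?U" by (rule vec.subspace_inter[OF sub(1) perp_subspace])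
      show "?U \<noteq> {0}" by (rule U0)
      fix z u assume z: "z \<in> k" and u: "u \<in> ?U"
      have "br z w \<in> ?n2" if "w \<in> ?n2" for w
      proof -
        have "?n2 \<subseteq> {w. br z w \<in> ?n2}"
        proof (rule lie_prod_least)
          show "vec.subspace {w. br z w \<in> ?n2}"
            by (rule vec.subspaceI) (auto simp: br_simps intro: vec.subspace_0[OF lie_prod_subspace] vec.subspace_add[OF lie_prod_subspace] vec.subspace_scale[OF lie_prod_subspace])
          fix s t assume "s \<in> nm" "t \<in> nm"
          then have "br (br z s) t + br s (br z t) \<in> ?n2" using knm[OF z]
            by (intro vec.subspace_add[OF lie_prod_subspace] lie_prod_mem) auto
          then show "br s t \<in> {w. br z w \<in> ?n2}" using jacobi[of z s t] by simp
        qed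
        then show ?thesis using that by blast
      qed
      then show "br z u \<in> ?U" using knp[OF z] perp_invariant[of ?n2 z u] u by blast
    next
      fix u y assume u: "u \<in> ?U" and y: "y \<in> nm"
      show "br u y \<in> k"
      proof (rule inq)
        fix y' assume "y' \<in> nm"
        then show "kf u (br y y') = 0" using u lie_prod_mem[OF y] unfolding perp_def by auto
      qed (use u y in auto)
    qed auto
    then have Uc: "kf u w = 0" if "u \<in> np" "w \<in> ?n2" for u w using that unfolding perp_def by blast
    have "kf (br x y) t = 0" for t
    proof -
      obtain a b c where t: "a \<in> nm" "b \<in> k" "c \<in> np" "t = a + b + c" using dec[of t] by blast
      have w: "br x y \<in> ?n2" "br x y \<in> nm" using lie_prod_mem[OF xy] nmnm[OF xy] by auto
      have "kf t (br x y) = 0" unfolding t(4) using Uc[OF t(3) w(1)] q0[OF subsetD[OF npsub(2) t(1)] w(2)] q0[OF subsetD[OF npsub(4) t(2)] w(2)]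
        by (simp add: kf_lin)
      then show ?thesis using kf_sym by metis
    qed
    then show False using nd nz by blast
  qed
  have npnm: "br x y \<in> k" if "x \<in> np" "y \<in> nm" for x y
    using inq[OF that] nm0[OF that(2)] by (simp add: kf_lin)
  \<comment> \<open>The future \<open>ad H\<close>.\<close>
  define D where "D v = (THE d. \<exists>a\<in>nm. \<exists>b\<in>k. \<exists>c\<in>np. v = a + b + c \<and> d = c - a)" for v
  have Deq: "D (a + b + c) = c - a" if "a \<in> nm" "b \<in> k" "c \<in> np" for a b c
    unfolding D_def
  proof (rule the_equality)
    show "\<exists>a'\<in>nm. \<exists>b'\<in>k. \<exists>c'\<in>np. a + b + c = a' + b' + c' \<and> c - a = c' - a'" using that by blast
    fix d assume "\<exists>a'\<in>nm. \<exists>b'\<in>k. \<exists>c'\<in>np. a + b + c = a' + b' + c' \<and> d = c' - a'"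
    then obtain a' b' c' where e: "a' \<in> nm" "b' \<in> k" "c' \<in> np" "a + b + c = a' + b' + c'" "d = c' - a'" by blast
    have "(a - a') + (b - b') + (c - c') = 0" using e(4) by (simp add: algebra_simps)
    then have "c - c' = 0 \<and> b - b' = 0 \<and> a - a' = 0"
      using e that by (intro dir) (auto intro: vec.subspace_diff sub)
    then show "d = c - a" using e(5) by simp
  qed
  have z0: "0 \<in> nm" "0 \<in> k" "0 \<in> np" using sub vec.subspace_0 by auto
  have Dlin: "lin D"
  proof (rule linI)
    fix x y c
    obtain a b d where x: "a \<in> nm" "b \<in> k" "d \<in> np" "x = a + b + d" using dec[of x] by blast
    obtain a' b' d' where y: "a' \<in> nm" "b' \<in> k" "d' \<in> np" "y = a' + b' + d'" using dec[of y] by blast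
    have "x + y = (a + a') + (b + b') + (d + d')" using x y by simp
    then have "D (x + y) = (d + d') - (a + a')" using Deq[OF vec.subspace_add[OF sub(3) x(1) y(1)] vec.subspace_add[OF sub(2) x(2) y(2)] vec.subspace_add[OF sub(1) x(3) y(3)]] by simp
    then show "D (x + y) = D x + D y" using x y Deq by simp
    have "c *s x = c *s a + c *s b + c *s d" using x by (simp add: vec.scale_right_distrib)
    then have "D (c *s x) = c *s d - c *s a" using Deq[OF vec.subspace_scale[OF sub(3) x(1)] vec.subspace_scale[OF sub(2) x(2)] vec.subspace_scale[OF sub(1) x(3)]] by simp
    then show "D (c *s x) = c *s D x" using x Deq by (simp add: vec.scale_right_diff_distrib)
  qed
  have Dder: "D (br u v) = br (D u) v + br u (D v)" for u v
  proof -
    obtain a b c where u: "a \<in> nm" "b \<in> k" "c \<in> np" "u = a + b + c" using dec[of u] by blast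
    obtain a' b' c' where v: "a' \<in> nm" "b' \<in> k" "c' \<in> np" "v = a' + b' + c'" using dec[of v] by blast
    have m: "br a b' + br b a' \<in> nm"
      by (rule vec.subspace_add[OF sub(3) br_mem_commute[OF sub(3) knm[OF v(2) u(1)]] knm[OF u(2) v(1)]])
    have p: "br b c' + br c b' \<in> np"
      by (rule vec.subspace_add[OF sub(1) knp[OF u(2) v(3)] br_mem_commute[OF sub(1) knp[OF v(2) u(3)]]])
    have kz: "br a c' + br b b' + br c a' \<in> k"
      by (intro vec.subspace_add[OF sub(2)] br_mem_commute[OF sub(2) npnm[OF v(3) u(1)]] kk[OF u(2) v(2)] npnm[OF u(3) v(1)])
    have "br u v = (br a b' + br b a') + (br a c' + br b b' + br c a') + (br b c' + br c b')"
      unfolding u(4) v(4) using nm0[OF u(1) v(1)] comm[OF u(3) v(3)] by (simp add: br_simps)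
    then have "D (br u v) = (br b c' + br c b') - (br a b' + br b a')" using Deq[OF m kz p] by simp
    moreover have "D u = c - a" "D v = c' - a'" using Deq u v by auto
    ultimately show ?thesis unfolding u(4) v(4) using nm0[OF u(1) v(1)] comm[OF u(3) v(3)]
      by (simp add: br_simps)
  qed
  obtain H where H: "\<And>v. D v = br H v" using derivation_inner[OF nd Dlin Dder] by blast
  have Hnp: "br H x = x" if "x \<in> np" for x using Deq[OF z0(1,2) that] H by simp
  have Hnm: "br H x = - x" if "x \<in> nm" for x using Deq[OF that z0(2,3)] H by simp
  have Hkz: "br H x = 0" if "x \<in> k" for x using Deq[OF z0(1) that z0(3)] H by simp
  have Hk: "H \<in> k"
  proof -
    obtain a b c where h: "a \<in> nm" "b \<in> k" "c \<in> np" "H = a + b + c" using dec[of H] by blast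
    have "c - a = 0" using Deq[OF h(1-3)] H[of H] h(4) by simp
    then have "a + 0 + (- c) = 0" by simp
    then have "a = 0" "c = 0" using dir[OF h(1) z0(2) vec.subspace_neg[OF sub(1) h(3)]] by auto
    then show ?thesis using h by simp
  qed
  have centre: "\<exists>a. w = a *s H" if w: "w \<in> k" "\<And>z. z \<in> k \<Longrightarrow> br w z = 0" for w
  proof -
    have "np \<noteq> {0}"
    proof
      assume "np = {0}"
      then have "p = UNIV" using perpnp kf_lin(6) unfolding perp_def by blast
      then show False using pne by blast
    qed
    then obtain x where x: "x \<in> np" "x \<noteq> 0" using z0 by blast
    have inv: "br w ` np \<subseteq> np" using knp[OF w(1)] by blast
    obtain v a where v: "v \<in> np" "v \<notin> {0}" "br w v - a *s v \<in> {0}"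
      using eigenvector_mod[OF br_lin(1) sub(1) inv vec.subspace_single_0 x(1)] x(2) by blast
    let ?U = "{u \<in> np. br w u = a *s u}"
    have Ue: "?U = np"
    proof (rule irr)
      show "vec.subspace ?U"
        by (rule vec.subspaceI) (auto simp: br_simps z0 vec.scale_right_distrib mult.commute intro: vec.subspace_add[OF sub(1)] vec.subspace_scale[OF sub(1)])
      show "?U \<noteq> {0}" using v by auto
      fix z u assume z: "z \<in> k" and u: "u \<in> ?U"
      have "br w (br z u) = a *s br z u" using jacobi[of w z u] w(2)[OF z] u by (simp add: br_simps)
      then show "br z u \<in> ?U" using knp[OF z] u by blast
    qed (use npnm in auto)
    have 1: "br w u = a *s u" if "u \<in> np" for u using Ue that by blast
    have 2: "br w y = - (a *s y)" if y: "y \<in> nm" for y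
    proof -
      let ?t = "br w y + a *s y"
      have tn: "?t \<in> nm" using knm[OF w(1) y] y vec.subspace_add[OF sub(3)] vec.subspace_scale[OF sub(3)] by blast
      have "kf ?t s = 0" for s
      proof -
        obtain a1 b c where s: "a1 \<in> nm" "b \<in> k" "c \<in> np" "s = a1 + b + c" using dec[of s] by blast
        have "kf (br w y) c = - kf (br y w) c" by (subst br_anti) (simp add: kf_lin)
        also have "\<dots> = - (a * kf y c)" using 1[OF s(3)] by (simp add: kf_invariant kf_lin)
        finally have "kf ?t c = 0" by (simp add: kf_lin)
        moreover have tq: "kf ?t u = 0" if "u \<in> q" for u using tn that unfolding nmq perp_def by blast
        have "kf ?t a1 = 0" "kf ?t b = 0"
          by (rule tq[OF subsetD[OF npsub(2) s(1)]], rule tq[OF subsetD[OF npsub(4) s(2)]])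
        ultimately show ?thesis unfolding s(4) by (simp only: kf_lin(3) add_0_left)
      qed
      then have "?t = 0" by (rule nd)
      then show ?thesis by (simp add: eq_neg_iff_add_eq_0)
    qed
    have "br (w - a *s H) s = 0" for s
    proof -
      obtain a1 b c where s: "a1 \<in> nm" "b \<in> k" "c \<in> np" "s = a1 + b + c" using dec[of s] by blast
      show ?thesis unfolding s(4) using 1[OF s(3)] 2[OF s(1)] w(2)[OF s(2)] Hnp[OF s(3)] Hnm[OF s(1)] Hkz[OF s(2)]
        by (simp add: br_simps)
    qed
    then have "kf (w - a *s H) s = 0" for s unfolding kf_tr by (simp add: tr_def trace_def matrix_def)
    then have "w - a *s H = 0" by (rule nd)
    then show ?thesis by (intro exI[of _ a]) simp
  qed
  show ?thesis
    by (rule exI[of _ H], unfold_locales)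
      (fact sub dec kk knp knm npnm comm nm0 Hk Hnp Hnm Hkz centre | erule nd | rule nd, blast)+
qed

section \<open>Polynomial functions and their directional derivatives\<close>

abbreviation PF :: "(complex ^ 'n \<Rightarrow> complex) set" where "PF \<equiv> poly_functions"
abbreviation dd :: "complex ^ 'n \<Rightarrow> (complex ^ 'n \<Rightarrow> complex) \<Rightarrow> complex ^ 'n \<Rightarrow> complex" where "dd \<equiv> directional_deriv"

lemmas PF_rules = poly_const poly_linear poly_add poly_mult

lemma functionalI:
  assumes "\<And>x y. l (x + y) = l x + l y" "\<And>c x. l (c *s x) = c * l x"
  shows "Vector_Spaces.linear (*s) (*) (l :: complex ^ 'n \<Rightarrow> complex)"
  using assms by unfold_locales (auto simp: algebra_simps)

lemma functional_rules:
  assumes "Vector_Spaces.linear (*s) (*) (l :: complex ^ 'n \<Rightarrow> complex)"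
  shows "l (x + y) = l x + l y" "l (c *s x) = c * l x" "l 0 = 0"
proof -
  interpret l: Vector_Spaces.linear "(*s)" "(*)" l by fact
  show "l (x + y) = l x + l y" "l (c *s x) = c * l x" "l 0 = 0"
    by (rule l.add, rule l.scale, rule l.zero)
qed

lemma functional_sum:
  assumes "Vector_Spaces.linear (*s) (*) (l :: complex ^ 'n \<Rightarrow> complex)"
  shows "l z = (\<Sum>i\<in>UNIV. z $ i * l (axis i 1))"
proof -
  have "l (\<Sum>i\<in>A. z $ i *s axis i 1) = (\<Sum>i\<in>A. z $ i * l (axis i 1))" for A
    by (induction A rule: infinite_finite_induct) (simp_all add: functional_rules[OF assms])
  from this[of UNIV] show ?thesis by (simp add: basis_expansion)
qed

lemma PF_nth: "(\<lambda>x. x $ i) \<in> PF"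
  by (rule poly_linear) (rule functionalI, simp_all)

lemma PF_cmult: "g \<in> PF \<Longrightarrow> (\<lambda>x. c * g x) \<in> PF"
  using poly_mult[OF poly_const] by blast

lemma PF_sum: "(\<And>i. i \<in> A \<Longrightarrow> g i \<in> PF) \<Longrightarrow> (\<lambda>x. \<Sum>i\<in>A. g i x) \<in> PF"
  by (induction A rule: infinite_finite_induct) (auto intro: poly_const poly_add)

lemma PF_power: "g \<in> PF \<Longrightarrow> (\<lambda>x. g x ^ m) \<in> PF"
  by (induction m) (auto intro: poly_const poly_mult)

lemma PF_diff: "g \<in> PF \<Longrightarrow> h \<in> PF \<Longrightarrow> (\<lambda>x. g x - h x) \<in> PF"
  using poly_add[OF _ PF_cmult[of h "-1"]] by simp

lemma PF_line:
  assumes "g \<in> PF"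
  shows "\<exists>q. \<forall>t. g (y + t *s u) = poly q t"
  using assms
proof induction
  case (poly_const c)
  show ?case by (intro exI[of _ "[:c:]"]) simp
next
  case (poly_linear l)
  show ?case by (intro exI[of _ "[:l y, l u:]"]) (simp add: functional_rules[OF poly_linear])
next
  case (poly_add p q)
  then obtain a b where "\<forall>t. p (y + t *s u) = poly a t" "\<forall>t. q (y + t *s u) = poly b t" by blast
  then show ?case by (intro exI[of _ "a + b"]) simp
next
  case (poly_mult p q)
  then obtain a b where "\<forall>t. p (y + t *s u) = poly a t" "\<forall>t. q (y + t *s u) = poly b t" by blast
  then show ?case by (intro exI[of _ "a * b"]) simp
qed

lemma poly_agree_nonzero:
  fixes p q :: "complex poly"
  assumes "\<And>t. t \<noteq> 0 \<Longrightarrow> poly p t = poly q t"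
  shows "p = q"
proof -
  have "poly ([:0, 1:] * p) = poly ([:0, 1:] * q)" using assms by (auto simp: fun_eq_iff)
  then have "[:0, 1:] * p = [:0, 1:] * q" using poly_eq_poly_eq_iff by blast
  then show ?thesis by simp
qed

lemma dd_eqI: "((\<lambda>t. g (y + t *s u)) has_field_derivative d) (at 0) \<Longrightarrow> dd u g y = d"
  unfolding directional_deriv_def by (rule DERIV_imp_deriv)

lemma dd_works:
  assumes "g \<in> PF"
  shows "((\<lambda>t. g (y + t *s u)) has_field_derivative dd u g y) (at 0)"
proof -
  obtain q where q: "\<And>t. g (y + t *s u) = poly q t" using PF_line[OF assms] by metis
  have "((\<lambda>t. g (y + t *s u)) has_field_derivative poly (pderiv q) 0) (at 0)" unfolding q by (rule poly_DERIV)
  then show ?thesis using dd_eqI by metis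
qed

lemma dd_const: "dd u (\<lambda>_. c) = (\<lambda>_. 0)"
  by (rule ext, rule dd_eqI) simp

lemma dd_functional:
  assumes "Vector_Spaces.linear (*s) (*) l"
  shows "dd u l = (\<lambda>_. l u)"
proof (rule ext, rule dd_eqI)
  fix y
  show "((\<lambda>t. l (y + t *s u)) has_field_derivative l u) (at 0)"
    unfolding functional_rules[OF assms] by (auto intro!: derivative_eq_intros)
qed

lemma dd_add: "g \<in> PF \<Longrightarrow> h \<in> PF \<Longrightarrow> dd u (\<lambda>x. g x + h x) = (\<lambda>x. dd u g x + dd u h x)"
  by (rule ext, rule dd_eqI) (intro DERIV_add dd_works)

lemma dd_mult:
  assumes "g \<in> PF" "h \<in> PF"
  shows "dd u (\<lambda>x. g x * h x) = (\<lambda>x. dd u g x * h x + g x * dd u h x)"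
proof (rule ext, rule dd_eqI)
  fix y
  show "((\<lambda>t. g (y + t *s u) * h (y + t *s u)) has_field_derivative dd u g y * h y + g y * dd u h y) (at 0)"
    using DERIV_mult[OF dd_works[OF assms(1), of y u] dd_works[OF assms(2), of y u]] by (simp add: algebra_simps)
qed

lemma dd_cmult: "g \<in> PF \<Longrightarrow> dd u (\<lambda>x. c * g x) = (\<lambda>x. c * dd u g x)"
  by (subst dd_mult[OF poly_const]) (simp_all add: dd_const)

lemma dd_PF: "g \<in> PF \<Longrightarrow> dd u g \<in> PF"
proof (induction rule: poly_functions.induct)
  case (poly_mult p q)
  then show ?case by (simp add: dd_mult poly_functions.poly_add poly_functions.poly_mult)
next
  case (poly_add p q)
  then show ?case by (simp add: dd_add poly_functions.poly_add)
qed (auto simp: dd_const dd_functional intro: PF_rules)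

lemma dd_sum: "(\<And>i. i \<in> A \<Longrightarrow> g i \<in> PF) \<Longrightarrow> dd u (\<lambda>x. \<Sum>i\<in>A. g i x) = (\<lambda>x. \<Sum>i\<in>A. dd u (g i) x)"
  by (induction A rule: infinite_finite_induct) (simp_all add: dd_const dd_add PF_sum)

lemma dd_dir_linear: "g \<in> PF \<Longrightarrow> Vector_Spaces.linear (*s) (*) (\<lambda>u. dd u g y)"
proof (induction rule: poly_functions.induct)
  case (poly_const c)
  show ?case by (rule functionalI) (simp_all add: dd_const)
next
  case (poly_linear l)
  then show ?case by (simp add: dd_functional)
next
  case (poly_add p q)
  show ?case using functional_rules[OF poly_add.IH(1)] functional_rules[OF poly_add.IH(2)] poly_add.hyps
    by (intro functionalI) (simp_all add: dd_add algebra_simps)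
next
  case (poly_mult p q)
  show ?case using functional_rules[OF poly_mult.IH(1)] functional_rules[OF poly_mult.IH(2)] poly_mult.hyps
    by (intro functionalI) (simp_all add: dd_mult algebra_simps)
qed

lemma dd_dir:
  assumes "g \<in> PF"
  shows "dd (u + v) g y = dd u g y + dd v g y" "dd (c *s u) g y = c * dd u g y" "dd 0 g y = 0"
    "dd (- u) g y = - dd u g y"
  using functional_rules[OF dd_dir_linear[OF assms]] functional_rules(2)[OF dd_dir_linear[OF assms], of "-1" u] by simp_all

lemma dd_basis: "g \<in> PF \<Longrightarrow> dd u g y = (\<Sum>i\<in>UNIV. u $ i * dd (axis i 1) g y)"
  using functional_sum[OF dd_dir_linear] .

lemma dd_commute: "g \<in> PF \<Longrightarrow> dd u (dd v g) = dd v (dd u g)"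
proof (induction rule: poly_functions.induct)
  case (poly_mult p q)
  then show ?case by (simp add: dd_mult dd_add dd_PF PF_rules fun_eq_iff algebra_simps)
qed (simp_all add: dd_const dd_functional dd_add dd_PF)

lemma dd_chain:
  assumes "g \<in> PF" and c: "\<And>i. ((\<lambda>t. c t $ i) has_field_derivative v $ i) (at 0)" and y: "c 0 = y"
  shows "((\<lambda>t. g (c t)) has_field_derivative dd v g y) (at 0)"
  using assms(1)
proof induction
  case (poly_linear l)
  have "((\<lambda>t. \<Sum>i\<in>UNIV. c t $ i * l (axis i 1)) has_field_derivative (\<Sum>i\<in>UNIV. v $ i * l (axis i 1))) (at 0)"
    by (intro DERIV_sum DERIV_cmult_right c)
  then show ?case unfolding functional_sum[OF poly_linear, symmetric] by (simp add: dd_functional[OF poly_linear])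
next
  case (poly_add p q)
  then show ?case by (simp add: dd_add) (intro DERIV_add)
next
  case (poly_mult p q)
  show ?case using DERIV_mult[OF poly_mult.IH] poly_mult.hyps y by (simp add: dd_mult algebra_simps)
qed (simp add: dd_const)

lemma dd_field_PF:
  assumes "g \<in> PF" "\<And>i. (\<lambda>y. A y $ i) \<in> PF"
  shows "(\<lambda>y. dd (A y) g y) \<in> PF"
  unfolding dd_basis[OF assms(1), of "A _"] by (intro PF_sum poly_mult assms dd_PF)

lemma dd_field_commute:
  assumes g: "g \<in> PF" and A: "\<And>i. (\<lambda>y. A y $ i) \<in> PF" and A': "\<And>i. dd u (\<lambda>y. A y $ i) y = A' $ i"
  shows "dd u (\<lambda>y. dd (A y) g y) y = dd (A y) (dd u g) y + dd A' g y"
proof -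
  have "dd u (\<lambda>y. dd (A y) g y) y = dd u (\<lambda>y. \<Sum>i\<in>UNIV. A y $ i * dd (axis i 1) g y) y"
    unfolding dd_basis[OF g, of "A _"] ..
  also have "\<dots> = (\<Sum>i\<in>UNIV. A' $ i * dd (axis i 1) g y + A y $ i * dd (axis i 1) (dd u g) y)"
    by (subst dd_sum) (simp_all add: dd_mult A A' g dd_PF PF_rules dd_commute[OF g, of u])
  also have "\<dots> = dd A' g y + dd (A y) (dd u g) y"
    by (simp add: sum.distrib dd_basis[OF g, of A'] dd_basis[OF dd_PF[OF g], of "A y"])
  finally show ?thesis by simp
qed

subsection \<open>Homogeneous polynomials\<close>

lemma homogeneous_decomposition:
  assumes "g \<in> PF"
  shows "\<exists>d G. (\<forall>i. G i \<in> PF \<and> (\<forall>c x. G i (c *s x) = c ^ i * G i x)) \<and> (\<forall>i>d. G i = (\<lambda>_. 0)) \<and> g = (\<lambda>x. \<Sum>i\<le>(d::nat). G i x)"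
  using assms
proof induction
  case (poly_const c)
  show ?case by (intro exI[of _ 0] exI[of _ "\<lambda>i x. if i = 0 then c else 0"]) (auto intro: poly_functions.poly_const)
next
  case (poly_linear l)
  show ?case
    by (intro exI[of _ 1] exI[of _ "\<lambda>i. if i = 1 then l else (\<lambda>_. 0)"])
      (auto simp: functional_rules[OF poly_linear] fun_eq_iff intro: PF_rules poly_functions.poly_linear[OF poly_linear])
next
  case (poly_add p q)
  obtain d1 G1 where 1: "\<forall>i. G1 i \<in> PF \<and> (\<forall>c x. G1 i (c *s x) = c ^ i * G1 i x)" "\<forall>i>d1. G1 i = (\<lambda>_. 0)" "p = (\<lambda>x. \<Sum>i\<le>d1. G1 i x)"
    using poly_add.IH(1) by blast
  obtain d2 G2 where 2: "\<forall>i. G2 i \<in> PF \<and> (\<forall>c x. G2 i (c *s x) = c ^ i * G2 i x)" "\<forall>i>d2. G2 i = (\<lambda>_. 0)" "q = (\<lambda>x. \<Sum>i\<le>d2. G2 i x)"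
    using poly_add.IH(2) by blast
  have e1: "p x = (\<Sum>i\<le>max d1 d2. G1 i x)" for x unfolding 1(3) by (rule sum.mono_neutral_left) (use 1(2) in auto)
  have e2: "q x = (\<Sum>i\<le>max d1 d2. G2 i x)" for x unfolding 2(3) by (rule sum.mono_neutral_left) (use 2(2) in auto)
  show ?case
  proof (intro exI conjI allI impI)
    show "(\<lambda>x. p x + q x) = (\<lambda>x. \<Sum>i\<le>max d1 d2. (\<lambda>i x. G1 i x + G2 i x) i x)" by (simp add: e1 e2 sum.distrib)
    show "(\<lambda>x. G1 i x + G2 i x) \<in> PF" for i using 1(1) 2(1) poly_functions.poly_add by blast
    show "G1 i (c *s x) + G2 i (c *s x) = c ^ i * (G1 i x + G2 i x)" for i c x using 1(1) 2(1) by (simp add: algebra_simps)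
    show "(\<lambda>x. G1 i x + G2 i x) = (\<lambda>_. 0)" if "max d1 d2 < i" for i using 1(2) 2(2) that by auto
  qed
next
  case (poly_mult p q)
  obtain d1 G1 where 1: "\<forall>i. G1 i \<in> PF \<and> (\<forall>c x. G1 i (c *s x) = c ^ i * G1 i x)" "\<forall>i>d1. G1 i = (\<lambda>_. 0)" "p = (\<lambda>x. \<Sum>i\<le>d1. G1 i x)"
    using poly_mult.IH(1) by blast
  obtain d2 G2 where 2: "\<forall>i. G2 i \<in> PF \<and> (\<forall>c x. G2 i (c *s x) = c ^ i * G2 i x)" "\<forall>i>d2. G2 i = (\<lambda>_. 0)" "q = (\<lambda>x. \<Sum>i\<le>d2. G2 i x)"
    using poly_mult.IH(2) by blast
  let ?G = "\<lambda>r x. \<Sum>k\<le>r. G1 k x * G2 (r - k) x"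
  show ?case
  proof (intro exI conjI allI impI)
    show "(\<lambda>x. p x * q x) = (\<lambda>x. \<Sum>r\<le>d1 + d2. ?G r x)"
    proof
      fix x
      show "p x * q x = (\<Sum>r\<le>d1 + d2. ?G r x)"
        using polynomial_product[of d1 "\<lambda>i. G1 i x" d2 "\<lambda>i. G2 i x" 1] 1(2) 2(2) unfolding 1(3) 2(3) by simp
    qed
    show "(\<lambda>x. ?G r x) \<in> PF" for r using 1(1) 2(1) by (intro PF_sum poly_functions.poly_mult) auto
    show "?G r (c *s x) = c ^ r * ?G r x" for r c x
    proof -
      have "G1 k (c *s x) * G2 (r - k) (c *s x) = c ^ r * (G1 k x * G2 (r - k) x)" if "k \<le> r" for k
        using 1(1) 2(1) that power_add[of c k "r - k"] by simp
      then show ?thesis unfolding sum_distrib_left by (intro sum.cong) auto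
    qed
    show "(\<lambda>x. ?G r x) = (\<lambda>_. 0)" if r: "d1 + d2 < r" for r
    proof
      fix x
      have "G1 k x * G2 (r - k) x = 0" if "k \<le> r" for k
        using 1(2)[rule_format, of k] 2(2)[rule_format, of "r - k"] r that by (cases "d1 < k") auto
      then show "?G r x = 0" by (intro sum.neutral) auto
    qed
  qed
qed

lemma euler_identity:
  assumes "g \<in> PF" "vec.subspace V" "\<And>c x. x \<in> V \<Longrightarrow> g (c *s x) = c ^ i * g x" "y \<in> V"
  shows "dd y g y = of_nat i * g y"
proof (rule dd_eqI)
  have e: "y + t *s y = (1 + t) *s y" for t by (simp add: vec.scale_left_distrib)
  show "((\<lambda>t. g (y + t *s y)) has_field_derivative of_nat i * g y) (at 0)"
    unfolding e assms(3)[OF assms(4)] by (auto intro!: derivative_eq_intros)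
qed

section \<open>Constant-coefficient operators and their symbols\<close>

lemma op_PF: "D \<in> cc_diff_ops V \<Longrightarrow> g \<in> PF \<Longrightarrow> D g \<in> PF"
  by (induction rule: cc_diff_ops.induct) (auto intro: dd_PF PF_rules PF_cmult)

lemma op_add': "D \<in> cc_diff_ops V \<Longrightarrow> g \<in> PF \<Longrightarrow> h \<in> PF \<Longrightarrow> D (\<lambda>x. g x + h x) = (\<lambda>x. D g x + D h x)"
proof (induction rule: cc_diff_ops.induct)
  case (op_deriv u D)
  then show ?case by (simp add: dd_add op_PF)
qed (simp_all add: algebra_simps)

lemma op_cmult: "D \<in> cc_diff_ops V \<Longrightarrow> g \<in> PF \<Longrightarrow> D (\<lambda>x. c * g x) = (\<lambda>x. c * D g x)"
proof (induction rule: cc_diff_ops.induct)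
  case (op_deriv u D)
  then show ?case by (simp add: dd_cmult op_PF)
qed (simp_all add: algebra_simps)

lemma op_zero: "D \<in> cc_diff_ops V \<Longrightarrow> D (\<lambda>x. 0) = (\<lambda>x. 0)"
  using op_cmult[of D V "\<lambda>_. 0" 0] by (simp add: poly_const)

lemma dd_local:
  assumes "vec.subspace V" "u \<in> V" "y \<in> V" "\<And>z. z \<in> V \<Longrightarrow> g z = h z"
  shows "dd u g y = dd u h y"
proof -
  have "(\<lambda>t. g (y + t *s u)) = (\<lambda>t. h (y + t *s u))"
    using assms vec.subspace_add[OF assms(1)] vec.subspace_scale[OF assms(1)] by (intro ext assms(4)) blast
  then show ?thesis unfolding directional_deriv_def by simp
qed

lemma op_local:
  assumes "vec.subspace V"
  shows "D \<in> cc_diff_ops V \<Longrightarrow> (\<And>z. z \<in> V \<Longrightarrow> g z = h z) \<Longrightarrow> y \<in> V \<Longrightarrow> D g y = D h y"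
proof (induction arbitrary: y rule: cc_diff_ops.induct)
  case (op_deriv u D)
  show ?case by (rule dd_local[OF assms op_deriv.hyps(1) op_deriv.prems(2)]) (rule op_deriv.IH[OF op_deriv.prems(1)])
qed auto

lemma op_comp: "D \<in> cc_diff_ops V \<Longrightarrow> E \<in> cc_diff_ops V \<Longrightarrow> (\<lambda>g. D (E g)) \<in> cc_diff_ops V"
  by (induction rule: cc_diff_ops.induct) (auto intro: cc_diff_ops.intros)

context short_grading begin

lemma kf_degree: "kf x y = 0"
  if "br H x = a *s x" "br H y = c *s y" "a + c \<noteq> 0"
proof -
  have "kf (br H x) y = - kf (br x H) y" by (subst br_anti) (simp add: kf_lin)
  then have "(a + c) * kf x y = 0" using that by (simp add: kf_invariant kf_lin algebra_simps)
  then show ?thesis using that(3) by simp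
qed

lemma kf_zero: "x \<in> nm \<Longrightarrow> y \<in> nm \<Longrightarrow> kf x y = 0" "x \<in> np \<Longrightarrow> y \<in> np \<Longrightarrow> kf x y = 0"
  "z \<in> k \<Longrightarrow> y \<in> nm \<Longrightarrow> kf z y = 0" "z \<in> k \<Longrightarrow> x \<in> np \<Longrightarrow> kf z x = 0"
proof -
  show "kf x y = 0" if "x \<in> nm" "y \<in> nm" by (rule kf_degree[of x "-1" y "-1"]) (simp_all add: Hnm that)
  show "kf x y = 0" if "x \<in> np" "y \<in> np" by (rule kf_degree[of x 1 y 1]) (simp_all add: Hnp that)
  show "kf z y = 0" if "z \<in> k" "y \<in> nm" by (rule kf_degree[of z 0 y "-1"]) (simp_all add: Hnm Hkz that)
  show "kf z x = 0" if "z \<in> k" "x \<in> np" by (rule kf_degree[of z 0 x 1]) (simp_all add: Hnp Hkz that)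
qed

lemma represent_graded:
  assumes "Vector_Spaces.linear (*s) (*) l"
  obtains a b c where "a \<in> nm" "b \<in> k" "c \<in> np" "\<And>z. l z = kf a z + kf b z + kf c z"
proof -
  obtain h where h: "\<And>z. kf h z = l z" using kf_represent[OF nd, of l] functional_rules[OF assms] by metis
  obtain a b c where "a \<in> nm" "b \<in> k" "c \<in> np" "h = a + b + c" using dec[of h] by blast
  then show thesis using that[of a b c] h by (simp add: kf_lin)
qed

lemma represent_nm:
  assumes "Vector_Spaces.linear (*s) (*) l"
  obtains x where "x \<in> np" "\<And>y. y \<in> nm \<Longrightarrow> l y = kf x y"
proof -
  obtain a b c where "a \<in> nm" "b \<in> k" "c \<in> np" "\<And>z. l z = kf a z + kf b z + kf c z"
    using represent_graded[OF assms] by metis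
  then show thesis using that[of c] kf_zero by simp
qed

lemma represent_np:
  assumes "Vector_Spaces.linear (*s) (*) l"
  obtains y where "y \<in> nm" "\<And>x. x \<in> np \<Longrightarrow> l x = kf x y"
proof -
  obtain a b c where "a \<in> nm" "b \<in> k" "c \<in> np" "\<And>z. l z = kf a z + kf b z + kf c z"
    using represent_graded[OF assms] by metis
  then have "l x = kf x a" if "x \<in> np" for x using kf_zero(2,4) kf_sym[of a x] that by simp
  then show thesis using that[OF \<open>a \<in> nm\<close>] by blast
qed

lemma represent_k:
  assumes "Vector_Spaces.linear (*s) (*) l"
  obtains w where "w \<in> k" "\<And>z. z \<in> k \<Longrightarrow> l z = kf w z"
proof -
  obtain a b c where "a \<in> nm" "b \<in> k" "c \<in> np" "\<And>z. l z = kf a z + kf b z + kf c z"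
    using represent_graded[OF assms] by metis
  then show thesis using that[of b] kf_zero(3,4) kf_sym by (metis add.right_neutral add_0)
qed

abbreviation ops :: "((complex ^ 'n \<Rightarrow> complex) \<Rightarrow> complex ^ 'n \<Rightarrow> complex) set" where "ops \<equiv> cc_diff_ops nm"

text \<open>The relation between an operator and its polynomial symbol, as in the definition of \<open>P(\<partial>)\<close> by its
action on exponentials. The factor \<open>c\<close> is what makes the relation compose (see \<open>symbol_comp\<close>): operators
act on arbitrary functions, where their linearity is not available.\<close>
definition symbol :: "((complex ^ 'n \<Rightarrow> complex) \<Rightarrow> complex ^ 'n \<Rightarrow> complex) \<Rightarrow> (complex ^ 'n \<Rightarrow> complex) \<Rightarrow> bool" where
  "symbol D \<sigma> \<longleftrightarrow> (\<forall>c. \<forall>x\<in>np. \<forall>y\<in>nm. D (\<lambda>z. c * exp (kf x z)) y = c * \<sigma> x * exp (kf x y))"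

lemma symbol_id: "symbol (\<lambda>g. g) (\<lambda>_. 1)" unfolding symbol_def by simp

lemma symbol_deriv:
  assumes "u \<in> nm" "symbol D \<sigma>"
  shows "symbol (\<lambda>g. dd u (D g)) (\<lambda>x. kf x u * \<sigma> x)"
  unfolding symbol_def
proof (intro allI ballI)
  fix c x y assume x: "x \<in> np" and y: "y \<in> nm"
  have "dd u (D (\<lambda>z. c * exp (kf x z))) y = dd u (\<lambda>y. c * \<sigma> x * exp (kf x y)) y"
    by (rule dd_local[OF sub(3) assms(1) y]) (use assms(2) x in \<open>auto simp: symbol_def\<close>)
  also have "\<dots> = c * (kf x u * \<sigma> x) * exp (kf x y)"
    by (rule dd_eqI) (simp add: kf_lin, auto intro!: derivative_eq_intros)
  finally show "dd u (D (\<lambda>z. c * exp (kf x z))) y = c * (kf x u * \<sigma> x) * exp (kf x y)" .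
qed

lemma symbol_scale: "symbol D \<sigma> \<Longrightarrow> symbol (\<lambda>g y. c * D g y) (\<lambda>x. c * \<sigma> x)"
  unfolding symbol_def by simp

lemma symbol_add: "symbol D \<sigma> \<Longrightarrow> symbol E \<tau> \<Longrightarrow> symbol (\<lambda>g y. D g y + E g y) (\<lambda>x. \<sigma> x + \<tau> x)"
  unfolding symbol_def by (simp add: algebra_simps)

lemma symbol_comp:
  assumes "D \<in> ops" "symbol D \<sigma>" "symbol E \<tau>"
  shows "symbol (\<lambda>g. D (E g)) (\<lambda>x. \<sigma> x * \<tau> x)"
  unfolding symbol_def
proof (intro allI ballI)
  fix c x y assume x: "x \<in> np" and y: "y \<in> nm"
  have "D (E (\<lambda>z. c * exp (kf x z))) y = D (\<lambda>z. (c * \<tau> x) * exp (kf x z)) y"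
    by (rule op_local[OF sub(3) assms(1) _ y]) (use assms(3) x in \<open>auto simp: symbol_def\<close>)
  also have "\<dots> = (c * \<tau> x) * \<sigma> x * exp (kf x y)" using assms(2) x y unfolding symbol_def by blast
  finally show "D (E (\<lambda>z. c * exp (kf x z))) y = c * (\<sigma> x * \<tau> x) * exp (kf x y)" by simp
qed

lemma symbol_cong: "symbol D \<sigma> \<Longrightarrow> (\<And>x. x \<in> np \<Longrightarrow> \<sigma> x = \<tau> x) \<Longrightarrow> symbol D \<tau>"
  unfolding symbol_def by simp

lemma symbol_unique: "symbol D \<sigma> \<Longrightarrow> symbol D \<tau> \<Longrightarrow> x \<in> np \<Longrightarrow> \<sigma> x = \<tau> x"
proof -
  assume "symbol D \<sigma>" "symbol D \<tau>" "x \<in> np"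
  then have "1 * \<sigma> x * exp (kf x 0) = 1 * \<tau> x * exp (kf x 0)"
    using vec.subspace_0[OF sub(3)] unfolding symbol_def by metis
  then show ?thesis by simp
qed

text \<open>The rule \<open>[P(\<partial>), x] = (\<partial>\<^sub>x P)(\<partial>)\<close> of symbolic calculus. It carries information from exponentials to
polynomials.\<close>
lemma symbol_commutator:
  "D \<in> ops \<Longrightarrow> \<exists>\<sigma>\<in>PF. symbol D \<sigma> \<and> (\<forall>x\<in>np. \<exists>D'\<in>ops. symbol D' (dd x \<sigma>) \<and>
     (\<forall>g\<in>PF. \<forall>y. D (\<lambda>z. kf x z * g z) y = kf x y * D g y + D' g y))"
proof (induction rule: cc_diff_ops.induct)
  case op_id
  have "symbol (\<lambda>g y. 0 * g y) (\<lambda>_. 0)" unfolding symbol_def by simp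
  moreover have "(\<lambda>g y. 0 * g y) \<in> ops" using cc_diff_ops.op_scale[OF cc_diff_ops.op_id] by blast
  ultimately have "\<forall>x\<in>np. \<exists>D'\<in>ops. symbol D' (dd x (\<lambda>_. 1)) \<and>
     (\<forall>g\<in>PF. \<forall>y. kf x y * g y = kf x y * g y + D' g y)"
    unfolding dd_const by (intro ballI bexI[of _ "\<lambda>g y. 0 * g y"]) auto
  then show ?case using symbol_id by (intro bexI[OF _ poly_const[of 1]]) auto
next
  case (op_deriv u D)
  then obtain \<sigma> where s: "\<sigma> \<in> PF" "symbol D \<sigma>" and c: "\<And>x. x \<in> np \<Longrightarrow> \<exists>D'\<in>ops. symbol D' (dd x \<sigma>) \<and>
     (\<forall>g\<in>PF. \<forall>y. D (\<lambda>z. kf x z * g z) y = kf x y * D g y + D' g y)" by blast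
  let ?s = "\<lambda>x. kf x u * \<sigma> x"
  have kfP: "(\<lambda>x. kf x u) \<in> PF" "(\<lambda>y. kf x y) \<in> PF" for x u by (rule poly_linear[OF kf_linear(1)], rule poly_linear[OF kf_linear(2)])
  have sP: "?s \<in> PF" by (rule poly_mult[OF kfP(1) s(1)])
  have "\<exists>D'\<in>ops. symbol D' (dd x ?s) \<and>
     (\<forall>g\<in>PF. \<forall>y. dd u (D (\<lambda>z. kf x z * g z)) y = kf x y * dd u (D g) y + D' g y)" if x: "x \<in> np" for x
  proof -
    obtain D' where D': "D' \<in> ops" "symbol D' (dd x \<sigma>)" "\<And>g y. g \<in> PF \<Longrightarrow> D (\<lambda>z. kf x z * g z) y = kf x y * D g y + D' g y"
      using c[OF x] by blast
    let ?D = "\<lambda>g y. kf x u * D g y + dd u (D' g) y"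
    have "?D \<in> ops"
      using cc_diff_ops.op_add[OF cc_diff_ops.op_scale[OF op_deriv.hyps(2)] cc_diff_ops.op_deriv[OF op_deriv.hyps(1) D'(1)]] .
    moreover have "symbol ?D (\<lambda>w. kf x u * \<sigma> w + kf w u * dd x \<sigma> w)"
      by (rule symbol_add[OF symbol_scale[OF s(2)] symbol_deriv[OF op_deriv.hyps(1) D'(2)]])
    moreover have "dd x ?s = (\<lambda>w. kf x u * \<sigma> w + kf w u * dd x \<sigma> w)"
      by (simp add: dd_mult[OF kfP(1) s(1)] dd_functional[OF kf_linear(1)])
    moreover have "dd u (D (\<lambda>z. kf x z * g z)) y = kf x y * dd u (D g) y + ?D g y" if g: "g \<in> PF" for g y
    proof -
      have "D (\<lambda>z. kf x z * g z) = (\<lambda>y. kf x y * D g y + D' g y)" using D'(3)[OF g] by blast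
      then show ?thesis
        by (simp add: dd_add dd_mult PF_rules kfP op_PF[OF op_deriv.hyps(2) g] op_PF[OF D'(1) g] dd_functional[OF kf_linear(2)])
    qed
    ultimately show ?thesis by (intro bexI[of _ ?D]) auto
  qed
  then show ?case using symbol_deriv[OF op_deriv.hyps(1) s(2)] sP by blast
next
  case (op_scale D c)
  then obtain \<sigma> where s: "\<sigma> \<in> PF" "symbol D \<sigma>" and cc: "\<And>x. x \<in> np \<Longrightarrow> \<exists>D'\<in>ops. symbol D' (dd x \<sigma>) \<and>
     (\<forall>g\<in>PF. \<forall>y. D (\<lambda>z. kf x z * g z) y = kf x y * D g y + D' g y)" by blast
  have "\<exists>D'\<in>ops. symbol D' (dd x (\<lambda>x. c * \<sigma> x)) \<and>
     (\<forall>g\<in>PF. \<forall>y. c * D (\<lambda>z. kf x z * g z) y = kf x y * (c * D g y) + D' g y)" if x: "x \<in> np" for x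
  proof -
    obtain D' where D': "D' \<in> ops" "symbol D' (dd x \<sigma>)" "\<And>g y. g \<in> PF \<Longrightarrow> D (\<lambda>z. kf x z * g z) y = kf x y * D g y + D' g y"
      using cc[OF x] by blast
    show ?thesis
      using cc_diff_ops.op_scale[OF D'(1), of c] symbol_scale[OF D'(2), of c] D'(3) dd_cmult[OF s(1)]
      by (intro bexI[of _ "\<lambda>g y. c * D' g y"]) (auto simp: algebra_simps)
  qed
  then show ?case using symbol_scale[OF s(2)] PF_cmult[OF s(1)] by blast
next
  case (op_add D E)
  obtain \<sigma> where s: "\<sigma> \<in> PF" "symbol D \<sigma>" and c: "\<And>x. x \<in> np \<Longrightarrow> \<exists>D'\<in>ops. symbol D' (dd x \<sigma>) \<and>
     (\<forall>g\<in>PF. \<forall>y. D (\<lambda>z. kf x z * g z) y = kf x y * D g y + D' g y)" using op_add.IH(1) by blast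
  obtain \<tau> where t: "\<tau> \<in> PF" "symbol E \<tau>" and c': "\<And>x. x \<in> np \<Longrightarrow> \<exists>D'\<in>ops. symbol D' (dd x \<tau>) \<and>
     (\<forall>g\<in>PF. \<forall>y. E (\<lambda>z. kf x z * g z) y = kf x y * E g y + D' g y)" using op_add.IH(2) by blast
  have "\<exists>D'\<in>ops. symbol D' (dd x (\<lambda>x. \<sigma> x + \<tau> x)) \<and>
     (\<forall>g\<in>PF. \<forall>y. D (\<lambda>z. kf x z * g z) y + E (\<lambda>z. kf x z * g z) y = kf x y * (D g y + E g y) + D' g y)" if x: "x \<in> np" for x
  proof -
    obtain D' where D': "D' \<in> ops" "symbol D' (dd x \<sigma>)" "\<And>g y. g \<in> PF \<Longrightarrow> D (\<lambda>z. kf x z * g z) y = kf x y * D g y + D' g y"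
      using c[OF x] by blast
    obtain E' where E': "E' \<in> ops" "symbol E' (dd x \<tau>)" "\<And>g y. g \<in> PF \<Longrightarrow> E (\<lambda>z. kf x z * g z) y = kf x y * E g y + E' g y"
      using c'[OF x] by blast
    show ?thesis
      using cc_diff_ops.op_add[OF D'(1) E'(1)] symbol_add[OF D'(2) E'(2)] D'(3) E'(3) dd_add[OF s(1) t(1)]
      by (intro bexI[of _ "\<lambda>g y. D' g y + E' g y"]) (auto simp: algebra_simps)
  qed
  then show ?case using symbol_add[OF s(2) t(2)] poly_add[OF s(1) t(1)] by blast
qed

lemma symbol_exists: "D \<in> ops \<Longrightarrow> \<exists>\<sigma>\<in>PF. symbol D \<sigma>"
  using symbol_commutator by blast

text \<open>An operator \<open>P(\<partial>)\<close> is characterised by its effect on exponentials; this is why that determines its effect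
on polynomials. If all operators with symbol \<open>0\<close> kill \<open>h\<close>, then by \<open>symbol_commutator\<close> they also kill
the product of \<open>h\<close> with a linear form; and on constants the symbol is evaluated at the origin.\<close>
lemma zero_symbol_vanishes:
  assumes "g \<in> PF" "D \<in> ops" "symbol D (\<lambda>_. 0)" "y \<in> nm"
  shows "D g y = 0"
proof -
  let ?Z = "\<lambda>h. \<forall>D\<in>ops. symbol D (\<lambda>_. 0) \<longrightarrow> (\<forall>y\<in>nm. D h y = 0)"
  have "\<forall>h\<in>PF. ?Z h \<longrightarrow> ?Z (\<lambda>z. g z * h z)"
    using assms(1)
  proof induction
    case (poly_const c)
    then show ?case by (intro ballI impI) (simp add: op_cmult)
  next
    case (poly_linear l)
    obtain x where x: "x \<in> np" "\<And>y. y \<in> nm \<Longrightarrow> l y = kf x y" using represent_nm[OF poly_linear] by metis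
    show ?case
    proof (intro ballI impI)
      fix h D y assume h: "h \<in> PF" and Z: "?Z h" and D: "D \<in> ops" "symbol D (\<lambda>_. 0)" and y: "y \<in> nm"
      obtain \<sigma> D' where s: "\<sigma> \<in> PF" "symbol D \<sigma>" "D' \<in> ops" "symbol D' (dd x \<sigma>)"
        "D (\<lambda>z. kf x z * h z) y = kf x y * D h y + D' h y"
        using symbol_commutator[OF D(1)] x(1) h by blast
      have s0: "\<sigma> w = 0" if "w \<in> np" for w using symbol_unique[OF s(2) D(2) that] .
      have "symbol D' (\<lambda>_. 0)"
      proof (rule symbol_cong[OF s(4)])
        fix w assume w: "w \<in> np"
        have "dd x \<sigma> w = dd x (\<lambda>_. 0) w" by (rule dd_local[OF sub(1) x(1) w s0])
        then show "dd x \<sigma> w = 0" by (simp add: dd_const)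
      qed
      then have "D' h y = 0" "D h y = 0" using Z D s(3) y by auto
      moreover have "D (\<lambda>z. l z * h z) y = D (\<lambda>z. kf x z * h z) y"
        by (rule op_local[OF sub(3) D(1) _ y]) (simp add: x)
      ultimately show "D (\<lambda>z. l z * h z) y = 0" using s(5) by simp
    qed
  next
    case (poly_add p q)
    show ?case
    proof (intro ballI impI)
      fix h D y assume h: "h \<in> PF" and Z: "?Z h" and D: "D \<in> ops" "symbol D (\<lambda>_. 0)" and y: "y \<in> nm"
      have "D (\<lambda>z. p z * h z) y = 0" "D (\<lambda>z. q z * h z) y = 0" using poly_add.IH h Z D y by blast+
      moreover have "D (\<lambda>z. (p z + q z) * h z) = D (\<lambda>z. p z * h z + q z * h z)" by (simp add: algebra_simps)
      ultimately show "D (\<lambda>z. (p z + q z) * h z) y = 0"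
        using op_add'[OF D(1) poly_mult[OF poly_add.hyps(1) h] poly_mult[OF poly_add.hyps(2) h]] by simp
    qed
  next
    case (poly_mult p q)
    show ?case
    proof (intro ballI impI)
      fix h D y assume h: "h \<in> PF" and Z: "?Z h" and D: "D \<in> ops" "symbol D (\<lambda>_. 0)" and y: "y \<in> nm"
      have "?Z (\<lambda>z. q z * h z)" using poly_mult.IH(2) h Z by blast
      then have "D (\<lambda>z. p z * (q z * h z)) y = 0"
        using poly_mult.IH(1) poly_functions.poly_mult[OF poly_mult.hyps(2) h] D y by blast
      then show "D (\<lambda>z. p z * q z * h z) y = 0" by (simp add: mult.assoc)
    qed
  qed
  moreover have "?Z (\<lambda>_. 1)"
  proof (intro ballI impI)
    fix D y assume "D \<in> ops" "symbol D (\<lambda>_. 0)" "y \<in> nm"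
    then have "D (\<lambda>z. c * exp (kf x z)) y = c * 0 * exp (kf x y)" if "x \<in> np" for c x
      using that unfolding symbol_def by blast
    from this[OF vec.subspace_0[OF sub(1)], of 1] show "D (\<lambda>_. 1) y = 0" by (simp add: kf_lin)
  qed
  ultimately have "?Z (\<lambda>z. g z * 1)" using poly_const[of 1] by blast
  then show ?thesis using assms by simp
qed

lemma symbol_determines:
  assumes "g \<in> PF" "D \<in> ops" "E \<in> ops" "symbol D \<sigma>" "symbol E \<tau>" "\<And>x. x \<in> np \<Longrightarrow> \<sigma> x = \<tau> x" "y \<in> nm"
  shows "D g y = E g y"
proof -
  let ?D = "\<lambda>g y. D g y + (-1) * E g y"
  have "?D \<in> ops" by (intro cc_diff_ops.op_add[OF assms(2)] cc_diff_ops.op_scale[OF assms(3)])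
  moreover have "symbol ?D (\<lambda>_. 0)"
    using symbol_cong[OF symbol_add[OF assms(4) symbol_scale[OF assms(5), of "-1"]], of "\<lambda>_. 0"] assms(6) by simp
  ultimately have "?D g y = 0" by (rule zero_symbol_vanishes[OF assms(1) _ _ assms(7)])
  then show ?thesis by simp
qed

lemma op_with_symbol:
  assumes "P \<in> PF"
  shows "\<exists>D\<in>ops. symbol D P"
  using assms
proof induction
  case (poly_const c)
  then show ?case using symbol_scale[OF symbol_id, of c] cc_diff_ops.op_scale[OF cc_diff_ops.op_id, of c nm] by auto
next
  case (poly_linear l)
  obtain u where u: "u \<in> nm" "\<And>x. x \<in> np \<Longrightarrow> l x = kf x u" using represent_np[OF poly_linear] by metis
  have "symbol (\<lambda>g. dd u g) l" by (rule symbol_cong[OF symbol_deriv[OF u(1) symbol_id]]) (simp add: u)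
  then show ?case using cc_diff_ops.op_deriv[OF u(1) cc_diff_ops.op_id] by blast
next
  case (poly_add p q)
  then show ?case using symbol_add cc_diff_ops.op_add by blast
next
  case (poly_mult p q)
  then show ?case using symbol_comp op_comp by blast
qed

text \<open>Conjugation with a dilation; it allows degrees to be compared without expanding into monomials.\<close>
lemma op_scaling:
  assumes "c \<noteq> 0"
  shows "D \<in> ops \<Longrightarrow> \<exists>E\<in>ops. \<exists>\<sigma>. symbol D \<sigma> \<and> symbol E (\<lambda>x. \<sigma> (inverse c *s x)) \<and>
    (\<forall>g\<in>PF. \<forall>y. D g (c *s y) = E (\<lambda>z. g (c *s z)) y)"
proof (induction rule: cc_diff_ops.induct)
  case op_id
  show ?case using symbol_id cc_diff_ops.op_id by (intro bexI[of _ "\<lambda>g. g"] exI[of _ "\<lambda>_. 1"]) auto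
next
  case (op_deriv u D)
  obtain E \<sigma> where E: "E \<in> ops" "symbol D \<sigma>" "symbol E (\<lambda>x. \<sigma> (inverse c *s x))" "\<And>g y. g \<in> PF \<Longrightarrow> D g (c *s y) = E (\<lambda>z. g (c *s z)) y"
    using op_deriv.IH by blast
  let ?E = "\<lambda>g y. inverse c * dd u (E g) y"
  have "?E \<in> ops" by (intro cc_diff_ops.op_scale cc_diff_ops.op_deriv op_deriv.hyps E)
  moreover have "symbol ?E (\<lambda>x. inverse c * (kf x u * \<sigma> (inverse c *s x)))"
    by (rule symbol_scale[OF symbol_deriv[OF op_deriv.hyps(1) E(3)]])
  moreover have "dd u (D g) (c *s y) = ?E (\<lambda>z. g (c *s z)) y" if g: "g \<in> PF" for g y
  proof -
    have "E (\<lambda>z. g (c *s z)) = (\<lambda>y. D g (c *s y))" using E(4)[OF g] by auto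
    moreover have "dd u (\<lambda>y. D g (c *s y)) y = c * dd u (D g) (c *s y)"
    proof (rule dd_eqI)
      have "((\<lambda>t. D g (c *s (y + t *s u))) has_field_derivative dd (c *s u) (D g) (c *s y)) (at 0)"
        by (rule dd_chain[OF op_PF[OF op_deriv.hyps(2) g]]) (auto intro!: derivative_eq_intros simp: algebra_simps)
      then show "((\<lambda>t. D g (c *s (y + t *s u))) has_field_derivative c * dd u (D g) (c *s y)) (at 0)"
        by (simp add: dd_dir[OF op_PF[OF op_deriv.hyps(2) g]])
    qed
    ultimately show ?thesis using assms by simp
  qed
  ultimately show ?case
    using symbol_deriv[OF op_deriv.hyps(1) E(2)]
    by (intro bexI[of _ ?E] exI[of _ "\<lambda>x. kf x u * \<sigma> x"]) (auto simp: kf_lin mult.assoc)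
next
  case (op_scale D a)
  obtain E \<sigma> where E: "E \<in> ops" "symbol D \<sigma>" "symbol E (\<lambda>x. \<sigma> (inverse c *s x))" "\<And>g y. g \<in> PF \<Longrightarrow> D g (c *s y) = E (\<lambda>z. g (c *s z)) y"
    using op_scale.IH by blast
  then show ?case using symbol_scale[OF E(2), of a] symbol_scale[OF E(3), of a] cc_diff_ops.op_scale[OF E(1), of a]
    by (intro bexI[of _ "\<lambda>g y. a * E g y"] exI[of _ "\<lambda>x. a * \<sigma> x"]) auto
next
  case (op_add D1 D2)
  obtain E \<sigma> where E: "E \<in> ops" "symbol D1 \<sigma>" "symbol E (\<lambda>x. \<sigma> (inverse c *s x))" "\<And>g y. g \<in> PF \<Longrightarrow> D1 g (c *s y) = E (\<lambda>z. g (c *s z)) y"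
    using op_add.IH(1) by blast
  obtain E' \<sigma>' where E': "E' \<in> ops" "symbol D2 \<sigma>'" "symbol E' (\<lambda>x. \<sigma>' (inverse c *s x))" "\<And>g y. g \<in> PF \<Longrightarrow> D2 g (c *s y) = E' (\<lambda>z. g (c *s z)) y"
    using op_add.IH(2) by blast
  show ?case using symbol_add[OF E(2) E'(2)] symbol_add[OF E(3) E'(3)] cc_diff_ops.op_add[OF E(1) E'(1)] E(4) E'(4)
    by (intro bexI[of _ "\<lambda>g y. E g y + E' g y"] exI[of _ "\<lambda>x. \<sigma> x + \<sigma>' x"]) auto
qed

lemma op_homogeneous:
  assumes D: "D \<in> ops" "symbol D \<sigma>" "\<And>c x. x \<in> np \<Longrightarrow> \<sigma> (c *s x) = c ^ i * \<sigma> x"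
    and g: "g \<in> PF" "\<And>c y. y \<in> nm \<Longrightarrow> g (c *s y) = c ^ j * g y" and y: "y \<in> nm" and c: "c \<noteq> 0"
  shows "c ^ i * D g (c *s y) = c ^ j * D g y"
proof -
  obtain E \<tau> where E: "E \<in> ops" "symbol D \<tau>" "symbol E (\<lambda>x. \<tau> (inverse c *s x))" "\<And>g y. g \<in> PF \<Longrightarrow> D g (c *s y) = E (\<lambda>z. g (c *s z)) y"
    using op_scaling[OF c D(1)] by blast
  have "E g y = inverse c ^ i * D g y"
  proof (rule symbol_determines[OF g(1) E(1) cc_diff_ops.op_scale[OF D(1)] E(3) symbol_scale[OF D(2)] _ y])
    fix x assume x: "x \<in> np"
    then have "inverse c *s x \<in> np" by (rule vec.subspace_scale[OF sub(1)])
    then have "\<tau> (inverse c *s x) = \<sigma> (inverse c *s x)" using symbol_unique[OF E(2) D(2)] by blast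
    then show "\<tau> (inverse c *s x) = inverse c ^ i * \<sigma> x" using D(3)[OF x] by simp
  qed
  moreover have "E (\<lambda>z. g (c *s z)) y = E (\<lambda>z. c ^ j * g z) y"
    by (rule op_local[OF sub(3) E(1) _ y]) (simp add: g)
  ultimately have "D g (c *s y) = c ^ j * (inverse c ^ i * D g y)" using E(4)[OF g(1)] op_cmult[OF E(1) g(1)] by simp
  then show ?thesis using c by (simp add: field_simps)
qed

text \<open>Along the line through \<open>y\<close> both sides are polynomials in \<open>c\<close>; this extends \<open>op_homogeneous\<close> to \<open>c = 0\<close> and excludes negative powers.\<close>
lemma op_degree:
  assumes D: "D \<in> ops" "symbol D \<sigma>" "\<And>c x. x \<in> np \<Longrightarrow> \<sigma> (c *s x) = c ^ i * \<sigma> x"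
    and g: "g \<in> PF" "\<And>c y. y \<in> nm \<Longrightarrow> g (c *s y) = c ^ j * g y" and y: "y \<in> nm"
  shows "i \<le> j \<Longrightarrow> D g (c *s y) = c ^ (j - i) * D g y" and "j < i \<Longrightarrow> D g y = 0"
proof -
  have DP: "D g \<in> PF" by (rule op_PF[OF D(1) g(1)])
  obtain q where q: "\<And>t. D g (0 + t *s y) = poly q t" using PF_line[OF DP] by metis
  have h: "t ^ i * poly q t = t ^ j * D g y" if "t \<noteq> 0" for t
    using op_homogeneous[OF D g y that] q[of t] by simp
  show "D g (c *s y) = c ^ (j - i) * D g y" if ij: "i \<le> j"
  proof -
    have "q = Polynomial.monom (D g y) (j - i)"
    proof (rule poly_agree_nonzero)
      fix t :: complex assume t: "t \<noteq> 0"
      have "t ^ i * poly q t = t ^ i * (t ^ (j - i) * D g y)" using h[OF t] ij by (simp add: power_add[symmetric])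
      then show "poly q t = poly (Polynomial.monom (D g y) (j - i)) t" using t by (simp add: poly_monom mult.commute)
    qed
    then show ?thesis using q[of c] by (simp add: poly_monom mult.commute)
  qed
  show "D g y = 0" if ij: "j < i"
  proof -
    have "Polynomial.monom 1 (i - j) * q = [:D g y:]"
    proof (rule poly_agree_nonzero)
      fix t :: complex assume t: "t \<noteq> 0"
      have "t ^ j * (t ^ (i - j) * poly q t) = t ^ j * D g y" using h[OF t] ij by (simp add: power_add[symmetric] mult.assoc[symmetric])
      then show "poly (Polynomial.monom 1 (i - j) * q) t = poly [:D g y:] t" using t by (simp add: poly_monom)
    qed
    then have "poly (Polynomial.monom 1 (i - j) * q) 0 = poly [:D g y:] 0" by simp
    moreover have "poly (Polynomial.monom 1 (i - j) * q) 0 = 0 ^ (i - j) * poly q 0" by (simp add: poly_monom)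
    moreover have "(0::complex) ^ (i - j) = 0" using ij by (intro zero_power) simp
    ultimately show ?thesis by simp
  qed
qed

end

section \<open>Representations of sl(2) and the strong Lefschetz property\<close>

text \<open>A graded module over \<open>sl(2)\<close> in which \<open>e\<close> lowers and \<open>f\<close> raises the degree and \<open>[e, f]\<close> acts on degree
\<open>d\<close> by \<open>N - 2 d\<close>. Additivity is only asked on homogeneous elements, because the operators
used later are linear on differentiable functions and not on all functions. Degrees are integers so that
the pieces outside \<open>{0..N}\<close> are zero without case distinctions.\<close>
locale sl2_module =
  fixes sc :: "complex \<Rightarrow> 'a :: ab_group_add \<Rightarrow> 'a" and V :: "int \<Rightarrow> 'a set" and e f :: "'a \<Rightarrow> 'a" and N :: int
  assumes sc: "sc a (x + y) = sc a x + sc a y" "sc (a + b) x = sc a x + sc b x" "sc a (sc b x) = sc (a * b) x" "sc 1 x = x"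
    and V0: "0 \<in> V d" and Vadd: "x \<in> V d \<Longrightarrow> y \<in> V d \<Longrightarrow> x + y \<in> V d" and Vsc: "x \<in> V d \<Longrightarrow> sc a x \<in> V d"
    and eV: "x \<in> V d \<Longrightarrow> e x \<in> V (d - 1)" and fV: "x \<in> V d \<Longrightarrow> f x \<in> V (d + 1)"
    and e_add: "x \<in> V d \<Longrightarrow> y \<in> V d \<Longrightarrow> e (x + y) = e x + e y" and f_add: "x \<in> V d \<Longrightarrow> y \<in> V d \<Longrightarrow> f (x + y) = f x + f y"
    and e_sc: "x \<in> V d \<Longrightarrow> e (sc a x) = sc a (e x)" and f_sc: "x \<in> V d \<Longrightarrow> f (sc a x) = sc a (f x)"
    and comm: "x \<in> V d \<Longrightarrow> e (f x) = f (e x) + sc (of_int (N - 2 * d)) x"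
    and bnd: "d < 0 \<or> N < d \<Longrightarrow> V d = {0}"
begin

lemma sc_zero: "sc 0 x = 0" "sc a 0 = 0"
proof -
  have "sc 0 x + sc 0 x = sc 0 x + 0" using sc(2)[of 0 0 x] by simp
  then show "sc 0 x = 0" by (rule add_left_imp_eq)
  have "sc a 0 + sc a 0 = sc a 0 + 0" using sc(1)[of a 0 0] by simp
  then show "sc a 0 = 0" by (rule add_left_imp_eq)
qed

lemma sc_minus: "sc (- a) x = - sc a x"
proof -
  have "sc (- a) x + sc a x = 0" using sc(2)[of "- a" a x] sc_zero(1) by simp
  then show ?thesis by (simp add: eq_neg_iff_add_eq_0)
qed

lemma ef_zero: "e 0 = 0" "f 0 = 0"
  using e_sc[OF V0, of 0] f_sc[OF V0, of 0] by (simp_all add: sc_zero)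

lemma Vminus: "x \<in> V d \<Longrightarrow> - x \<in> V d" using Vsc[of x d "-1"] sc_minus[of 1 x] sc(4) by simp

lemma Vdiff: "x \<in> V d \<Longrightarrow> y \<in> V d \<Longrightarrow> x - y \<in> V d" using Vadd[OF _ Vminus] by fastforce

lemma e_minus: "x \<in> V d \<Longrightarrow> e (- x) = - e x"
  using e_sc[of x d "-1"] sc_minus[of 1] sc(4) by simp

lemma e_diff: "x \<in> V d \<Longrightarrow> y \<in> V d \<Longrightarrow> e (x - y) = e x - e y"
  using e_add[OF _ Vminus, of x d y] e_minus[of y d] by simp

text \<open>In the upper half the operator \<open>e f\<close> has only nonnegative eigenvalues. The proof replaces eigenvalues by
descending to \<open>f v\<close>, for which the same equation holds with a larger shift; it ends in
degree above \<open>N\<close>.\<close>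
lemma shifted_injective:
  assumes "v \<in> V d" "N \<le> 2 * d" "0 < a" "e (f v) + sc (of_int a) v = 0"
  shows "v = 0"
  using assms
proof (induction "nat (N + 1 - d)" arbitrary: d a v rule: less_induct)
  case less
  show ?case
  proof (cases "N < d")
    case True
    then show ?thesis using bnd[of d] less.prems by auto
  next
    case False
    let ?u = "f v"
    have u: "?u \<in> V (d + 1)" using fV less.prems by blast
    have eu: "e ?u \<in> V d" using eV[OF u] by simp
    have "f (e ?u + sc (of_int a) v) = f (e ?u) + sc (of_int a) ?u"
      using f_add[OF eu Vsc[OF less.prems(1)]] f_sc[OF less.prems(1)] by simp
    then have "f (e ?u) + sc (of_int a) ?u = 0" using less.prems(4) ef_zero by simp
    moreover have "f (e ?u) = e (f ?u) + sc (of_int (2 * (d + 1) - N)) ?u"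
    proof -
      have "of_int (2 * (d + 1) - N) = - complex_of_int (N - 2 * (d + 1))" by simp
      then show ?thesis using comm[OF u] sc_minus[of "of_int (N - 2 * (d + 1))" ?u] by simp
    qed
    ultimately have "e (f ?u) + sc (of_int (2 * (d + 1) - N + a)) ?u = 0" by (simp add: sc(2) add.assoc)
    moreover have "nat (N + 1 - (d + 1)) < nat (N + 1 - d)" using False by simp
    ultimately have "?u = 0" using less.hyps[OF _ u, of "2 * (d + 1) - N + a"] less.prems by simp
    then have "sc (of_int a) v = 0" using less.prems(4) ef_zero by simp
    then have "sc (inverse (of_int a)) (sc (of_int a) v) = 0" using sc_zero by simp
    then show ?thesis using less.prems(3) by (simp add: sc(3,4))
  qed
qed

text \<open>The dual statement in the lower half, solved recursively from degree \<open>d - 1\<close>.\<close>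
lemma shifted_surjective:
  assumes "w \<in> V d" "2 * d \<le> N" "0 < a"
  shows "\<exists>u\<in>V d. f (e u) + sc (of_int a) u = w"
  using assms
proof (induction "nat (d + 1)" arbitrary: d a w rule: less_induct)
  case less
  show ?case
  proof (cases "d < 0")
    case True
    then have "w = 0" using bnd[of d] less.prems by auto
    then show ?thesis using V0 by (intro bexI[of _ 0]) (simp_all add: ef_zero sc_zero)
  next
    case False
    let ?a = "N - 2 * (d - 1) + a"
    have "nat (d - 1 + 1) < nat (d + 1)" using False by simp
    then obtain u' where u': "u' \<in> V (d - 1)" "f (e u') + sc (of_int ?a) u' = e w"
      using less.hyps[OF _ eV[OF less.prems(1)], of ?a] less.prems by auto
    have fu: "f u' \<in> V d" using fV[OF u'(1)] by simp
    let ?u = "sc (inverse (of_int a)) (w - f u')"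
    have uV: "?u \<in> V d" by (rule Vsc[OF Vdiff[OF less.prems(1) fu]])
    have "e w = e (f u') + sc (of_int a) u'"
      unfolding u'(2)[symmetric] comm[OF u'(1)] of_int_add sc(2) by (simp add: add.assoc)
    then have "e ?u = sc (inverse (of_int a)) (sc (of_int a) u')"
      using e_sc[OF Vdiff[OF less.prems(1) fu]] e_diff[OF less.prems(1) fu] by simp
    then have "e ?u = u'" using less.prems(3) by (simp add: sc(3,4))
    moreover have "sc (of_int a) ?u = w - f u'" using less.prems(3) by (simp add: sc(3,4))
    ultimately show ?thesis using uV by (intro bexI[of _ ?u]) simp_all
  qed
qed

lemma epow_V: "x \<in> V d \<Longrightarrow> (e ^^ j) x \<in> V (d - int j)"
proof (induction j)
  case (Suc j)
  then show ?case using eV[of "(e ^^ j) x" "d - int j"] by (simp add: algebra_simps)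
qed simp

lemma fpow_V: "x \<in> V d \<Longrightarrow> (f ^^ j) x \<in> V (d + int j)"
proof (induction j)
  case (Suc j)
  then show ?case using fV[of "(f ^^ j) x" "d + int j"] by (simp add: algebra_simps)
qed simp

lemma epow_add: "x \<in> V d \<Longrightarrow> y \<in> V d \<Longrightarrow> (e ^^ j) (x + y) = (e ^^ j) x + (e ^^ j) y"
proof (induction j)
  case (Suc j)
  then show ?case using e_add[OF epow_V[OF Suc.prems(1)] epow_V[OF Suc.prems(2)]] by simp
qed simp

lemma fpow_add: "x \<in> V d \<Longrightarrow> y \<in> V d \<Longrightarrow> (f ^^ j) (x + y) = (f ^^ j) x + (f ^^ j) y"
proof (induction j)
  case (Suc j)
  then show ?case using f_add[OF fpow_V[OF Suc.prems(1)] fpow_V[OF Suc.prems(2)]] by simp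
qed simp

lemma epow_sc: "x \<in> V d \<Longrightarrow> (e ^^ j) (sc a x) = sc a ((e ^^ j) x)"
proof (induction j)
  case (Suc j)
  then show ?case using e_sc[OF epow_V[OF Suc.prems]] by simp
qed simp

lemma fpow_sc: "x \<in> V d \<Longrightarrow> (f ^^ j) (sc a x) = sc a ((f ^^ j) x)"
proof (induction j)
  case (Suc j)
  then show ?case using f_sc[OF fpow_V[OF Suc.prems]] by simp
qed simp

text \<open>The commutation relation of \<open>f\<close> with powers of \<open>e\<close>, arranged so that the last factor has the form
treated in \<open>shifted_injective\<close>.\<close>
lemma f_epow:
  assumes v: "v \<in> V d"
  shows "f ((e ^^ Suc j) v) = (e ^^ j) (e (f v) + sc (of_int (int (Suc j) * (2 * d - N - int j))) v)"
proof (induction j)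
  case 0
  have "of_int (2 * d - N) = - complex_of_int (N - 2 * d)" by simp
  then show ?case using comm[OF v] sc_minus[of "of_int (N - 2 * d)" v] by simp
next
  case (Suc j)
  let ?w = "(e ^^ Suc j) v"
  have w: "?w \<in> V (d - int (Suc j))" by (rule epow_V[OF v])
  have efv: "e (f v) \<in> V d" using eV[OF fV[OF v]] by simp
  have "f (e ?w) = e (f ?w) - sc (of_int (N - 2 * (d - int (Suc j)))) ?w" using comm[OF w] by simp
  also have "\<dots> = e (f ?w) + sc (of_int (2 * d - N - 2 * int (Suc j))) ?w"
  proof -
    have q: "of_int (2 * d - N - 2 * int (Suc j)) = - complex_of_int (N - 2 * (d - int (Suc j)))" by simp
    show ?thesis unfolding q sc_minus by simp
  qed
  also have "e (f ?w) = (e ^^ Suc j) (e (f v)) + sc (of_int (int (Suc j) * (2 * d - N - int j))) ?w"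
    unfolding Suc using epow_add[OF efv Vsc[OF v], of "Suc j"] epow_sc[OF v, of "Suc j"] by simp
  finally have "f (e ?w) = (e ^^ Suc j) (e (f v)) + sc (of_int (int (Suc j) * (2 * d - N - int j)) + of_int (2 * d - N - 2 * int (Suc j))) ?w"
    by (simp only: sc(2) add.assoc)
  also have "of_int (int (Suc j) * (2 * d - N - int j)) + of_int (2 * d - N - 2 * int (Suc j))
     = complex_of_int (int (Suc (Suc j)) * (2 * d - N - int (Suc j)))"
    by (simp add: algebra_simps)
  finally show ?case
    using epow_add[OF efv Vsc[OF v], of "Suc j"] epow_sc[OF v, of "Suc j"] by simp
qed

lemma e_fpow:
  assumes u: "u \<in> V d"
  shows "e ((f ^^ Suc j) u) = (f ^^ j) (f (e u) + sc (of_int (int (Suc j) * (N - 2 * d - int j))) u)"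
proof (induction j)
  case 0
  then show ?case using comm[OF u] by simp
next
  case (Suc j)
  let ?w = "(f ^^ Suc j) u"
  have w: "?w \<in> V (d + int (Suc j))" by (rule fpow_V[OF u])
  have feu: "f (e u) \<in> V d" using fV[OF eV[OF u]] by simp
  have "e (f ?w) = f (e ?w) + sc (of_int (N - 2 * (d + int (Suc j)))) ?w" using comm[OF w] by simp
  also have "f (e ?w) = (f ^^ Suc j) (f (e u)) + sc (of_int (int (Suc j) * (N - 2 * d - int j))) ?w"
    unfolding Suc using fpow_add[OF feu Vsc[OF u], of "Suc j"] fpow_sc[OF u, of "Suc j"] by simp
  finally have "e (f ?w) = (f ^^ Suc j) (f (e u)) + sc (of_int (int (Suc j) * (N - 2 * d - int j)) + of_int (N - 2 * (d + int (Suc j)))) ?w"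
    by (simp only: sc(2) add.assoc)
  also have "of_int (int (Suc j) * (N - 2 * d - int j)) + of_int (N - 2 * (d + int (Suc j)))
     = complex_of_int (int (Suc (Suc j)) * (N - 2 * d - int (Suc j)))"
    by (simp add: algebra_simps)
  finally show ?case
    using fpow_add[OF feu Vsc[OF u], of "Suc j"] fpow_sc[OF u, of "Suc j"] by simp
qed

lemma epow_injective:
  assumes "v \<in> V d" "int j \<le> 2 * d - N" "(e ^^ j) v = 0"
  shows "v = 0"
  using assms
proof (induction j arbitrary: v)
  case (Suc j)
  let ?a = "int (Suc j) * (2 * d - N - int j)"
  let ?v = "e (f v) + sc (of_int ?a) v"
  have V: "?v \<in> V d" using Vadd[OF _ Vsc[OF Suc.prems(1)]] eV[OF fV[OF Suc.prems(1)]] by simp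
  have "(e ^^ j) ?v = 0" using f_epow[OF Suc.prems(1), of j] Suc.prems(3) ef_zero by metis
  then have v0: "?v = 0" using Suc.IH[OF V] Suc.prems(2) by simp
  have pos: "0 < ?a" using Suc.prems(2) by (intro mult_pos_pos) auto
  show ?case by (rule shifted_injective[OF Suc.prems(1) _ pos v0]) (use Suc.prems(2) in simp)
qed simp

lemma epow_fpow_surjective:
  assumes "int j \<le> N - 2 * d" "w \<in> V d"
  shows "\<exists>u\<in>V d. (e ^^ j) ((f ^^ j) u) = w"
  using assms
proof (induction j)
  case (Suc j)
  then obtain u' where u': "u' \<in> V d" "(e ^^ j) ((f ^^ j) u') = w" by auto
  let ?a = "int (Suc j) * (N - 2 * d - int j)"
  have "0 < ?a" using Suc.prems(1) by (intro mult_pos_pos) auto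
  then obtain u where u: "u \<in> V d" "f (e u) + sc (of_int ?a) u = u'"
    using shifted_surjective[OF u'(1), of ?a] Suc.prems(1) by auto
  have "(e ^^ Suc j) ((f ^^ Suc j) u) = (e ^^ j) (e ((f ^^ Suc j) u))" by (simp only: funpow_Suc_right o_apply)
  also have "\<dots> = (e ^^ j) ((f ^^ j) u')" unfolding e_fpow[OF u(1)] u(2) ..
  finally show ?case using u(1) u'(2) by (intro bexI[of _ u]) simp_all
qed auto

text \<open>The strong Lefschetz property of a graded \<open>sl(2)\<close>-module. Injectivity in the upper
half and surjectivity onto the lower half are proved by induction on the power of \<open>e\<close>, without
decomposing into irreducibles.\<close>
theorem sl2_lefschetz:
  assumes "int j = N - 2 * d"
  shows "bij_betw (e ^^ j) (V (N - d)) (V d)"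
  unfolding bij_betw_def
proof
  show "inj_on (e ^^ j) (V (N - d))"
  proof (rule inj_onI)
    fix x y assume xy: "x \<in> V (N - d)" "y \<in> V (N - d)" "(e ^^ j) x = (e ^^ j) y"
    have "(e ^^ j) (x - y + y) = (e ^^ j) (x - y) + (e ^^ j) y" by (rule epow_add[OF Vdiff[OF xy(1,2)] xy(2)])
    then have "(e ^^ j) (x - y) = 0" using xy(3) by simp
    then have "x - y = 0" using epow_injective[OF Vdiff[OF xy(1,2)], of j] assms by simp
    then show "x = y" by simp
  qed
  show "(e ^^ j) ` V (N - d) = V d"
  proof
    show "(e ^^ j) ` V (N - d) \<subseteq> V d" using epow_V[of _ "N - d" j] assms by auto
    show "V d \<subseteq> (e ^^ j) ` V (N - d)"
    proof
      fix w assume "w \<in> V d"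
      then obtain u where u: "u \<in> V d" "(e ^^ j) ((f ^^ j) u) = w" using epow_fpow_surjective[of j d w] assms by auto
      then show "w \<in> (e ^^ j) ` V (N - d)" using fpow_V[OF u(1), of j] assms by (intro image_eqI[of _ _ "(f ^^ j) u"]) auto
    qed
  qed
qed

end

section \<open>Relative invariants of the Levi subalgebra\<close>

text \<open>Relative invariance in infinitesimal form. Homogeneity is a part of it, since \<open>H\<close> lies in \<open>k\<close> and its
one-parameter group acts on \<open>nm\<close> by dilations.\<close>
locale invariant_form = short_grading br np k nm H
  for br :: "complex ^ 'n \<Rightarrow> complex ^ 'n \<Rightarrow> complex ^ 'n" and np k nm H +
  fixes f :: "complex ^ 'n \<Rightarrow> complex" and r :: nat
  assumes f_PF: "f \<in> PF" and f_hom: "\<And>c y. y \<in> nm \<Longrightarrow> f (c *s y) = c ^ r * f y" and r: "r > 0"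
    and f_nz: "\<exists>v\<in>nm. f v \<noteq> 0" and f_inv: "\<And>z. z \<in> k \<Longrightarrow> \<exists>\<mu>. \<forall>y\<in>nm. dd (br z y) f y = \<mu> * f y"
begin

lemma br_PF: "(\<lambda>y. br z y $ i) \<in> PF" "(\<lambda>y. br (br x y) y $ i) \<in> PF"
proof -
  show 1: "(\<lambda>y. br z y $ i) \<in> PF" for z by (rule poly_linear) (rule functionalI, simp_all add: br_simps)
  have 2: "(\<lambda>y. br (br x y) (axis j 1) $ i) \<in> PF" for j by (rule poly_linear) (rule functionalI, simp_all add: br_simps)
  have "br (br x y) y $ i = (\<Sum>j\<in>UNIV. y $ j * br (br x y) (axis j 1) $ i)" for y
  proof -
    have "Vector_Spaces.linear (*s) (*) (\<lambda>z. br (br x y) z $ i)" by (rule functionalI) (simp_all add: br_simps)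
    from functional_sum[OF this, of y] show ?thesis .
  qed
  then show "(\<lambda>y. br (br x y) y $ i) \<in> PF" by (simp add: PF_sum poly_mult PF_nth 2)
qed

lemma dd_br: "dd u (\<lambda>y. br z y $ i) y = br z u $ i"
  by (rule dd_eqI) (simp add: br_simps, auto intro!: derivative_eq_intros)

lemma dd_br2: "dd u (\<lambda>y. br (br x y) y $ i) y = (br (br x u) y + br (br x y) u) $ i"
  by (rule dd_eqI) (simp add: br_simps algebra_simps, auto intro!: derivative_eq_intros)

lemma linear_field_commute:
  assumes "g \<in> PF"
  shows "dd u (\<lambda>y. dd (br z y) g y) y = dd (br z y) (dd u g) y + dd (br z u) g y"
  by (rule dd_field_commute[OF assms br_PF(1) dd_br])

lemma k_orthogonal_zero:
  assumes "w \<in> k" "\<And>z. z \<in> k \<Longrightarrow> kf w z = 0"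
  shows "w = 0"
proof (rule nd)
  fix t
  obtain a b c where t: "a \<in> nm" "b \<in> k" "c \<in> np" "t = a + b + c" using dec[of t] by blast
  show "kf w t = 0" unfolding t(4) using kf_zero(3)[OF assms(1) t(1)] kf_zero(4)[OF assms(1) t(3)] assms(2)[OF t(2)]
    by (simp add: kf_lin)
qed

text \<open>The scalar \<open>\<mu> z\<close> by which \<open>z\<close> acts vanishes on \<open>[k, k]\<close>, as the second-derivative terms of the two orders
are equal. The element \<open>w\<close> representing \<open>\<mu>\<close> is therefore central in \<open>k\<close> and a multiple of \<open>H\<close>. Since \<open>H\<close>
acts on \<open>f\<close> by \<open>- r\<close>, the multiple is determined and nonzero.\<close>
lemma character:
  obtains a where "\<And>z y. z \<in> k \<Longrightarrow> y \<in> nm \<Longrightarrow> dd (br z y) f y = a * kf H z * f y" "a * kf H H = - of_nat r" "a \<noteq> 0"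
proof -
  obtain v where v: "v \<in> nm" "f v \<noteq> 0" using f_nz by blast
  let ?\<mu> = "\<lambda>z. dd (br z v) f v / f v"
  have mu: "dd (br z y) f y = ?\<mu> z * f y" if "z \<in> k" "y \<in> nm" for z y
  proof -
    obtain m where m: "\<forall>y\<in>nm. dd (br z y) f y = m * f y" using f_inv[OF \<open>z \<in> k\<close>] by blast
    then have "m = ?\<mu> z" using v by simp
    then show ?thesis using m that by blast
  qed
  have mulin: "Vector_Spaces.linear (*s) (*) ?\<mu>"
    by (rule functionalI) (simp_all add: br_simps dd_dir[OF f_PF] add_divide_distrib)
  have mu0: "?\<mu> (br z z') = 0" if z: "z \<in> k" "z' \<in> k" for z z'
  proof -
    have second: "?\<mu> z' * (?\<mu> z * f v) = dd (br z' v) (dd (br z v) f) v + dd (br z' (br z v)) f v" if "z \<in> k" "z' \<in> k" for z z'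
    proof -
      have u: "br z v \<in> nm" using knm[OF that(1) v(1)] .
      have "dd (br z v) (\<lambda>y. dd (br z' y) f y) v = dd (br z v) (\<lambda>y. ?\<mu> z' * f y) v"
        by (rule dd_local[OF sub(3) u v(1)]) (rule mu[OF that(2)])
      also have "\<dots> = ?\<mu> z' * (?\<mu> z * f v)" unfolding dd_cmult[OF f_PF] using v(2) by simp
      finally show ?thesis using linear_field_commute[OF f_PF, of "br z v" z' v] by simp
    qed
    have "dd (br z' (br z v)) f v = dd (br z (br z' v)) f v"
      using second[OF z] second[OF z(2,1)] dd_commute[OF f_PF, of "br z v" "br z' v"] v(2) by (simp add: mult.commute)
    then have "dd (br (br z z') v) f v = 0"
      using jacobi[of z z' v] dd_dir(1)[OF f_PF, of "br (br z z') v" "br z' (br z v)" v] by simp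
    then show ?thesis by simp
  qed
  obtain w where w: "w \<in> k" "\<And>z. z \<in> k \<Longrightarrow> ?\<mu> z = kf w z" using represent_k[OF mulin] by metis
  have "br w z = 0" if "z \<in> k" for z
  proof (rule k_orthogonal_zero)
    show "br w z \<in> k" by (rule kk[OF w(1) that])
    fix z' assume "z' \<in> k"
    then show "kf (br w z) z' = 0" using w(2)[OF kk[OF that]] mu0[OF that] by (simp add: kf_invariant)
  qed
  then obtain a where a: "w = a *s H" using centre[OF w(1)] by blast
  have 1: "dd (br z y) f y = a * kf H z * f y" if "z \<in> k" "y \<in> nm" for z y
    using mu[OF that] w(2)[OF that(1)] unfolding a by (simp add: kf_lin)
  have "a * kf H H * f v = dd (br H v) f v" using 1[OF Hk v(1)] by simp
  also have "\<dots> = - (of_nat r * f v)" using Hnm[OF v(1)] euler_identity[OF f_PF sub(3) f_hom v(1)] by (simp add: dd_dir[OF f_PF])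
  finally have "a * kf H H * f v = (- of_nat r) * f v" by simp
  then have 2: "a * kf H H = - of_nat r" using v(2) mult_right_cancel by blast
  then have "a \<noteq> 0" using r by auto
  then show thesis using that 1 2 by blast
qed

text \<open>\<open>x\<close> represents the logarithmic derivative of \<open>f\<close> at \<open>L\<close>. Against \<open>z\<close> in \<open>k\<close>, the element \<open>[x, L]\<close> pairs to
\<open>- a (H, z)\<close>, by invariance of the Killing form.\<close>
lemma lowering_partner:
  assumes a: "\<And>z y. z \<in> k \<Longrightarrow> y \<in> nm \<Longrightarrow> dd (br z y) f y = a * kf H z * f y"
    and L: "L \<in> nm" "f L \<noteq> 0"
  obtains x where "x \<in> np" "br x L = (- a) *s H" "kf x L = of_nat r"
proof -
  have "Vector_Spaces.linear (*s) (*) (\<lambda>v. dd v f L / f L)"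
    by (rule functionalI) (simp_all add: dd_dir[OF f_PF] add_divide_distrib)
  then obtain x where x: "x \<in> np" "\<And>v. v \<in> nm \<Longrightarrow> dd v f L / f L = kf x v" by (rule represent_nm) (rule that)
  have "br x L + a *s H = 0"
  proof (rule k_orthogonal_zero)
    show "br x L + a *s H \<in> k" using npnm[OF x(1) L(1)] vec.subspace_add[OF sub(2)] vec.subspace_scale[OF sub(2) Hk] by blast
    fix z assume z: "z \<in> k"
    have "kf (br x L) z = kf x (br L z)" by (rule kf_invariant)
    also have "\<dots> = - kf x (br z L)" by (subst br_anti) (simp add: kf_lin)
    also have "\<dots> = - (a * kf H z)" using x(2)[OF knm[OF z L(1)]] a[OF z L(1)] L(2) by simp
    finally show "kf (br x L + a *s H) z = 0" by (simp add: kf_lin)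
  qed
  then have "br x L = (- a) *s H" by (simp add: eq_neg_iff_add_eq_0)
  moreover have "kf x L = of_nat r"
    using x(2)[OF L(1)] euler_identity[OF f_PF sub(3) f_hom L(1)] L(2) by simp
  ultimately show thesis using that x(1) by blast
qed

text \<open>The preimage of \<open>u\<close> is \<open>[x, u] / a\<close>: since \<open>nm\<close> is commutative, \<open>[[x, u], L] = [[x, L], u] = a u\<close>.\<close>
lemma k_orbit_map_surjective:
  assumes L: "L \<in> nm" "f L \<noteq> 0" and u: "u \<in> nm"
  shows "\<exists>z\<in>k. br z L = u"
proof -
  obtain a where a: "\<And>z y. z \<in> k \<Longrightarrow> y \<in> nm \<Longrightarrow> dd (br z y) f y = a * kf H z * f y" "a \<noteq> 0" using character by metis
  obtain x where x: "x \<in> np" "br x L = (- a) *s H" using lowering_partner[OF a(1) L] by metis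
  have "br (br x u) L = br (br x L) u"
    using jacobi[of x u L] jacobi[of x L u] nmnm[OF u L(1)] nmnm[OF L(1) u] br_anti[of u "br x L"] by (simp add: br_simps)
  also have "\<dots> = a *s u" unfolding x(2) using Hnm[OF u] by (simp add: br_simps)
  finally have "br (inverse a *s br x u) L = u" using a(2) by (simp add: br_simps)
  then show ?thesis using npnm[OF x(1) u] vec.subspace_scale[OF sub(2)] by blast
qed

end

locale invariant_power = invariant_form br np k nm H f r
  for br :: "complex ^ 'n \<Rightarrow> complex ^ 'n \<Rightarrow> complex ^ 'n" and np k nm H f r +
  fixes s :: nat
  assumes s: "s > 0"
begin

definition F :: "complex ^ 'n \<Rightarrow> complex" where "F y = f y ^ s"

definition N :: nat where "N = r * s"

lemma F_PF: "F \<in> PF" unfolding F_def[abs_def] by (rule PF_power[OF f_PF])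

lemma F_hom: "y \<in> nm \<Longrightarrow> F (c *s y) = c ^ N * F y"
  unfolding F_def N_def by (simp add: f_hom power_mult_distrib power_mult)

lemma dd_F: "dd u F y = of_nat s * f y ^ (s - 1) * dd u f y"
  unfolding F_def by (rule dd_eqI) (auto intro!: derivative_eq_intros dd_works[OF f_PF])

lemma F_character:
  assumes a: "\<And>z y. z \<in> k \<Longrightarrow> y \<in> nm \<Longrightarrow> dd (br z y) f y = a * kf H z * f y" and z: "z \<in> k" "y \<in> nm"
  shows "dd (br z y) F y = of_nat s * a * kf H z * F y"
proof -
  have "f y ^ (s - 1) * f y = F y" using s unfolding F_def by (cases s) simp_all
  then show ?thesis unfolding dd_F a[OF z] by (simp add: algebra_simps)
qed

text \<open>The action of \<open>x\<close> in \<open>np\<close> on functions on \<open>nm\<close>. In the geometric picture \<open>nm\<close> is an open cell of the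
flag variety of \<open>p\<close>, the elements of \<open>np\<close> are vector fields vanishing to second order at the origin,
and the parameter \<open>m\<close> selects a line bundle.\<close>
definition rho :: "complex \<Rightarrow> complex ^ 'n \<Rightarrow> (complex ^ 'n \<Rightarrow> complex) \<Rightarrow> complex ^ 'n \<Rightarrow> complex" where
  "rho m x g y = dd ((1/2) *s br (br x y) y) g y + m * kf x y * g y"

lemma rho_field_PF: "(\<lambda>y. ((1/2) *s br (br x y) y) $ i) \<in> PF"
  using PF_cmult[OF br_PF(2), of "1/2" x i] by simp

lemma kf_PF: "(\<lambda>y. kf x y) \<in> PF" by (rule poly_linear[OF kf_linear(2)])

lemma rho_PF: "g \<in> PF \<Longrightarrow> rho m x g \<in> PF"
  unfolding rho_def[abs_def]
  by (intro poly_add dd_field_PF rho_field_PF poly_mult PF_cmult kf_PF)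

lemma rho_local:
  assumes "x \<in> np" "y \<in> nm" "\<And>z. z \<in> nm \<Longrightarrow> g z = h z"
  shows "rho m x g y = rho m x h y"
proof -
  have "(1/2) *s br (br x y) y \<in> nm" using npnm knm assms(1,2) vec.subspace_scale[OF sub(3)] by blast
  then show ?thesis unfolding rho_def using dd_local[OF sub(3) _ assms(2,3)] assms(2,3) by simp
qed

lemma rho_add: "g \<in> PF \<Longrightarrow> h \<in> PF \<Longrightarrow> rho m x (\<lambda>y. g y + h y) = (\<lambda>y. rho m x g y + rho m x h y)"
  unfolding rho_def by (simp add: dd_add algebra_simps)

lemma rho_cmult: "g \<in> PF \<Longrightarrow> rho m x (\<lambda>y. c * g y) = (\<lambda>y. c * rho m x g y)"
  unfolding rho_def by (simp add: dd_cmult algebra_simps)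

text \<open>\<open>[x, y]\<close> lies in \<open>k\<close>, so the vector field differentiates \<open>F\<close> by \<open>s a kf H [x, y] = s a kf x y\<close>; the
factor \<open>1/2\<close> of the field explains the one in \<open>m\<close>.\<close>
lemma rho_F:
  assumes a: "\<And>z y. z \<in> k \<Longrightarrow> y \<in> nm \<Longrightarrow> dd (br z y) f y = a * kf H z * f y" and m: "m = - (1/2) * of_nat s * a"
    and x: "x \<in> np" and y: "y \<in> nm"
  shows "rho m x F y = 0"
proof -
  have "kf H (br x y) = kf x y" using Hnp[OF x] kf_invariant[of H x y] by simp
  moreover have "dd (br (br x y) y) F y = of_nat s * a * kf H (br x y) * F y"
    by (rule F_character[OF a npnm[OF x y] y])
  ultimately show ?thesis unfolding rho_def dd_dir(2)[OF F_PF] m by simp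
qed

text \<open>The commutator stays inside the Lie algebra: it is \<open>[x, u]\<close>, acting with a scalar shift. The
factor \<open>1/2\<close> cancels on differentiating because \<open>[[x, y], u]\<close> and \<open>[[x, u], y]\<close> agree.\<close>
lemma rho_commute:
  assumes g: "g \<in> PF" and x: "x \<in> np" and u: "u \<in> nm" and y: "y \<in> nm"
  shows "rho m x (dd u g) y = dd u (rho m x g) y - (dd (br (br x u) y) g y + m * kf x u * g y)"
proof -
  have sym: "br (br x y) u = br (br x u) y"
    using jacobi[of x u y] jacobi[of x y u] nmnm[OF u y] nmnm[OF y u] br_anti[of u "br x y"] by (simp add: br_simps)
  have A': "dd u (\<lambda>y. ((1/2) *s br (br x y) y) $ i) y = br (br x u) y $ i" for i
  proof -
    have "dd u (\<lambda>y. 1/2 * br (br x y) y $ i) y = 1/2 * dd u (\<lambda>y. br (br x y) y $ i) y"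
      by (subst dd_cmult[OF br_PF(2)]) simp
    then show ?thesis by (simp add: dd_br2 sym)
  qed
  have "dd u (rho m x g) y = dd u (\<lambda>y. dd ((1/2) *s br (br x y) y) g y) y + dd u (\<lambda>y. m * kf x y * g y) y"
    unfolding rho_def[abs_def] by (subst dd_add) (intro dd_field_PF g rho_field_PF poly_mult PF_cmult kf_PF refl)+
  also have "dd u (\<lambda>y. dd ((1/2) *s br (br x y) y) g y) y = dd ((1/2) *s br (br x y) y) (dd u g) y + dd (br (br x u) y) g y"
    by (rule dd_field_commute[OF g rho_field_PF A'])
  also have "dd u (\<lambda>y. m * kf x y * g y) y = m * kf x u * g y + m * kf x y * dd u g y"
    by (simp add: dd_mult g PF_cmult kf_PF dd_cmult dd_functional[OF kf_linear(2)])
  finally show ?thesis unfolding rho_def by simp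
qed

lemma k_stable:
  assumes z: "z \<in> k"
  shows "D \<in> ops \<Longrightarrow> \<exists>E\<in>ops. \<forall>y\<in>nm. dd (br z y) (D F) y = E F y"
proof (induction rule: cc_diff_ops.induct)
  case op_id
  obtain a where a: "\<And>z y. z \<in> k \<Longrightarrow> y \<in> nm \<Longrightarrow> dd (br z y) f y = a * kf H z * f y" using character by metis
  show ?case using F_character[OF a z] by (intro bexI[OF _ cc_diff_ops.op_scale[OF cc_diff_ops.op_id, of "of_nat s * a * kf H z"]]) auto
next
  case (op_deriv u D)
  then obtain E where E: "E \<in> ops" "\<forall>y\<in>nm. dd (br z y) (D F) y = E F y" by blast
  let ?E = "\<lambda>g y. dd u (E g) y + (-1) * dd (br z u) (D g) y"
  have "?E \<in> ops"
    by (rule cc_diff_ops.op_add[OF cc_diff_ops.op_deriv[OF op_deriv.hyps(1) E(1)]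
          cc_diff_ops.op_scale[OF cc_diff_ops.op_deriv[OF knm[OF z op_deriv.hyps(1)] op_deriv.hyps(2)]]])
  moreover have "dd (br z y) (dd u (D F)) y = ?E F y" if y: "y \<in> nm" for y
  proof -
    have "dd u (\<lambda>y. dd (br z y) (D F) y) y = dd u (E F) y" by (rule dd_local[OF sub(3) op_deriv.hyps(1) y]) (use E(2) in blast)
    then show ?thesis using linear_field_commute[OF op_PF[OF op_deriv.hyps(2) F_PF], of u z y] by (simp add: algebra_simps)
  qed
  ultimately show ?case by (intro bexI[of _ ?E]) auto
next
  case (op_scale D c)
  then obtain E where E: "E \<in> ops" "\<forall>y\<in>nm. dd (br z y) (D F) y = E F y" by blast
  then show ?case using dd_cmult[OF op_PF[OF op_scale.hyps F_PF]]
    by (intro bexI[OF _ cc_diff_ops.op_scale[OF E(1), of c]]) simp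
next
  case (op_add D1 D2)
  then obtain E1 E2 where E: "E1 \<in> ops" "\<forall>y\<in>nm. dd (br z y) (D1 F) y = E1 F y" "E2 \<in> ops" "\<forall>y\<in>nm. dd (br z y) (D2 F) y = E2 F y" by blast
  then show ?case using dd_add[OF op_PF[OF op_add.hyps(1) F_PF] op_PF[OF op_add.hyps(2) F_PF]]
    by (intro bexI[OF _ cc_diff_ops.op_add[OF E(1,3)]]) simp
qed

text \<open>Stability of the derivatives of \<open>F\<close> under the whole action: \<open>F\<close> itself is killed, and each further
derivative is passed with \<open>rho_commute\<close> and \<open>k_stable\<close>.\<close>
lemma rho_stable:
  assumes a: "\<And>z y. z \<in> k \<Longrightarrow> y \<in> nm \<Longrightarrow> dd (br z y) f y = a * kf H z * f y" and m: "m = - (1/2) * of_nat s * a"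
    and x: "x \<in> np"
  shows "D \<in> ops \<Longrightarrow> \<exists>E\<in>ops. \<forall>y\<in>nm. rho m x (D F) y = E F y"
proof (induction rule: cc_diff_ops.induct)
  case op_id
  show ?case using rho_F[OF a m x] by (intro bexI[OF _ cc_diff_ops.op_scale[OF cc_diff_ops.op_id, of 0]]) auto
next
  case (op_deriv u D)
  then obtain E where E: "E \<in> ops" "\<forall>y\<in>nm. rho m x (D F) y = E F y" by blast
  obtain E' where E': "E' \<in> ops" "\<forall>y\<in>nm. dd (br (br x u) y) (D F) y = E' F y"
    using k_stable[OF npnm[OF x op_deriv.hyps(1)] op_deriv.hyps(2)] by blast
  let ?E = "\<lambda>g y. dd u (E g) y + (-1) * (E' g y + m * kf x u * D g y)"
  have "?E \<in> ops"
    by (rule cc_diff_ops.op_add[OF cc_diff_ops.op_deriv[OF op_deriv.hyps(1) E(1)]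
          cc_diff_ops.op_scale[OF cc_diff_ops.op_add[OF E'(1) cc_diff_ops.op_scale[OF op_deriv.hyps(2)]]]])
  moreover have "rho m x (dd u (D F)) y = ?E F y" if y: "y \<in> nm" for y
  proof -
    have "dd u (rho m x (D F)) y = dd u (E F) y" by (rule dd_local[OF sub(3) op_deriv.hyps(1) y]) (use E(2) in blast)
    then show ?thesis using rho_commute[OF op_PF[OF op_deriv.hyps(2) F_PF] x op_deriv.hyps(1) y, of m] E'(2) y by simp
  qed
  ultimately show ?case by (intro bexI[of _ ?E]) auto
next
  case (op_scale D c)
  then obtain E where E: "E \<in> ops" "\<forall>y\<in>nm. rho m x (D F) y = E F y" by blast
  then show ?case using rho_cmult[OF op_PF[OF op_scale.hyps F_PF]]
    by (intro bexI[OF _ cc_diff_ops.op_scale[OF E(1), of c]]) simp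
next
  case (op_add D1 D2)
  then obtain E1 E2 where E: "E1 \<in> ops" "\<forall>y\<in>nm. rho m x (D1 F) y = E1 F y" "E2 \<in> ops" "\<forall>y\<in>nm. rho m x (D2 F) y = E2 F y" by blast
  then show ?case using rho_add[OF op_PF[OF op_add.hyps(1) F_PF] op_PF[OF op_add.hyps(2) F_PF]]
    by (intro bexI[OF _ cc_diff_ops.op_add[OF E(1,3)]]) simp
qed

lemma op_sum: "(\<And>i. i \<in> A \<Longrightarrow> D i \<in> ops) \<Longrightarrow> (\<And>i. i \<in> A \<Longrightarrow> symbol (D i) (\<sigma> i)) \<Longrightarrow>
    (\<lambda>g y. \<Sum>i\<in>A. D i g y) \<in> ops \<and> symbol (\<lambda>g y. \<Sum>i\<in>A. D i g y) (\<lambda>x. \<Sum>i\<in>A. \<sigma> i x)"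
proof (induction A rule: infinite_finite_induct)
  case (insert a A)
  then show ?case using cc_diff_ops.op_add[of "D a" nm "\<lambda>g y. \<Sum>i\<in>A. D i g y"] symbol_add[of "D a" "\<sigma> a" "\<lambda>g y. \<Sum>i\<in>A. D i g y"] by simp
qed (use cc_diff_ops.op_scale[OF cc_diff_ops.op_id, of 0 nm] in \<open>simp_all add: symbol_def\<close>)

lemma op_components:
  assumes "D \<in> ops"
  obtains d :: nat and E \<sigma> where "\<And>i. E i \<in> ops" "\<And>i. symbol (E i) (\<sigma> i)" "\<And>i. \<sigma> i \<in> PF"
    "\<And>i c x. \<sigma> i (c *s x) = c ^ i * \<sigma> i x" "\<And>g y. g \<in> PF \<Longrightarrow> y \<in> nm \<Longrightarrow> D g y = (\<Sum>i\<le>d. E i g y)"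
proof -
  obtain \<tau> where t: "\<tau> \<in> PF" "symbol D \<tau>" using symbol_exists[OF assms] by blast
  obtain d and \<sigma> :: "nat \<Rightarrow> complex ^ 'n \<Rightarrow> complex" where s: "\<And>i. \<sigma> i \<in> PF" "\<And>i c x. \<sigma> i (c *s x) = c ^ i * \<sigma> i x" "\<tau> = (\<lambda>x. \<Sum>i\<le>d. \<sigma> i x)"
    using homogeneous_decomposition[OF t(1)] by blast
  have "\<forall>i. \<exists>E. E \<in> ops \<and> symbol E (\<sigma> i)" using op_with_symbol[OF s(1)] by blast
  then obtain E where E: "\<And>i. E i \<in> ops" "\<And>i. symbol (E i) (\<sigma> i)" by metis
  have "D g y = (\<Sum>i\<le>d. E i g y)" if "g \<in> PF" "y \<in> nm" for g y
  proof -
    have S: "(\<lambda>g y. \<Sum>i\<le>d. E i g y) \<in> ops \<and> symbol (\<lambda>g y. \<Sum>i\<le>d. E i g y) (\<lambda>x. \<Sum>i\<le>d. \<sigma> i x)"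
      by (rule op_sum) (rule E)+
    show ?thesis
      by (rule symbol_determines[OF that(1) assms conjunct1[OF S] t(2) conjunct2[OF S] _ that(2)]) (simp add: s(3))
  qed
  then show thesis using that E s by blast
qed

text \<open>Functions are only meaningful on \<open>nm\<close>. Setting them to \<open>0\<close> elsewhere turns agreement on \<open>nm\<close> into equality.\<close>
definition nf :: "(complex ^ 'n \<Rightarrow> complex) \<Rightarrow> complex ^ 'n \<Rightarrow> complex" where "nf g = (\<lambda>y. if y \<in> nm then g y else 0)"

lemma nf_eq_iff: "nf g = nf h \<longleftrightarrow> (\<forall>y\<in>nm. g y = h y)" unfolding nf_def fun_eq_iff by auto

definition homog :: "nat \<Rightarrow> (complex ^ 'n \<Rightarrow> complex) \<Rightarrow> bool" where
  "homog d g \<longleftrightarrow> (\<forall>c. \<forall>y\<in>nm. g (c *s y) = c ^ d * g y)"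

text \<open>Degrees are integers, with \<open>0\<close> as the only element in negative degree, to fit \<open>sl2_module\<close>.\<close>
definition Vd :: "int \<Rightarrow> (complex ^ 'n \<Rightarrow> complex) set" where
  "Vd d = (if d < 0 then {0} else {nf (D F) |D. D \<in> ops \<and> homog (nat d) (D F)})"

text \<open>The homogeneous components of the operator send \<open>F\<close> either to \<open>0\<close> or to polynomials of degree at most \<open>N\<close>.\<close>
lemma homog_high:
  assumes D: "D \<in> ops" "homog d (D F)" "N < d" and y: "y \<in> nm"
  shows "D F y = 0"
proof -
  obtain l :: nat and E \<sigma> where E: "\<And>i. E i \<in> ops" "\<And>i. symbol (E i) (\<sigma> i)" "\<And>i. \<sigma> i \<in> PF"
    "\<And>i c x. \<sigma> i (c *s x) = c ^ i * \<sigma> i x" "\<And>g y. g \<in> PF \<Longrightarrow> y \<in> nm \<Longrightarrow> D g y = (\<Sum>i\<le>l. E i g y)"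
    using op_components[OF D(1)] by metis
  \<comment> \<open>The restriction of \<open>D F\<close> to the line through \<open>y\<close>: components of degree above \<open>N\<close> kill \<open>F\<close>, and the
    condition keeps the truncated \<open>N - i\<close> from counting them.\<close>
  let ?q = "\<Sum>i\<le>l. Polynomial.monom (if i \<le> N then E i F y else 0) (N - i)"
  have "Polynomial.monom (D F y) d = ?q"
  proof (rule poly_agree_nonzero)
    fix t :: complex
    have ty: "t *s y \<in> nm" using vec.subspace_scale[OF sub(3) y] .
    have "E i F (t *s y) = (if i \<le> N then E i F y else 0) * t ^ (N - i)" for i
      using op_degree(1)[OF E(1,2) E(4) F_PF F_hom y, of i t] op_degree(2)[OF E(1,2) E(4) F_PF F_hom ty, of i] by (cases "i \<le> N") auto
    then have "D F (t *s y) = poly ?q t" unfolding E(5)[OF F_PF ty] by (simp add: poly_sum poly_monom)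
    moreover have "D F (t *s y) = t ^ d * D F y" using D(2) y unfolding homog_def by blast
    ultimately show "poly (Polynomial.monom (D F y) d) t = poly ?q t" by (simp add: poly_monom mult.commute)
  qed
  then have "Polynomial.coeff (Polynomial.monom (D F y) d) d = Polynomial.coeff ?q d" by simp
  also have "\<dots> = 0" unfolding coeff_sum by (rule sum.neutral) (use D(3) in auto)
  finally show ?thesis by simp
qed

lemma symbol_dd: "u \<in> nm \<Longrightarrow> (\<lambda>g. dd u g) \<in> ops \<and> symbol (\<lambda>g. dd u g) (\<lambda>x. kf x u)"
  using cc_diff_ops.op_deriv[OF _ cc_diff_ops.op_id] symbol_deriv[OF _ symbol_id] by auto

lemma homog_dd:
  assumes "g \<in> PF" "homog d g" "u \<in> nm"
  shows "homog (d - 1) (dd u g)" "d = 0 \<Longrightarrow> y \<in> nm \<Longrightarrow> dd u g y = 0"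
proof -
  note S = symbol_dd[OF assms(3)]
  have h: "\<And>c y. y \<in> nm \<Longrightarrow> g (c *s y) = c ^ d * g y" using assms(2) unfolding homog_def by blast
  have k1: "\<And>c x. x \<in> np \<Longrightarrow> kf (c *s x) u = c ^ 1 * kf x u" by (simp add: kf_lin)
  note R = op_degree[OF conjunct1[OF S] conjunct2[OF S] k1 assms(1) h]
  show z: "dd u g y = 0" if "d = 0" "y \<in> nm" for y using R(2)[OF _ _ that(2)] that(1) by simp
  show "homog (d - 1) (dd u g)"
  proof (cases "d = 0")
    case True
    then show ?thesis unfolding homog_def using z vec.subspace_scale[OF sub(3)] by simp
  next
    case False
    then show ?thesis unfolding homog_def using R(1) by simp
  qed
qed

lemma homog_rho:
  assumes g: "g \<in> PF" "homog d g" and x: "x \<in> np"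
  shows "homog (d + 1) (rho m x g)"
  unfolding homog_def
proof (intro allI ballI)
  fix c y assume y: "y \<in> nm"
  let ?u = "(1/2) *s br (br x y) y"
  have u: "?u \<in> nm" using npnm[OF x y] knm y vec.subspace_scale[OF sub(3)] by blast
  have 1: "c * dd ?u g (c *s y) = c ^ d * dd ?u g y"
  proof (cases "d = 0")
    case True
    then show ?thesis using homog_dd(2)[OF g u True] y vec.subspace_scale[OF sub(3) y] by simp
  next
    case False
    then have "dd ?u g (c *s y) = c ^ (d - 1) * dd ?u g y" using homog_dd(1)[OF g u] y unfolding homog_def by blast
    then show ?thesis using False by (cases d) simp_all
  qed
  have "(1/2) *s br (br x (c *s y)) (c *s y) = (c * c) *s ?u" by (simp add: br_simps mult.commute)
  then have "rho m x g (c *s y) = c * (c * dd ?u g (c *s y)) + m * (c * kf x y) * (c ^ d * g y)"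
    using g(2) y unfolding rho_def homog_def by (simp add: dd_dir[OF g(1)] kf_lin mult.assoc)
  then show "rho m x g (c *s y) = c ^ (d + 1) * rho m x g y"
    unfolding 1 rho_def by (simp add: algebra_simps)
qed

lemma nf_dd_local: "u \<in> nm \<Longrightarrow> nf (dd u (nf g)) = nf (dd u g)"
  unfolding nf_eq_iff using dd_local[OF sub(3), of u _ "nf g" g] by (auto simp: nf_def)

text \<open>The \<open>sl(2)\<close>-triple of \<open>L\<close> acts on the derivatives of \<open>F\<close> by \<open>e = dd L\<close> and by a multiple of \<open>rho m x\<close>. On degree \<open>d\<close>
the commutator of \<open>dd L\<close> and \<open>rho m x\<close> is \<open>a d + m r\<close> by \<open>rho_commute\<close> and Euler's identity. With
\<open>m = - s a / 2\<close> and the factor \<open>- 2 / a\<close> this becomes \<open>r s - 2 d\<close>.\<close>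
theorem lefschetz_for_derivatives:
  assumes L: "L \<in> nm" "f L \<noteq> 0" and j: "j + 2 * i = N"
  shows "bij_betw ((\<lambda>g. nf (dd L g)) ^^ j) (Vd (int N - int i)) (Vd (int i))"
proof -
  obtain a where a: "\<And>z y. z \<in> k \<Longrightarrow> y \<in> nm \<Longrightarrow> dd (br z y) f y = a * kf H z * f y" "a \<noteq> 0" using character by metis
  obtain x where x: "x \<in> np" "br x L = (- a) *s H" "kf x L = of_nat r" using lowering_partner[OF a(1) L] by metis
  define m where "m = - (1/2) * of_nat s * a"
  define e where "e = (\<lambda>g. nf (dd L g))"
  define f' where "f' = (\<lambda>g. nf (\<lambda>y. (- 2 / a) * rho m x g y))"
  define sc :: "complex \<Rightarrow> (complex ^ 'n \<Rightarrow> complex) \<Rightarrow> complex ^ 'n \<Rightarrow> complex" where "sc = (\<lambda>c g y. c * g y)"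
  have VdE: "\<exists>D\<in>ops. g = nf (D F) \<and> homog (nat d) (D F) \<and> (d < 0 \<longrightarrow> (\<forall>y\<in>nm. D F y = 0))" if "g \<in> Vd d" for g d
  proof (cases "d < 0")
    case True
    let ?D = "\<lambda>g y. 0 * g y"
    have "?D \<in> ops" using cc_diff_ops.op_scale[OF cc_diff_ops.op_id] by blast
    moreover have "g = nf (?D F)" using that True unfolding Vd_def nf_def by (auto simp: fun_eq_iff)
    ultimately show ?thesis by (intro bexI[of _ ?D]) (auto simp: homog_def)
  next
    case False
    then show ?thesis using that unfolding Vd_def by auto
  qed
  have VdI: "nf (D F) \<in> Vd d" if "D \<in> ops" "homog (nat d) (D F)" "0 \<le> d" for D d using that unfolding Vd_def by auto
  have VdI': "nf h \<in> Vd d" if "D \<in> ops" "\<And>y. y \<in> nm \<Longrightarrow> h y = D F y" "homog (nat d) h" "0 \<le> d" for D h d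
  proof -
    have "nf h = nf (D F)" unfolding nf_eq_iff using that(2) by blast
    moreover have "homog (nat d) (D F)" using that(2,3) vec.subspace_scale[OF sub(3)] unfolding homog_def by metis
    ultimately show ?thesis using VdI[OF that(1) _ that(4)] by simp
  qed
  have nf0: "nf g = 0" if "\<And>y. y \<in> nm \<Longrightarrow> g y = 0" for g using that unfolding nf_def by (auto simp: fun_eq_iff)
  have z: "0 \<in> Vd d" for d
  proof (cases "d < 0")
    case False
    have "nf ((\<lambda>g y. 0 * g y) F) \<in> Vd d"
      by (rule VdI[OF cc_diff_ops.op_scale[OF cc_diff_ops.op_id]]) (use False in \<open>auto simp: homog_def\<close>)
    then show ?thesis using nf0[of "\<lambda>y. 0 * F y"] by simp
  qed (simp add: Vd_def)
  have e_nf: "e (nf g) = nf (dd L g)" for g unfolding e_def by (rule nf_dd_local[OF L(1)])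
  have f'_nf: "f' (nf g) = nf (\<lambda>y. (- 2 / a) * rho m x g y)" for g
    unfolding f'_def nf_eq_iff using rho_local[OF x(1), of _ "nf g" g m] by (auto simp: nf_def)
  interpret S: sl2_module sc Vd e f' "int N"
  proof
    fix a' b :: complex and g h :: "complex ^ 'n \<Rightarrow> complex" and d :: int
    show "sc a' (g + h) = sc a' g + sc a' h" "sc (a' + b) g = sc a' g + sc b g" "sc a' (sc b g) = sc (a' * b) g" "sc 1 g = g"
      by (auto simp: sc_def fun_eq_iff algebra_simps)
    show "0 \<in> Vd d" by (rule z)
    show "g + h \<in> Vd d" if gh: "g \<in> Vd d" "h \<in> Vd d"
    proof (cases "d < 0")
      case False
      obtain D E where D: "D \<in> ops" "g = nf (D F)" "homog (nat d) (D F)" "E \<in> ops" "h = nf (E F)" "homog (nat d) (E F)"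
        using VdE[OF gh(1)] VdE[OF gh(2)] by blast
      have "nf (\<lambda>y. D F y + E F y) \<in> Vd d"
        by (rule VdI[OF cc_diff_ops.op_add[OF D(1,4)]]) (use False D(3,6) in \<open>auto simp: homog_def algebra_simps\<close>)
      moreover have "nf (\<lambda>y. D F y + E F y) = g + h" unfolding D(2,5) nf_def by (auto simp: fun_eq_iff)
      ultimately show ?thesis by simp
    qed (use gh in \<open>simp add: Vd_def\<close>)
    show "sc b g \<in> Vd d" if g: "g \<in> Vd d"
    proof (cases "d < 0")
      case False
      obtain D where D: "D \<in> ops" "g = nf (D F)" "homog (nat d) (D F)" using VdE[OF g] by blast
      have "nf (\<lambda>y. b * D F y) \<in> Vd d"
        by (rule VdI[OF cc_diff_ops.op_scale[OF D(1)]]) (use False D(3) in \<open>auto simp: homog_def algebra_simps\<close>)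
      moreover have "nf (\<lambda>y. b * D F y) = sc b g" unfolding D(2) nf_def sc_def by (auto simp: fun_eq_iff)
      ultimately show ?thesis by simp
    qed (use g in \<open>auto simp: Vd_def sc_def fun_eq_iff\<close>)
    show "e g \<in> Vd (d - 1)" if g: "g \<in> Vd d"
    proof -
      obtain D where D: "D \<in> ops" "g = nf (D F)" "homog (nat d) (D F)" "d < 0 \<Longrightarrow> \<forall>y\<in>nm. D F y = 0" using VdE[OF g] by blast
      have DP: "D F \<in> PF" by (rule op_PF[OF D(1) F_PF])
      have eg: "e g = nf (dd L (D F))" unfolding e_def D(2) by (rule nf_dd_local[OF L(1)])
      show ?thesis
      proof (cases "d \<ge> 1")
        case True
        then show ?thesis unfolding eg
          using VdI[OF cc_diff_ops.op_deriv[OF L(1) D(1)], of "d - 1"] homog_dd(1)[OF DP D(3) L(1)] by (simp add: nat_diff_distrib)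
      next
        case False
        then have "homog 0 (D F)" using D(3) by (simp add: nat_eq_iff2)
        then have "e g = 0" unfolding eg using homog_dd(2)[OF DP _ L(1)] by (intro nf0) blast
        then show ?thesis using False by (simp add: Vd_def)
      qed
    qed
    show "f' g \<in> Vd (d + 1)" if g: "g \<in> Vd d"
    proof -
      obtain D where D: "D \<in> ops" "g = nf (D F)" "homog (nat d) (D F)" "d < 0 \<Longrightarrow> \<forall>y\<in>nm. D F y = 0" using VdE[OF g] by blast
      have DP: "D F \<in> PF" by (rule op_PF[OF D(1) F_PF])
      have fg: "f' g = nf (\<lambda>y. (- 2 / a) * rho m x (D F) y)" unfolding D(2) by (rule f'_nf)
      show ?thesis
      proof (cases "d < 0")
        case True
        have "rho m x (D F) y = 0" if y: "y \<in> nm" for y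
        proof -
          have "rho m x (D F) y = rho m x (\<lambda>_. 0) y" by (rule rho_local[OF x(1) y]) (use D(4) True in blast)
          then show ?thesis by (simp add: rho_def dd_const)
        qed
        then have "f' g = 0" unfolding fg by (intro nf0) simp
        then show ?thesis using z by simp
      next
        case False
        obtain E where E: "E \<in> ops" "\<forall>y\<in>nm. rho m x (D F) y = E F y"
          using rho_stable[OF a(1) m_def x(1) D(1)] by blast
        show ?thesis unfolding fg
        proof (rule VdI'[OF cc_diff_ops.op_scale[OF E(1), of "- 2 / a"]])
          show "(- 2 / a) * rho m x (D F) y = (- 2 / a) * E F y" if "y \<in> nm" for y using E(2) that by simp
          have "nat (d + 1) = nat d + 1" using False by simp
          then show "homog (nat (d + 1)) (\<lambda>y. (- 2 / a) * rho m x (D F) y)"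
            using homog_rho[OF DP D(3) x(1), of m] unfolding homog_def by (simp add: algebra_simps)
        qed (use False in simp)
      qed
    qed
    show "e (g + h) = e g + e h" "f' (g + h) = f' g + f' h" if gh: "g \<in> Vd d" "h \<in> Vd d"
    proof -
      obtain D E where D: "D \<in> ops" "g = nf (D F)" "E \<in> ops" "h = nf (E F)"
        using VdE[OF gh(1)] VdE[OF gh(2)] by blast
      have P: "D F \<in> PF" "E F \<in> PF" using D op_PF F_PF by blast+
      have gh: "g + h = nf (\<lambda>y. D F y + E F y)" unfolding D(2,4) nf_def by (auto simp: fun_eq_iff)
      show "e (g + h) = e g + e h" unfolding gh unfolding D(2,4) e_nf dd_add[OF P] by (auto simp: nf_def fun_eq_iff)
      show "f' (g + h) = f' g + f' h" unfolding gh
        unfolding D(2,4) f'_nf rho_add[OF P] by (auto simp: nf_def fun_eq_iff algebra_simps)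
    qed
    show "e (sc b g) = sc b (e g)" "f' (sc b g) = sc b (f' g)" if g: "g \<in> Vd d"
    proof -
      obtain D where D: "D \<in> ops" "g = nf (D F)" using VdE[OF g] by blast
      have P: "D F \<in> PF" using D op_PF F_PF by blast
      have bg: "sc b g = nf (\<lambda>y. b * D F y)" unfolding D(2) nf_def sc_def by (auto simp: fun_eq_iff)
      show "e (sc b g) = sc b (e g)" unfolding bg unfolding D(2) e_nf dd_cmult[OF P] by (auto simp: nf_def sc_def fun_eq_iff)
      show "f' (sc b g) = sc b (f' g)" unfolding bg
        unfolding D(2) f'_nf rho_cmult[OF P] by (auto simp: nf_def sc_def fun_eq_iff algebra_simps)
    qed
    show "e (f' g) = f' (e g) + sc (of_int (int N - 2 * d)) g" if g: "g \<in> Vd d"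
    proof -
      obtain D where D: "D \<in> ops" "g = nf (D F)" "homog (nat d) (D F)" "d < 0 \<Longrightarrow> \<forall>y\<in>nm. D F y = 0" using VdE[OF g] by blast
      have P: "D F \<in> PF" using D op_PF F_PF by blast
      have eu: "dd y (D F) y = of_int d * D F y" if y: "y \<in> nm" for y
      proof (cases "d < 0")
        case True
        have "dd y (D F) y = dd y (\<lambda>_. 0) y" by (rule dd_local[OF sub(3) y y]) (use D(4) True in blast)
        then show ?thesis using D(4) True y by (simp add: dd_const)
      next
        case False
        have "dd y (D F) y = of_nat (nat d) * D F y"
          by (rule euler_identity[OF P sub(3) _ y]) (use D(3) in \<open>auto simp: homog_def\<close>)
        then show ?thesis using False by simp
      qed
      have l: "e (f' g) = nf (\<lambda>y. (- 2 / a) * dd L (rho m x (D F)) y)"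
        unfolding D(2) unfolding f'_nf e_nf dd_cmult[OF rho_PF[OF P]] ..
      have rr: "f' (e g) = nf (\<lambda>y. (- 2 / a) * rho m x (dd L (D F)) y)"
        unfolding D(2) unfolding e_nf f'_nf ..
      have "(- 2 / a) * dd L (rho m x (D F)) y = (- 2 / a) * rho m x (dd L (D F)) y + of_int (int N - 2 * d) * D F y" if y: "y \<in> nm" for y
      proof -
        have b: "br (br x L) y = a *s y" unfolding x(2) using Hnm[OF y] by (simp add: br_simps)
        have "dd L (rho m x (D F)) y = rho m x (dd L (D F)) y + (a * of_int d + m * of_nat r) * D F y"
          using rho_commute[OF P x(1) L(1) y, of m] unfolding b dd_dir(2)[OF P] eu[OF y] x(3) by (simp add: algebra_simps)
        moreover have "(- 2 / a) * (a * of_int d + m * of_nat r) = of_int (int N - 2 * d)"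
          using a(2) unfolding m_def N_def by (simp add: field_simps)
        ultimately show ?thesis by (simp only: distrib_left mult.assoc[symmetric])
      qed
      then show ?thesis unfolding l rr unfolding D(2) nf_def sc_def by (auto simp: fun_eq_iff)
    qed
    show "Vd d = {0}" if "d < 0 \<or> int N < d"
    proof (cases "d < 0")
      case False
      have "g = 0" if "g \<in> Vd d" for g
      proof -
        obtain D where D: "D \<in> ops" "g = nf (D F)" "homog (nat d) (D F)" using VdE[OF \<open>g \<in> Vd d\<close>] by blast
        have "N < nat d" using \<open>d < 0 \<or> int N < d\<close> False by simp
        then show ?thesis unfolding D(2) using homog_high[OF D(1,3)] by (intro nf0) blast
      qed
      then show ?thesis using z by blast
    qed (simp add: Vd_def)
  qed
  have "bij_betw (e ^^ j) (Vd (int N - int i)) (Vd (int i))" by (rule S.sl2_lefschetz) (use j in simp)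
  then show ?thesis unfolding e_def .
qed

end

section \<open>Exponentials and open orbits\<close>

lemma norm_smult: "norm (c *s v) = cmod c * norm v" for v :: "complex ^ 'n"
  unfolding norm_vec_def by (simp add: norm_mult L2_set_right_distrib)

lemma scaleR_smult: "a *\<^sub>R v = complex_of_real a *s v" for v :: "complex ^ 'n"
  by (simp only: vec_eq_iff vector_scaleR_component vector_smult_component) (simp add: scaleR_conv_of_real)

lemma lin_real_linear:
  fixes T :: "complex ^ 'n \<Rightarrow> complex ^ 'n"
  assumes "lin T"
  shows "Real_Vector_Spaces.linear T"
  by (rule Real_Vector_Spaces.linearI) (simp_all add: lin_rules[OF assms] scaleR_smult)

lemma real_subspace:
  fixes V :: "(complex ^ 'n) set"
  assumes "vec.subspace V"
  shows "Real_Vector_Spaces.subspace V"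
  unfolding Real_Vector_Spaces.subspace_def using assms vec.subspace_0 vec.subspace_add vec.subspace_scale scaleR_smult by metis

context complex_lie_algebra begin

lemma br_bound: "\<exists>K\<ge>0. \<forall>x y. norm (br x y) \<le> K * norm x * norm y"
proof -
  have "bilinear br" unfolding bilinear_def using lin_real_linear[OF br_lin(1)] lin_real_linear[OF br_lin(2)] by blast
  then obtain B where B: "\<And>x y. norm (br x y) \<le> B * norm x * norm y" using bilinear_bounded by blast
  have "norm (br x y) \<le> \<bar>B\<bar> * norm x * norm y" for x y
    using B[of x y] mult_right_mono[OF mult_right_mono[OF abs_ge_self[of B], of "norm x"], of "norm y"] by simp
  then show ?thesis by (intro exI[of _ "\<bar>B\<bar>"]) simp
qed

lemma br_pow_bound:
  assumes K: "K \<ge> 0" "\<And>x y. norm (br x y) \<le> K * norm x * norm y"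
  shows "norm ((br x ^^ m) y) \<le> (K * norm x) ^ m * norm y"
proof (induction m)
  case (Suc m)
  have "norm (br x ((br x ^^ m) y)) \<le> K * norm x * norm ((br x ^^ m) y)" by (rule K(2))
  also have "\<dots> \<le> K * norm x * ((K * norm x) ^ m * norm y)" using Suc K(1) by (intro mult_left_mono) auto
  finally show ?case by (simp add: mult.assoc)
qed simp

lemma exp_ad_term_bound:
  assumes K: "K \<ge> 0" "\<And>x y. norm (br x y) \<le> K * norm x * norm y"
  shows "norm ((1 / fact m) *s (br x ^^ m) y) \<le> inverse (fact m) * (K * norm x) ^ m * norm y"
  using br_pow_bound[OF K, where x = x and m = m and y = y] by (simp add: norm_smult norm_divide field_simps)

lemma exp_ad_summable: "summable (\<lambda>m. (1 / fact m) *s (br x ^^ m) y)"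
proof -
  obtain K where K: "K \<ge> 0" "\<And>x y. norm (br x y) \<le> K * norm x * norm y" using br_bound by blast
  have "summable (\<lambda>m. inverse (fact m) * (K * norm x) ^ m * norm y)"
    using summable_mult2[OF summable_exp[of "K * norm x"], of "norm y"] by simp
  then show ?thesis by (rule summable_comparison_test') (use exp_ad_term_bound[OF K] in auto)
qed

lemma exp_ad_nth: "exp_ad br x y $ i = (\<Sum>m. (br x ^^ m) y $ i / fact m)"
proof -
  have "exp_ad br x y $ i = (\<Sum>m. ((1 / fact m) *s (br x ^^ m) y) $ i)"
    unfolding exp_ad_def by (rule bounded_linear.suminf[OF bounded_linear_vec_nth exp_ad_summable])
  then show ?thesis by simp
qed

lemma exp_ad_nth_summable: "summable (\<lambda>m. (br x ^^ m) y $ i / fact m)"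
  using bounded_linear.summable[OF bounded_linear_vec_nth exp_ad_summable[of x y], of i] by simp

lemma exp_ad_lin: "lin (exp_ad br x)"
proof (rule linI)
  fix u v :: "complex ^ 'n" and c
  note P = lin_rules[OF lin_funpow[OF br_lin(1)[of x]]]
  show "exp_ad br x (u + v) = exp_ad br x u + exp_ad br x v"
    unfolding vec_eq_iff using suminf_add[OF exp_ad_nth_summable exp_ad_nth_summable, of x u _ x v]
    by (simp add: exp_ad_nth P add_divide_distrib)
  show "exp_ad br x (c *s u) = c *s exp_ad br x u"
    unfolding vec_eq_iff using suminf_mult[OF exp_ad_nth_summable, of c x u]
    by (simp add: exp_ad_nth P)
qed

lemma br_pow_scale: "(br (t *s x) ^^ m) y = t ^ m *s (br x ^^ m) y"
  by (induction m) (simp_all add: br_simps mult.commute)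

lemma exp_ad_power_series: "exp_ad br (t *s x) y $ i = (\<Sum>m. ((br x ^^ m) y $ i / fact m) * t ^ m)"
  unfolding exp_ad_nth br_pow_scale by (simp add: mult.commute)

lemma exp_ad_zero: "exp_ad br 0 y = y"
proof -
  have "exp_ad br (0 *s 0) y $ i = y $ i" for i unfolding exp_ad_power_series
    using powser_zero[of "\<lambda>m. (br 0 ^^ m) y $ i / fact m"] by simp
  then show ?thesis by (simp add: vec_eq_iff)
qed

lemma exp_ad_derivative: "((\<lambda>t. exp_ad br (t *s x) y $ i) has_field_derivative exp_ad br (t *s x) (br x y) $ i) (at t)"
proof -
  let ?c = "\<lambda>m. (br x ^^ m) y $ i / fact m"
  have s: "summable (\<lambda>m. ?c m * t ^ m)" for t
    using exp_ad_nth_summable[of "t *s x" y i] unfolding br_pow_scale by (simp add: mult.commute)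
  have d: "diffs ?c = (\<lambda>m. (br x ^^ m) (br x y) $ i / fact m)"
  proof
    fix m
    have "(br x ^^ Suc m) y = (br x ^^ m) (br x y)" by (simp only: funpow_Suc_right o_apply)
    then show "diffs ?c m = (br x ^^ m) (br x y) $ i / fact m"
      unfolding diffs_def by (simp add: field_simps del: of_nat_Suc funpow.simps)
  qed
  show ?thesis using termdiffs_strong_converges_everywhere[of ?c t, OF s] unfolding d exp_ad_power_series .
qed

text \<open>The derivative of \<open>t \<mapsto> exp (- t ad x) (exp (t ad x) y)\<close> vanishes. The function is expanded in
coordinates so that only one-variable calculus is needed.\<close>
lemma exp_ad_inverse: "exp_ad br (- x) (exp_ad br x y) = y"
proof -
  have lincomb: "exp_ad br z w $ i = (\<Sum>j\<in>UNIV. w $ j * exp_ad br z (axis j 1) $ i)" for z w i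
  proof -
    have "Vector_Spaces.linear (*s) (*) (\<lambda>w. exp_ad br z w $ i)" by (rule functionalI) (simp_all add: lin_rules[OF exp_ad_lin])
    from functional_sum[OF this] show ?thesis .
  qed
  have "exp_ad br (- x) (exp_ad br x y) $ i = y $ i" for i
  proof -
    let ?h = "\<lambda>t. \<Sum>j\<in>UNIV. exp_ad br (t *s x) y $ j * exp_ad br ((- t) *s x) (axis j 1) $ i"
    have "(?h has_field_derivative 0) (at t)" for t
    proof -
      have E: "((\<lambda>t. exp_ad br ((- t) *s x) (axis j 1) $ i) has_field_derivative - exp_ad br ((- t) *s x) (br x (axis j 1)) $ i) (at t)" for j
      proof -
        have "((\<lambda>t. exp_ad br ((- t) *s x) (axis j 1) $ i) has_field_derivative exp_ad br ((- t) *s x) (br x (axis j 1)) $ i * (- 1)) (at t)"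
          by (rule DERIV_chain2[where f = "\<lambda>t. exp_ad br (t *s x) (axis j 1) $ i" and g = uminus, OF exp_ad_derivative])
            (auto intro!: derivative_eq_intros)
        then show ?thesis by simp
      qed
      have "(?h has_field_derivative (\<Sum>j\<in>UNIV. exp_ad br (t *s x) (br x y) $ j * exp_ad br ((- t) *s x) (axis j 1) $ i
          + - exp_ad br ((- t) *s x) (br x (axis j 1)) $ i * exp_ad br (t *s x) y $ j)) (at t)"
        by (intro DERIV_sum DERIV_mult exp_ad_derivative E)
      also have "(\<Sum>j\<in>UNIV. exp_ad br (t *s x) (br x y) $ j * exp_ad br ((- t) *s x) (axis j 1) $ i
          + - exp_ad br ((- t) *s x) (br x (axis j 1)) $ i * exp_ad br (t *s x) y $ j)
        = exp_ad br ((- t) *s x) (exp_ad br (t *s x) (br x y)) $ i - exp_ad br ((- t) *s x) (br x (exp_ad br (t *s x) y)) $ i"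
      proof -
        have "Vector_Spaces.linear (*s) (*) (\<lambda>w. exp_ad br ((- t) *s x) (br x w) $ i)"
          by (rule functionalI) (simp_all add: lin_rules[OF exp_ad_lin] br_simps)
        note L1 = functional_sum[OF this, of "exp_ad br (t *s x) y"] and L2 = lincomb[of "(- t) *s x" "exp_ad br (t *s x) (br x y)" i]
        show ?thesis unfolding L1 L2 sum_subtractf[symmetric] by (rule sum.cong) (simp_all only: mult_minus_left mult_minus_right mult.commute add_uminus_conv_diff)
      qed
      also have "br x (exp_ad br (t *s x) y) = exp_ad br (t *s x) (br x y)"
      proof -
        have "br x (exp_ad br z y) $ l = (\<Sum>m. br x ((1 / fact m) *s (br z ^^ m) y) $ l)" for z l
        proof -
          have bl: "bounded_linear (\<lambda>v. br x v $ l)"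
            using bounded_linear_compose[OF bounded_linear_vec_nth linear_conv_bounded_linear[THEN iffD1, OF lin_real_linear[OF br_lin(1)]]] .
          show ?thesis unfolding exp_ad_def by (rule bounded_linear.suminf[OF bl exp_ad_summable])
        qed
        moreover have "br x ((br (t *s x) ^^ m) y) = (br (t *s x) ^^ m) (br x y)" for m
          unfolding br_pow_scale by (simp add: br_simps funpow_swap1)
        ultimately show ?thesis by (simp add: vec_eq_iff exp_ad_nth br_simps)
      qed
      finally show ?thesis by simp
    qed
    then have "\<exists>c. \<forall>t\<in>UNIV. ?h t = c" by (intro has_field_derivative_zero_constant) auto
    then obtain c where c: "\<forall>t\<in>UNIV. ?h t = c" by blast
    have "?h 1 = ?h 0" by (rule trans[OF bspec[OF c UNIV_I] bspec[OF c UNIV_I, symmetric]])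
    then show ?thesis using lincomb[of "- x" "exp_ad br x y" i] lincomb[of 0 y i] by (simp add: exp_ad_zero)
  qed
  then show ?thesis by (simp add: vec_eq_iff)
qed

text \<open>The partial sums lie in \<open>V\<close>, which is closed.\<close>
lemma exp_ad_mem:
  assumes V: "vec.subspace V" "\<And>y. y \<in> V \<Longrightarrow> br x y \<in> V" and y: "y \<in> V"
  shows "exp_ad br x y \<in> V"
proof -
  have p: "(br x ^^ m) y \<in> V" for m by (induction m) (use V y in auto)
  have "closed V" by (rule closed_subspace[OF real_subspace[OF V(1)]])
  moreover have "(\<Sum>m<n. (1 / fact m) *s (br x ^^ m) y) \<in> V" for n
    by (intro vec.subspace_sum[OF V(1)] vec.subspace_scale[OF V(1)] p)
  moreover have "(\<lambda>n. \<Sum>m<n. (1 / fact m) *s (br x ^^ m) y) \<longlonglongrightarrow> exp_ad br x y"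
    unfolding exp_ad_def by (rule summable_LIMSEQ[OF exp_ad_summable])
  ultimately show ?thesis by (rule closed_sequentially)
qed

lemma exp_ad_scalar:
  assumes "br x y = y"
  shows "exp_ad br (t *s x) y = exp t *s y"
proof -
  have p: "(br x ^^ m) y = y" for m by (induction m) (simp_all add: assms)
  have "exp_ad br (t *s x) y $ i = exp t * y $ i" for i
  proof -
    have "(\<lambda>m. (t ^ m /\<^sub>R fact m) * y $ i) sums (exp t * y $ i)" by (rule sums_mult2[OF exp_converges])
    then have "(\<Sum>m. (t ^ m /\<^sub>R fact m) * y $ i) = exp t * y $ i" by (rule sums_unique[symmetric])
    moreover have "(\<lambda>m. (t ^ m /\<^sub>R fact m) * y $ i) = (\<lambda>m. (y $ i / fact m) * t ^ m)"
      by (rule ext) (simp add: scaleR_conv_of_real field_simps)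
    ultimately show ?thesis unfolding exp_ad_power_series p by simp
  qed
  then show ?thesis by (simp add: vec_eq_iff)
qed

lemma br_pow_continuous: "continuous_on UNIV (\<lambda>x. (br x ^^ m) y)"
proof (induction m)
  case (Suc m)
  have bb: "bounded_bilinear br"
    using bilinear_conv_bounded_bilinear lin_real_linear[OF br_lin(1)] lin_real_linear[OF br_lin(2)] unfolding bilinear_def by blast
  show ?case using bounded_bilinear.continuous_on[OF bb continuous_on_id Suc] by simp
qed simp

lemma exp_ad_continuous: "continuous_on UNIV (\<lambda>x. exp_ad br x y)"
proof -
  obtain K where K: "K \<ge> 0" "\<And>x y. norm (br x y) \<le> K * norm x * norm y" using br_bound by blast
  have "continuous_on (ball 0 R) (\<lambda>x. exp_ad br x y)" for R
  proof (rule uniform_limit_theorem)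
    let ?f = "\<lambda>n x. \<Sum>m<n. (1 / fact m) *s (br x ^^ m) y"
    show "uniform_limit (ball 0 R) ?f (\<lambda>x. exp_ad br x y) sequentially"
      unfolding exp_ad_def
    proof (rule Weierstrass_m_test)
      fix m x assume x: "x \<in> ball (0 :: complex ^ 'n) R"
      have "norm ((1 / fact m) *s (br x ^^ m) y) \<le> inverse (fact m) * (K * norm x) ^ m * norm y"
        by (rule exp_ad_term_bound[OF K])
      also have "\<dots> \<le> inverse (fact m) * (K * R) ^ m * norm y"
        using x K(1) by (intro mult_right_mono mult_left_mono power_mono) auto
      finally show "norm ((1 / fact m) *s (br x ^^ m) y) \<le> inverse (fact m) * (K * R) ^ m * norm y" .
    next
      show "summable (\<lambda>m. inverse (fact m) * (K * R) ^ m * norm y)"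
        using summable_mult2[OF summable_exp[of "K * R"], of "norm y"] by simp
    qed
    have "continuous_on (ball 0 R) (\<lambda>x. (1 / fact m) *s (br x ^^ m) y)" for m
    proof -
      have "lin (\<lambda>v :: complex ^ 'n. (1 / fact m) *s v)" by (rule linI) (simp_all add: vec.scale_right_distrib mult.commute)
      then have "continuous_on UNIV (\<lambda>v :: complex ^ 'n. (1 / fact m) *s v)"
        by (intro linear_continuous_on linear_conv_bounded_linear[THEN iffD1] lin_real_linear)
      then have "continuous_on UNIV (\<lambda>x. (1 / fact m) *s (br x ^^ m) y)"
        using continuous_on_compose2[OF _ br_pow_continuous[of m y]] by blast
      then show ?thesis by (rule continuous_on_subset) simp
    qed
    then show "\<forall>\<^sub>F n in sequentially. continuous_on (ball 0 R) (?f n)" by (auto intro!: always_eventually continuous_on_sum)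
  qed simp
  then have "isCont (\<lambda>x. exp_ad br x y) x" for x
    using continuous_on_eq_continuous_at[of "ball 0 (norm x + 1)" "\<lambda>x. exp_ad br x y"] by simp
  then show ?thesis by (simp add: continuous_at_imp_continuous_on)
qed

text \<open>The remainder after the linear term is \<open>(norm h)\<^sup>2\<close> times a locally bounded factor.\<close>
lemma exp_ad_has_derivative: "((\<lambda>x. exp_ad br x y) has_derivative (\<lambda>x. br x y)) (at 0)"
proof -
  obtain K where K: "K \<ge> 0" "\<And>x y. norm (br x y) \<le> K * norm x * norm y" using br_bound by blast
  have bl: "bounded_linear (\<lambda>x. br x y)" by (rule linear_conv_bounded_linear[THEN iffD1, OF lin_real_linear[OF br_lin(2)]])
  have bound: "norm (exp_ad br h y - y - br h y) \<le> (K * norm h)\<^sup>2 * exp (K * norm h) * norm y" for h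
  proof -
    let ?g = "\<lambda>m. (1 / fact m) *s (br h ^^ m) y"
    let ?b = "\<lambda>m. inverse (fact m) * (K * norm h) ^ m * ((K * norm h)\<^sup>2 * norm y)"
    have "(\<Sum>m. ?g (m + 2)) = exp_ad br h y - (\<Sum>m<2. ?g m)"
      unfolding exp_ad_def by (rule suminf_minus_initial_segment[OF exp_ad_summable])
    also have "\<dots> = exp_ad br h y - y - br h y" by (simp add: numeral_2_eq_2)
    finally have e: "exp_ad br h y - y - br h y = (\<Sum>m. ?g (m + 2))" ..
    have sb: "summable ?b" using summable_mult2[OF summable_exp[of "K * norm h"]] by simp
    have le: "norm (?g (m + 2)) \<le> ?b m" for m
    proof -
      have "inverse (fact (m + 2)) \<le> (inverse (fact m) :: real)"
        by (rule le_imp_inverse_le) (rule fact_mono, simp_all)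
      then have le: "inverse (fact (m + 2)) * (K * norm h) ^ (m + 2) * norm y \<le> inverse (fact m) * (K * norm h) ^ (m + 2) * norm y"
        using K(1) by (intro mult_right_mono) auto
      have "norm (?g (m + 2)) \<le> inverse (fact (m + 2)) * (K * norm h) ^ (m + 2) * norm y" by (rule exp_ad_term_bound[OF K])
      also note le
      finally show ?thesis by (simp add: power_add power2_eq_square mult_ac)
    qed
    have "norm (\<Sum>m. ?g (m + 2)) \<le> (\<Sum>m. ?b m)" by (rule norm_suminf_le[OF le sb])
    also have "(\<Sum>m. ?b m) = exp (K * norm h) * ((K * norm h)\<^sup>2 * norm y)"
      using suminf_mult2[OF summable_exp[of "K * norm h"], of "(K * norm h)\<^sup>2 * norm y"]
      by (simp add: exp_def divide_inverse mult.commute)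
    finally show ?thesis unfolding e by (simp add: mult_ac)
  qed
  show ?thesis
    unfolding has_derivative_at
  proof (intro conjI bl)
    show "(\<lambda>h. norm (exp_ad br (0 + h) y - exp_ad br 0 y - br h y) / norm h) \<midarrow>0\<rightarrow> 0"
    proof (rule Lim_null_comparison)
      let ?r = "\<lambda>h :: complex ^ 'n. K\<^sup>2 * norm h * exp (K * norm h) * norm y"
      show "\<forall>\<^sub>F h in at 0. norm (norm (exp_ad br (0 + h) y - exp_ad br 0 y - br h y) / norm h) \<le> ?r h"
      proof (rule always_eventually, rule allI)
        fix h :: "complex ^ 'n"
        show "norm (norm (exp_ad br (0 + h) y - exp_ad br 0 y - br h y) / norm h) \<le> ?r h"
        proof (cases "h = 0")
          case False
          then show ?thesis using bound[of h] by (simp add: exp_ad_zero divide_le_eq power_mult_distrib power2_eq_square mult_ac)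
        qed (use K in simp)
      qed
      have "(?r \<longlongrightarrow> K\<^sup>2 * norm (0 :: complex ^ 'n) * exp (K * norm (0 :: complex ^ 'n)) * norm y) (at 0)"
        by (intro tendsto_intros)
      then show "(?r \<longlongrightarrow> 0) (at 0)" by simp
    qed
  qed
qed

text \<open>Surjectivity of the infinitesimal orbit map makes the orbit a neighbourhood. The map
\<open>w \<mapsto> exp (ad (T w)) y + (w - P w)\<close>, with a projection \<open>P\<close> onto \<open>V\<close> and a linear section \<open>T\<close> of the
orbit map, has the identity as derivative at \<open>0\<close>; the summand \<open>w - P w\<close> fills the directions
transversal to \<open>V\<close> and disappears on projecting back.\<close>
lemma orbit_neighbourhood:
  assumes V: "vec.subspace V" and k: "vec.subspace k" "\<And>x v. x \<in> k \<Longrightarrow> v \<in> V \<Longrightarrow> br x v \<in> V"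
    and y: "y \<in> V" and sur: "\<And>u. u \<in> V \<Longrightarrow> \<exists>z\<in>k. br z y = u"
  shows "\<exists>e>0. \<forall>v\<in>V. dist y v < e \<longrightarrow> (\<exists>z\<in>k. v = exp_ad br z y)"
proof -
  obtain B where B: "B \<subseteq> V" "vec.independent B" "V \<subseteq> vec.span B" by (rule vec.basis_exists[of V], rule that)
  let ?C = "vec.extend_basis B"
  have C: "B \<subseteq> ?C" "vec.independent ?C"
    using vec.extend_basis_superset[OF B(2)] vec.independent_extend_basis[OF B(2)] by auto
  obtain P where P: "lin P" "\<And>x. x \<in> ?C \<Longrightarrow> P x = (if x \<in> B then x else 0)"
    using vec.linear_independent_extend[OF C(2), of "\<lambda>x. if x \<in> B then x else 0"] by blast
  have spC: "vec.span ?C = UNIV" by (rule vec.span_extend_basis[OF B(2)])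
  have PV: "P x \<in> V" for x
  proof -
    have "?C \<subseteq> {x. P x \<in> V}" using P(2) B(1) vec.subspace_0[OF V] by auto
    moreover have "vec.subspace {x. P x \<in> V}"
      by (rule vec.subspaceI) (auto simp: lin_rules[OF P(1)] intro: vec.subspace_0[OF V] vec.subspace_add[OF V] vec.subspace_scale[OF V])
    ultimately show ?thesis using vec.span_minimal spC by blast
  qed
  have Pid: "P x = x" if "x \<in> V" for x
  proof -
    have "B \<subseteq> {x. P x = x}" using P(2) C(1) by auto
    moreover have "vec.subspace {x. P x = x}"
      by (rule vec.subspaceI) (auto simp: lin_rules[OF P(1)])
    ultimately show ?thesis using vec.span_minimal B(3) that by blast
  qed
  have "\<forall>u\<in>V. \<exists>z. z \<in> k \<and> br z y = u" using sur by blast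
  then obtain z where z: "\<And>u. u \<in> V \<Longrightarrow> z u \<in> k \<and> br (z u) y = u" by metis
  obtain T where T: "lin T" "\<And>x. x \<in> ?C \<Longrightarrow> T x = (if x \<in> B then z x else 0)"
    using vec.linear_independent_extend[OF C(2), of "\<lambda>x. if x \<in> B then z x else 0"] by blast
  have Tk: "T x \<in> k" for x
  proof -
    have "?C \<subseteq> {x. T x \<in> k}" using T(2) B(1) z vec.subspace_0[OF k(1)] by auto
    moreover have "vec.subspace {x. T x \<in> k}"
      by (rule vec.subspaceI) (auto simp: lin_rules[OF T(1)] intro: vec.subspace_0[OF k(1)] vec.subspace_add[OF k(1)] vec.subspace_scale[OF k(1)])
    ultimately show ?thesis using vec.span_minimal spC by blast
  qed
  have TP: "br (T x) y = P x" for x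
  proof -
    have "?C \<subseteq> {x. br (T x) y = P x}" using T(2) P(2) B(1) z by (auto simp: br_simps)
    moreover have "vec.subspace {x. br (T x) y = P x}"
      by (rule vec.subspaceI) (auto simp: lin_rules[OF T(1)] lin_rules[OF P(1)] br_simps)
    ultimately show ?thesis using vec.span_minimal spC by blast
  qed
  let ?\<Phi> = "\<lambda>w. exp_ad br (T w) y + (w - P w)"
  have blT: "bounded_linear T" and blP: "bounded_linear P"
    using linear_conv_bounded_linear lin_real_linear T(1) P(1) by blast+
  have cont: "continuous_on UNIV ?\<Phi>"
    using continuous_on_compose2[OF exp_ad_continuous linear_continuous_on[OF blT]] linear_continuous_on[OF blP]
    by (intro continuous_intros) auto
  have T0: "T 0 = 0" by (rule lin_rules(3)[OF T(1)])
  have "((\<lambda>w. exp_ad br (T w) y) has_derivative (\<lambda>w. br (T w) y)) (at 0)"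
  proof -
    have "((\<lambda>x. exp_ad br x y) has_derivative (\<lambda>x. br x y)) (at (T 0))" unfolding T0 by (rule exp_ad_has_derivative)
    from diff_chain_at[OF bounded_linear_imp_has_derivative[OF blT] this] show ?thesis by (simp add: o_def)
  qed
  then have "(?\<Phi> has_derivative (\<lambda>w. br (T w) y + (w - P w))) (at 0)"
    by (intro has_derivative_add has_derivative_diff has_derivative_ident bounded_linear_imp_has_derivative[OF blP])
  then have der: "(?\<Phi> has_derivative (\<lambda>w. w)) (at 0)" by (simp add: TP)
  have "?\<Phi> 0 \<in> interior (?\<Phi> ` UNIV)"
    by (rule sussmann_open_mapping[OF open_UNIV cont UNIV_I der bounded_linear_ident]) (auto simp: o_def id_def)
  moreover have "?\<Phi> 0 = y" by (simp add: T0 lin_rules(3)[OF P(1)] exp_ad_zero)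
  ultimately obtain e where e: "e > 0" "ball y e \<subseteq> range ?\<Phi>" using mem_interior[of y "range ?\<Phi>"] by auto
  have "\<exists>z\<in>k. v = exp_ad br z y" if v: "v \<in> V" "dist y v < e" for v
  proof -
    have "v \<in> range ?\<Phi>" by (rule subsetD[OF e(2)]) (simp add: v(2))
    then obtain w where w: "v = ?\<Phi> w" by blast
    have E: "exp_ad br (T w) y \<in> V" by (rule exp_ad_mem[OF V k(2)[OF Tk] y])
    have "v = P (?\<Phi> w)" using Pid[OF v(1)] w by simp
    also have "\<dots> = exp_ad br (T w) y" using Pid[OF E] Pid[OF PV[of w]] by (simp add: lin_rules[OF P(1)])
    finally show ?thesis using Tk by blast
  qed
  then show ?thesis using e(1) by blast
qed

lemma Ad_group_comp: "g \<in> Ad_group br k \<Longrightarrow> h \<in> Ad_group br k \<Longrightarrow> g \<circ> h \<in> Ad_group br k"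
proof (induction rule: Ad_group.induct)
  case (Ad_exp x g)
  have "exp_ad br x \<circ> (g \<circ> h) \<in> Ad_group br k" by (rule Ad_group.Ad_exp[OF Ad_exp.hyps(1) Ad_exp.IH[OF Ad_exp.prems]])
  then show ?case unfolding comp_assoc .
qed simp

lemma Ad_group_single: "x \<in> k \<Longrightarrow> exp_ad br x \<in> Ad_group br k"
  using Ad_group.Ad_exp[OF _ Ad_group.Ad_id, of x k br] by simp

lemma Ad_group_inverse:
  assumes "vec.subspace k" and "g \<in> Ad_group br k"
  shows "\<exists>h\<in>Ad_group br k. \<forall>y. h (g y) = y"
  using assms(2)
proof induction
  case Ad_id
  show ?case using Ad_group.Ad_id by (intro bexI[of _ id]) auto
next
  case (Ad_exp x g)
  then obtain h where h: "h \<in> Ad_group br k" "\<forall>y. h (g y) = y" by blast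
  have "exp_ad br (- x) \<in> Ad_group br k" using Ad_group_single vec.subspace_neg[OF assms(1)] Ad_exp by blast
  then have "h \<circ> exp_ad br (- x) \<in> Ad_group br k" using Ad_group_comp h by blast
  then show ?case using h(2) exp_ad_inverse by (intro bexI[of _ "h \<circ> exp_ad br (- x)"]) auto
qed

lemma Ad_group_mem:
  assumes "vec.subspace V" "\<And>x v. x \<in> k \<Longrightarrow> v \<in> V \<Longrightarrow> br x v \<in> V" "g \<in> Ad_group br k" "v \<in> V"
  shows "g v \<in> V"
  using assms(3)
proof induction
  case (Ad_exp x g)
  then show ?case using exp_ad_mem[OF assms(1) assms(2)[OF Ad_exp(1)]] by simp
qed (use assms in simp)

end

context short_grading begin

text \<open>Passage from the group to the Lie algebra. Differentiating \<open>t \<mapsto> f (exp (t ad z) y)\<close> gives the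
infinitesimal character. The one-parameter group of \<open>H\<close> consists of all nonzero dilations of \<open>nm\<close>, so \<open>f\<close> is an
eigenvector of the dilations and hence homogeneous.\<close>
lemma relative_invariant_form:
  assumes f: "f \<in> PF" "\<exists>v\<in>nm. f v \<noteq> 0" "\<nexists>c. \<forall>v\<in>nm. f v = c"
    and ch: "\<And>g. g \<in> Ad_group br k \<Longrightarrow> \<exists>c. \<forall>v\<in>nm. f (g v) = c * f v"
  shows "\<exists>r. invariant_form br np k nm H f r"
proof -
  obtain v0 where v0: "v0 \<in> nm" "f v0 \<noteq> 0" using f(2) by blast
  have inv: "\<exists>\<mu>. \<forall>y\<in>nm. dd (br z y) f y = \<mu> * f y" if z: "z \<in> k" for z
  proof -
    have "\<forall>t. \<exists>c. \<forall>v\<in>nm. f (exp_ad br (t *s z) v) = c * f v"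
      using ch Ad_group_single vec.subspace_scale[OF sub(2) z] by blast
    then obtain c where c: "\<And>t v. v \<in> nm \<Longrightarrow> f (exp_ad br (t *s z) v) = c t * f v" by metis
    have der: "((\<lambda>t. f (exp_ad br (t *s z) y)) has_field_derivative dd (br z y) f y) (at 0)" for y
    proof (rule dd_chain[OF f(1)])
      show "((\<lambda>t. exp_ad br (t *s z) y $ i) has_field_derivative br z y $ i) (at 0)" for i
        using exp_ad_derivative[of z y i 0] by (simp add: exp_ad_zero)
    qed (simp add: exp_ad_zero)
    let ?\<mu> = "dd (br z v0) f v0 / f v0"
    have "c = (\<lambda>t. f (exp_ad br (t *s z) v0) / f v0)" using c[OF v0(1)] v0(2) by (auto simp: fun_eq_iff)
    then have dc: "(c has_field_derivative ?\<mu>) (at 0)" using DERIV_cdivide[OF der[of v0], of "f v0"] by simp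
    have "dd (br z y) f y = ?\<mu> * f y" if y: "y \<in> nm" for y
    proof (rule DERIV_unique[OF der])
      show "((\<lambda>t. f (exp_ad br (t *s z) y)) has_field_derivative ?\<mu> * f y) (at 0)"
        unfolding c[OF y] by (rule DERIV_cmult_right[OF dc])
    qed
    then show ?thesis by blast
  qed
  obtain d :: nat and G where G: "\<And>i. G i \<in> PF" "\<And>i c x. G i (c *s x) = c ^ i * G i x" "f = (\<lambda>x. \<Sum>i\<le>d. G i x)"
    using homogeneous_decomposition[OF f(1)] by blast
  have scal: "f (c *s v) * f v0 = f (c *s v0) * f v" if v: "v \<in> nm" and c: "c \<noteq> 0" for c v
  proof -
    \<comment> \<open>\<open>ad H\<close> is \<open>- 1\<close> on \<open>nm\<close>, so this multiple of \<open>H\<close> exponentiates to the dilation by \<open>c\<close>.\<close>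
    let ?t = "- ln c"
    have e: "exp_ad br (?t *s H) w = c *s w" if w: "w \<in> nm" for w
    proof -
      have "exp_ad br (ln c *s (- H)) w = exp (ln c) *s w"
        by (rule exp_ad_scalar) (use Hnm[OF w] in \<open>simp add: br_simps\<close>)
      then show ?thesis using c by (simp add: vec.scale_minus_right vec.scale_minus_left)
    qed
    have "exp_ad br (?t *s H) \<in> Ad_group br k" by (rule Ad_group_single[OF vec.subspace_scale[OF sub(2) Hk]])
    then obtain b where b: "\<forall>v\<in>nm. f (exp_ad br (?t *s H) v) = b * f v" using ch by blast
    then have "f (c *s v) = b * f v" "f (c *s v0) = b * f v0" using e v v0(1) by metis+
    then show ?thesis by simp
  qed
  have prp: "G i v * f v0 = G i v0 * f v" if v: "v \<in> nm" and i: "i \<le> d" for i v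
  proof -
    let ?p = "\<Sum>i\<le>d. Polynomial.monom (G i v * f v0) i" and ?q = "\<Sum>i\<le>d. Polynomial.monom (G i v0 * f v) i"
    have "?p = ?q"
    proof (rule poly_agree_nonzero)
      fix t :: complex assume t: "t \<noteq> 0"
      have e: "f (t *s w) = (\<Sum>i\<le>d. t ^ i * G i w)" for w unfolding G(3) G(2) ..
      have "poly ?p t = f (t *s v) * f v0" unfolding e sum_distrib_right by (simp add: poly_sum poly_monom mult_ac)
      moreover have "poly ?q t = f (t *s v0) * f v" unfolding e sum_distrib_right by (simp add: poly_sum poly_monom mult_ac)
      ultimately show "poly ?p t = poly ?q t" using scal[OF v t] by simp
    qed
    then have "Polynomial.coeff ?p i = Polynomial.coeff ?q i" by simp
    then show ?thesis using i by (simp add: coeff_sum)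
  qed
  have "\<exists>i\<le>d. G i v0 \<noteq> 0"
  proof (rule ccontr)
    assume "\<not> ?thesis"
    then have "f v0 = 0" unfolding G(3) by (intro sum.neutral) auto
    then show False using v0(2) by simp
  qed
  then obtain r where r: "r \<le> d" "G r v0 \<noteq> 0" by blast
  have fh: "f (c *s y) = c ^ r * f y" if y: "y \<in> nm" for c y
  proof -
    have cy: "c *s y \<in> nm" using vec.subspace_scale[OF sub(3) y] .
    have "G r v0 * f (c *s y) = c ^ r * (G r v0 * f y)"
      unfolding prp[OF cy r(1), symmetric] prp[OF y r(1), symmetric] G(2) by simp
    then show ?thesis using r(2) by (simp add: mult.left_commute)
  qed
  have "r > 0"
  proof (rule ccontr)
    assume "\<not> r > 0"
    then have "f (0 *s y) = f y" if "y \<in> nm" for y using fh[OF that, of 0] by simp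
    then have "\<forall>v\<in>nm. f v = f 0" by simp
    then show False using f(3) by blast
  qed
  then have "invariant_form br np k nm H f r"
    by unfold_locales (use f fh inv in auto)
  then show ?thesis by blast
qed

end

context invariant_form begin

text \<open>Two points of the set \<open>f \<noteq> 0\<close> are joined by a complex line, which meets the set in the complement of
finitely many points. On this connected set lying in the same orbit is an open equivalence
relation.\<close>
theorem orbit_eq_nonvanishing:
  assumes ch: "\<And>g. g \<in> Ad_group br k \<Longrightarrow> \<exists>c. c \<noteq> 0 \<and> (\<forall>v\<in>nm. f (g v) = c * f v)"
    and L: "L \<in> nm" "f L \<noteq> 0"
  shows "group_orbit (Ad_group br k) L = {v \<in> nm. f v \<noteq> 0}"
proof
  let ?G = "Ad_group br k"
  have Gmem: "g v \<in> nm" if "g \<in> ?G" "v \<in> nm" for g v using Ad_group_mem[OF sub(3) knm that] by blast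
  show "group_orbit ?G L \<subseteq> {v \<in> nm. f v \<noteq> 0}"
  proof
    fix v assume "v \<in> group_orbit ?G L"
    then obtain g where g: "g \<in> ?G" "v = g L" unfolding group_orbit_def by blast
    obtain c where "c \<noteq> 0" "f (g L) = c * f L" using ch[OF g(1)] L(1) by blast
    then show "v \<in> {v \<in> nm. f v \<noteq> 0}" using Gmem[OF g(1) L(1)] g(2) L(2) by simp
  qed
  show "{v \<in> nm. f v \<noteq> 0} \<subseteq> group_orbit ?G L"
  proof
    fix v assume v: "v \<in> {v \<in> nm. f v \<noteq> 0}"
    define \<gamma> where "\<gamma> t = L + t *s (v - L)" for t :: complex
    have \<gamma>n: "\<gamma> t \<in> nm" for t
      unfolding \<gamma>_def using L(1) v vec.subspace_add[OF sub(3)] vec.subspace_scale[OF sub(3)] vec.subspace_diff[OF sub(3)] by blast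
    obtain q where q: "\<And>t. f (\<gamma> t) = poly q t" using PF_line[OF f_PF] unfolding \<gamma>_def by metis
    have q0: "q \<noteq> 0" using q[of 0] L(2) by (auto simp: \<gamma>_def)
    define S where "S = UNIV - {t. poly q t = 0}"
    have S: "connected S" unfolding S_def
      by (rule connected_open_delete_finite) (auto simp: poly_roots_finite[OF q0])
    define R where "R t t' \<longleftrightarrow> (\<exists>g\<in>?G. \<gamma> t' = g (\<gamma> t))" for t t'
    have cont: "continuous_on UNIV \<gamma>"
    proof -
      have "\<gamma> = (\<lambda>t. L + (\<chi> i. t * (v - L) $ i))" by (simp add: \<gamma>_def fun_eq_iff vector_scalar_mult_def)
      then show ?thesis by (simp only:) (intro continuous_intros)
    qed
    have "R 0 1"
    proof (rule connected_equivalence_relation[OF S])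
      show "0 \<in> S" "1 \<in> S" using q[of 0] q[of 1] L(2) v by (auto simp: S_def \<gamma>_def)
    next
      fix a b assume "R a b"
      then obtain g where g: "g \<in> ?G" "\<gamma> b = g (\<gamma> a)" unfolding R_def by blast
      obtain h where "h \<in> ?G" "\<forall>y. h (g y) = y" using Ad_group_inverse[OF sub(2) g(1)] by blast
      then show "R b a" unfolding R_def using g(2) by metis
    next
      fix a b c assume "R a b" "R b c"
      then obtain g h where "g \<in> ?G" "\<gamma> b = g (\<gamma> a)" "h \<in> ?G" "\<gamma> c = h (\<gamma> b)" unfolding R_def by blast
      then show "R a c" unfolding R_def using Ad_group_comp[of h k g] by (intro bexI[of _ "h \<circ> g"]) auto
    next
      fix a assume a: "a \<in> S"
      then have fa: "f (\<gamma> a) \<noteq> 0" using q by (simp add: S_def)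
      obtain e where e: "e > 0" "\<forall>v\<in>nm. dist (\<gamma> a) v < e \<longrightarrow> (\<exists>z\<in>k. v = exp_ad br z (\<gamma> a))"
        using orbit_neighbourhood[OF sub(3) sub(2) knm \<gamma>n k_orbit_map_surjective[OF \<gamma>n fa]] by blast
      let ?T = "S \<inter> \<gamma> -` ball (\<gamma> a) e"
      have "open (\<gamma> -` ball (\<gamma> a) e)" using open_vimage[OF open_ball cont] .
      then have "openin (top_of_set S) ?T" by (rule openin_open_Int)
      moreover have "a \<in> ?T" using a e(1) by simp
      moreover have "\<forall>t\<in>?T. R a t"
      proof
        fix t assume "t \<in> ?T"
        then obtain z where "z \<in> k" "\<gamma> t = exp_ad br z (\<gamma> a)" using e(2) \<gamma>n[of t] by auto
        then show "R a t" unfolding R_def using Ad_group_single by blast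
      qed
      ultimately show "\<exists>T. openin (top_of_set S) T \<and> a \<in> T \<and> (\<forall>x\<in>T. R a x)" by blast
    qed
    then obtain g where "g \<in> ?G" "\<gamma> 1 = g (\<gamma> 0)" unfolding R_def by blast
    then show "v \<in> group_orbit ?G L" unfolding group_orbit_def \<gamma>_def by (auto intro: image_eqI[of _ _ g])
  qed
qed

end

section \<open>Rings of polynomial functions\<close>

lemma coord_carrier: "carrier (coord_ring V) = (\<lambda>p. restrict p V) ` PF"
  by (simp add: coord_ring_def)

lemma coord_mem: "P \<in> PF \<Longrightarrow> restrict P V \<in> carrier (coord_ring V)"
  by (simp add: coord_carrier)

lemma coord_ops:
  "restrict p V \<otimes>\<^bsub>coord_ring V\<^esub> restrict q V = restrict (\<lambda>x. p x * q x) V"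
  "restrict p V \<oplus>\<^bsub>coord_ring V\<^esub> restrict q V = restrict (\<lambda>x. p x + q x) V"
  "\<one>\<^bsub>coord_ring V\<^esub> = restrict (\<lambda>x. 1) V" "\<zero>\<^bsub>coord_ring V\<^esub> = restrict (\<lambda>x. 0) V"
  by (auto simp: coord_ring_def restrict_def fun_eq_iff)

lemma coord_cring: "cring (coord_ring V)"
proof (rule cringI)
  show "abelian_group (coord_ring V)"
  proof (rule abelian_groupI)
    fix x assume "x \<in> carrier (coord_ring V)"
    then obtain p where p: "p \<in> PF" "x = restrict p V" by (auto simp: coord_carrier)
    have "restrict (\<lambda>x. - p x) V \<oplus>\<^bsub>coord_ring V\<^esub> x = \<zero>\<^bsub>coord_ring V\<^esub>" unfolding p(2) coord_ops by simp
    moreover have "(\<lambda>x. - p x) \<in> PF" using PF_cmult[OF p(1), of "-1"] by simp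
    ultimately show "\<exists>y\<in>carrier (coord_ring V). y \<oplus>\<^bsub>coord_ring V\<^esub> x = \<zero>\<^bsub>coord_ring V\<^esub>" using coord_mem by blast
  qed (auto simp: coord_carrier coord_ops image_iff ac_simps intro: poly_add poly_const)
  show "comm_monoid (coord_ring V)"
    by (rule comm_monoidI) (auto simp: coord_carrier coord_ops image_iff ac_simps intro: poly_mult poly_const)
qed (auto simp: coord_carrier coord_ops algebra_simps)

lemma coord_pow: "restrict p V [^]\<^bsub>coord_ring V\<^esub> (m::nat) = restrict (\<lambda>x. p x ^ m) V"
proof -
  interpret cring "coord_ring V" by (rule coord_cring)
  show ?thesis
  proof (induction m)
    case 0
    show ?case by (simp only: nat_pow_0 coord_ops(3) power_0)
  next
    case (Suc m)
    show ?case by (simp only: nat_pow_Suc Suc coord_ops(1) power_Suc2)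
  qed
qed

lemma coord_diff:
  assumes "p \<in> PF" "q \<in> PF"
  shows "restrict p V \<ominus>\<^bsub>coord_ring V\<^esub> restrict q V = restrict (\<lambda>x. p x - q x) V"
proof -
  interpret cring "coord_ring V" by (rule coord_cring)
  have m: "(\<lambda>x. - q x) \<in> PF" using PF_cmult[OF assms(2), of "-1"] by simp
  have "\<ominus>\<^bsub>coord_ring V\<^esub> restrict q V = restrict (\<lambda>x. - q x) V"
    by (rule minus_equality) (use assms m in \<open>auto simp: coord_mem coord_ops\<close>)
  then show ?thesis unfolding a_minus_def by (simp add: coord_ops)
qed

section \<open>Finite-dimensional spaces of functions\<close>

lemma function_space: "vector_space (\<lambda>(c::complex) (g :: 'b \<Rightarrow> complex) x. c * g x)"
  by unfold_locales (auto simp: fun_eq_iff algebra_simps)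

global_interpretation fs: vector_space "\<lambda>(c::complex) (g :: 'b \<Rightarrow> complex) x. c * g x"
  by (rule function_space)

text \<open>The chain is constant from the member with the smallest basis on.\<close>
lemma descending_subspaces_stabilise:
  fixes J :: "nat \<Rightarrow> ('b \<Rightarrow> complex) set"
  assumes sub: "\<And>m. fs.subspace (J m)" and dec: "\<And>m. J (Suc m) \<subseteq> J m" and B: "finite B" "J 0 \<subseteq> fs.span B"
  shows "\<exists>M. \<forall>m\<ge>M. J m = J M"
proof -
  have dec': "J n \<subseteq> J m" if "m \<le> n" for m n using that by (rule lift_Suc_antimono_le[of J, OF dec])
  have "\<exists>S. S \<subseteq> J m \<and> fs.independent S \<and> J m \<subseteq> fs.span S \<and> finite S" for m
  proof -
    obtain S where S: "S \<subseteq> J m" "fs.independent S" "J m \<subseteq> fs.span S" by (rule fs.basis_exists[of "J m"], rule that)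
    have "S \<subseteq> fs.span B" using S(1) dec'[of 0 m] B(2) by blast
    then show ?thesis using S fs.independent_span_bound[OF B(1) S(2)] by blast
  qed
  then obtain S where S: "\<And>m. S m \<subseteq> J m" "\<And>m. fs.independent (S m)" "\<And>m. J m \<subseteq> fs.span (S m)" "\<And>m. finite (S m)" by metis
  have le: "card T \<le> card (S m)" if "fs.independent T" "T \<subseteq> J m" for T m
    using fs.independent_span_bound[OF S(4)[of m] that(1)] S(3)[of m] that(2) by blast
  define M where "M = (ARG_MIN (\<lambda>m. card (S m)) m. True)"
  have M: "card (S M) \<le> card (S m)" for m unfolding M_def using arg_min_nat_le[of "\<lambda>_. True" m "\<lambda>m. card (S m)"] by simp
  have "J m = J M" if m: "M \<le> m" for m
  proof
    show "J m \<subseteq> J M" by (rule dec'[OF m])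
    show "J M \<subseteq> J m"
    proof
      fix v assume v: "v \<in> J M"
      have "v \<in> fs.span (S m)"
      proof (rule ccontr)
        assume nv: "v \<notin> fs.span (S m)"
        then have "fs.independent (insert v (S m))" using fs.independent_insertI S(2) by blast
        moreover have "insert v (S m) \<subseteq> J M" using v S(1)[of m] dec'[OF m] by blast
        ultimately have "card (insert v (S m)) \<le> card (S M)" by (rule le)
        moreover have "v \<notin> S m" using nv fs.span_base by blast
        ultimately show False using M[of m] S(4)[of m] by simp
      qed
      then show "v \<in> J m" using fs.span_minimal[OF S(1) sub] by blast
    qed
  qed
  then show ?thesis by blast
qed

lemma span_product:
  assumes "x \<in> fs.span A" "y \<in> fs.span B"
  shows "(\<lambda>z. x z * y z) \<in> fs.span {\<lambda>z. a z * b z |a b. a \<in> A \<and> b \<in> B}" (is "_ \<in> fs.span ?C")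
proof -
  have 1: "(\<lambda>z. a z * y z) \<in> fs.span ?C" if a: "a \<in> A" for a
  proof -
    have "B \<subseteq> {y. (\<lambda>z. a z * y z) \<in> fs.span ?C}" using a by (auto intro!: fs.span_base)
    moreover have "fs.subspace {y. (\<lambda>z. a z * y z) \<in> fs.span ?C}"
    proof (rule fs.subspaceI)
      show "0 \<in> {y. (\<lambda>z. a z * y z) \<in> fs.span ?C}" using fs.span_zero[of ?C] by (simp add: zero_fun_def)
    next
      fix u v assume "u \<in> {y. (\<lambda>z. a z * y z) \<in> fs.span ?C}" "v \<in> {y. (\<lambda>z. a z * y z) \<in> fs.span ?C}"
      then have "(\<lambda>z. a z * u z) + (\<lambda>z. a z * v z) \<in> fs.span ?C" using fs.span_add by blast
      then show "u + v \<in> {y. (\<lambda>z. a z * y z) \<in> fs.span ?C}" by (simp add: plus_fun_def distrib_left)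
    next
      fix c u assume "u \<in> {y. (\<lambda>z. a z * y z) \<in> fs.span ?C}"
      then have "(\<lambda>z. c * (a z * u z)) \<in> fs.span ?C" using fs.span_scale[of "\<lambda>z. a z * u z" ?C c] by simp
      then show "(\<lambda>z. c * u z) \<in> {y. (\<lambda>z. a z * y z) \<in> fs.span ?C}" by (simp add: mult.left_commute)
    qed
    ultimately show ?thesis using fs.span_minimal assms(2) by blast
  qed
  have "A \<subseteq> {x. (\<lambda>z. x z * y z) \<in> fs.span ?C}" using 1 by blast
  moreover have "fs.subspace {x. (\<lambda>z. x z * y z) \<in> fs.span ?C}"
  proof (rule fs.subspaceI)
    show "0 \<in> {x. (\<lambda>z. x z * y z) \<in> fs.span ?C}" using fs.span_zero[of ?C] by (simp add: zero_fun_def)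
  next
    fix u v assume "u \<in> {x. (\<lambda>z. x z * y z) \<in> fs.span ?C}" "v \<in> {x. (\<lambda>z. x z * y z) \<in> fs.span ?C}"
    then have "(\<lambda>z. u z * y z) + (\<lambda>z. v z * y z) \<in> fs.span ?C" using fs.span_add by blast
    then show "u + v \<in> {x. (\<lambda>z. x z * y z) \<in> fs.span ?C}" by (simp add: plus_fun_def distrib_right)
  next
    fix c u assume "u \<in> {x. (\<lambda>z. x z * y z) \<in> fs.span ?C}"
    then have "(\<lambda>z. c * (u z * y z)) \<in> fs.span ?C" using fs.span_scale[of "\<lambda>z. u z * y z" ?C c] by simp
    then show "(\<lambda>z. c * u z) \<in> {x. (\<lambda>z. x z * y z) \<in> fs.span ?C}" by (simp add: mult.assoc)
  qed
  ultimately show ?thesis using fs.span_minimal assms(1) by blast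
qed

text \<open>A finite-dimensional space containing \<open>g\<close> and closed under differentiation, built along the
construction of the polynomial: sums of spaces for sums, products of basis elements for products.\<close>
lemma derivatives_finite_dimensional:
  assumes "g \<in> PF"
  shows "\<exists>B. finite B \<and> B \<subseteq> PF \<and> g \<in> fs.span B \<and> (\<forall>u. \<forall>b\<in>B. dd u b \<in> fs.span B)"
  using assms
proof induction
  case (poly_const c)
  have 1: "(\<lambda>_. a) \<in> fs.span {\<lambda>_. 1}" for a
    using fs.span_scale[OF fs.span_base[of "\<lambda>_. 1" "{\<lambda>_. 1}"], of a] by simp
  then show ?case by (intro exI[of _ "{\<lambda>_. 1}"]) (auto simp: dd_const intro: poly_functions.poly_const)
next
  case (poly_linear l)
  have 1: "(\<lambda>_. a) \<in> fs.span {l, \<lambda>_. 1}" for a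
    using fs.span_scale[OF fs.span_base[of "\<lambda>_. 1" "{l, \<lambda>_. 1}"], of a] by simp
  then show ?case
    by (intro exI[of _ "{l, \<lambda>_. 1}"])
      (auto simp: dd_const dd_functional[OF poly_linear] fs.span_base intro: poly_functions.poly_const poly_functions.poly_linear[OF poly_linear])
next
  case (poly_add p q)
  obtain A where A: "finite A" "A \<subseteq> PF" "p \<in> fs.span A" "\<And>u b. b \<in> A \<Longrightarrow> dd u b \<in> fs.span A" using poly_add.IH(1) by blast
  obtain B where B: "finite B" "B \<subseteq> PF" "q \<in> fs.span B" "\<And>u b. b \<in> B \<Longrightarrow> dd u b \<in> fs.span B" using poly_add.IH(2) by blast
  have m: "fs.span A \<subseteq> fs.span (A \<union> B)" "fs.span B \<subseteq> fs.span (A \<union> B)" by (intro fs.span_mono; blast)+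
  have "p + q \<in> fs.span (A \<union> B)" by (rule fs.span_add) (use A(3) B(3) m in blast)+
  then have "(\<lambda>x. p x + q x) \<in> fs.span (A \<union> B)" by (simp add: plus_fun_def)
  then show ?case using A B m by (intro exI[of _ "A \<union> B"]) blast
next
  case (poly_mult p q)
  obtain A where A: "finite A" "A \<subseteq> PF" "p \<in> fs.span A" "\<And>u b. b \<in> A \<Longrightarrow> dd u b \<in> fs.span A" using poly_mult.IH(1) by blast
  obtain B where B: "finite B" "B \<subseteq> PF" "q \<in> fs.span B" "\<And>u b. b \<in> B \<Longrightarrow> dd u b \<in> fs.span B" using poly_mult.IH(2) by blast
  let ?C = "{\<lambda>z. a z * b z |a b. a \<in> A \<and> b \<in> B}"
  have "?C = (\<lambda>(a, b) z. a z * b z) ` (A \<times> B)" by auto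
  then have 1: "finite ?C" using A(1) B(1) by simp
  have 2: "?C \<subseteq> PF" using A(2) B(2) poly_functions.poly_mult by blast
  have 3: "(\<lambda>x. p x * q x) \<in> fs.span ?C" by (rule span_product[OF A(3) B(3)])
  have 4: "dd u c \<in> fs.span ?C" if "c \<in> ?C" for u c
  proof -
    obtain a b where ab: "c = (\<lambda>z. a z * b z)" "a \<in> A" "b \<in> B" using \<open>c \<in> ?C\<close> by blast
    have P: "a \<in> PF" "b \<in> PF" using A(2) B(2) ab by auto
    have "(\<lambda>z. dd u a z * b z) + (\<lambda>z. a z * dd u b z) \<in> fs.span ?C"
      by (intro fs.span_add span_product A(4) B(4) ab fs.span_base)
    then show ?thesis unfolding ab(1) dd_mult[OF P] by (simp add: plus_fun_def)
  qed
  show ?case by (intro exI[of _ ?C] conjI allI ballI 1 2 3 4)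
qed

lemma op_span:
  assumes B: "B \<subseteq> PF" "\<And>u b. b \<in> B \<Longrightarrow> dd u b \<in> fs.span B" and g: "g \<in> fs.span B"
  shows "D \<in> cc_diff_ops V \<Longrightarrow> D g \<in> fs.span B"
proof (induction rule: cc_diff_ops.induct)
  case (op_deriv u D)
  have "B \<subseteq> {h \<in> PF. dd u h \<in> fs.span B}" using B by blast
  moreover have "fs.subspace {h \<in> PF. dd u h \<in> fs.span B}"
  proof (rule fs.subspaceI)
    show "0 \<in> {h \<in> PF. dd u h \<in> fs.span B}"
      using poly_const[of 0] fs.span_zero[of B] by (simp add: zero_fun_def dd_const)
  next
    fix h h' assume h: "h \<in> {h \<in> PF. dd u h \<in> fs.span B}" "h' \<in> {h \<in> PF. dd u h \<in> fs.span B}"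
    then have P: "h \<in> PF" "h' \<in> PF" and "dd u h + dd u h' \<in> fs.span B" using fs.span_add by blast+
    then have "(\<lambda>x. dd u h x + dd u h' x) \<in> fs.span B" by (simp add: plus_fun_def)
    moreover have "h + h' = (\<lambda>x. h x + h' x)" by (simp add: plus_fun_def)
    ultimately show "h + h' \<in> {h \<in> PF. dd u h \<in> fs.span B}"
      unfolding mem_Collect_eq using poly_add[OF P] dd_add[OF P, of u] by simp
  next
    fix c h assume h: "h \<in> {h \<in> PF. dd u h \<in> fs.span B}"
    then have P: "h \<in> PF" and "(\<lambda>x. c * dd u h x) \<in> fs.span B" using fs.span_scale[of "dd u h" B c] by simp_all
    then show "(\<lambda>x. c * h x) \<in> {h \<in> PF. dd u h \<in> fs.span B}"
      unfolding mem_Collect_eq using PF_cmult[OF P, of c] dd_cmult[OF P, of u c] by simp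
  qed
  ultimately show ?case using fs.span_minimal op_deriv.IH by blast
next
  case (op_scale D c)
  then show ?case using fs.span_scale[of "D g" B c] by simp
next
  case (op_add D E)
  then show ?case using fs.span_add[of "D g" B "E g"] by (simp add: plus_fun_def)
qed (rule g)

section \<open>The Gorenstein algebra of a power of the relative invariant\<close>

lemma bij_betw_transport:
  assumes "bij_betw \<psi> A A'" "bij_betw \<psi> B B'" "bij_betw g A' B'" "\<And>a. a \<in> A \<Longrightarrow> h a \<in> B \<and> \<psi> (h a) = g (\<psi> a)"
  shows "bij_betw h A B"
  unfolding bij_betw_def
proof
  have i: "inj_on \<psi> A" "\<psi> ` A = A'" "inj_on \<psi> B" "\<psi> ` B = B'" "inj_on g A'" "g ` A' = B'" using assms(1-3) unfolding bij_betw_def by auto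
  show "inj_on h A"
  proof (rule inj_onI)
    fix x y assume "x \<in> A" "y \<in> A" "h x = h y"
    then have "g (\<psi> x) = g (\<psi> y)" using assms(4) by metis
    then have "\<psi> x = \<psi> y" using inj_onD[OF i(5)] i(2) \<open>x \<in> A\<close> \<open>y \<in> A\<close> by blast
    then show "x = y" using inj_onD[OF i(1)] \<open>x \<in> A\<close> \<open>y \<in> A\<close> by blast
  qed
  show "h ` A = B"
  proof
    show "h ` A \<subseteq> B" using assms(4) by blast
    show "B \<subseteq> h ` A"
    proof
      fix b assume b: "b \<in> B"
      then have "\<psi> b \<in> g ` A'" using i(4,6) by blast
      then obtain a where a: "a \<in> A" "\<psi> b = g (\<psi> a)" using i(2) by blast
      then have "\<psi> (h a) = \<psi> b" "h a \<in> B" using assms(4) by auto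
      then have "h a = b" using inj_onD[OF i(3)] b by blast
      then show "b \<in> h ` A" using a(1) by blast
    qed
  qed
qed

text \<open>\<open>Fb\<close> is the given power of the invariant. It is only known to agree with \<open>F\<close> on \<open>nm\<close>, as elements of the coordinate
ring are undefined elsewhere.\<close>
locale gorenstein_quotient = invariant_power br np k nm H f r s
  for br :: "complex ^ 'n \<Rightarrow> complex ^ 'n \<Rightarrow> complex ^ 'n" and np k nm H f r s +
  fixes Fb :: "complex ^ 'n \<Rightarrow> complex"
  assumes Fb: "\<And>y. y \<in> nm \<Longrightarrow> Fb y = F y"
begin

abbreviation "A \<equiv> gor_algebra br np nm Fb"
abbreviation "gr \<equiv> gor_grading br np nm Fb"
abbreviation "kk0 \<equiv> gor_field br np nm Fb"
abbreviation "cl P \<equiv> gor_class br np nm Fb (restrict P np)"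
abbreviation "Ann \<equiv> annihilator br np nm Fb"

text \<open>\<open>P \<mapsto> P(\<partial>) F\<close>. The kernel is the annihilator of \<open>F\<close>, so every statement about the quotient ring
becomes one about derivatives of \<open>F\<close>.\<close>
definition Phi :: "(complex ^ 'n \<Rightarrow> complex) \<Rightarrow> complex ^ 'n \<Rightarrow> complex" where
  "Phi P = nf ((SOME D. D \<in> ops \<and> symbol D P) F)"

lemma Phi_eq:
  assumes "P \<in> PF" "D \<in> ops" "symbol D \<sigma>" "\<And>x. x \<in> np \<Longrightarrow> \<sigma> x = P x"
  shows "Phi P = nf (D F)"
proof -
  have "\<exists>D. D \<in> ops \<and> symbol D P" using op_with_symbol[OF assms(1)] by blast
  then have E: "(SOME D. D \<in> ops \<and> symbol D P) \<in> ops \<and> symbol (SOME D. D \<in> ops \<and> symbol D P) P" by (rule someI_ex)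
  show ?thesis unfolding Phi_def nf_eq_iff
    using symbol_determines[OF F_PF conjunct1[OF E] assms(2) conjunct2[OF E] assms(3)] assms(4) by auto
qed

lemma Phi_cases:
  assumes "P \<in> PF"
  obtains D where "D \<in> ops" "symbol D P" "Phi P = nf (D F)"
  using op_with_symbol[OF assms] Phi_eq[OF assms] by metis

lemma Phi_cong: "P \<in> PF \<Longrightarrow> Q \<in> PF \<Longrightarrow> (\<And>x. x \<in> np \<Longrightarrow> P x = Q x) \<Longrightarrow> Phi P = Phi Q"
  using Phi_cases[of Q] Phi_eq[of P] by metis

lemma diff_op_Phi:
  assumes P: "P \<in> PF" and y: "y \<in> nm"
  shows "diff_op br np nm (restrict P np) Fb y = Phi P y"
proof -
  let ?Q = "\<lambda>D. D \<in> cc_diff_ops nm \<and> (\<forall>x\<in>np. \<forall>y\<in>nm. D (\<lambda>z. exp (kf x z)) y = restrict P np x * exp (kf x y))"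
  obtain D0 where D0: "D0 \<in> ops" "symbol D0 P" using op_with_symbol[OF P] by blast
  have "D0 (\<lambda>z. 1 * exp (kf x z)) y = 1 * P x * exp (kf x y)" if "x \<in> np" "y \<in> nm" for x y
    using D0(2) that unfolding symbol_def by blast
  then have "?Q D0" using D0(1) by simp
  then have D: "?Q (diff_op br np nm (restrict P np))" unfolding diff_op_def by (rule someI[of ?Q])
  let ?D = "diff_op br np nm (restrict P np)"
  obtain \<sigma> where s: "\<sigma> \<in> PF" "symbol ?D \<sigma>" using symbol_exists D by blast
  have "\<sigma> x = P x" if x: "x \<in> np" for x
  proof -
    have "?D (\<lambda>z. 1 * exp (kf x z)) 0 = 1 * \<sigma> x * exp (kf x 0)"
      using s(2) x vec.subspace_0[OF sub(3)] unfolding symbol_def by blast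
    then show ?thesis using D x vec.subspace_0[OF sub(3)] by (simp add: kf_lin)
  qed
  then have "Phi P = nf (?D F)" using Phi_eq[OF P _ s(2)] D by blast
  moreover have "?D Fb y = ?D F y" by (rule op_local[where g=Fb and h=F, OF sub(3) conjunct1[OF D] Fb y])
  ultimately show ?thesis using y by (simp add: nf_def)
qed

lemma Phi_off: "y \<notin> nm \<Longrightarrow> Phi P y = 0" unfolding Phi_def nf_def by simp

lemma Phi_add: "P \<in> PF \<Longrightarrow> Q \<in> PF \<Longrightarrow> Phi (\<lambda>x. P x + Q x) = (\<lambda>y. Phi P y + Phi Q y)"
proof -
  assume P: "P \<in> PF" and Q: "Q \<in> PF"
  obtain D E where D: "D \<in> ops" "symbol D P" "Phi P = nf (D F)" "E \<in> ops" "symbol E Q" "Phi Q = nf (E F)"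
    using Phi_cases[OF P] Phi_cases[OF Q] by metis
  have "Phi (\<lambda>x. P x + Q x) = nf (\<lambda>y. D F y + E F y)"
    using Phi_eq[OF poly_add[OF P Q] cc_diff_ops.op_add[OF D(1,4)] symbol_add[OF D(2,5)]] by simp
  then show ?thesis unfolding D(3,6) nf_def by auto
qed

lemma Phi_cmult: "P \<in> PF \<Longrightarrow> Phi (\<lambda>x. c * P x) = (\<lambda>y. c * Phi P y)"
proof -
  assume P: "P \<in> PF"
  obtain D where D: "D \<in> ops" "symbol D P" "Phi P = nf (D F)" using Phi_cases[OF P] by metis
  have "Phi (\<lambda>x. c * P x) = nf (\<lambda>y. c * D F y)"
    using Phi_eq[OF PF_cmult[OF P] cc_diff_ops.op_scale[OF D(1)] symbol_scale[OF D(2)]] by simp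
  then show ?thesis unfolding D(3) nf_def by auto
qed

lemma Phi_diff: "P \<in> PF \<Longrightarrow> Q \<in> PF \<Longrightarrow> Phi (\<lambda>x. P x - Q x) = (\<lambda>y. Phi P y - Phi Q y)"
  using Phi_add[of P "\<lambda>x. (-1) * Q x"] Phi_cmult[of Q "-1"] PF_cmult[of Q "-1"] by simp

lemma Phi_zero: "Phi (\<lambda>x. 0) = (\<lambda>y. 0)"
  using Phi_cmult[OF poly_const[of 0], of 0] by simp

lemma Phi_mult:
  assumes P: "P \<in> PF" and D: "D \<in> ops" "symbol D P" and Q: "Q \<in> PF" and g: "\<And>y. y \<in> nm \<Longrightarrow> Phi Q y = g y"
  shows "Phi (\<lambda>x. P x * Q x) = nf (D g)"
proof -
  obtain E where E: "E \<in> ops" "symbol E Q" "Phi Q = nf (E F)" using Phi_cases[OF Q] by metis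
  have "Phi (\<lambda>x. P x * Q x) = nf (D (E F))"
    using Phi_eq[OF poly_mult[OF P Q] op_comp[OF D(1) E(1)] symbol_comp[OF D E(2)]] by simp
  moreover have "E F y = g y" if "y \<in> nm" for y using g[OF that] that unfolding E(3) nf_def by simp
  then have "D (E F) y = D g y" if "y \<in> nm" for y using op_local[OF sub(3) D(1) _ that] by blast
  ultimately show ?thesis by (simp add: nf_eq_iff)
qed

lemma Phi_ideal: "P \<in> PF \<Longrightarrow> Q \<in> PF \<Longrightarrow> Phi Q = (\<lambda>_. 0) \<Longrightarrow> Phi (\<lambda>x. P x * Q x) = (\<lambda>_. 0)"
proof -
  assume P: "P \<in> PF" and Q: "Q \<in> PF" "Phi Q = (\<lambda>_. 0)"
  obtain D where D: "D \<in> ops" "symbol D P" using op_with_symbol[OF P] by blast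
  have "Phi (\<lambda>x. P x * Q x) = nf (D (\<lambda>_. 0))" by (rule Phi_mult[OF P D Q(1)]) (simp add: Q(2))
  then show ?thesis unfolding op_zero[OF D(1)] nf_def by simp
qed

lemma kf_PF': "(\<lambda>x. kf x u) \<in> PF" by (rule poly_linear[OF kf_linear(1)])

lemma Phi_kf_mult:
  assumes "u \<in> nm" "P \<in> PF"
  shows "Phi (\<lambda>x. kf x u * P x) = nf (dd u (Phi P))"
  using Phi_mult[OF kf_PF' conjunct1[OF symbol_dd[OF assms(1)]] conjunct2[OF symbol_dd[OF assms(1)]] assms(2)] by simp

lemma Phi_pow:
  assumes "L \<in> nm" "P \<in> PF"
  shows "Phi (\<lambda>x. kf x L ^ j * P x) = ((\<lambda>g. nf (dd L g)) ^^ j) (Phi P)"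
proof (induction j)
  case (Suc j)
  have "(\<lambda>x. kf x L ^ j * P x) \<in> PF" by (intro poly_mult PF_power kf_PF' assms)
  from Phi_kf_mult[OF assms(1) this] show ?case by (simp add: Suc mult.assoc)
qed simp

definition hom_np :: "nat \<Rightarrow> (complex ^ 'n \<Rightarrow> complex) \<Rightarrow> bool" where
  "hom_np i P \<longleftrightarrow> P \<in> PF \<and> (\<forall>c. \<forall>x\<in>np. P (c *s x) = c ^ i * P x)"

lemma Phi_hom:
  assumes "hom_np i P"
  shows "i \<le> N \<Longrightarrow> homog (N - i) (Phi P)" "N < i \<Longrightarrow> Phi P = (\<lambda>_. 0)"
proof -
  have P: "P \<in> PF" "\<And>c x. x \<in> np \<Longrightarrow> P (c *s x) = c ^ i * P x" using assms unfolding hom_np_def by auto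
  obtain D where D: "D \<in> ops" "symbol D P" "Phi P = nf (D F)" using Phi_cases[OF P(1)] by metis
  note R = op_degree[OF D(1,2) P(2) F_PF F_hom]
  show "homog (N - i) (Phi P)" if "i \<le> N"
    unfolding homog_def D(3) nf_def using R(1)[OF _ _ _ that] vec.subspace_scale[OF sub(3)] by auto
  show "Phi P = (\<lambda>_. 0)" if "N < i" unfolding D(3) nf_def using R(2)[OF _ _ _ that] by (auto simp: fun_eq_iff)
qed

text \<open>The identification of graded pieces. That a derivative of degree \<open>N - i\<close> comes from a homogeneous symbol
of degree \<open>i\<close> follows by comparing coefficients along the line through \<open>y\<close>.\<close>
lemma Phi_Vd:
  assumes i: "i \<le> N"
  shows "Vd (int N - int i) = Phi ` {P. hom_np i P}"
proof
  have nat: "nat (int N - int i) = N - i" and pos: "\<not> int N - int i < 0" using i by auto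
  show "Phi ` {P. hom_np i P} \<subseteq> Vd (int N - int i)"
  proof
    fix g assume "g \<in> Phi ` {P. hom_np i P}"
    then obtain P where P: "hom_np i P" "g = Phi P" by blast
    obtain D where D: "D \<in> ops" "symbol D P" "Phi P = nf (D F)" using Phi_cases P(1) unfolding hom_np_def by metis
    have "homog (N - i) (nf (D F))" using Phi_hom(1)[OF P(1) i] unfolding D(3) .
    then have "homog (N - i) (D F)" unfolding homog_def nf_def using vec.subspace_scale[OF sub(3)] by auto
    then show "g \<in> Vd (int N - int i)" unfolding P(2) D(3) Vd_def nat using D(1) pos by auto
  qed
  show "Vd (int N - int i) \<subseteq> Phi ` {P. hom_np i P}"
  proof
    fix g assume "g \<in> Vd (int N - int i)"
    then obtain D where D: "D \<in> ops" "g = nf (D F)" "homog (N - i) (D F)" unfolding Vd_def nat using pos by auto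
    obtain l :: nat and E \<sigma> where E: "\<And>i. E i \<in> ops" "\<And>i. symbol (E i) (\<sigma> i)" "\<And>i. \<sigma> i \<in> PF"
      "\<And>i c x. \<sigma> i (c *s x) = c ^ i * \<sigma> i x" "\<And>g y. g \<in> PF \<Longrightarrow> y \<in> nm \<Longrightarrow> D g y = (\<Sum>i\<le>l. E i g y)"
      using op_components[OF D(1)] by metis
    have key: "D F y = (if i \<le> l then E i F y else 0)" if y: "y \<in> nm" for y
    proof -
      let ?q = "\<Sum>i\<le>l. Polynomial.monom (if i \<le> N then E i F y else 0) (N - i)"
      have "Polynomial.monom (D F y) (N - i) = ?q"
      proof (rule poly_agree_nonzero)
        fix t :: complex
        have ty: "t *s y \<in> nm" using vec.subspace_scale[OF sub(3) y] .
        have "E i F (t *s y) = (if i \<le> N then E i F y else 0) * t ^ (N - i)" for i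
          using op_degree(1)[OF E(1,2) E(4) F_PF F_hom y, of i t] op_degree(2)[OF E(1,2) E(4) F_PF F_hom ty, of i] by (cases "i \<le> N") auto
        then have "D F (t *s y) = poly ?q t" unfolding E(5)[OF F_PF ty] by (simp add: poly_sum poly_monom)
        moreover have "D F (t *s y) = t ^ (N - i) * D F y" using D(3) y unfolding homog_def by blast
        ultimately show "poly (Polynomial.monom (D F y) (N - i)) t = poly ?q t" by (simp add: poly_monom mult.commute)
      qed
      then have "Polynomial.coeff (Polynomial.monom (D F y) (N - i)) (N - i) = Polynomial.coeff ?q (N - i)" by simp
      also have "\<dots> = (\<Sum>j\<le>l. if j = i then E i F y else 0)"
        unfolding coeff_sum by (rule sum.cong) (use i in auto)
      finally show ?thesis by simp
    qed
    show "g \<in> Phi ` {P. hom_np i P}"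
    proof (cases "i \<le> l")
      case True
      have "Phi (\<sigma> i) = nf (E i F)" by (rule Phi_eq[OF E(3) E(1,2)]) simp
      then have "g = Phi (\<sigma> i)" unfolding D(2) nf_eq_iff using key True by (simp add: nf_eq_iff)
      then show ?thesis using E(3,4) unfolding hom_np_def by auto
    next
      case False
      have "g = Phi (\<lambda>_. 0)" unfolding D(2) Phi_zero using key False by (auto simp: nf_def fun_eq_iff)
      then show ?thesis using poly_const[of 0] unfolding hom_np_def by auto
    qed
  qed
qed

subsection \<open>The quotient ring\<close>

lemma Ann_mem: "P \<in> PF \<Longrightarrow> restrict P np \<in> Ann \<longleftrightarrow> Phi P = (\<lambda>_. 0)"
  unfolding annihilator_def using diff_op_Phi[of P] coord_mem[of P np] Phi_off by (auto simp: fun_eq_iff)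

lemma Ann_eq: "Ann = (\<lambda>P. restrict P np) ` {P \<in> PF. Phi P = (\<lambda>_. 0)}"
proof -
  have "Ann \<subseteq> carrier (coord_ring np)" unfolding annihilator_def by blast
  then show ?thesis using Ann_mem unfolding coord_carrier by (auto simp: image_iff)
qed

lemma Ann_ideal: "ideal Ann (coord_ring np)"
proof -
  interpret R: cring "coord_ring np" by (rule coord_cring)
  show ?thesis
  proof (rule idealI)
    show "ring (coord_ring np)" by (rule R.ring_axioms)
    show "subgroup Ann (add_monoid (coord_ring np))"
    proof (rule R.add.subgroupI)
      show "Ann \<subseteq> carrier (coord_ring np)" unfolding annihilator_def by blast
      show "Ann \<noteq> {}" unfolding Ann_eq using poly_const[of 0] Phi_zero by blast
      fix a b assume "a \<in> Ann" "b \<in> Ann"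
      then obtain P Q where P: "P \<in> PF" "Phi P = (\<lambda>_. 0)" "a = restrict P np" and Q: "Q \<in> PF" "Phi Q = (\<lambda>_. 0)" "b = restrict Q np"
        unfolding Ann_eq by blast
      show "a \<oplus>\<^bsub>coord_ring np\<^esub> b \<in> Ann" unfolding P(3) Q(3) coord_ops Ann_mem[OF poly_add[OF P(1) Q(1)]]
        by (simp add: Phi_add P Q)
    next
      fix a assume "a \<in> Ann"
      then obtain P where P: "P \<in> PF" "Phi P = (\<lambda>_. 0)" "a = restrict P np" unfolding Ann_eq by blast
      have m: "(\<lambda>x. - P x) \<in> PF" using PF_cmult[OF P(1), of "-1"] by simp
      have "\<ominus>\<^bsub>coord_ring np\<^esub> a = restrict (\<lambda>x. - P x) np"
        by (rule R.minus_equality) (use P m in \<open>auto simp: coord_mem coord_ops\<close>)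
      then show "\<ominus>\<^bsub>coord_ring np\<^esub> a \<in> Ann" using Ann_mem[OF m] Phi_cmult[OF P(1), of "-1"] P(2) by simp
    qed
  next
    fix a x assume "a \<in> Ann" "x \<in> carrier (coord_ring np)"
    then obtain P Q where P: "P \<in> PF" "Phi P = (\<lambda>_. 0)" "a = restrict P np" and Q: "Q \<in> PF" "x = restrict Q np"
      unfolding Ann_eq coord_carrier by blast
    show "x \<otimes>\<^bsub>coord_ring np\<^esub> a \<in> Ann" unfolding P(3) Q(2) coord_ops Ann_mem[OF poly_mult[OF Q(1) P(1)]]
      by (rule Phi_ideal[OF Q(1) P(1,2)])
    then show "a \<otimes>\<^bsub>coord_ring np\<^esub> x \<in> Ann" using R.m_comm P Q coord_mem by metis
  qed
qed

sublocale Q: cring A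
  unfolding gor_algebra_def by (rule ideal.quotient_is_cring[OF Ann_ideal coord_cring])

lemma A_carrier: "carrier A = cl ` PF"
  unfolding gor_algebra_def FactRing_def A_RCOSETS_def RCOSETS_def gor_class_def a_r_coset_def
  by (auto simp: coord_carrier)

lemma cl_mem: "P \<in> PF \<Longrightarrow> cl P \<in> carrier A" unfolding A_carrier by blast

lemma cl_eq_iff: "P \<in> PF \<Longrightarrow> Q \<in> PF \<Longrightarrow> cl P = cl Q \<longleftrightarrow> Phi P = Phi Q"
proof -
  interpret R: cring "coord_ring np" by (rule coord_cring)
  assume P: "P \<in> PF" and Q: "Q \<in> PF"
  have "cl P = cl Q \<longleftrightarrow> restrict P np \<ominus>\<^bsub>coord_ring np\<^esub> restrict Q np \<in> Ann"
    unfolding gor_class_def using R.quotient_eq_iff_same_a_r_cos[OF Ann_ideal coord_mem[OF P] coord_mem[OF Q]] by simp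
  also have "\<dots> \<longleftrightarrow> Phi P = Phi Q"
    unfolding coord_diff[OF P Q] Ann_mem[OF PF_diff[OF P Q]] Phi_diff[OF P Q] by (auto simp: fun_eq_iff)
  finally show ?thesis .
qed

lemma cl_mult: "P \<in> PF \<Longrightarrow> Q \<in> PF \<Longrightarrow> cl P \<otimes>\<^bsub>A\<^esub> cl Q = cl (\<lambda>x. P x * Q x)"
  unfolding gor_algebra_def gor_class_def FactRing_def
  using ideal.rcoset_mult_add[OF Ann_ideal coord_mem coord_mem, of P Q] by (simp add: coord_ops)

lemma cl_add: "P \<in> PF \<Longrightarrow> Q \<in> PF \<Longrightarrow> cl P \<oplus>\<^bsub>A\<^esub> cl Q = cl (\<lambda>x. P x + Q x)"
  unfolding gor_algebra_def gor_class_def FactRing_def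
  using ideal.a_rcos_sum[OF Ann_ideal coord_mem coord_mem, of P Q] by (simp add: coord_ops)

lemma cl_one: "\<one>\<^bsub>A\<^esub> = cl (\<lambda>_. 1)"
  unfolding gor_algebra_def gor_class_def FactRing_def by (simp add: coord_ops)

lemma cl_zero: "\<zero>\<^bsub>A\<^esub> = cl (\<lambda>_. 0)"
proof -
  have "cl (\<lambda>_. 0) \<oplus>\<^bsub>A\<^esub> cl (\<lambda>_. 0) = cl (\<lambda>_. 0)" using cl_add[OF poly_const poly_const] by simp
  then show ?thesis using cl_mem[OF poly_const[of 0]] by (metis Q.add.r_cancel_one')
qed

lemma cl_zero_iff: "P \<in> PF \<Longrightarrow> cl P = \<zero>\<^bsub>A\<^esub> \<longleftrightarrow> Phi P = (\<lambda>_. 0)"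
  unfolding cl_zero using cl_eq_iff[OF _ poly_const[of 0]] Phi_zero by simp

lemma cl_pow: "P \<in> PF \<Longrightarrow> cl P [^]\<^bsub>A\<^esub> (m::nat) = cl (\<lambda>x. P x ^ m)"
  by (induction m) (simp_all add: cl_one cl_mult PF_power mult.commute)

lemma cl_neg: "P \<in> PF \<Longrightarrow> \<ominus>\<^bsub>A\<^esub> cl P = cl (\<lambda>x. - P x)"
proof -
  assume P: "P \<in> PF"
  have m: "(\<lambda>x. - P x) \<in> PF" using PF_cmult[OF P, of "-1"] by simp
  show ?thesis by (rule Q.minus_equality) (use P m in \<open>auto simp: cl_mem cl_add cl_zero\<close>)
qed

lemma cl_finsum: "finite I \<Longrightarrow> (\<And>i. i \<in> I \<Longrightarrow> P i \<in> PF) \<Longrightarrow> (\<Oplus>\<^bsub>A\<^esub>i\<in>I. cl (P i)) = cl (\<lambda>x. \<Sum>i\<in>I. P i x)"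
proof (induction I rule: finite_induct)
  case empty
  show ?case by (simp only: Q.finsum_empty cl_zero sum.empty)
next
  case (insert a I)
  have P: "P a \<in> PF" and Ps: "\<And>i. i \<in> I \<Longrightarrow> P i \<in> PF" using insert.prems by auto
  have S: "(\<lambda>x. \<Sum>i\<in>I. P i x) \<in> PF" by (rule PF_sum) (rule Ps)
  have IH: "(\<Oplus>\<^bsub>A\<^esub>i\<in>I. cl (P i)) = cl (\<lambda>x. \<Sum>i\<in>I. P i x)" by (rule insert.IH) (rule Ps)
  have "(\<Oplus>\<^bsub>A\<^esub>i\<in>insert a I. cl (P i)) = cl (P a) \<oplus>\<^bsub>A\<^esub> (\<Oplus>\<^bsub>A\<^esub>i\<in>I. cl (P i))"
    by (rule Q.finsum_insert[OF insert.hyps]) (use P Ps cl_mem in blast)+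
  also have "\<dots> = cl (P a) \<oplus>\<^bsub>A\<^esub> cl (\<lambda>x. \<Sum>i\<in>I. P i x)" by (simp only: IH)
  also have "\<dots> = cl (\<lambda>x. P a x + (\<Sum>i\<in>I. P i x))" by (rule cl_add[OF P S])
  finally show ?case by (simp only: sum.insert[OF insert.hyps])
qed

lemma gr_eq: "gr i = cl ` {P. hom_np i P}"
proof -
  have "homogeneous_part np i = (\<lambda>P. restrict P np) ` {P. hom_np i P}"
    unfolding homogeneous_part_def coord_carrier hom_np_def using vec.subspace_scale[OF sub(1)] by (auto simp: image_iff)
  then show ?thesis unfolding gor_grading_def by (auto simp: image_image)
qed

lemma field_eq: "kk0 = cl ` {\<lambda>_. c |c. True}"
proof -
  have "kk0 = (\<lambda>c. cl (\<lambda>_. c)) ` UNIV" unfolding gor_field_def by simp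
  then show ?thesis by blast
qed

lemma gr_0: "gr 0 = kk0"
proof
  show "gr 0 \<subseteq> kk0"
  proof
    fix a assume "a \<in> gr 0"
    then obtain P where P: "hom_np 0 P" "a = cl P" unfolding gr_eq by blast
    have "P x = P 0" if "x \<in> np" for x
    proof -
      have "P (0 *s x) = 0 ^ 0 * P x" using P(1) that unfolding hom_np_def by blast
      then show ?thesis by simp
    qed
    then have "Phi P = Phi (\<lambda>_. P 0)" using P(1) unfolding hom_np_def by (intro Phi_cong) (auto intro: poly_const)
    then have "a = cl (\<lambda>_. P 0)" unfolding P(2) using P(1) cl_eq_iff poly_const unfolding hom_np_def by blast
    then show "a \<in> kk0" unfolding field_eq by blast
  qed
  show "kk0 \<subseteq> gr 0" unfolding field_eq gr_eq hom_np_def by (auto intro: poly_const)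
qed

lemma hom_PF: "hom_np i P \<Longrightarrow> P \<in> PF" unfolding hom_np_def by blast

lemma hom_np_rules: "hom_np i (\<lambda>_. 0)" "hom_np i P \<Longrightarrow> hom_np i Q \<Longrightarrow> hom_np i (\<lambda>x. P x + Q x)"
  "hom_np i P \<Longrightarrow> hom_np i (\<lambda>x. c * P x)" "hom_np i P \<Longrightarrow> hom_np j Q \<Longrightarrow> hom_np (i + j) (\<lambda>x. P x * Q x)"
  unfolding hom_np_def using PF_cmult by (auto intro: poly_const poly_add poly_mult simp: algebra_simps power_add)

lemma hom_np_kf: "hom_np 1 (\<lambda>x. kf x u)" unfolding hom_np_def using kf_PF' by (simp add: kf_lin)

lemma gr_subgroup: "additive_subgroup (gr i) A"
proof (rule additive_subgroup.intro, rule Q.add.subgroupI)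
  show "gr i \<subseteq> carrier A" unfolding gr_eq A_carrier hom_np_def by blast
  show "gr i \<noteq> {}" unfolding gr_eq using hom_np_rules(1) by blast
  fix a assume "a \<in> gr i"
  then obtain P where P: "hom_np i P" "a = cl P" unfolding gr_eq by blast
  show "\<ominus>\<^bsub>A\<^esub> a \<in> gr i" unfolding P(2) cl_neg[OF hom_PF[OF P(1)]] gr_eq using hom_np_rules(3)[OF P(1), of "-1"] by auto
  fix b assume "b \<in> gr i"
  then obtain P' where P': "hom_np i P'" "b = cl P'" unfolding gr_eq by blast
  show "a \<oplus>\<^bsub>A\<^esub> b \<in> gr i" unfolding P(2) P'(2) cl_add[OF hom_PF[OF P(1)] hom_PF[OF P'(1)]] gr_eq using hom_np_rules(2)[OF P(1) P'(1)] by blast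
qed

lemma gr_mult: "a \<in> gr i \<Longrightarrow> b \<in> gr j \<Longrightarrow> a \<otimes>\<^bsub>A\<^esub> b \<in> gr (i + j)"
  unfolding gr_eq using cl_mult[OF hom_PF hom_PF] hom_np_rules(4) by auto

lemma gr_high: "N < i \<Longrightarrow> gr i = {\<zero>\<^bsub>A\<^esub>}"
proof -
  assume i: "N < i"
  have "cl P = \<zero>\<^bsub>A\<^esub>" if "hom_np i P" for P using cl_zero_iff[OF hom_PF[OF that]] Phi_hom(2)[OF that i] by simp
  then show ?thesis unfolding gr_eq using hom_np_rules(1) by blast
qed

lemma homog_sum_zero:
  assumes g: "\<And>i. i \<le> N \<Longrightarrow> homog (N - i) (g i)" and z: "\<And>y. y \<in> nm \<Longrightarrow> (\<Sum>i\<le>N. g i y) = 0" and i: "i \<le> N" and y: "y \<in> nm"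
  shows "g i y = 0"
proof -
  let ?q = "\<Sum>i\<le>N. Polynomial.monom (g i y) (N - i)"
  have "?q = 0"
  proof (rule poly_agree_nonzero)
    fix t :: complex
    have "g i (t *s y) = g i y * t ^ (N - i)" if "i \<le> N" for i using g[OF that] y unfolding homog_def by simp
    then have "poly ?q t = (\<Sum>i\<le>N. g i (t *s y))" by (simp add: poly_sum poly_monom)
    then show "poly ?q t = poly 0 t" using z[OF vec.subspace_scale[OF sub(3) y]] by simp
  qed
  then have "Polynomial.coeff ?q (N - i) = 0" by simp
  moreover have "Polynomial.coeff ?q (N - i) = (\<Sum>j\<le>N. if j = i then g i y else 0)"
    unfolding coeff_sum by (rule sum.cong) (use i in auto)
  ultimately show ?thesis using i by simp
qed

lemma Phi_sum: "(\<And>i. i \<in> I \<Longrightarrow> P i \<in> PF) \<Longrightarrow> Phi (\<lambda>x. \<Sum>i\<in>I. P i x) = (\<lambda>y. \<Sum>i\<in>I. Phi (P i) y)"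
  by (induction I rule: infinite_finite_induct) (simp_all add: Phi_zero Phi_add PF_sum)

text \<open>Existence comes from the homogeneous components of a polynomial, where those of degree above \<open>N\<close> have class
\<open>0\<close>. Uniqueness holds because \<open>Phi\<close> sends the summands to polynomials of different degrees.\<close>
lemma unique_decomposition:
  assumes a: "a \<in> carrier A"
  shows "\<exists>!h. h \<in> PiE {..N} gr \<and> a = (\<Oplus>\<^bsub>A\<^esub>i\<in>{..N}. h i)"
proof -
  obtain P where P: "P \<in> PF" "a = cl P" using a unfolding A_carrier by blast
  obtain d :: nat and G where G: "\<And>i. G i \<in> PF" "\<And>i c x. G i (c *s x) = c ^ i * G i x" "\<And>i. d < i \<Longrightarrow> G i = (\<lambda>_. 0)" "P = (\<lambda>x. \<Sum>i\<le>d. G i x)"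
    using homogeneous_decomposition[OF P(1)] by blast
  have Gh: "hom_np i (G i)" for i unfolding hom_np_def using G by blast
  let ?h = "restrict (\<lambda>i. cl (G i)) {..N}"
  have "?h \<in> PiE {..N} gr" using Gh unfolding gr_eq by auto
  moreover have "a = (\<Oplus>\<^bsub>A\<^esub>i\<in>{..N}. ?h i)"
  proof -
    have "(\<Oplus>\<^bsub>A\<^esub>i\<in>{..N}. ?h i) = (\<Oplus>\<^bsub>A\<^esub>i\<in>{..N}. cl (G i))"
      by (rule Q.finsum_cong') (auto simp: cl_mem G(1))
    also have "\<dots> = cl (\<lambda>x. \<Sum>i\<le>N. G i x)" by (rule cl_finsum) (use G(1) in auto)
    also have "\<dots> = cl P"
    proof -
      have "Phi (\<lambda>x. \<Sum>i\<le>N. G i x) = (\<lambda>y. \<Sum>i\<le>max d N. Phi (G i) y)"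
        unfolding Phi_sum[OF G(1)] by (rule ext, rule sum.mono_neutral_left) (use Phi_hom(2)[OF Gh] in auto)
      also have "\<dots> = Phi P"
        unfolding G(4) Phi_sum[OF G(1)] by (rule ext, rule sum.mono_neutral_right) (use G(3) Phi_zero in auto)
      finally have e: "Phi (\<lambda>x. \<Sum>i\<le>N. G i x) = Phi P" .
      have "(\<lambda>x. \<Sum>i\<le>N. G i x) \<in> PF" by (rule PF_sum) (rule G(1))
      then show ?thesis using cl_eq_iff[OF _ P(1)] e by blast
    qed
    finally show ?thesis unfolding P(2) by simp
  qed
  moreover have "h = h'" if h: "h \<in> PiE {..N} gr" "a = (\<Oplus>\<^bsub>A\<^esub>i\<in>{..N}. h i)" and h': "h' \<in> PiE {..N} gr" "a = (\<Oplus>\<^bsub>A\<^esub>i\<in>{..N}. h' i)" for h h'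
  proof -
    have rep: "\<exists>p. \<forall>i\<le>N. hom_np i (p i) \<and> h i = cl (p i)" if "h \<in> PiE {..N} gr" for h
    proof -
      have "\<forall>i. \<exists>P. i \<le> N \<longrightarrow> hom_np i P \<and> h i = cl P" using that unfolding gr_eq by (auto simp: PiE_iff)
      then show ?thesis by metis
    qed
    obtain p where p: "\<And>i. i \<le> N \<Longrightarrow> hom_np i (p i) \<and> h i = cl (p i)" using rep[OF h(1)] by blast
    obtain q where q: "\<And>i. i \<le> N \<Longrightarrow> hom_np i (q i) \<and> h' i = cl (q i)" using rep[OF h'(1)] by blast
    have pP: "p i \<in> PF" "q i \<in> PF" if "i \<le> N" for i using p[OF that] q[OF that] hom_PF by blast+
    have "a = (\<Oplus>\<^bsub>A\<^esub>i\<in>{..N}. cl (p i))" unfolding h(2) by (rule Q.finsum_cong') (use p pP cl_mem in auto)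
    also have "\<dots> = cl (\<lambda>x. \<Sum>i\<in>{..N}. p i x)" by (rule cl_finsum) (use pP in auto)
    finally have 1: "a = cl (\<lambda>x. \<Sum>i\<le>N. p i x)" .
    have "a = (\<Oplus>\<^bsub>A\<^esub>i\<in>{..N}. cl (q i))" unfolding h'(2) by (rule Q.finsum_cong') (use q pP cl_mem in auto)
    also have "\<dots> = cl (\<lambda>x. \<Sum>i\<in>{..N}. q i x)" by (rule cl_finsum) (use pP in auto)
    finally have 2: "a = cl (\<lambda>x. \<Sum>i\<le>N. q i x)" .
    have S: "(\<lambda>x. \<Sum>i\<le>N. p i x) \<in> PF" "(\<lambda>x. \<Sum>i\<le>N. q i x) \<in> PF" using pP by (auto intro: PF_sum)
    have "Phi (\<lambda>x. \<Sum>i\<le>N. p i x) = Phi (\<lambda>x. \<Sum>i\<le>N. q i x)" using 1 2 cl_eq_iff[OF S] by simp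
    then have e: "(\<lambda>y. \<Sum>i\<le>N. Phi (p i) y) = (\<lambda>y. \<Sum>i\<le>N. Phi (q i) y)" using pP by (subst (asm) (1 2) Phi_sum) auto
    have z: "Phi (p i) y - Phi (q i) y = 0" if i: "i \<le> N" and y: "y \<in> nm" for i y
    proof (rule homog_sum_zero[of "\<lambda>i y. Phi (p i) y - Phi (q i) y", OF _ _ i y])
      show "homog (N - i) (\<lambda>y. Phi (p i) y - Phi (q i) y)" if "i \<le> N" for i
        using Phi_hom(1)[OF conjunct1[OF p[OF that]] that] Phi_hom(1)[OF conjunct1[OF q[OF that]] that]
        unfolding homog_def by (simp add: algebra_simps)
      show "(\<Sum>i\<le>N. Phi (p i) y - Phi (q i) y) = 0" for y using fun_cong[OF e, of y] by (simp add: sum_subtractf)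
    qed
    have "h i = h' i" if i: "i \<le> N" for i
    proof -
      have "Phi (p i) y = Phi (q i) y" for y using z[OF i, of y] Phi_off[of y] by (cases "y \<in> nm") auto
      then have "Phi (p i) = Phi (q i)" by blast
      then have "cl (p i) = cl (q i)" using cl_eq_iff[OF pP[OF i]] by simp
      then show ?thesis using p[OF i] q[OF i] by simp
    qed
    then show "h = h'" using h(1) h'(1) by (intro PiE_ext[of h "{..N}" gr h']) auto
  qed
  ultimately show ?thesis by blast
qed

text \<open>An ideal corresponds under \<open>Phi\<close> to a subspace of the finite-dimensional space of derivatives of \<open>F\<close>.\<close>
lemma artinian: "artinian_ring A"
  unfolding artinian_ring_def
proof (intro conjI allI impI)
  show "cring A" by (rule Q.cring_axioms)
  fix I :: "nat \<Rightarrow> (complex ^ 'n \<Rightarrow> complex) set set"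
  assume I: "\<forall>m. ideal (I m) A \<and> I (Suc m) \<subseteq> I m"
  define J where "J m = Phi ` {P \<in> PF. cl P \<in> I m}" for m
  have Jmem: "Phi P \<in> J m \<longleftrightarrow> cl P \<in> I m" if "P \<in> PF" for P m
    unfolding J_def using that cl_eq_iff by (auto simp: image_iff) (metis cl_eq_iff)
  obtain B where B: "finite B" "B \<subseteq> PF" "F \<in> fs.span B" "\<And>u b. b \<in> B \<Longrightarrow> dd u b \<in> fs.span B"
    using derivatives_finite_dimensional[OF F_PF] by blast
  have "\<exists>M. \<forall>m\<ge>M. J m = J M"
  proof (rule descending_subspaces_stabilise)
    show "J (Suc m) \<subseteq> J m" for m using I unfolding J_def by blast
    show "fs.subspace (J m)" for m
    proof -
      interpret Im: ideal "I m" A using I by blast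
      show ?thesis
      proof (rule fs.subspaceI)
        have "Phi (\<lambda>_. 0) \<in> J m" using Jmem[OF poly_const[of 0]] Im.zero_closed cl_zero by simp
        then show "0 \<in> J m" by (simp add: Phi_zero zero_fun_def)
      next
        fix x y assume "x \<in> J m" "y \<in> J m"
        then obtain P Q where P: "P \<in> PF" "cl P \<in> I m" "x = Phi P" and Q: "Q \<in> PF" "cl Q \<in> I m" "y = Phi Q" unfolding J_def by blast
        have "cl (\<lambda>x. P x + Q x) \<in> I m" using Im.a_closed[OF P(2) Q(2)] cl_add[OF P(1) Q(1)] by simp
        then have "Phi (\<lambda>x. P x + Q x) \<in> J m" using Jmem[OF poly_add[OF P(1) Q(1)]] by simp
        then show "x + y \<in> J m" unfolding Phi_add[OF P(1) Q(1)] P(3) Q(3) by (simp add: plus_fun_def)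
      next
        fix c x assume "x \<in> J m"
        then obtain P where P: "P \<in> PF" "cl P \<in> I m" "x = Phi P" unfolding J_def by blast
        have "cl (\<lambda>_. c) \<otimes>\<^bsub>A\<^esub> cl P \<in> I m" by (rule Im.I_l_closed[OF P(2) cl_mem[OF poly_const]])
        then have "cl (\<lambda>x. c * P x) \<in> I m" using cl_mult[OF poly_const P(1)] by simp
        then have "Phi (\<lambda>x. c * P x) \<in> J m" using Jmem[OF PF_cmult[OF P(1)]] by simp
        then show "(\<lambda>y. c * x y) \<in> J m" unfolding Phi_cmult[OF P(1)] P(3) .
      qed
    qed
    show "finite (nf ` B)" using B(1) by simp
    show "J 0 \<subseteq> fs.span (nf ` B)"
    proof
      fix g assume "g \<in> J 0"
      then obtain P where P: "P \<in> PF" "g = Phi P" unfolding J_def by blast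
      obtain D where D: "D \<in> ops" "symbol D P" "Phi P = nf (D F)" using Phi_cases[OF P(1)] by metis
      have "D F \<in> fs.span B" by (rule op_span[OF B(2) B(4) B(3) D(1)])
      moreover have "fs.span B \<subseteq> {h. nf h \<in> fs.span (nf ` B)}"
      proof (rule fs.span_minimal)
        show "B \<subseteq> {h. nf h \<in> fs.span (nf ` B)}" by (auto intro: fs.span_base)
        show "fs.subspace {h. nf h \<in> fs.span (nf ` B)}"
        proof (rule fs.subspaceI)
          have "nf 0 = 0" by (simp add: nf_def fun_eq_iff)
          then show "0 \<in> {h. nf h \<in> fs.span (nf ` B)}" using fs.span_zero[of "nf ` B"] by simp
        next
          fix x y assume "x \<in> {h. nf h \<in> fs.span (nf ` B)}" "y \<in> {h. nf h \<in> fs.span (nf ` B)}"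
          moreover have "nf (x + y) = nf x + nf y" by (auto simp: nf_def fun_eq_iff)
          ultimately show "x + y \<in> {h. nf h \<in> fs.span (nf ` B)}" using fs.span_add by auto
        next
          fix c x assume "x \<in> {h. nf h \<in> fs.span (nf ` B)}"
          then have "(\<lambda>y. c * nf x y) \<in> fs.span (nf ` B)" using fs.span_scale[of "nf x" "nf ` B" c] by simp
          moreover have "nf (\<lambda>y. c * x y) = (\<lambda>y. c * nf x y)" by (auto simp: nf_def fun_eq_iff)
          ultimately show "(\<lambda>y. c * x y) \<in> {h. nf h \<in> fs.span (nf ` B)}" by simp
        qed
      qed
      ultimately show "g \<in> fs.span (nf ` B)" unfolding P(2) D(3) by blast
    qed
  qed
  then obtain M where M: "\<And>m. m \<ge> M \<Longrightarrow> J m = J M" by blast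
  have "I m = I M" if m: "m \<ge> M" for m
  proof -
    have sub: "I l \<subseteq> carrier A" for l using I ideal.axioms(1) additive_subgroup.a_subset by blast
    have "cl P \<in> I m \<longleftrightarrow> cl P \<in> I M" if "P \<in> PF" for P using Jmem[OF that] M[OF m] by metis
    then show ?thesis using sub[of m] sub[of M] unfolding A_carrier by blast
  qed
  then show "\<exists>N. \<forall>m\<ge>N. I m = I N" by blast
qed

lemma F_nonzero: "\<exists>L\<in>nm. f L \<noteq> 0 \<and> F L \<noteq> 0"
proof -
  obtain v where "v \<in> nm" "f v \<noteq> 0" using f_nz by blast
  then show ?thesis by (intro bexI[of _ v]) (simp_all add: F_def)
qed

lemma Phi_const: "Phi (\<lambda>_. c) = nf (\<lambda>y. c * F y)"
  using Phi_eq[OF poly_const cc_diff_ops.op_scale[OF cc_diff_ops.op_id] symbol_scale[OF symbol_id], of c c] by simp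

lemma Phi_const_zero: "Phi (\<lambda>_. c) = (\<lambda>_. 0) \<longleftrightarrow> c = 0"
  unfolding Phi_const using F_nonzero by (auto simp: nf_def fun_eq_iff)

lemma field_subfield: "subfield kk0 A"
proof (rule Q.subfieldI)
  have mem: "a \<in> kk0 \<longleftrightarrow> (\<exists>c. a = cl (\<lambda>_. c))" for a unfolding field_eq by blast
  have mult: "cl (\<lambda>_. c) \<otimes>\<^bsub>A\<^esub> cl (\<lambda>_. d) = cl (\<lambda>_. c * d)" for c d using cl_mult[OF poly_const poly_const] .
  have sub: "subring kk0 A"
  proof (rule Q.subringI)
    show "kk0 \<subseteq> carrier A"
    proof
      fix a assume "a \<in> kk0"
      then obtain c where "a = cl (\<lambda>_. c)" using mem by blast
      then show "a \<in> carrier A" using cl_mem[OF poly_const[of c]] by simp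
    qed
    show "\<one>\<^bsub>A\<^esub> \<in> kk0" using mem cl_one by blast
    show "\<ominus>\<^bsub>A\<^esub> h \<in> kk0" if "h \<in> kk0" for h using that cl_neg[OF poly_const] unfolding mem by auto
    show "h1 \<otimes>\<^bsub>A\<^esub> h2 \<in> kk0" if "h1 \<in> kk0" "h2 \<in> kk0" for h1 h2 using that mult unfolding mem by auto
    show "h1 \<oplus>\<^bsub>A\<^esub> h2 \<in> kk0" if "h1 \<in> kk0" "h2 \<in> kk0" for h1 h2 using that cl_add[OF poly_const poly_const] unfolding mem by auto
  qed
  show "subcring kk0 A"
  proof (rule subcring.intro[OF sub], unfold_locales)
    fix a b assume "a \<in> kk0" "b \<in> kk0"
    then have "a \<in> carrier A" "b \<in> carrier A" using subringE(1)[OF sub] by blast+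
    then show "a \<otimes>\<^bsub>A\<^esub> b = b \<otimes>\<^bsub>A\<^esub> a" by (rule Q.m_comm)
  qed
  show "Units (A\<lparr>carrier := kk0\<rparr>) = kk0 - {\<zero>\<^bsub>A\<^esub>}"
  proof
    show "Units (A\<lparr>carrier := kk0\<rparr>) \<subseteq> kk0 - {\<zero>\<^bsub>A\<^esub>}"
    proof
      fix a assume "a \<in> Units (A\<lparr>carrier := kk0\<rparr>)"
      then obtain b where ab: "a \<in> kk0" "b \<in> kk0" "b \<otimes>\<^bsub>A\<^esub> a = \<one>\<^bsub>A\<^esub>" unfolding Units_def by auto
      have "a \<noteq> \<zero>\<^bsub>A\<^esub>"
      proof
        assume "a = \<zero>\<^bsub>A\<^esub>"
        then have "\<one>\<^bsub>A\<^esub> = \<zero>\<^bsub>A\<^esub>" using ab mem cl_mem[OF poly_const] Q.r_null by metis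
        then show False using cl_zero_iff[OF poly_const[of 1]] Phi_const_zero[of 1] unfolding cl_one by simp
      qed
      then show "a \<in> kk0 - {\<zero>\<^bsub>A\<^esub>}" using ab by blast
    qed
    show "kk0 - {\<zero>\<^bsub>A\<^esub>} \<subseteq> Units (A\<lparr>carrier := kk0\<rparr>)"
    proof
      fix a assume a: "a \<in> kk0 - {\<zero>\<^bsub>A\<^esub>}"
      then obtain c where c: "a = cl (\<lambda>_. c)" using mem by blast
      have "c \<noteq> 0" using a cl_zero unfolding c by auto
      then have "cl (\<lambda>_. inverse c) \<otimes>\<^bsub>A\<^esub> a = \<one>\<^bsub>A\<^esub>" "a \<otimes>\<^bsub>A\<^esub> cl (\<lambda>_. inverse c) = \<one>\<^bsub>A\<^esub>"
        unfolding c mult cl_one by simp_all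
      moreover have "cl (\<lambda>_. inverse c) \<in> kk0" using mem by blast
      ultimately show "a \<in> Units (A\<lparr>carrier := kk0\<rparr>)" using a unfolding Units_def by auto
    qed
  qed
qed

text \<open>The Lefschetz property in degree \<open>0\<close>, applied to the class of \<open>1\<close>.\<close>
lemma top_nonzero:
  assumes L: "L \<in> nm" "f L \<noteq> 0"
  shows "Phi (\<lambda>x. kf x L ^ N * 1) \<noteq> (\<lambda>_. 0)"
proof
  assume z: "Phi (\<lambda>x. kf x L ^ N * 1) = (\<lambda>_. 0)"
  let ?e = "\<lambda>g. nf (dd L g)"
  have b: "bij_betw (?e ^^ N) (Vd (int N - int 0)) (Vd (int 0))" by (rule lefschetz_for_derivatives[OF L]) simp
  have V: "Vd (int N - int 0) = Phi ` {P. hom_np 0 P}" by (rule Phi_Vd) simp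
  have m: "Phi (\<lambda>_. 1) \<in> Vd (int N - int 0)" "Phi (\<lambda>_. 0) \<in> Vd (int N - int 0)"
    unfolding V by (intro imageI, simp add: hom_np_def poly_const)+
  have "(?e ^^ N) (Phi (\<lambda>_. 1)) = (\<lambda>_. 0)" using z Phi_pow[OF L(1) poly_const[of 1]] by simp
  moreover have "(?e ^^ N) (Phi (\<lambda>_. 0)) = (\<lambda>_. 0)" using Phi_pow[OF L(1) poly_const[of 0], of N] Phi_zero by simp
  ultimately have "Phi (\<lambda>_. 1) = Phi (\<lambda>_. 0)" using b m unfolding bij_betw_def inj_on_def by metis
  then show False using Phi_const_zero[of 1] Phi_zero by simp
qed

lemma graded: "graded_artinian_algebra kk0 A gr N"
proof -
  have "gr N \<noteq> {\<zero>\<^bsub>A\<^esub>}"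
  proof
    assume z: "gr N = {\<zero>\<^bsub>A\<^esub>}"
    obtain L where L: "L \<in> nm" "f L \<noteq> 0" using F_nonzero by blast
    have h: "hom_np N (\<lambda>x. kf x L ^ N * 1)" unfolding hom_np_def
      by (intro conjI poly_mult PF_power kf_PF' poly_const) (simp add: kf_lin power_mult_distrib)
    then have "cl (\<lambda>x. kf x L ^ N * 1) = \<zero>\<^bsub>A\<^esub>" using z unfolding gr_eq by blast
    then show False using cl_zero_iff[OF hom_PF[OF h]] top_nonzero[OF L] by blast
  qed
  then show ?thesis unfolding graded_artinian_algebra_def
    by (intro conjI allI ballI impI artinian field_subfield gr_0 gr_subgroup gr_mult unique_decomposition gr_high)
qed

lemma constant_of_derivatives:
  assumes g: "g \<in> PF" "\<And>u y. u \<in> nm \<Longrightarrow> y \<in> nm \<Longrightarrow> dd u g y = 0" and y: "y \<in> nm"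
  shows "g y = g 0"
proof -
  obtain q where q: "\<And>t. g (0 + t *s y) = poly q t" using PF_line[OF g(1)] by metis
  have "poly (pderiv q) t = 0" for t
  proof -
    have "dd y g (t *s y) = 0" by (rule g(2)[OF y vec.subspace_scale[OF sub(3) y]])
    moreover have "dd y g (t *s y) = poly (pderiv q) t"
    proof (rule dd_eqI)
      have "t *s y + x *s y = 0 + (t + x) *s y" for x by (simp add: vec.scale_left_distrib)
      then have e: "(\<lambda>x. g (t *s y + x *s y)) = (\<lambda>x. poly q (t + x))" by (simp only: q)
      have "((\<lambda>x. poly q (t + x)) has_field_derivative poly (pderiv q) (t + 0) * 1) (at 0)"
        by (rule DERIV_chain2[OF poly_DERIV]) (auto intro!: derivative_eq_intros)
      then show "((\<lambda>x. g (t *s y + x *s y)) has_field_derivative poly (pderiv q) t) (at 0)" unfolding e by simp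
    qed
    ultimately show ?thesis by simp
  qed
  then have "pderiv q = 0" using poly_eq_poly_eq_iff[of "pderiv q" 0] by (simp add: fun_eq_iff)
  then have "degree q = 0" by (simp add: pderiv_eq_0_iff)
  then obtain c where "q = [:c:]" using degree_eq_zeroE by blast
  then show ?thesis using q[of 0] q[of 1] by simp
qed

text \<open>A class in the socle has all its first derivatives equal to \<open>0\<close> under \<open>Phi\<close>, and is therefore sent to a
constant. Constants are realised by \<open>P0\<close>, a multiple of the \<open>N\<close>-th power of the linear form of some \<open>L\<close>
with \<open>f L \<noteq> 0\<close>.\<close>
lemma socle_dimension: "ring.dimension A 1 kk0 (socle A gr)"
proof -
  obtain L where L: "L \<in> nm" "f L \<noteq> 0" using F_nonzero by blast
  let ?T = "\<lambda>x. kf x L ^ N * 1"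
  have h: "hom_np N ?T" unfolding hom_np_def
    by (intro conjI poly_mult PF_power kf_PF' poly_const) (simp add: kf_lin power_mult_distrib)
  have "homog 0 (Phi ?T)" using Phi_hom(1)[OF h] by simp
  then have c: "Phi ?T y = Phi ?T 0" if "y \<in> nm" for y
  proof -
    have "Phi ?T (0 *s y) = 0 ^ 0 * Phi ?T y" using \<open>homog 0 (Phi ?T)\<close> that unfolding homog_def by blast
    then show ?thesis by simp
  qed
  define c0 where "c0 = Phi ?T 0"
  have c0: "c0 \<noteq> 0"
  proof
    assume "c0 = 0"
    then have "Phi ?T y = 0" for y using c[of y] Phi_off[of y] unfolding c0_def by (cases "y \<in> nm") auto
    then show False using top_nonzero[OF L] by blast
  qed
  define P0 where "P0 = (\<lambda>x. inverse c0 * ?T x)"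
  have P0: "P0 \<in> PF" unfolding P0_def by (rule PF_cmult[OF hom_PF[OF h]])
  have Phi0: "Phi P0 = nf (\<lambda>_. 1)"
    unfolding P0_def Phi_cmult[OF hom_PF[OF h]] using c Phi_off c0 unfolding c0_def nf_def by (auto simp: fun_eq_iff)
  have Phic: "Phi (\<lambda>x. c * P0 x) = nf (\<lambda>_. c)" for c unfolding Phi_cmult[OF P0] Phi0 nf_def by (auto simp: fun_eq_iff)
  have cP0: "(\<lambda>x. c * P0 x) \<in> PF" for c by (rule PF_cmult[OF P0])
  have soc: "socle A gr = (\<lambda>c. cl (\<lambda>x. c * P0 x)) ` UNIV"
  proof
    show "socle A gr \<subseteq> (\<lambda>c. cl (\<lambda>x. c * P0 x)) ` UNIV"
    proof
      fix a assume a: "a \<in> socle A gr"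
      then obtain P where P: "P \<in> PF" "a = cl P" unfolding socle_def A_carrier by blast
      obtain D where D: "D \<in> ops" "symbol D P" "Phi P = nf (D F)" using Phi_cases[OF P(1)] by metis
      have "dd u (D F) y = 0" if u: "u \<in> nm" and y: "y \<in> nm" for u y
      proof -
        have "cl (\<lambda>x. kf x u) \<in> gr 1" unfolding gr_eq using hom_np_kf by blast
        then have "a \<otimes>\<^bsub>A\<^esub> cl (\<lambda>x. kf x u) = \<zero>\<^bsub>A\<^esub>" using a unfolding socle_def by blast
        then have "cl (\<lambda>x. kf x u * P x) = \<zero>\<^bsub>A\<^esub>" unfolding P(2) cl_mult[OF P(1) kf_PF'] by (simp add: mult.commute)
        then have "nf (dd u (Phi P)) = (\<lambda>_. 0)" using cl_zero_iff[OF poly_mult[OF kf_PF' P(1)]] Phi_kf_mult[OF u P(1)] by simp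
        then have "nf (dd u (D F)) = (\<lambda>_. 0)" unfolding D(3) nf_dd_local[OF u] .
        then show ?thesis using y unfolding nf_def by (metis)
      qed
      then have "D F y = D F 0" if "y \<in> nm" for y using constant_of_derivatives[OF op_PF[OF D(1) F_PF] _ that] by blast
      then have "Phi P = Phi (\<lambda>x. D F 0 * P0 x)" unfolding Phic D(3) nf_eq_iff by blast
      then have "a = cl (\<lambda>x. D F 0 * P0 x)" unfolding P(2) using cl_eq_iff[OF P(1) cP0] by blast
      then show "a \<in> (\<lambda>c. cl (\<lambda>x. c * P0 x)) ` UNIV" by blast
    qed
    show "(\<lambda>c. cl (\<lambda>x. c * P0 x)) ` UNIV \<subseteq> socle A gr"
    proof
      fix a assume "a \<in> (\<lambda>c. cl (\<lambda>x. c * P0 x)) ` UNIV"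
      then obtain c where a: "a = cl (\<lambda>x. c * P0 x)" by blast
      have "a \<otimes>\<^bsub>A\<^esub> x = \<zero>\<^bsub>A\<^esub>" if i: "1 \<le> i" and x: "x \<in> gr i" for i x
      proof -
        obtain Q where Q: "hom_np i Q" "x = cl Q" using x unfolding gr_eq by blast
        obtain E where E: "E \<in> ops" "symbol E Q" using op_with_symbol[OF hom_PF[OF Q(1)]] by blast
        have "Phi (\<lambda>x. Q x * (c * P0 x)) = nf (E (\<lambda>_. c))"
          by (rule Phi_mult[OF hom_PF[OF Q(1)] E cP0]) (simp add: Phic nf_def)
        moreover have "E (\<lambda>_. c) y = 0" if "y \<in> nm" for y
        proof (rule op_degree(2)[OF E _ poly_const])
          show "0 < i" using i by simp
          show "Q (b *s x) = b ^ i * Q x" if "x \<in> np" for b x using Q(1) that unfolding hom_np_def by blast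
        qed (use that in auto)
        ultimately have "Phi (\<lambda>x. Q x * (c * P0 x)) = (\<lambda>_. 0)" by (auto simp: nf_def fun_eq_iff)
        moreover have "a \<otimes>\<^bsub>A\<^esub> x = cl (\<lambda>x. Q x * (c * P0 x))"
          unfolding a Q(2) cl_mult[OF cP0 hom_PF[OF Q(1)]] by (simp add: mult.commute)
        ultimately show ?thesis using cl_zero_iff[OF poly_mult[OF hom_PF[OF Q(1)] cP0]] by simp
      qed
      then show "a \<in> socle A gr" unfolding socle_def using cl_mem[OF cP0] a by auto
    qed
  qed
  have "Q.line_extension kk0 (cl P0) {\<zero>\<^bsub>A\<^esub>} = socle A gr"
  proof -
    have "Q.line_extension kk0 (cl P0) {\<zero>\<^bsub>A\<^esub>} = {a \<otimes>\<^bsub>A\<^esub> cl P0 \<oplus>\<^bsub>A\<^esub> \<zero>\<^bsub>A\<^esub> |a. a \<in> kk0}"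
      unfolding Q.line_extension_def set_add_def set_mult_def r_coset_def by auto
    also have "\<dots> = (\<lambda>c. cl (\<lambda>_. c) \<otimes>\<^bsub>A\<^esub> cl P0 \<oplus>\<^bsub>A\<^esub> \<zero>\<^bsub>A\<^esub>) ` UNIV" unfolding field_eq by blast
    also have "\<dots> = socle A gr" unfolding soc cl_mult[OF poly_const P0] using cl_mem[OF cP0] by simp
    finally show ?thesis .
  qed
  moreover have "cl P0 \<notin> {\<zero>\<^bsub>A\<^esub>}"
    using cl_zero_iff[OF P0] Phi0 vec.subspace_0[OF sub(3)] by (auto simp: nf_def fun_eq_iff)
  ultimately show ?thesis
    using Q.Suc_dim[OF cl_mem[OF P0] _ Q.zero_dim, of kk0] by simp
qed

lemma gorenstein: "graded_artinian_gorenstein kk0 A gr"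
  unfolding graded_artinian_gorenstein_def using graded socle_dimension by blast

lemma top_degree_unique:
  assumes "graded_artinian_algebra kk0 A gr c"
  shows "c = N"
proof (rule ccontr)
  assume "c \<noteq> N"
  have top: "gr c \<noteq> {\<zero>\<^bsub>A\<^esub>} \<and> (\<forall>i>c. gr i = {\<zero>\<^bsub>A\<^esub>})" if "graded_artinian_algebra kk0 A gr c" for c
    using that unfolding graded_artinian_algebra_def by (elim conjE) (intro conjI)
  note c = top[OF assms, THEN conjunct1] top[OF assms, THEN conjunct2, rule_format]
  have "gr N \<noteq> {\<zero>\<^bsub>A\<^esub>}" using top[OF graded] by (rule conjunct1)
  then have "\<not> c < N" using c(2) by blast
  moreover have "\<not> N < c" using c(1) gr_high by blast
  ultimately show False using \<open>c \<noteq> N\<close> by linarith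
qed

lemma killing_form_class:
  "gor_class br np nm Fb (killing_linear_form br np L) = cl (\<lambda>x. kf x L)"
  unfolding killing_linear_form_def ..

text \<open>The map induced by \<open>Phi\<close> on the quotient.\<close>
definition Psi :: "(complex ^ 'n \<Rightarrow> complex) set \<Rightarrow> complex ^ 'n \<Rightarrow> complex" where
  "Psi a = Phi (SOME P. P \<in> PF \<and> a = cl P)"

lemma Psi_cl: "P \<in> PF \<Longrightarrow> Psi (cl P) = Phi P"
proof -
  assume P: "P \<in> PF"
  let ?P = "SOME P'. P' \<in> PF \<and> cl P = cl P'"
  have E: "?P \<in> PF \<and> cl P = cl ?P"
    by (rule someI[of "\<lambda>P'. P' \<in> PF \<and> cl P = cl P'" P]) (use P in simp)
  then have "Phi P = Phi ?P" using cl_eq_iff[OF P conjunct1[OF E]] by blast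
  then show ?thesis unfolding Psi_def by simp
qed

lemma Psi_bij: "i \<le> N \<Longrightarrow> bij_betw Psi (gr i) (Vd (int N - int i))"
proof -
  assume i: "i \<le> N"
  show ?thesis unfolding bij_betw_def
  proof
    show "inj_on Psi (gr i)"
    proof (rule inj_onI)
      fix x y assume "x \<in> gr i" "y \<in> gr i" and e: "Psi x = Psi y"
      then obtain P Q where "hom_np i P" "x = cl P" "hom_np i Q" "y = cl Q" unfolding gr_eq by blast
      then show "x = y" using e Psi_cl cl_eq_iff hom_PF by metis
    qed
    show "Psi ` gr i = Vd (int N - int i)"
      unfolding Phi_Vd[OF i] gr_eq image_image using Psi_cl[OF hom_PF] by auto
  qed
qed

lemma lefschetz_if_nonvanishing:
  assumes L: "L \<in> nm" "f L \<noteq> 0"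
  shows "lefschetz_element kk0 A gr (cl (\<lambda>x. kf x L))"
  unfolding lefschetz_element_def
proof (intro conjI exI[of _ N] graded allI impI)
  show "cl (\<lambda>x. kf x L) \<in> gr 1" unfolding gr_eq using hom_np_kf by blast
  fix i assume "i \<le> N div 2"
  then have i: "i \<le> N" "2 * i \<le> N" by auto
  let ?e = "\<lambda>g. nf (dd L g)"
  have "bij_betw (?e ^^ (N - 2 * i)) (Vd (int N - int i)) (Vd (int i))"
    by (rule lefschetz_for_derivatives[OF L]) (use i in simp)
  moreover have "Vd (int i) = Vd (int N - int (N - i))" using i by simp
  ultimately have b: "bij_betw (?e ^^ (N - 2 * i)) (Vd (int N - int i)) (Vd (int N - int (N - i)))" by simp
  show "bij_betw (\<lambda>a. cl (\<lambda>x. kf x L) [^]\<^bsub>A\<^esub> (N - 2 * i) \<otimes>\<^bsub>A\<^esub> a) (gr i) (gr (N - i))"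
  proof (rule bij_betw_transport[OF Psi_bij[OF i(1)] Psi_bij b])
    fix a assume "a \<in> gr i"
    then obtain P where P: "hom_np i P" "a = cl P" unfolding gr_eq by blast
    have e: "cl (\<lambda>x. kf x L) [^]\<^bsub>A\<^esub> (N - 2 * i) \<otimes>\<^bsub>A\<^esub> a = cl (\<lambda>x. kf x L ^ (N - 2 * i) * P x)"
      unfolding P(2) cl_pow[OF kf_PF'] by (rule cl_mult[OF PF_power[OF kf_PF'] hom_PF[OF P(1)]])
    have PP: "(\<lambda>x. kf x L ^ (N - 2 * i) * P x) \<in> PF" by (intro poly_mult PF_power kf_PF' hom_PF[OF P(1)])
    have "hom_np (N - 2 * i) (\<lambda>x. kf x L ^ (N - 2 * i))" unfolding hom_np_def
      using PF_power[OF kf_PF'] by (simp add: kf_lin power_mult_distrib)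
    from hom_np_rules(4)[OF this P(1)] have "hom_np (N - i) (\<lambda>x. kf x L ^ (N - 2 * i) * P x)" using i by simp
    then have "cl (\<lambda>x. kf x L ^ (N - 2 * i) * P x) \<in> gr (N - i)" unfolding gr_eq by blast
    moreover have "Psi (cl (\<lambda>x. kf x L ^ (N - 2 * i) * P x)) = (?e ^^ (N - 2 * i)) (Psi a)"
      unfolding Psi_cl[OF PP] P(2) Psi_cl[OF hom_PF[OF P(1)]] by (rule Phi_pow[OF L(1) hom_PF[OF P(1)]])
    ultimately show "cl (\<lambda>x. kf x L) [^]\<^bsub>A\<^esub> (N - 2 * i) \<otimes>\<^bsub>A\<^esub> a \<in> gr (N - i) \<and>
        Psi (cl (\<lambda>x. kf x L) [^]\<^bsub>A\<^esub> (N - 2 * i) \<otimes>\<^bsub>A\<^esub> a) = (?e ^^ (N - 2 * i)) (Psi a)" unfolding e by blast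
  qed simp
qed

text \<open>By Euler's identity \<open>dd L\<close> multiplies the value at \<open>L\<close> by the degree, so the value at \<open>L\<close> of an iterated
derivative of \<open>F\<close> along \<open>L\<close> is a multiple of \<open>F L\<close>.\<close>
lemma derivative_power_top:
  assumes L: "L \<in> nm" and j: "j \<le> N"
  shows "\<exists>D\<in>ops. ((\<lambda>g. nf (dd L g)) ^^ j) (Phi (\<lambda>_. 1)) = nf (D F) \<and> homog (N - j) (D F) \<and> (F L = 0 \<longrightarrow> D F L = 0)"
  using j
proof (induction j)
  case 0
  have "Phi (\<lambda>_. 1) = nf F" using Phi_const[of 1] by simp
  then show ?case using F_hom by (intro bexI[OF _ cc_diff_ops.op_id]) (auto simp: homog_def)
next
  case (Suc j)
  then obtain D where D: "D \<in> ops" "((\<lambda>g. nf (dd L g)) ^^ j) (Phi (\<lambda>_. 1)) = nf (D F)" "homog (N - j) (D F)" "F L = 0 \<longrightarrow> D F L = 0"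
    by auto
  have P: "D F \<in> PF" by (rule op_PF[OF D(1) F_PF])
  have "dd L (D F) L = of_nat (N - j) * D F L"
    by (rule euler_identity[OF P sub(3) _ L]) (use D(3) in \<open>auto simp: homog_def\<close>)
  moreover have "homog (N - Suc j) (dd L (D F))" using homog_dd(1)[OF P D(3) L] by simp
  ultimately show ?case using D(2,4) nf_dd_local[OF L]
    by (intro bexI[OF _ cc_diff_ops.op_deriv[OF L D(1)]]) auto
qed

text \<open>If \<open>f L = 0\<close>, the \<open>N\<close>-th derivative of \<open>F\<close> along \<open>L\<close> is a constant whose value at \<open>L\<close> is \<open>0\<close>. Then the \<open>N\<close>-th power of the
linear form of \<open>L\<close> kills the class of \<open>1\<close>.\<close>
lemma nonvanishing_if_lefschetz:
  assumes L: "L \<in> nm" and l: "lefschetz_element kk0 A gr (cl (\<lambda>x. kf x L))"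
  shows "f L \<noteq> 0"
proof
  assume z: "f L = 0"
  then have FL: "F L = 0" using s unfolding F_def by simp
  obtain c where "graded_artinian_algebra kk0 A gr c"
    "\<forall>i\<le>c div 2. bij_betw (\<lambda>a. cl (\<lambda>x. kf x L) [^]\<^bsub>A\<^esub> (c - 2 * i) \<otimes>\<^bsub>A\<^esub> a) (gr i) (gr (c - i))"
    using l unfolding lefschetz_element_def by blast
  then have "\<forall>i\<le>N div 2. bij_betw (\<lambda>a. cl (\<lambda>x. kf x L) [^]\<^bsub>A\<^esub> (N - 2 * i) \<otimes>\<^bsub>A\<^esub> a) (gr i) (gr (N - i))"
    using top_degree_unique by metis
  from this[rule_format, of 0] have b: "inj_on (\<lambda>a. cl (\<lambda>x. kf x L) [^]\<^bsub>A\<^esub> N \<otimes>\<^bsub>A\<^esub> a) (gr 0)"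
    unfolding bij_betw_def by simp
  obtain D where D: "D \<in> ops" "((\<lambda>g. nf (dd L g)) ^^ N) (Phi (\<lambda>_. 1)) = nf (D F)" "homog 0 (D F)" "D F L = 0"
    using derivative_power_top[OF L order_refl] FL by auto
  have "D F y = 0" if "y \<in> nm" for y
  proof -
    have c: "D F (0 *s y) = D F y" if "y \<in> nm" for y using D(3) that unfolding homog_def by (metis mult_1 power_0)
    show ?thesis using c[OF that] c[OF L] D(4) by simp
  qed
  then have "nf (D F) = (\<lambda>_. 0)" by (auto simp: nf_def)
  then have "Phi (\<lambda>x. kf x L ^ N * 1) = (\<lambda>_. 0)" using Phi_pow[OF L poly_const[of 1], of N] D(2) by simp
  then have "cl (\<lambda>x. kf x L) [^]\<^bsub>A\<^esub> N \<otimes>\<^bsub>A\<^esub> cl (\<lambda>_. 1) = \<zero>\<^bsub>A\<^esub>"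
    unfolding cl_pow[OF kf_PF'] cl_mult[OF PF_power[OF kf_PF'] poly_const]
    using cl_zero_iff[OF poly_mult[OF PF_power[OF kf_PF'] poly_const]] by blast
  moreover have "cl (\<lambda>x. kf x L) [^]\<^bsub>A\<^esub> N \<otimes>\<^bsub>A\<^esub> cl (\<lambda>_. 0) = \<zero>\<^bsub>A\<^esub>"
    using cl_zero Q.r_null[OF Q.nat_pow_closed[OF cl_mem[OF kf_PF']]] by metis
  moreover have "cl (\<lambda>_. 1) \<in> gr 0" "cl (\<lambda>_. 0) \<in> gr 0" unfolding gr_0 field_eq by blast+
  ultimately have "cl (\<lambda>_. 1) = cl (\<lambda>_. 0)" using inj_onD[OF b, of "cl (\<lambda>_. 1)" "cl (\<lambda>_. 0)"] by simp
  then have "Phi (\<lambda>_. 1) = (\<lambda>_. 0)" using cl_eq_iff[OF poly_const poly_const] Phi_zero by metis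
  then show False using Phi_const_zero by simp
qed

end

section \<open>Lefschetz elements and the open orbit\<close>

context invariant_form begin

text \<open>A Zariski open orbit contains the complement of the zeros of some \<open>q\<close> with \<open>q L \<noteq> 0\<close>. If \<open>f L = 0\<close>, then \<open>f\<close>
vanishes on the orbit and \<open>q f\<close> vanishes on \<open>nm\<close>; on the line from \<open>L\<close> to a point with \<open>f \<noteq> 0\<close> neither factor is the
zero polynomial.\<close>
lemma open_orbit_iff:
  assumes ch: "\<And>g. g \<in> Ad_group br k \<Longrightarrow> \<exists>c. c \<noteq> 0 \<and> (\<forall>v\<in>nm. f (g v) = c * f v)" and L: "L \<in> nm"
  shows "L \<in> open_orbit (Ad_group br k) nm \<longleftrightarrow> f L \<noteq> 0"
proof
  assume fL: "f L \<noteq> 0"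
  have o: "group_orbit (Ad_group br k) L = {v \<in> nm. f v \<noteq> 0}" by (rule orbit_eq_nonvanishing[OF ch L fL])
  have "zariski_open nm (group_orbit (Ad_group br k) L)"
    unfolding zariski_open_def o
    by (intro exI[of _ "{restrict f nm}"]) (auto simp: coord_mem[OF f_PF])
  then show "L \<in> open_orbit (Ad_group br k) nm" unfolding open_orbit_def using L by blast
next
  assume "L \<in> open_orbit (Ad_group br k) nm"
  then obtain S where S: "S \<subseteq> carrier (coord_ring nm)" "group_orbit (Ad_group br k) L = nm - {v \<in> nm. \<forall>p\<in>S. p v = 0}"
    unfolding open_orbit_def zariski_open_def by blast
  have "L \<in> group_orbit (Ad_group br k) L" unfolding group_orbit_def by (rule image_eqI[of _ _ id]) (simp_all add: Ad_group.Ad_id)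
  then obtain p where p: "p \<in> S" "p L \<noteq> 0" using S(2) by blast
  obtain q where q: "q \<in> PF" "p = restrict q nm" using S(1) p(1) unfolding coord_carrier by blast
  have qL: "q L \<noteq> 0" using p(2) L unfolding q(2) by simp
  show "f L \<noteq> 0"
  proof
    assume fL: "f L = 0"
    have orb: "f v = 0" if v: "v \<in> group_orbit (Ad_group br k) L" for v
    proof -
      obtain g where g: "g \<in> Ad_group br k" "v = g L" using v unfolding group_orbit_def by blast
      obtain c where "\<forall>v\<in>nm. f (g v) = c * f v" using ch[OF g(1)] by blast
      then show ?thesis using L fL g(2) by simp
    qed
    have z: "q v * f v = 0" if v: "v \<in> nm" for v
    proof (cases "q v = 0")
      case False
      then have "p v \<noteq> 0" using v unfolding q(2) by simp
      then have "v \<in> group_orbit (Ad_group br k) L" unfolding S(2) using v p(1) by blast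
      then show ?thesis using orb by simp
    qed simp
    obtain w where w: "w \<in> nm" "f w \<noteq> 0" using f_nz by blast
    obtain a where a: "\<And>t. q (L + t *s (w - L)) = poly a t" using PF_line[OF q(1)] by metis
    obtain b where b: "\<And>t. f (L + t *s (w - L)) = poly b t" using PF_line[OF f_PF] by metis
    have mm: "L + t *s (w - L) \<in> nm" for t
      using L w(1) vec.subspace_add[OF sub(3)] vec.subspace_scale[OF sub(3)] vec.subspace_diff[OF sub(3)] by blast
    have "poly (a * b) t = 0" for t using z[OF mm[of t]] unfolding a b by simp
    then have "a * b = 0" using poly_eq_poly_eq_iff[of "a * b" 0] by (simp add: fun_eq_iff)
    then have "a = 0 \<or> b = 0" by simp
    then show False using a[of 0] b[of 1] qL w(2) by auto
  qed
qed

end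

theorem theorem4:
  fixes br :: "complex ^ 'n \<Rightarrow> complex ^ 'n \<Rightarrow> complex ^ 'n"
    and p k np nm :: "(complex ^ 'n) set"
    and f F :: "complex ^ 'n \<Rightarrow> complex"
    and s :: nat
  assumes "commutative_parabolic_type br p k np nm"
    and "regular_prehomogeneous (Ad_group br k) np"
    and "basic_relative_invariant (Ad_group br k) nm f"
    and "s > 0"
    and "F = f [^]\<^bsub>coord_ring nm\<^esub> s"
  shows "graded_artinian_gorenstein (gor_field br np nm F) (gor_algebra br np nm F) (gor_grading br np nm F) \<and>
    strong_lefschetz (gor_field br np nm F) (gor_algebra br np nm F) (gor_grading br np nm F) \<and>
    (\<forall>L\<in>nm.
       lefschetz_element (gor_field br np nm F) (gor_algebra br np nm F) (gor_grading br np nm F)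
         (gor_class br np nm F (killing_linear_form br np L))
       \<longleftrightarrow> L \<in> open_orbit (Ad_group br k) nm)"
proof -
  have "lie_algebra br"
    using assms(1) unfolding commutative_parabolic_type_def simple_lie_algebra_def by blast
  then interpret complex_lie_algebra br by unfold_locales
  obtain H where "short_grading br np k nm H" using commutative_parabolic_short_grading[OF assms(1)] by blast
  then interpret short_grading br np k nm H .
  have rel: "relative_invariant (Ad_group br k) nm f" and irr: "ring_irreducible\<^bsub>coord_ring nm\<^esub> f"
    using assms(3) unfolding basic_relative_invariant_def by auto
  obtain f0 where f0: "f0 \<in> PF" "f = restrict f0 nm" using rel unfolding relative_invariant_def coord_carrier by blast
  obtain ch where ch: "group_character (Ad_group br k) ch" "\<And>g v. g \<in> Ad_group br k \<Longrightarrow> v \<in> nm \<Longrightarrow> f (g v) = ch g * f v"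
    using rel unfolding relative_invariant_def by blast
  have ch0: "ch g \<noteq> 0 \<and> (\<forall>v\<in>nm. f0 (g v) = ch g * f0 v)" if g: "g \<in> Ad_group br k" for g
  proof -
    have "f0 (g v) = ch g * f0 v" if v: "v \<in> nm" for v
      using ch(2)[OF g v] v Ad_group_mem[OF sub(3) knm g v] unfolding f0(2) by simp
    then show ?thesis using ch(1) g unfolding group_character_def by blast
  qed
  have fz: "f \<noteq> \<zero>\<^bsub>coord_ring nm\<^esub>" and fu: "f \<notin> Units (coord_ring nm)"
    using irr unfolding ring_irreducible_def irreducible_def by auto
  \<comment> \<open>Irreducibility enters through these two facts: \<open>f\<close> is neither zero nor constant.\<close>
  have nz: "\<exists>v\<in>nm. f0 v \<noteq> 0" using fz unfolding f0(2) coord_ops by (metis restrict_ext)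
  have nc: "\<nexists>c. \<forall>v\<in>nm. f0 v = c"
  proof
    assume "\<exists>c. \<forall>v\<in>nm. f0 v = c"
    then obtain c where c: "\<forall>v\<in>nm. f0 v = c" by blast
    then have "c \<noteq> 0" using nz by auto
    have fc: "f = restrict (\<lambda>_. c) nm" unfolding f0(2) using c by (intro restrict_ext) blast
    have "restrict (\<lambda>_. inverse c) nm \<otimes>\<^bsub>coord_ring nm\<^esub> f = \<one>\<^bsub>coord_ring nm\<^esub>"
      "f \<otimes>\<^bsub>coord_ring nm\<^esub> restrict (\<lambda>_. inverse c) nm = \<one>\<^bsub>coord_ring nm\<^esub>"
      unfolding fc coord_ops using \<open>c \<noteq> 0\<close> by simp_all
    then have "f \<in> Units (coord_ring nm)"
      unfolding Units_def using coord_mem[OF poly_const, of "inverse c" nm] coord_mem[OF f0(1), of nm] f0(2) by auto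
    then show False using fu by blast
  qed
  obtain r where "invariant_form br np k nm H f0 r"
    using relative_invariant_form[OF f0(1) nz nc] ch0 by blast
  then interpret invariant_form br np k nm H f0 r .
  interpret invariant_power br np k nm H f0 r s by unfold_locales (rule assms(4))
  have Fb: "F y = f0 y ^ s" if "y \<in> nm" for y using that unfolding assms(5) f0(2) coord_pow by simp
  interpret gorenstein_quotient br np k nm H f0 r s F
    by unfold_locales (simp add: Fb F_def)
  have iff: "lefschetz_element (gor_field br np nm F) (gor_algebra br np nm F) (gor_grading br np nm F)
         (gor_class br np nm F (killing_linear_form br np L)) \<longleftrightarrow> f0 L \<noteq> 0" if "L \<in> nm" for L
    unfolding killing_form_class using lefschetz_if_nonvanishing[OF that] nonvanishing_if_lefschetz[OF that] by blast
  have "strong_lefschetz (gor_field br np nm F) (gor_algebra br np nm F) (gor_grading br np nm F)"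
    unfolding strong_lefschetz_def using iff nz by blast
  moreover have "f0 L \<noteq> 0 \<longleftrightarrow> L \<in> open_orbit (Ad_group br k) nm" if "L \<in> nm" for L
    using open_orbit_iff[OF _ that] ch0 by blast
  ultimately show ?thesis using gorenstein iff by blast
qed

end
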